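(* Let $\frac12\le s<1$, $n\ge2$, and let $\Omega\subsetneqq\mathbb{R}^n$ be a domain, with $d(x)=\mathrm{dist}(x,\partial\Omega)$. Functions $f\in C_0^\infty(\Omega)$ are extended by $0$ to $\mathbb{R}^n$, and $((-\Delta)^s_Df,f)_{\mathbb{R}^n}$ denotes the quadratic form of the Dirichlet fractional Laplacian. Set $$k_{n,s}:=\frac{2^{1-2s}\,\pi^{\frac{n-2}{2}}\,\Gamma(1-s)\,\Gamma^2(s+\frac12)}{s\,\Gamma(\frac{n+2s}{2})}.$$ (i) If in addition $\Omega$ is convex, then for all $f\in C_0^\infty(\Omega)$ $$((-\Delta)^s_Df,f)_{\mathbb{R}^n}\ \ge\ \frac{\Gamma^2(s+\frac12)}{\pi}\int_\Omega\frac{f^2(x)}{d^{2s}(x)}\,dx. \qquad (1)$$ Equivalently, $$\int_{\mathbb{R}^n}\int_{\mathbb{R}^n}\frac{|f(x)-f(\xi)|^2}{|x-\xi|^{n+2s}}\,dx\,d\xi\ \ge\ k_{n,s}\int_\Omega\frac{f^2(x)}{d^{2s}(x)}\,dx. \qquad (2)$$ (ii) Suppose there exist a point $x_0\in\partial\Omega$ and $r>0$ such that the part of the boundary $\partial\Omega\cap B(x_0,r)$ is $C^1$ regular. Then the Hardy constants $\frac{\Gamma^2(s+\frac12)}{\pi}$ in (1) and $k_{n,s}$ in (2) are optimal, i.e. neither inequality holds for all $f\in C_0^\infty(\Omega)$ with a larger constant. (iii) If $\Omega$ is a uniformly Lipschitz and convex domain with finite inner radius and $s\in(\frac12,1)$,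 then there exists a positive constant $c$ such that for all $f\in C_0^\infty(\Omega)$ $$((-\Delta)^s_Df,f)_{\mathbb{R}^n}\ \ge\ \frac{\Gamma^2(s+\frac12)}{\pi}\int_\Omega\frac{f^2(x)}{d^{2s}(x)}\,dx+c\left(\int_\Omega|f(x)|^{\frac{2n}{n-2s}}dx\right)^{\frac{n-2s}{n}}.$$ Equivalently (with a possibly different positive constant $c$), $$\int_{\mathbb{R}^n}\int_{\mathbb{R}^n}\frac{|f(x)-f(\xi)|^2}{|x-\xi|^{n+2s}}\,dx\,d\xi\ \ge\ k_{n,s}\int_\Omega\frac{f^2(x)}{d^{2s}(x)}\,dx+c\left(\int_\Omega|f(x)|^{\frac{2n}{n-2s}}dx\right)^{\frac{n-2s}{n}}.$$
   Context: Dirichlet fractional Laplacian: for $f\in C_0^\infty(\Omega)$, extended by $f=0$ in $\mathbb{R}^n\setminus\Omega$, one uses $(-\Delta)^sf(x)=c_{n,s}\,\mathrm{P.V.}\int_{\mathbb{R}^n}\frac{f(x)-f(\xi)}{|x-\xi|^{n+2s}}\,d\xi$, with $c_{n,s}=\frac{s2^{2s}\Gamma(\frac{n+2s}{2})}{\Gamma(1-s)\pi^{n/2}}$. Its quadratic form is $$((-\Delta)^s_Df,f)_{\mathbb{R}^n}=\frac{c_{n,s}}{2}\int_{\mathbb{R}^n}\int_{\mathbb{R}^n}\frac{|f(x)-f(\xi)|^2}{|x-\xi|^{n+2s}}\,dx\,d\xi.$$ The inner radius of $\Omega$ is $R_{in}:=\sup_{x\in\Omega}d(x)$, and $\Omega$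 has finite inner radius if $R_{in}<\infty$. "$C^1$ regular" has the usual meaning: locally $\partial\Omega$ is, in suitable coordinates, the graph of a $C^1$ function with $\Omega$ lying on one side of it. A domain $\Omega\subset\mathbb{R}^n$ is called uniformly Lipschitz if there exist $\varepsilon>0$, $L>0$, $M\in\mathbb{N}$ and a locally finite countable open cover $\{U_i\}$ of $\partial\Omega$ such that: (1) if $x\in\partial\Omega$ then $B(x,\varepsilon)\subset U_i$ for some $i$; (2) every point of $\mathbb{R}^n$ is contained in at most $M$ of the $U_i$'s; (3) for each $i$ there exist local coordinates $y=(y',y_n)\in\mathbb{R}^{n-1}\times\mathbb{R}$ and a Lipschitz function $g:\mathbb{R}^{n-1}\to\mathbb{R}$ with Lipschitz constant at most $L$ such that $U_i\cap\Omega=U_i\cap\{(y',y_n): y_n>g(y')\}$. *)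

theory Defs
  imports "HOL-Analysis.Analysis"
begin

text \<open>Euclidean space of dimension \<open>n\<close> is a type \<open>'a :: euclidean_space\<close> with \<open>n = DIM('a)\<close>.\<close>

text \<open>\<open>C_diff k f\<close>: \<open>f\<close> is of class \<open>C\<^sup>k\<close> on the whole space. Differentiability is total (Frechet)
  differentiability; together with continuous partial derivatives this is the usual class.\<close>

primrec C_diff :: "nat \<Rightarrow> ('a::euclidean_space \<Rightarrow> real) \<Rightarrow> bool" where
  "C_diff 0 f \<longleftrightarrow> continuous_on UNIV f"
| "C_diff (Suc k) f \<longleftrightarrow>
     (\<forall>x. f differentiable (at x)) \<and>
     (\<forall>b\<in>Basis. C_diff k (\<lambda>x. frechet_derivative f (at x) b))"

text \<open>Functions in \<open>C\<^sub>0\<^sup>\<infinity>(\<Omega>)\<close> are represented by their extension by zero to the whole space.\<close>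

definition test_functions :: "'a::euclidean_space set \<Rightarrow> ('a \<Rightarrow> real) set" where
  "test_functions \<Omega> =
     {f. (\<forall>k. C_diff k f) \<and> compact (closure {x. f x \<noteq> 0}) \<and> closure {x. f x \<noteq> 0} \<subseteq> \<Omega>}"

definition bdist :: "'a::euclidean_space set \<Rightarrow> 'a \<Rightarrow> real" where
  "bdist \<Omega> x = infdist x (frontier \<Omega>)"

definition inner_radius :: "'a::euclidean_space set \<Rightarrow> ereal" where
  "inner_radius \<Omega> = (SUP x\<in>\<Omega>. ereal (bdist \<Omega> x))"

definition frac_const :: "nat \<Rightarrow> real \<Rightarrow> real" where
  "frac_const n s =
     s * 2 powr (2 * s) * Gamma ((real n + 2 * s) / 2) / (Gamma (1 - s) * pi powr (real n / 2))"

definition k_const :: "nat \<Rightarrow> real \<Rightarrow> real" where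
  "k_const n s =
     2 powr (1 - 2 * s) * pi powr ((real n - 2) / 2) * Gamma (1 - s) * (Gamma (s + 1 / 2))\<^sup>2
       / (s * Gamma ((real n + 2 * s) / 2))"

text \<open>The integrand below is \<open>0\<close> on the diagonal, as \<open>0 / 0 = 0\<close>; the diagonal is a null set.\<close>

definition gagliardo :: "real \<Rightarrow> ('a::euclidean_space \<Rightarrow> real) \<Rightarrow> real" where
  "gagliardo s f =
     (LINT \<xi>|lborel. LINT x|lborel.
        \<bar>f x - f \<xi>\<bar>\<^sup>2 / norm (x - \<xi>) powr (real DIM('a) + 2 * s))"

text \<open>The quadratic form of the Dirichlet fractional Laplacian.\<close>

definition frac_form :: "real \<Rightarrow> ('a::euclidean_space \<Rightarrow> real) \<Rightarrow> real" where
  "frac_form s f = frac_const DIM('a) s / 2 * gagliardo s f"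

definition hardy_integral :: "real \<Rightarrow> 'a::euclidean_space set \<Rightarrow> ('a \<Rightarrow> real) \<Rightarrow> real" where
  "hardy_integral s \<Omega> f = (LINT x:\<Omega>|lborel. (f x)\<^sup>2 / bdist \<Omega> x powr (2 * s))"

definition sobolev_term :: "real \<Rightarrow> 'a::euclidean_space set \<Rightarrow> ('a \<Rightarrow> real) \<Rightarrow> real" where
  "sobolev_term s \<Omega> f =
     (LINT x:\<Omega>|lborel. \<bar>f x\<bar> powr (2 * real DIM('a) / (real DIM('a) - 2 * s)))
       powr ((real DIM('a) - 2 * s) / real DIM('a))"

text \<open>Local coordinates \<open>(y', y\<^sub>n)\<close> are given by a unit vector \<open>\<nu>\<close>, the direction of the
  \<open>y\<^sub>n\<close>-axis: \<open>y\<^sub>n = x \<bullet> \<nu>\<close>, and \<open>y'\<close> is the projection of \<open>x\<close> to the hyperplane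
  \<open>{y. y \<bullet> \<nu> = 0}\<close>, a copy of the Euclidean space of dimension \<open>n - 1\<close>. The choice of origin and
  of an orthonormal basis of the hyperplane is absorbed in \<open>g\<close>, of which only the restriction to
  the hyperplane matters.\<close>

definition hproj :: "'a::euclidean_space \<Rightarrow> 'a \<Rightarrow> 'a" where
  "hproj \<nu> x = x - (x \<bullet> \<nu>) *\<^sub>R \<nu>"

definition graph_over :: "'a::euclidean_space \<Rightarrow> ('a \<Rightarrow> real) \<Rightarrow> 'a set" where
  "graph_over \<nu> g = {x. x \<bullet> \<nu> = g (hproj \<nu> x)}"

definition above_graph :: "'a::euclidean_space \<Rightarrow> ('a \<Rightarrow> real) \<Rightarrow> 'a set" where
  "above_graph \<nu> g = {x. x \<bullet> \<nu> > g (hproj \<nu> x)}"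

text \<open>\<open>S\<close> is a part of the boundary of \<open>\<Omega>\<close>. A \<open>C\<^sup>1\<close> function on the hyperplane is the same as the
  restriction of a \<open>C\<^sup>1\<close> function on the whole space (extend it constantly in direction \<open>\<nu>\<close>).\<close>

definition C1_regular :: "'a::euclidean_space set \<Rightarrow> 'a set \<Rightarrow> bool" where
  "C1_regular \<Omega> S \<longleftrightarrow>
     (\<forall>p\<in>S. \<exists>\<delta>>0. \<exists>\<nu> g. norm \<nu> = 1 \<and> C_diff 1 g \<and>
        ball p \<delta> \<inter> frontier \<Omega> = ball p \<delta> \<inter> graph_over \<nu> g \<and>
        ball p \<delta> \<inter> \<Omega> = ball p \<delta> \<inter> above_graph \<nu> g)"

definition uniformly_Lipschitz :: "'a::euclidean_space set \<Rightarrow> bool" where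
  "uniformly_Lipschitz \<Omega> \<longleftrightarrow>
     (\<exists>\<epsilon>>0. \<exists>L>0. \<exists>M::nat. \<exists>\<U>::'a set set.
        countable \<U> \<and> (\<forall>U\<in>\<U>. open U) \<and> locally_finite_in euclidean \<U> \<and>
        frontier \<Omega> \<subseteq> \<Union>\<U> \<and>
        (\<forall>x\<in>frontier \<Omega>. \<exists>U\<in>\<U>. ball x \<epsilon> \<subseteq> U) \<and>
        (\<forall>x. finite {U \<in> \<U>. x \<in> U} \<and> card {U \<in> \<U>. x \<in> U} \<le> M) \<and>
        (\<forall>U\<in>\<U>. \<exists>\<nu> g. norm \<nu> = 1 \<and> L-lipschitz_on {y. y \<bullet> \<nu> = 0} g \<and>
           U \<inter> \<Omega> = U \<inter> above_graph \<nu> g))"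

end

theory Submission
  imports Defs "HOL-Probability.Probability" "HOL-Real_Asymp.Real_Asymp"
begin

text \<open>
  Put \<open>\<beta> = s - 1/2\<close> and \<open>w = d powr \<beta>\<close> on \<open>\<Omega>\<close>, \<open>w = 0\<close> elsewhere. With \<open>f = w * \<psi>\<close>,
  \<open>(f y - f x)\<^sup>2 = w x * w y * (\<psi> y - \<psi> x)\<^sup>2 + f x * \<psi> x * (w x - w y) + f y * \<psi> y * (w y - w x)\<close>,
  so the energy of \<open>f\<close> is a nonnegative weighted energy of \<open>\<psi>\<close> plus twice the integral of
  \<open>f * \<psi>\<close> against the regularised fractional Laplacian of \<open>w\<close>. A supporting half-space at the
  boundary point nearest to \<open>x\<close> dominates \<open>w\<close> by the half-space weight and touches it at \<open>x\<close>, so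
  this Laplacian is at least that of the half-space weight. Integrating over hyperplanes reduces
  the latter to one dimension, where a Beta integral yields exactly the sharp constant.

  If \<open>d\<close> is bounded, the half-space weight is strictly larger than \<open>w\<close> far away, which gains a
  multiple of \<open>f\<^sup>2\<close>; a Hedberg-type pointwise estimate on balls inside \<open>\<Omega>\<close> turns this and the
  weighted energy of \<open>\<psi>\<close> into the Sobolev term.

  For optimality, in a half-space the virtual ground state \<open>t powr \<beta>\<close> in the normal direction, cut
  off on a long logarithmic scale and multiplied by wide tangential bumps, has Rayleigh quotient
  close to the constant. Rescaling it into a boundary point where the boundary is \<open>C\<^sup>1\<close>
  carries this over to \<open>\<Omega>\<close>.
\<close>

section \<open>The Riesz kernel and its marginals\<close>

text \<open>The exponent is forced by \<open>2 * \<beta> - 2 * s = - 1\<close>. The Hardy density of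
  t^\<beta> on the half-line is then 1/t, so a cut-off spread over |ln t| < R has Hardy mass of
  order R and error energy of order 1/R; and the substitution t/(1+t) matches the two halves of the
  second difference of t^\<beta> up to a perfect square. Let Q be the integral of that square
  against the kernel over (0,1). The lower bound and the trial energy both lead to 1/s + 2Q, which
  is why they meet.

  The obstacle: for s > 1/2 the increments of \<open>w\<close> are in general not absolutely
  integrable against the kernel near h = 0, so the terms of the energy identity cannot be integrated
  one by one. The kernel is cut off to |h| > \<epsilon>; its evenness turns increments of the
  half-space weight into second differences, whose missing part near 0 is O(|h|^2) uniformly on the
  support of f; \<epsilon> tends to 0 only at the end. For s = 1/2 \<open>w\<close> is the indicator
  of the domain, and the integrals that are otherwise evaluated through a degenerating Beta function
  are computed directly.\<close>

lemma nn_integral_lborel_scaleR: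
  fixes F :: "'a::euclidean_space \<Rightarrow> ennreal"
  assumes [measurable]: "F \<in> borel_measurable borel" and c: "c \<noteq> 0"
  shows "(\<integral>\<^sup>+x. F x \<partial>lborel) = ennreal (\<bar>c\<bar> ^ DIM('a)) * (\<integral>\<^sup>+x. F (t + c *\<^sub>R x) \<partial>lborel)"
  by (subst lborel_affine[OF c, of t], subst nn_integral_density) (auto simp: nn_integral_distr nn_integral_cmult)

text \<open>A determinant-free argument. Test against the unit ball B, which \<open>T\<close>
  preserves because it preserves norms: translations and exchanges of the order of integration turn
  the double integral of 1_A(T x) 1_B(y) into that of 1_A(y) 1_B(T x), and the positive finite
  measure of B cancels.\<close>

lemma distr_lborel_reflection:
  fixes T :: "'a::euclidean_space \<Rightarrow> 'a"
  assumes T: "linear T" "\<And>x. norm (T x) = norm x" "\<And>x. T (T x) = x"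
  shows "distr lborel borel T = lborel"
proof -
  have [measurable]: "T \<in> borel_measurable borel"
    using linear_continuous_on[of T] T(1) by (intro borel_measurable_continuous_onI) (simp add: linear_linear)
  have add: "T (x + y) = T x + T y" for x y using T(1) by (simp add: linear_add)
  show ?thesis
  proof (rule measure_eqI)
    fix A assume "A \<in> sets (distr lborel borel T)"
    then have [measurable]: "A \<in> sets borel" by simp
    define B where "B = (ball 0 1 :: 'a set)"
    have [measurable]: "B \<in> sets borel" by (simp add: B_def)
    have shift: "(\<integral>\<^sup>+x. G x \<partial>lborel) = (\<integral>\<^sup>+x. G (t + x) \<partial>lborel)" if [measurable]: "G \<in> borel_measurable borel"
      for G :: "'a \<Rightarrow> ennreal" and t
      using nn_integral_lborel_scaleR[of G 1 t] by simp
    have neg: "(\<integral>\<^sup>+x. G x \<partial>lborel) = (\<integral>\<^sup>+x. G (- x) \<partial>lborel)" if [measurable]: "G \<in> borel_measurable borel"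
      for G :: "'a \<Rightarrow> ennreal"
      using nn_integral_lborel_scaleR[of G "-1" 0] by simp
    define I where "I = (\<lambda>X. indicator X :: 'a \<Rightarrow> ennreal)"
    have [measurable]: "I A \<in> borel_measurable borel" "I B \<in> borel_measurable borel" by (auto simp: I_def)
    have "emeasure (distr lborel borel T) A = (\<integral>\<^sup>+x. I A x \<partial>distr lborel borel T)"
      by (simp add: I_def)
    also have "\<dots> = (\<integral>\<^sup>+x. I A (T x) \<partial>lborel)"
      by (rule nn_integral_distr) measurable
    finally have distr_A: "emeasure (distr lborel borel T) A = (\<integral>\<^sup>+x. I A (T x) \<partial>lborel)" .
    define m where "m = (\<integral>\<^sup>+x. I A (T x) \<partial>lborel)"
    have "m * (\<integral>\<^sup>+y. I B y \<partial>lborel) = (\<integral>\<^sup>+x. \<integral>\<^sup>+y. I A (T x) * I B y \<partial>lborel \<partial>lborel)"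
      by (simp add: m_def nn_integral_cmult nn_integral_multc)
    also have "\<dots> = (\<integral>\<^sup>+x. \<integral>\<^sup>+y. I A (T x) * I B (T x + y) \<partial>lborel \<partial>lborel)"
      by (intro nn_integral_cong shift) measurable
    also have "\<dots> = (\<integral>\<^sup>+y. \<integral>\<^sup>+x. I A (T x) * I B (T x + y) \<partial>lborel \<partial>lborel)"
      by (rule lborel_pair.Fubini') measurable
    also have "\<dots> = (\<integral>\<^sup>+y. \<integral>\<^sup>+x. I A (T x - y) * I B (T x) \<partial>lborel \<partial>lborel)"
    proof (rule nn_integral_cong)
      fix y
      have "(\<integral>\<^sup>+x. I A (T x) * I B (T x + y) \<partial>lborel) = (\<integral>\<^sup>+x. I A (T (- T y + x)) * I B (T (- T y + x) + y) \<partial>lborel)"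
        by (rule shift) measurable
      then show "(\<integral>\<^sup>+x. I A (T x) * I B (T x + y) \<partial>lborel) = (\<integral>\<^sup>+x. I A (T x - y) * I B (T x) \<partial>lborel)"
        using T by (simp add: linear_diff)
    qed
    also have "\<dots> = (\<integral>\<^sup>+x. \<integral>\<^sup>+y. I A (T x - y) * I B (T x) \<partial>lborel \<partial>lborel)"
      by (rule lborel_pair.Fubini') measurable
    also have "\<dots> = (\<integral>\<^sup>+x. I B (T x) * (\<integral>\<^sup>+y. I A y \<partial>lborel) \<partial>lborel)"
    proof (rule nn_integral_cong)
      fix x
      have "(\<integral>\<^sup>+y. I A y \<partial>lborel) = (\<integral>\<^sup>+y. I A (T x + y) \<partial>lborel)" by (rule shift) measurable
      also have "\<dots> = (\<integral>\<^sup>+y. I A (T x - y) \<partial>lborel)"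
        using neg[of "\<lambda>y. I A (T x + y)"] by simp
      finally show "(\<integral>\<^sup>+y. I A (T x - y) * I B (T x) \<partial>lborel) = I B (T x) * (\<integral>\<^sup>+y. I A y \<partial>lborel)"
        by (subst nn_integral_multc) (simp_all add: mult.commute)
    qed
    also have "\<dots> = (\<integral>\<^sup>+x. I B x \<partial>lborel) * (\<integral>\<^sup>+y. I A y \<partial>lborel)"
      by (simp add: nn_integral_multc I_def B_def T(2) indicator_def)
    finally have eq: "m * emeasure lborel B = emeasure lborel A * emeasure lborel B"
      by (simp add: I_def mult.commute)
    have "emeasure lborel B < \<infinity>" unfolding B_def by (rule emeasure_lborel_ball_finite)
    moreover have "emeasure lborel B \<noteq> 0"
    proof
      assume "emeasure lborel B = 0"
      then have "negligible B"
        by (auto simp: negligible_iff_null_sets intro!: null_sets_completionI)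
      then show False
        using open_not_negligible[of B] by (simp add: B_def)
    qed
    ultimately have "m = emeasure lborel A" using eq
      by (metis mult_divide_eq_ennreal infinity_ennreal_def less_irrefl)
    then show "emeasure (distr lborel borel T) A = emeasure lborel A"
      using distr_A by (simp add: m_def)
  qed simp
qed

text \<open>The Householder reflection in the hyperplane orthogonal to \<open>a - b\<close>. An
  involutive isometry is its own inverse and adjoint (\<open>inner_reflection\<close>), which keeps
  every later change of direction short.\<close>

lemma reflection_exists:
  fixes a b :: "'a::euclidean_space"
  assumes "norm a = 1" "norm b = 1"
  obtains T where "linear T" "\<And>x. norm (T x) = norm x" "\<And>x. T (T x) = x" "T a = b"
proof (cases "a = b")
  case True
  show ?thesis by (rule that[of id]) (auto simp: True linear_id)
next
  case False
  define v where "v = a - b"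
  have v: "v \<bullet> v \<noteq> 0" using False by (simp add: v_def)
  define T where "T = (\<lambda>x. x - (2 * (x \<bullet> v) / (v \<bullet> v)) *\<^sub>R v)"
  have aa: "a \<bullet> a = 1" "b \<bullet> b = 1" using assms by (auto simp: norm_eq_1)
  have "linear T"
    by (rule linearI) (auto simp: T_def inner_add_left algebra_simps add_divide_distrib)
  moreover have "norm (T x) = norm x" for x
  proof -
    have "T x \<bullet> T x = x \<bullet> x" using v
      by (simp add: T_def inner_diff_left inner_diff_right inner_commute[of v x] field_simps)
    then show ?thesis by (simp add: norm_eq_sqrt_inner)
  qed
  moreover have "T (T x) = x" for x using v
    by (simp add: T_def inner_diff_left field_simps scaleR_diff_left[symmetric] flip: scaleR_add_left)
  moreover have "T a = b"
  proof -
    have "2 * (a \<bullet> v) = v \<bullet> v" using aa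
      by (simp add: v_def inner_diff_left inner_diff_right inner_commute)
    then show ?thesis using v by (simp add: T_def v_def)
  qed
  ultimately show ?thesis by (rule that)
qed

text \<open>At the origin the value is \<open>0\<close>, because \<open>1 / 0 = 0\<close>.\<close>

definition riesz :: "real \<Rightarrow> 'a::euclidean_space \<Rightarrow> real" where
  "riesz s h = 1 / norm h powr (real DIM('a) + 2 * s)"

text \<open>The mass constant left when \<open>riesz s\<close> is integrated over the hyperplanes orthogonal to a unit vector.\<close>

definition marg_const :: "nat \<Rightarrow> real \<Rightarrow> real" where
  "marg_const n s = pi powr ((real n - 1) / 2) * Gamma (s + 1/2) / Gamma ((real n + 2 * s) / 2)"

lemma riesz_measurable [measurable]: "riesz s \<in> borel_measurable borel"
  unfolding riesz_def[abs_def] by measurable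

lemma riesz_nonneg [simp]: "0 \<le> riesz s h" by (simp add: riesz_def)

lemma riesz_minus [simp]: "riesz s (- h) = riesz s h" by (simp add: riesz_def)

lemma riesz_scaleR: "c \<noteq> 0 \<Longrightarrow> riesz s (c *\<^sub>R h :: 'a::euclidean_space) = riesz s h / \<bar>c\<bar> powr (real DIM('a) + 2 * s)"
  by (simp add: riesz_def powr_mult)

section \<open>Marginals of the kernel by Gaussian subordination\<close>

lemma nn_integral_Gamma_scaled:
  assumes a: "a > 0" and p: "p > (0::real)"
  shows "(\<integral>\<^sup>+t. ennreal (indicator {0..} t * t powr (p - 1) * exp (- (a * t))) \<partial>lborel) = ennreal (Gamma p * a powr (- p))"
proof -
  have "ennreal (Gamma p) = (\<integral>\<^sup>+t. ennreal (indicator {0..} t * t powr (p - 1) / exp t) \<partial>lborel)"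
    by (rule Gamma_conv_nn_integral_real[OF p])
  also have "\<dots> = a * (\<integral>\<^sup>+t. ennreal (indicator {0..} (0 + a * t) * (0 + a * t) powr (p - 1) / exp (0 + a * t)) \<partial>lborel)"
    using a by (subst nn_integral_real_affine[where c=a and t=0]) auto
  also have "(\<integral>\<^sup>+t. ennreal (indicator {0..} (0 + a * t) * (0 + a * t) powr (p - 1) / exp (0 + a * t)) \<partial>lborel)
     = (\<integral>\<^sup>+t. ennreal (a powr (p - 1)) * ennreal (indicator {0..} t * t powr (p - 1) * exp (- (a * t))) \<partial>lborel)"
    using a by (intro nn_integral_cong) (auto simp: indicator_def zero_le_mult_iff powr_mult exp_minus field_simps simp flip: ennreal_mult)
  also have "\<dots> = ennreal (a powr (p - 1)) * (\<integral>\<^sup>+t. ennreal (indicator {0..} t * t powr (p - 1) * exp (- (a * t))) \<partial>lborel)"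
    by (rule nn_integral_cmult) measurable
  finally have "ennreal (Gamma p) = ennreal (a powr p) * (\<integral>\<^sup>+t. ennreal (indicator {0..} t * t powr (p - 1) * exp (- (a * t))) \<partial>lborel)" (is "_ = _ * ?I")
    using a by (simp add: mult.assoc[symmetric] powr_diff flip: ennreal_mult)
  then have "ennreal (a powr (- p)) * ennreal (Gamma p) = ennreal (a powr (- p)) * ennreal (a powr p) * ?I"
    by (simp add: mult.assoc)
  then show ?thesis using a p by (simp add: powr_minus mult.commute flip: ennreal_mult)
qed

lemma nn_integral_gaussian:
  assumes "t > 0"
  shows "(\<integral>\<^sup>+x. ennreal (exp (- (t * x\<^sup>2))) \<partial>lborel) = ennreal (sqrt (pi / t))"
proof -
  define \<sigma> where "\<sigma> = sqrt (1 / (2 * t))"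
  have s: "\<sigma> > 0" "\<sigma>\<^sup>2 = 1 / (2 * t)" using assms by (auto simp: \<sigma>_def)
  have "1 = (\<integral>\<^sup>+x. ennreal (normal_density 0 \<sigma> x) \<partial>lborel)"
    using s by (subst nn_integral_eq_integral) auto
  also have "\<dots> = (\<integral>\<^sup>+x. ennreal (1 / sqrt (pi / t)) * ennreal (exp (- (t * x\<^sup>2))) \<partial>lborel)"
    using assms by (intro nn_integral_cong) (simp add: normal_density_def s field_simps flip: ennreal_mult)
  also have "\<dots> = ennreal (1 / sqrt (pi / t)) * (\<integral>\<^sup>+x. ennreal (exp (- (t * x\<^sup>2))) \<partial>lborel)"
    by (rule nn_integral_cmult) measurable
  finally have "ennreal (sqrt (pi / t)) * 1 = ennreal (sqrt (pi / t)) * ennreal (1 / sqrt (pi / t)) * (\<integral>\<^sup>+x. ennreal (exp (- (t * x\<^sup>2))) \<partial>lborel)"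
    by (simp add: mult.assoc)
  then show ?thesis using assms by (simp flip: ennreal_mult)
qed

lemma nn_integral_inner_mult_gaussian:
  fixes b :: "'a::euclidean_space" and g :: "real \<Rightarrow> ennreal"
  assumes b: "b \<in> Basis" and [measurable]: "g \<in> borel_measurable borel" and t: "t > 0"
  shows "(\<integral>\<^sup>+h. g (h \<bullet> b) * ennreal (exp (- (t * (norm h)\<^sup>2))) \<partial>lborel)
    = ennreal ((pi / t) powr ((real DIM('a) - 1) / 2)) * (\<integral>\<^sup>+x. g x * ennreal (exp (- (t * x\<^sup>2))) \<partial>lborel)"
proof -
  define F where "F = (\<lambda>c x. (if c = b then g x else 1) * ennreal (exp (- (t * x\<^sup>2))))"
  have [measurable]: "F c \<in> borel_measurable borel" for c unfolding F_def by (cases "c = b") auto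
  have "(\<integral>\<^sup>+h. g (h \<bullet> b) * ennreal (exp (- (t * (norm h)\<^sup>2))) \<partial>lborel) = (\<integral>\<^sup>+h. (\<Prod>c\<in>Basis. F c (h \<bullet> c)) \<partial>lborel)"
  proof (rule nn_integral_cong)
    fix h :: 'a
    have "(norm h)\<^sup>2 = (\<Sum>c\<in>Basis. (h \<bullet> c)\<^sup>2)" 
      unfolding dot_square_norm[symmetric] by (subst euclidean_inner) (simp add: power2_eq_square)
    then have "ennreal (exp (- (t * (norm h)\<^sup>2))) = (\<Prod>c\<in>Basis. ennreal (exp (- (t * (h \<bullet> c)\<^sup>2))))"
      by (subst prod_ennreal) (auto simp: exp_sum[symmetric] sum_distrib_left sum_negf)
    moreover have "(\<Prod>c\<in>Basis. if c = b then g (h \<bullet> c) else 1) = g (h \<bullet> b)"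
      using b by (subst prod.delta) auto
    ultimately show "g (h \<bullet> b) * ennreal (exp (- (t * (norm h)\<^sup>2))) = (\<Prod>c\<in>Basis. F c (h \<bullet> c))"
      by (simp add: F_def prod.distrib)
  qed
  also have "\<dots> = (\<Prod>c\<in>Basis. \<integral>\<^sup>+x. F c x \<partial>lborel)"
    by (rule nn_integral_lborel_prod) simp_all
  also have "\<dots> = (\<integral>\<^sup>+x. F b x \<partial>lborel) * (\<Prod>c\<in>Basis - {b}. \<integral>\<^sup>+x. F c x \<partial>lborel)"
    using b by (subst prod.remove[of _ b]) auto
  also have "(\<Prod>c\<in>Basis - {b}. \<integral>\<^sup>+x. F c x \<partial>lborel) = (\<Prod>c\<in>Basis - {b}. ennreal (sqrt (pi / t)))"
    using t by (intro prod.cong) (auto simp: F_def nn_integral_gaussian)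
  also have "\<dots> = ennreal (sqrt (pi / t) ^ (DIM('a) - 1))"
    using b t by (simp add: card_Diff_singleton ennreal_power)
  also have "sqrt (pi / t) ^ (DIM('a) - 1) = (pi / t) powr ((real DIM('a) - 1) / 2)"
    using t by (simp add: powr_half_sqrt[symmetric] powr_powr flip: powr_realpow)
  finally show ?thesis by (simp add: F_def mult.commute)
qed

text \<open>Gaussian subordination: the kernel is a Gamma integral of Gaussians, and a Gaussian factors over
  the coordinates.\<close>

lemma nn_integral_inner_riesz_Basis:
  fixes b :: "'a::euclidean_space" and g :: "real \<Rightarrow> ennreal"
  assumes b: "b \<in> Basis" and [measurable]: "g \<in> borel_measurable borel" and s: "s > 0"
  shows "(\<integral>\<^sup>+h. g (h \<bullet> b) * ennreal (riesz s h) \<partial>lborel)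
    = ennreal (marg_const DIM('a) s) * (\<integral>\<^sup>+x. g x * ennreal (1 / \<bar>x\<bar> powr (1 + 2 * s)) \<partial>lborel)"
proof -
  define n where "n = real DIM('a)"
  define p where "p = (n + 2 * s) / 2"
  have n: "n \<ge> 1" by (simp add: n_def DIM_positive Suc_leI)
  have p: "p > 0" using n s by (simp add: p_def)
  have pp: "2 * p = n + 2 * s" by (simp add: p_def)
  define E where "E = (\<lambda>t. indicator {0<..} t * t powr (p - 1) :: real)"
  have [measurable]: "E \<in> borel_measurable borel" by (simp add: E_def)
  have [simp]: "E t \<ge> 0" for t by (simp add: E_def)
  have G: "(\<integral>\<^sup>+t. ennreal (indicator {0<..} t * t powr (q - 1)) * ennreal (exp (- (t * a\<^sup>2))) \<partial>lborel) = ennreal (Gamma q / \<bar>a\<bar> powr (2 * q))"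
    if "q > 0" "a \<noteq> 0" for q a :: real
  proof -
    have "(\<integral>\<^sup>+t. ennreal (indicator {0<..} t * t powr (q - 1)) * ennreal (exp (- (t * a\<^sup>2))) \<partial>lborel)
       = (\<integral>\<^sup>+t. ennreal (indicator {0..} t * t powr (q - 1) * exp (- (a\<^sup>2 * t))) \<partial>lborel)"
      by (intro nn_integral_cong) (auto simp: indicator_def mult.commute simp flip: ennreal_mult)
    also have "\<dots> = ennreal (Gamma q * (a\<^sup>2) powr (- q))"
      using that by (intro nn_integral_Gamma_scaled) auto
    also have "(a\<^sup>2) powr (- q) = 1 / \<bar>a\<bar> powr (2 * q)"
    proof -
      have "a\<^sup>2 = \<bar>a\<bar> powr 2" using that by simp
      then show ?thesis by (metis powr_powr powr_minus inverse_eq_divide mult_minus_right)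
    qed
    finally show ?thesis by simp
  qed
  have "ennreal (Gamma p) * (\<integral>\<^sup>+h. g (h \<bullet> b) * ennreal (riesz s h) \<partial>lborel) = (\<integral>\<^sup>+h. ennreal (Gamma p) * (g (h \<bullet> b) * ennreal (riesz s h)) \<partial>lborel)"
    by (rule nn_integral_cmult[symmetric]) measurable
  also have "\<dots> = (\<integral>\<^sup>+h. (\<integral>\<^sup>+t. g (h \<bullet> b) * (ennreal (E t) * ennreal (exp (- (t * (norm h)\<^sup>2)))) \<partial>lborel) \<partial>lborel)"
  proof (rule nn_integral_cong_AE)
    show "AE h in lborel. ennreal (Gamma p) * (g (h \<bullet> b) * ennreal (riesz s h)) = (\<integral>\<^sup>+t. g (h \<bullet> b) * (ennreal (E t) * ennreal (exp (- (t * (norm h)\<^sup>2)))) \<partial>lborel)"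
      using AE_lborel_singleton[of "0::'a"]
    proof eventually_elim
      fix h :: 'a assume "h \<noteq> 0"
      then have "(\<integral>\<^sup>+t. ennreal (E t) * ennreal (exp (- (t * (norm h)\<^sup>2))) \<partial>lborel) = ennreal (Gamma p * riesz s h)"
        using G[of p "norm h"] p pp by (simp add: E_def riesz_def n_def)
      then show "ennreal (Gamma p) * (g (h \<bullet> b) * ennreal (riesz s h)) = (\<integral>\<^sup>+t. g (h \<bullet> b) * (ennreal (E t) * ennreal (exp (- (t * (norm h)\<^sup>2)))) \<partial>lborel)"
        using p by (subst nn_integral_cmult) (auto simp: ennreal_mult mult_ac)
    qed
  qed
  also have "\<dots> = (\<integral>\<^sup>+t. (\<integral>\<^sup>+h. g (h \<bullet> b) * (ennreal (E t) * ennreal (exp (- (t * (norm h)\<^sup>2)))) \<partial>lborel) \<partial>lborel)"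
    by (rule lborel_pair.Fubini') measurable
  also have "\<dots> = (\<integral>\<^sup>+t. (\<integral>\<^sup>+x. g x * (ennreal (pi powr ((n - 1) / 2)) * (ennreal (indicator {0<..} t * t powr ((s + 1/2) - 1)) * ennreal (exp (- (t * x\<^sup>2))))) \<partial>lborel) \<partial>lborel)"
  proof (rule nn_integral_cong)
    fix t :: real
    show "(\<integral>\<^sup>+h. g (h \<bullet> b) * (ennreal (E t) * ennreal (exp (- (t * (norm h)\<^sup>2)))) \<partial>lborel) = 
       (\<integral>\<^sup>+x. g x * (ennreal (pi powr ((n - 1) / 2)) * (ennreal (indicator {0<..} t * t powr ((s + 1/2) - 1)) * ennreal (exp (- (t * x\<^sup>2))))) \<partial>lborel)"
    proof (cases "t > 0")
      case False
      then show ?thesis by (simp add: E_def)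
    next
      case True
      have "(\<integral>\<^sup>+h. g (h \<bullet> b) * (ennreal (E t) * ennreal (exp (- (t * (norm h)\<^sup>2)))) \<partial>lborel)
        = ennreal (E t) * (\<integral>\<^sup>+h. g (h \<bullet> b) * ennreal (exp (- (t * (norm h)\<^sup>2))) \<partial>lborel)"
        by (subst nn_integral_cmult[symmetric]) (auto simp: mult_ac)
      also have "\<dots> = ennreal (E t) * ennreal ((pi / t) powr ((n - 1) / 2)) * (\<integral>\<^sup>+x. g x * ennreal (exp (- (t * x\<^sup>2))) \<partial>lborel)"
        using True b by (subst nn_integral_inner_mult_gaussian) (auto simp: n_def mult_ac)
      also have "ennreal (E t) * ennreal ((pi / t) powr ((n - 1) / 2)) = ennreal (pi powr ((n - 1) / 2)) * ennreal (indicator {0<..} t * t powr ((s + 1/2) - 1))"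
      proof -
        \<comment> \<open>The n - 1 transversal Gaussian integrals use up t^((n - 1)/2). What is
          left is a Gamma integral of exponent s + 1/2, hence the one-dimensional kernel.\<close>
        have "p - 1 = (s + 1/2 - 1) + (n - 1) / 2" by (simp add: p_def field_simps)
        then have "t powr (p - 1) = t powr (s + 1/2 - 1) * t powr ((n - 1) / 2)" by (simp only: powr_add)
        then show ?thesis using True by (simp add: E_def powr_divide flip: ennreal_mult)
      qed
      also have "ennreal (pi powr ((n - 1) / 2)) * ennreal (indicator {0<..} t * t powr ((s + 1/2) - 1)) * (\<integral>\<^sup>+x. g x * ennreal (exp (- (t * x\<^sup>2))) \<partial>lborel)
        = (\<integral>\<^sup>+x. g x * (ennreal (pi powr ((n - 1) / 2)) * (ennreal (indicator {0<..} t * t powr ((s + 1/2) - 1)) * ennreal (exp (- (t * x\<^sup>2))))) \<partial>lborel)"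
        by (subst nn_integral_cmult[symmetric]) (auto simp: mult_ac)
      finally show ?thesis .
    qed
  qed
  also have "\<dots> = (\<integral>\<^sup>+x. (\<integral>\<^sup>+t. g x * (ennreal (pi powr ((n - 1) / 2)) * (ennreal (indicator {0<..} t * t powr ((s + 1/2) - 1)) * ennreal (exp (- (t * x\<^sup>2))))) \<partial>lborel) \<partial>lborel)"
    by (rule lborel_pair.Fubini') measurable
  also have "\<dots> = (\<integral>\<^sup>+x. ennreal (pi powr ((n - 1) / 2) * Gamma (s + 1/2)) * (g x * ennreal (1 / \<bar>x\<bar> powr (1 + 2 * s))) \<partial>lborel)"
  proof (rule nn_integral_cong_AE)
    show "AE x in lborel. (\<integral>\<^sup>+t. g x * (ennreal (pi powr ((n - 1) / 2)) * (ennreal (indicator {0<..} t * t powr ((s + 1/2) - 1)) * ennreal (exp (- (t * x\<^sup>2))))) \<partial>lborel)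
       = ennreal (pi powr ((n - 1) / 2) * Gamma (s + 1/2)) * (g x * ennreal (1 / \<bar>x\<bar> powr (1 + 2 * s)))"
      using AE_lborel_singleton[of "0::real"]
    proof eventually_elim
      fix x :: real assume x: "x \<noteq> 0"
      have "(\<integral>\<^sup>+t. g x * (ennreal (pi powr ((n - 1) / 2)) * (ennreal (indicator {0<..} t * t powr ((s + 1/2) - 1)) * ennreal (exp (- (t * x\<^sup>2))))) \<partial>lborel)
        = g x * (ennreal (pi powr ((n - 1) / 2)) * (\<integral>\<^sup>+t. ennreal (indicator {0<..} t * t powr ((s + 1/2) - 1)) * ennreal (exp (- (t * x\<^sup>2))) \<partial>lborel))"
        by (simp add: nn_integral_cmult)
      also have "(\<integral>\<^sup>+t. ennreal (indicator {0<..} t * t powr ((s + 1/2) - 1)) * ennreal (exp (- (t * x\<^sup>2))) \<partial>lborel) = ennreal (Gamma (s + 1/2) / \<bar>x\<bar> powr (1 + 2 * s))"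
        using G[of "s + 1/2" x] s x by (simp add: algebra_simps)
      finally show "(\<integral>\<^sup>+t. g x * (ennreal (pi powr ((n - 1) / 2)) * (ennreal (indicator {0<..} t * t powr ((s + 1/2) - 1)) * ennreal (exp (- (t * x\<^sup>2))))) \<partial>lborel)
       = ennreal (pi powr ((n - 1) / 2) * Gamma (s + 1/2)) * (g x * ennreal (1 / \<bar>x\<bar> powr (1 + 2 * s)))"
        using s by (simp add: ennreal_mult[symmetric] mult_ac)
    qed
  qed
  also have "\<dots> = ennreal (pi powr ((n - 1) / 2) * Gamma (s + 1/2)) * (\<integral>\<^sup>+x. g x * ennreal (1 / \<bar>x\<bar> powr (1 + 2 * s)) \<partial>lborel)"
    by (rule nn_integral_cmult) measurable
  finally have "ennreal (1 / Gamma p) * ennreal (Gamma p) * (\<integral>\<^sup>+h. g (h \<bullet> b) * ennreal (riesz s h) \<partial>lborel) = 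
     ennreal (1 / Gamma p) * ennreal (pi powr ((n - 1) / 2) * Gamma (s + 1/2)) * (\<integral>\<^sup>+x. g x * ennreal (1 / \<bar>x\<bar> powr (1 + 2 * s)) \<partial>lborel)"
    by (simp add: mult.assoc)
  moreover have "ennreal (1 / Gamma p) * ennreal (Gamma p) = 1"
    using Gamma_real_pos[OF p] by (simp flip: ennreal_mult)
  moreover have "ennreal (1 / Gamma p) * ennreal (pi powr ((n - 1) / 2) * Gamma (s + 1/2)) = ennreal (marg_const DIM('a) s)"
    using Gamma_real_pos[OF p] s by (simp add: marg_const_def p_def n_def flip: ennreal_mult)
  ultimately show ?thesis by simp
qed

lemma nn_integral_reflection:
  fixes T :: "'a::euclidean_space \<Rightarrow> 'a" and F :: "'a \<Rightarrow> ennreal"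
  assumes T: "linear T" "\<And>x. norm (T x) = norm x" "\<And>x. T (T x) = x"
    and [measurable]: "F \<in> borel_measurable borel"
  shows "(\<integral>\<^sup>+x. F (T x) \<partial>lborel) = (\<integral>\<^sup>+x. F x \<partial>lborel)"
proof -
  have [measurable]: "T \<in> borel_measurable borel"
    using linear_continuous_on[of T] T(1) by (intro borel_measurable_continuous_onI) (simp add: linear_linear)
  show ?thesis
    by (subst (2) distr_lborel_reflection[OF T, symmetric]) (simp add: nn_integral_distr)
qed

lemma inner_reflection:
  assumes T: "linear T" "\<And>x. norm (T x) = norm x" "\<And>x. T (T x) = x"
  shows "T x \<bullet> y = x \<bullet> T y"
proof -
  have *: "T u \<bullet> T v = u \<bullet> v" for u v
  proof -
    have n: "T w \<bullet> T w = w \<bullet> w" for w by (simp add: dot_square_norm T(2))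
    from n[of "u + v"] show ?thesis
      by (simp add: linear_add[OF T(1)] inner_add_left inner_add_right inner_commute n)
  qed
  show ?thesis using *[of x "T y"] by (simp add: T(3))
qed

lemma nn_integral_inner_riesz:
  fixes e :: "'a::euclidean_space" and g :: "real \<Rightarrow> ennreal"
  assumes e: "norm e = 1" and [measurable]: "g \<in> borel_measurable borel" and s: "s > 0"
  shows "(\<integral>\<^sup>+h. g (h \<bullet> e) * ennreal (riesz s h) \<partial>lborel)
    = ennreal (marg_const DIM('a) s) * (\<integral>\<^sup>+x. g x * ennreal (1 / \<bar>x\<bar> powr (1 + 2 * s)) \<partial>lborel)"
proof -
  obtain b :: 'a where b: "b \<in> Basis" using nonempty_Basis by blast
  obtain T where T: "linear T" "\<And>x. norm (T x) = norm x" "\<And>x. T (T x) = x" "T b = e"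
    using reflection_exists[of b e] b e by auto
  have "(\<integral>\<^sup>+h. g (h \<bullet> e) * ennreal (riesz s h) \<partial>lborel) = (\<integral>\<^sup>+h. g (T h \<bullet> b) * ennreal (riesz s (T h)) \<partial>lborel)"
    using inner_reflection[OF T(1-3)] T(2,4) by (simp add: riesz_def)
  also have "\<dots> = (\<integral>\<^sup>+h. g (h \<bullet> b) * ennreal (riesz s h) \<partial>lborel)"
    by (rule nn_integral_reflection[OF T(1-3)]) measurable
  finally show ?thesis using nn_integral_inner_riesz_Basis[OF b _ s] by simp
qed

lemma marg_const_pos: "s > 0 \<Longrightarrow> 0 < marg_const n s"
  unfolding marg_const_def by (intro divide_pos_pos mult_pos_pos Gamma_real_pos) auto

text \<open>The marginal as an identity of measures, so that it also transports Bochner integrals of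
  signed functions such as second differences.\<close>

lemma distr_inner_riesz:
  fixes e :: "'a::euclidean_space"
  assumes e: "norm e = 1" and s: "s > 0"
  shows "distr (density lborel (\<lambda>h. ennreal (riesz s h))) borel (\<lambda>h. h \<bullet> e)
     = density lborel (\<lambda>t. ennreal (marg_const DIM('a) s / \<bar>t\<bar> powr (1 + 2 * s)))"
proof (rule measure_eqI)
  fix A assume "A \<in> sets (distr (density lborel (\<lambda>h. ennreal (riesz s h))) borel (\<lambda>h. h \<bullet> e))"
  then have [measurable]: "A \<in> sets borel" by simp
  have "emeasure (distr (density lborel (\<lambda>h. ennreal (riesz s h))) borel (\<lambda>h. h \<bullet> e)) A
     = (\<integral>\<^sup>+t. indicator A t \<partial>distr (density lborel (\<lambda>h. ennreal (riesz s h))) borel (\<lambda>h. h \<bullet> e))"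
    by simp
  also have "\<dots> = (\<integral>\<^sup>+h. indicator A (h \<bullet> e) \<partial>density lborel (\<lambda>h. ennreal (riesz s h)))"
    by (rule nn_integral_distr) measurable
  also have "\<dots> = (\<integral>\<^sup>+h. indicator A (h \<bullet> e) * ennreal (riesz s h) \<partial>lborel)"
    by (subst nn_integral_density) (auto simp: mult.commute)
  also have "\<dots> = ennreal (marg_const DIM('a) s) * (\<integral>\<^sup>+x. indicator A x * ennreal (1 / \<bar>x\<bar> powr (1 + 2 * s)) \<partial>lborel)"
    by (rule nn_integral_inner_riesz[OF e _ s]) simp
  also have "\<dots> = (\<integral>\<^sup>+x. ennreal (marg_const DIM('a) s / \<bar>x\<bar> powr (1 + 2 * s)) * indicator A x \<partial>lborel)"
    using marg_const_pos[OF s, of "DIM('a)"]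
    by (subst nn_integral_cmult[symmetric]) (auto intro!: nn_integral_cong simp: indicator_def simp flip: ennreal_mult)
  also have "\<dots> = emeasure (density lborel (\<lambda>t. ennreal (marg_const DIM('a) s / \<bar>t\<bar> powr (1 + 2 * s)))) A"
    by (subst emeasure_density) auto
  finally show "emeasure (distr (density lborel (\<lambda>h. ennreal (riesz s h))) borel (\<lambda>h. h \<bullet> e)) A
    = emeasure (density lborel (\<lambda>t. ennreal (marg_const DIM('a) s / \<bar>t\<bar> powr (1 + 2 * s)))) A" .
qed simp

lemma integral_inner_riesz:
  fixes e :: "'a::euclidean_space" and g :: "real \<Rightarrow> real"
  assumes e: "norm e = 1" and s: "s > 0" and [measurable]: "g \<in> borel_measurable borel"
    and int: "integrable lborel (\<lambda>t. g t / \<bar>t\<bar> powr (1 + 2 * s))"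
  shows "integrable lborel (\<lambda>h. g (h \<bullet> e) * riesz s h)"
    and "(LINT h|lborel. g (h \<bullet> e) * riesz s h) = marg_const DIM('a) s * (LINT t|lborel. g t / \<bar>t\<bar> powr (1 + 2 * s))"
proof -
  have m: "0 \<le> marg_const DIM('a) s" using marg_const_pos[OF s] by (simp add: less_imp_le)
  let ?D = "distr (density lborel (\<lambda>h. ennreal (riesz s h))) borel (\<lambda>h. h \<bullet> e)"
  have i: "integrable ?D g"
    unfolding distr_inner_riesz[OF e s] using integrable_mult_right[OF int, of "marg_const DIM('a) s"] m
    by (subst integrable_density) (auto simp: mult_ac)
  then have "integrable (density lborel (\<lambda>h. ennreal (riesz s h))) (\<lambda>h. g (h \<bullet> e))"
    by (subst (asm) integrable_distr_eq) auto
  then show "integrable lborel (\<lambda>h. g (h \<bullet> e) * riesz s h)"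
    by (subst (asm) integrable_density) (auto simp: mult_ac)
  have "(LINT h|lborel. g (h \<bullet> e) * riesz s h) = (LINT h|density lborel (\<lambda>h. ennreal (riesz s h)). g (h \<bullet> e))"
    by (subst integral_density) (auto simp: mult_ac)
  also have "\<dots> = (LINT t|?D. g t)" by (rule integral_distr[symmetric]) auto
  also have "\<dots> = (LINT t|lborel. marg_const DIM('a) s * (g t / \<bar>t\<bar> powr (1 + 2 * s)))"
    unfolding distr_inner_riesz[OF e s] using m by (subst integral_density) (auto simp: mult_ac)
  also have "\<dots> = marg_const DIM('a) s * (LINT t|lborel. g t / \<bar>t\<bar> powr (1 + 2 * s))"
    by (rule integral_mult_right_zero)
  finally show "(LINT h|lborel. g (h \<bullet> e) * riesz s h) = marg_const DIM('a) s * (LINT t|lborel. g t / \<bar>t\<bar> powr (1 + 2 * s))" .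
qed

lemma nn_integral_fold_sign:
  fixes F :: "real \<Rightarrow> ennreal"
  assumes [measurable]: "F \<in> borel_measurable borel"
  shows "(\<integral>\<^sup>+t. F t \<partial>lborel) = (\<integral>\<^sup>+t. indicator {0<..} t * (F t + F (- t)) \<partial>lborel)"
proof -
  have "(\<integral>\<^sup>+t. F t \<partial>lborel) = (\<integral>\<^sup>+t. indicator {0<..} t * F t + indicator {..<0} t * F t \<partial>lborel)"
    by (rule nn_integral_cong_AE, use AE_lborel_singleton[of "0::real"] in eventually_elim) (auto simp: indicator_def)
  also have "\<dots> = (\<integral>\<^sup>+t. indicator {0<..} t * F t \<partial>lborel) + (\<integral>\<^sup>+t. indicator {..<0} t * F t \<partial>lborel)"
    by (rule nn_integral_add) measurable
  also have "(\<integral>\<^sup>+t. indicator {..<0} t * F t \<partial>lborel) = (\<integral>\<^sup>+t. indicator {0<..} t * F (- t) \<partial>lborel)"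
    by (subst nn_integral_real_affine[where c="-1" and t=0]) (auto intro!: nn_integral_cong simp: indicator_def)
  finally show ?thesis by (simp add: distrib_left nn_integral_add)
qed

lemma nn_integral_min_1D_finite:
  assumes s: "0 < s" "s < 1"
  shows "(\<integral>\<^sup>+t. ennreal (min (t\<^sup>2) 1) * ennreal (1 / \<bar>t\<bar> powr (1 + 2 * s)) \<partial>lborel) < \<infinity>"
proof -
  have "(\<integral>\<^sup>+t. ennreal (min (t\<^sup>2) 1) * ennreal (1 / \<bar>t\<bar> powr (1 + 2 * s)) \<partial>lborel)
    = (\<integral>\<^sup>+t. indicator {0<..} t * (2 * (ennreal (min (t\<^sup>2) 1) * ennreal (1 / \<bar>t\<bar> powr (1 + 2 * s)))) \<partial>lborel)"
    by (subst nn_integral_fold_sign, measurable) (simp only: mult_2 power2_minus abs_minus_cancel)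
  also have "\<dots> \<le> (\<integral>\<^sup>+t. 2 * (ennreal (t powr (1 - 2 * s)) * indicator {0..1} t) + 2 * (ennreal (t powr (- 1 - 2 * s)) * indicator {1..} t) \<partial>lborel)"
  proof (rule nn_integral_mono)
    fix t :: real
    consider "t \<le> 0" | "0 < t" "t \<le> 1" | "t > 1" by linarith
    then show "indicator {0<..} t * (2 * (ennreal (min (t\<^sup>2) 1) * ennreal (1 / \<bar>t\<bar> powr (1 + 2 * s))))
      \<le> 2 * (ennreal (t powr (1 - 2 * s)) * indicator {0..1} t) + 2 * (ennreal (t powr (- 1 - 2 * s)) * indicator {1..} t)"
    proof cases
      case 2
      have "t\<^sup>2 / t powr (1 + 2 * s) = t powr (1 - 2 * s)"
        using 2 by (simp add: powr_diff[symmetric] flip: powr_numeral)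
      moreover have "min (t\<^sup>2) 1 = t\<^sup>2" using 2 by (simp add: power_le_one)
      ultimately show ?thesis using 2 by (auto simp: indicator_def simp flip: ennreal_mult)
    next
      case 3
      have "1 / t powr (1 + 2 * s) = t powr (- 1 - 2 * s)"
        using 3 by (simp add: powr_minus[symmetric] divide_inverse)
      moreover have "min (t\<^sup>2) 1 = 1" using 3 by (simp add: one_le_power)
      ultimately show ?thesis using 3 by (auto simp: indicator_def)
    qed (auto simp: indicator_def)
  qed
  also have "\<dots> = 2 * (\<integral>\<^sup>+t. ennreal (t powr (1 - 2 * s)) * indicator {0..1} t \<partial>lborel) + 2 * (\<integral>\<^sup>+t. ennreal (t powr (- 1 - 2 * s)) * indicator {1..} t \<partial>lborel)"
    by (simp add: nn_integral_add nn_integral_cmult)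
  also have "\<dots> < \<infinity>"
    using s nn_integral_has_integral_lebesgue'[OF _ has_integral_powr_from_0[of "1 - 2 * s" 1]]
      nn_integral_has_integral_lebesgue'[OF _ has_integral_powr_to_inf[of "- 1 - 2 * s" 1]]
    by (simp add: ennreal_mult_less_top)
  finally show ?thesis .
qed

lemma min_sum_le:
  assumes "finite A" "\<And>i. i \<in> A \<Longrightarrow> 0 \<le> f i"
  shows "min (\<Sum>i\<in>A. f i) 1 \<le> (\<Sum>i\<in>A. min (f i) (1::real))"
  using assms
proof (induction A rule: finite_induct)
  case (insert a A)
  have "0 \<le> (\<Sum>i\<in>A. f i)" "0 \<le> f a" using insert by (auto intro: sum_nonneg)
  moreover have "min (\<Sum>i\<in>A. f i) 1 \<le> (\<Sum>i\<in>A. min (f i) 1)" using insert by auto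
  moreover have "(\<Sum>i\<in>insert a A. f i) = f a + (\<Sum>i\<in>A. f i)"
    "(\<Sum>i\<in>insert a A. min (f i) 1) = min (f a) 1 + (\<Sum>i\<in>A. min (f i) 1)" using insert by auto
  ultimately show ?case by linarith
qed auto

text \<open>By \<open>min_sum_le\<close> the truncated square of the norm is at most a sum over
  coordinates, so the marginal reduces finiteness to dimension one. There s < 1 controls the origin
  and s > 0 controls infinity.\<close>

lemma nn_integral_min_riesz_finite:
  assumes s: "0 < s" "s < 1"
  shows "(\<integral>\<^sup>+h. ennreal (min ((norm h)\<^sup>2) 1 * riesz s h) \<partial>lborel) < \<infinity>"
proof -
  have "(\<integral>\<^sup>+(h::'a). ennreal (min ((norm h)\<^sup>2) 1 * riesz s h) \<partial>lborel)
     \<le> (\<integral>\<^sup>+(h::'a). (\<Sum>b\<in>Basis. ennreal (min ((h \<bullet> b)\<^sup>2) 1) * ennreal (riesz s h)) \<partial>lborel)"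
  proof (rule nn_integral_mono)
    fix h :: 'a
    have "(norm h)\<^sup>2 = (\<Sum>c\<in>Basis. (h \<bullet> c)\<^sup>2)" 
      unfolding dot_square_norm[symmetric] by (subst euclidean_inner) (simp add: power2_eq_square)
    then have "min ((norm h)\<^sup>2) 1 * riesz s h \<le> (\<Sum>b\<in>Basis. min ((h \<bullet> b)\<^sup>2) 1) * riesz s h"
      using min_sum_le[of "Basis" "\<lambda>c. (h \<bullet> c)\<^sup>2"] by (intro mult_right_mono) auto
    then show "ennreal (min ((norm h)\<^sup>2) 1 * riesz s h) \<le> (\<Sum>b\<in>Basis. ennreal (min ((h \<bullet> b)\<^sup>2) 1) * ennreal (riesz s h))"
      by (simp add: sum_distrib_right ennreal_mult[symmetric] ennreal_leI)
  qed
  also have "\<dots> = (\<Sum>b\<in>Basis. \<integral>\<^sup>+(h::'a). ennreal (min ((h \<bullet> b)\<^sup>2) 1) * ennreal (riesz s h) \<partial>lborel)"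
    by (rule nn_integral_sum) measurable
  also have "\<dots> < \<infinity>"
    using nn_integral_min_1D_finite[OF s] s
    by (subst sum.cong[OF refl nn_integral_inner_riesz_Basis]) (auto simp: ennreal_mult_less_top ennreal_of_nat_eq_real_of_nat)
  finally show ?thesis .
qed

lemma integrable_min_riesz:
  "0 < s \<Longrightarrow> s < 1 \<Longrightarrow> integrable lborel (\<lambda>h. min ((norm h)\<^sup>2) 1 * riesz s h)"
  using nn_integral_min_riesz_finite[of s] by (intro integrableI_bounded) auto

lemma integrable_riesz_outside:
  fixes \<epsilon> :: real
  assumes s: "0 < s" "s < 1" and \<epsilon>: "\<epsilon> > 0"
  shows "integrable lborel (\<lambda>h::'a::euclidean_space. indicator {h. norm h > \<epsilon>} h * riesz s h)"
proof (rule Bochner_Integration.integrable_bound)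
  show "integrable lborel (\<lambda>h::'a. (1 / min (\<epsilon>\<^sup>2) 1) * (min ((norm h)\<^sup>2) 1 * riesz s h))"
    by (intro integrable_mult_right integrable_min_riesz s)
  show "AE h::'a in lborel. norm (indicator {h. norm h > \<epsilon>} h * riesz s h) \<le> norm ((1 / min (\<epsilon>\<^sup>2) 1) * (min ((norm h)\<^sup>2) 1 * riesz s h))"
  proof (rule AE_I2)
    fix h :: 'a
    show "norm (indicator {h. norm h > \<epsilon>} h * riesz s h) \<le> norm ((1 / min (\<epsilon>\<^sup>2) 1) * (min ((norm h)\<^sup>2) 1 * riesz s h))"
    proof (cases "norm h > \<epsilon>")
      case True
      then have "\<epsilon>\<^sup>2 \<le> (norm h)\<^sup>2" using \<epsilon> by (intro power_mono) auto
      then have "1 \<le> min ((norm h)\<^sup>2) 1 / min (\<epsilon>\<^sup>2) 1"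
        using \<epsilon> by (simp add: min.coboundedI1)
      then have "1 * riesz s h \<le> min ((norm h)\<^sup>2) 1 / min (\<epsilon>\<^sup>2) 1 * riesz s h"
        by (intro mult_right_mono) auto
      then show ?thesis using True \<epsilon> by simp
    qed auto
  qed
qed measurable

lemma nn_integral_riesz_scale:
  fixes F :: "'a::euclidean_space \<Rightarrow> ennreal"
  assumes [measurable]: "F \<in> borel_measurable borel" and c: "c > 0"
  shows "(\<integral>\<^sup>+h. F (c *\<^sub>R h) * ennreal (riesz s h) \<partial>lborel) = ennreal (c powr (2 * s)) * (\<integral>\<^sup>+h. F h * ennreal (riesz s h) \<partial>lborel)"
proof -
  have "(\<integral>\<^sup>+h. F h * ennreal (riesz s h) \<partial>lborel) = ennreal (\<bar>c\<bar> ^ DIM('a)) * (\<integral>\<^sup>+h. F (0 + c *\<^sub>R h) * ennreal (riesz s (0 + c *\<^sub>R h)) \<partial>lborel)"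
    using c by (intro nn_integral_lborel_scaleR) auto
  also have "\<dots> = (\<integral>\<^sup>+h. ennreal (c powr (- (2 * s))) * (F (c *\<^sub>R h) * ennreal (riesz s h)) \<partial>lborel)"
  proof (subst nn_integral_cmult[symmetric], measurable, rule nn_integral_cong)
    fix h :: 'a
    have "ennreal (riesz s (c *\<^sub>R h)) * ennreal (\<bar>c\<bar> ^ DIM('a)) = ennreal (c powr (- (2 * s))) * ennreal (riesz s h)"
      using c by (simp add: riesz_scaleR powr_add powr_minus powr_realpow divide_inverse flip: ennreal_mult)
    then show "ennreal (\<bar>c\<bar> ^ DIM('a)) * (F (0 + c *\<^sub>R h) * ennreal (riesz s (0 + c *\<^sub>R h))) = ennreal (c powr (- (2 * s))) * (F (c *\<^sub>R h) * ennreal (riesz s h))"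
      by (simp add: mult_ac)
  qed
  also have "\<dots> = ennreal (c powr (- (2 * s))) * (\<integral>\<^sup>+h. F (c *\<^sub>R h) * ennreal (riesz s h) \<partial>lborel)"
    by (rule nn_integral_cmult) measurable
  finally have "ennreal (c powr (2 * s)) * (\<integral>\<^sup>+h. F h * ennreal (riesz s h) \<partial>lborel) =
     ennreal (c powr (2 * s)) * ennreal (c powr (- (2 * s))) * (\<integral>\<^sup>+h. F (c *\<^sub>R h) * ennreal (riesz s h) \<partial>lborel)"
    by (simp add: mult.assoc)
  then show ?thesis using c by (simp add: powr_minus flip: ennreal_mult)
qed

section \<open>The one-dimensional constant\<close>

text \<open>Half the sharp Hardy constant of the half-line, in the Gagliardo normalisation.\<close>

definition hardy_const1 :: "real \<Rightarrow> real" where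
  "hardy_const1 s = 2 powr (- (2 * s)) * Gamma (1 - s) * Gamma (s + 1/2) / (s * sqrt pi)"

lemma Gamma_legendre_duplication_real:
  assumes "z > (0::real)"
  shows "Gamma z * Gamma (z + 1/2) = 2 powr (1 - 2 * z) * sqrt pi * Gamma (2 * z)"
proof -
  have "complex_of_real (Gamma z * Gamma (z + 1/2)) = Gamma (of_real z) * Gamma (of_real z + 1/2)"
    using Gamma_complex_of_real[of z] Gamma_complex_of_real[of "z + 1/2"] by simp
  also have "\<dots> = exp ((1 - 2 * of_real z) * of_real (ln 2)) * of_real (sqrt pi) * Gamma (2 * of_real z)"
  proof (rule Gamma_legendre_duplication)
    show "complex_of_real z \<notin> \<int>\<^sub>\<le>\<^sub>0" using assms by (auto elim!: nonpos_Ints_cases simp: complex_eq_iff)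
    show "complex_of_real z + 1/2 \<notin> \<int>\<^sub>\<le>\<^sub>0" using assms by (auto elim!: nonpos_Ints_cases simp: complex_eq_iff)
  qed
  also have "\<dots> = complex_of_real (2 powr (1 - 2 * z) * sqrt pi * Gamma (2 * z))"
    using Gamma_complex_of_real[of "2 * z"] by (simp add: powr_def exp_of_real[symmetric])
  finally show ?thesis by (simp only: of_real_eq_iff)
qed

text \<open>Legendre duplication at \<open>1 - s\<close> together with
  \<open>Gamma (s + 1/2) = (s - 1/2) * Gamma (s - 1/2)\<close>. This is the form in which
  integration by parts delivers the constant. It needs s > 1/2: at s = 1/2 the factor
  \<open>s - 1/2\<close> vanishes while the Beta function blows up.\<close>

lemma hardy_const1_Beta:
  assumes s: "1/2 < s" "s < 1"
  shows "hardy_const1 s = (s - 1/2) / (2 * s) * Beta (s - 1/2) (2 - 2 * s)"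
proof -
  have pos: "Gamma (1 - s) > 0" "Gamma (1 - s + 1/2) > 0" "Gamma (s + 1/2) > 0" using s by (auto intro!: Gamma_real_pos)
  have 1: "Gamma (s + 1/2) = (s - 1/2) * Gamma (s - 1/2)"
  proof -
    have "s - 1/2 \<notin> \<int>\<^sub>\<le>\<^sub>0" using s by (auto elim!: nonpos_Ints_cases)
    from Gamma_plus1[OF this] show ?thesis by (simp add: algebra_simps)
  qed
  have 2: "Gamma (1 - s) * Gamma (1 - s + 1/2) = 2 powr (2 * s - 1) * sqrt pi * Gamma (2 - 2 * s)"
    using Gamma_legendre_duplication_real[of "1 - s"] s by (simp add: algebra_simps)
  have 3: "2 powr (- (2 * s)) * 2 powr (2 * s - 1) = (1/2::real)"
    unfolding powr_add[symmetric] by (simp add: powr_minus)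
  have arg: "s - 1/2 + (2 - 2 * s) = 1 - s + 1/2" by simp
  define g where "g = Gamma (1 - s + 1/2)"
  have "hardy_const1 s * g = 2 powr (- (2 * s)) * (Gamma (1 - s) * g) * Gamma (s + 1/2) / (s * sqrt pi)"
    by (simp add: hardy_const1_def)
  also have "\<dots> = (2 powr (- (2 * s)) * 2 powr (2 * s - 1)) * Gamma (2 - 2 * s) * Gamma (s + 1/2) / s"
    unfolding 2 g_def by simp
  finally have "hardy_const1 s * g = Gamma (2 - 2 * s) * Gamma (s + 1/2) / (2 * s)" unfolding 3 by simp
  moreover have "(s - 1/2) / (2 * s) * Beta (s - 1/2) (2 - 2 * s) = Gamma (2 - 2 * s) * Gamma (s + 1/2) / (2 * s) / g"
    unfolding Beta_def arg 1 g_def by simp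
  moreover have "g > 0" using pos(2) unfolding g_def .
  ultimately show ?thesis by (metis nonzero_mult_div_cancel_right less_irrefl)
qed

lemma hardy_const1_half: "hardy_const1 (1/2) = 1"
proof -
  have "hardy_const1 (1/2) = 2 powr (-1) * sqrt pi * Gamma 1 / (1/2 * sqrt pi)"
    unfolding hardy_const1_def using Gamma_one_half_real by simp
  also have "\<dots> = 1" by (simp add: powr_minus)
  finally show ?thesis .
qed

lemma one_minus_powr_le:
  assumes "0 \<le> \<beta>" "\<beta> \<le> 1" "0 \<le> y" "y \<le> (1::real)" "y > 0 \<or> \<beta> > 0"
  shows "0 \<le> 1 - y powr \<beta>" "1 - y powr \<beta> \<le> 1 - y"
proof -
  show "0 \<le> 1 - y powr \<beta>" using assms by (simp add: powr_le1)
  have "y \<le> y powr \<beta>"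
  proof (cases "y = 0")
    case False
    then have "y powr 1 \<le> y powr \<beta>" using assms by (intro powr_mono') auto
    then show ?thesis using assms False by simp
  qed simp
  then show "1 - y powr \<beta> \<le> 1 - y" by simp
qed

text \<open>Two integrations by parts, packed into the primitive \<Phi>: its derivative is the
  integrand minus \<beta>/(2s) times a Beta density. The boundary values are 0 at 1 and 1/(2s) at 0,
  which accounts for the subtracted 1/(2s). This integral is the Q of the whole development: the
  part of the one-dimensional constant that comes from pairs of points inside the half-line.\<close>

lemma has_integral_hardy_Q:
  assumes s: "1/2 < s" "s < 1"
  defines "\<beta> \<equiv> s - 1/2"
  shows "((\<lambda>y. (1 - y powr \<beta>)\<^sup>2 * (1 - y) powr (- 1 - 2 * s)) has_integral (hardy_const1 s - 1 / (2 * s))) {0..1}"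
proof -
  have b: "0 < \<beta>" "\<beta> < 1/2" "2 * \<beta> = 2 * s - 1" using s by (auto simp: \<beta>_def)
  define \<Phi>1 where "\<Phi>1 = (\<lambda>y. (1 - y powr \<beta>)\<^sup>2 * (1 - y) powr (- (2 * s)))"
  define \<Phi>2 where "\<Phi>2 = (\<lambda>y. (y powr \<beta> - (y powr \<beta>)\<^sup>2) * (1 - y) powr (1 - 2 * s))"
  define \<Phi> where "\<Phi> = (\<lambda>y. (\<Phi>1 y + \<Phi>2 y) / (2 * s))"
  \<comment> \<open>At y = 1 both parts of \<Phi> have the shape 0 times a negative power. The
    convention \<open>0 powr r = 0\<close> gives the right value 0, but continuity there rests on
    the bound (1 - y)^(2 - 2s) and on s < 1.\<close>
  have lim0: "((\<lambda>y. (1 - y) powr (2 - 2 * s)) \<longlongrightarrow> 0) (at 1 within {0..1})"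
  proof -
    have "continuous_on {0..1} (\<lambda>y::real. (1 - y) powr (2 - 2 * s))"
      using s by (intro continuous_on_powr' continuous_intros) auto
    then show ?thesis using s by (auto simp: continuous_on_def dest!: bspec[of _ _ 1])
  qed
  have bound1: "\<bar>\<Phi>1 y\<bar> \<le> (1 - y) powr (2 - 2 * s)" if "y \<in> {0..1}" for y
  proof (cases "y = 1")
    case False
    then have y: "0 \<le> y" "y < 1" using that by auto
    have "(1 - y powr \<beta>)\<^sup>2 \<le> (1 - y)\<^sup>2" using one_minus_powr_le[of \<beta> y] b y by (intro power_mono) auto
    then have "\<bar>\<Phi>1 y\<bar> \<le> (1 - y)\<^sup>2 * (1 - y) powr (- (2 * s))" unfolding \<Phi>1_def abs_mult
      by (intro mult_mono) auto
    also have "\<dots> = (1 - y) powr (2 - 2 * s)" using y by (simp add: powr_diff powr_minus divide_inverse)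
    finally show ?thesis .
  qed (simp add: \<Phi>1_def)
  have bound2: "\<bar>\<Phi>2 y\<bar> \<le> (1 - y) powr (2 - 2 * s)" if "y \<in> {0..1}" for y
  proof (cases "y = 1")
    case False
    then have y: "0 \<le> y" "y < 1" using that by auto
    have "\<bar>y powr \<beta> - (y powr \<beta>)\<^sup>2\<bar> = y powr \<beta> * (1 - y powr \<beta>)"
      using one_minus_powr_le[of \<beta> y] b y by (simp add: power2_eq_square algebra_simps abs_of_nonneg mult_left_le)
    also have "\<dots> \<le> 1 * (1 - y)" using one_minus_powr_le[of \<beta> y] b y by (intro mult_mono) auto
    finally have "\<bar>\<Phi>2 y\<bar> \<le> (1 - y) * (1 - y) powr (1 - 2 * s)" unfolding \<Phi>2_def abs_mult
      by (intro mult_mono) auto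
    also have "\<dots> = (1 - y) powr (2 - 2 * s)" using y powr_add[of "1 - y" 1 "1 - 2 * s"] by simp
    finally show ?thesis .
  qed (simp add: \<Phi>2_def)
  have cont: "continuous_on {0..1} \<Phi>"
    unfolding continuous_on_eq_continuous_within
  proof
    fix y :: real assume y: "y \<in> {0..1}"
    show "continuous (at y within {0..1}) \<Phi>"
    proof (cases "y = 1")
      case True
      have "((\<lambda>y. (\<Phi>1 y + \<Phi>2 y) / (2 * s)) \<longlongrightarrow> (0 + 0) / (2 * s)) (at 1 within {0..1})"
        using s by (intro tendsto_intros Lim_null_comparison[OF _ lim0]) (auto simp: eventually_at_filter bound1 bound2)
      then show ?thesis unfolding True continuous_within by (simp add: \<Phi>_def \<Phi>1_def \<Phi>2_def)
    next
      case False
      have "continuous_on {0..<1} \<Phi>" unfolding \<Phi>_def \<Phi>1_def \<Phi>2_def using b s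
        by (intro continuous_intros continuous_on_powr') auto
      then have "continuous (at y within {0..<1}) \<Phi>" using y False by (simp add: continuous_on_eq_continuous_within)
      moreover have "at y within {0..<1} = at y within {0..1}"
        using y False by (intro at_within_nhd[where S="{..<1}"]) auto
      ultimately show ?thesis by simp
    qed
  qed
  define d where "d = (\<lambda>y. (1 - y powr \<beta>)\<^sup>2 * (1 - y) powr (- 1 - 2 * s) - \<beta> / (2 * s) * (y powr (\<beta> - 1) * (1 - y) powr (1 - 2 * s)))"
  have "(d has_integral (\<Phi> 1 - \<Phi> 0)) {0..1}"
  proof (rule fundamental_theorem_of_calculus_interior[OF _ cont])
    fix y :: real assume y: "y \<in> {0<..<1}"
    define a where "a = y powr \<beta>"
    define v where "v = (1 - y) powr (- 1 - 2 * s)"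
    define z where "z = 1 - y"
    have z: "z > 0" "y = 1 - z" using y by (auto simp: z_def)
    have p1: "y powr (\<beta> - 1) = a / y" using y by (simp add: a_def powr_diff)
    have p2: "z powr (- (2 * s)) = z * v" using z(1) powr_add[of z 1 "- 1 - 2 * s"] by (simp add: v_def z_def)
    have p3: "z powr (1 - 2 * s) = z * (z * v)" using z(1) powr_add[of z 1 "- (2 * s)"] by (simp add: p2)
    have "- (2 * s) - 1 = - 1 - 2 * s" by simp
    then have p4: "z powr (- 1 - 2 * s) = v" "z powr (- (2 * s) - 1) = v" by (simp_all only: v_def z_def)
    have "1 - 2 * s - 1 = - (2 * s)" by simp
    then have p5: "z powr (1 - 2 * s - 1) = z * v" using p2 by (simp only:)
    have da: "((\<lambda>y. y powr \<beta>) has_real_derivative (\<beta> * (a / y))) (at y)"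
      using y by (auto intro!: derivative_eq_intros simp: p1[symmetric])
    have dz: "((\<lambda>y. (1 - y) powr r) has_real_derivative (- (r * z powr (r - 1)))) (at y)" for r
      using y by (auto intro!: derivative_eq_intros simp: z_def)
    have da2: "((\<lambda>y. (y powr \<beta>)\<^sup>2) has_real_derivative (2 * a * (\<beta> * (a / y)))) (at y)"
      using DERIV_power[OF da, of 2] by (simp add: a_def mult_ac)
    have D1: "(\<Phi>1 has_real_derivative (2 * (1 - a) * (- (\<beta> * (a / y))) * (z * v) + (1 - a)\<^sup>2 * (2 * s * v))) (at y)"
      unfolding \<Phi>1_def 
      by (rule derivative_eq_intros da dz refl)+ (simp add: p2 p4 a_def[symmetric] z_def[symmetric])
    have D2: "(\<Phi>2 has_real_derivative ((\<beta> * (a / y) - 2 * a * (\<beta> * (a / y))) * (z * (z * v)) + (a - a\<^sup>2) * ((2 * s - 1) * (z * v)))) (at y)"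
      unfolding \<Phi>2_def
      by (rule DERIV_cong[OF DERIV_mult[OF DERIV_diff[OF da da2] dz[of "1 - 2 * s"]]])
        (simp only: p3 p5 a_def[symmetric] z_def[symmetric], algebra)
    have D: "(\<Phi> has_real_derivative ((2 * (1 - a) * (- (\<beta> * (a / y))) * (z * v) + (1 - a)\<^sup>2 * (2 * s * v)) + 
         ((\<beta> * (a / y) - 2 * a * (\<beta> * (a / y))) * (z * (z * v)) + (a - a\<^sup>2) * ((2 * s - 1) * (z * v)))) / (2 * s)) (at y)"
      unfolding \<Phi>_def by (intro DERIV_cdivide DERIV_add D1 D2)
    have ya: "a = (a / y) * y" using y by simp
    define q where "q = a / y"
    have aq: "a = q * (1 - z)" using y z by (simp add: q_def)
    \<comment> \<open>After a = q (1 - z) this is a polynomial identity;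
      \<open>2 * \<beta> = 2 * s - 1\<close> is what makes the mixed terms cancel.\<close>
    have eq: "((2 * (1 - a) * (- (\<beta> * (a / y))) * (z * v) + (1 - a)\<^sup>2 * (2 * s * v)) + 
         ((\<beta> * (a / y) - 2 * a * (\<beta> * (a / y))) * (z * (z * v)) + (a - a\<^sup>2) * ((2 * s - 1) * (z * v)))) 
       = 2 * s * ((1 - a)\<^sup>2 * v) - \<beta> * (a / y * (z * (z * v)))"
      unfolding q_def[symmetric] unfolding b(3)[symmetric] aq by algebra
    have dy: "d y = (1 - a)\<^sup>2 * v - \<beta> / (2 * s) * (a / y * (z * (z * v)))"
      unfolding d_def by (simp only: a_def[symmetric] v_def[symmetric] p1 z_def[symmetric] p3 p4)
    have "d y = ((2 * (1 - a) * (- (\<beta> * (a / y))) * (z * v) + (1 - a)\<^sup>2 * (2 * s * v)) + 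
         ((\<beta> * (a / y) - 2 * a * (\<beta> * (a / y))) * (z * (z * v)) + (a - a\<^sup>2) * ((2 * s - 1) * (z * v)))) / (2 * s)"
      unfolding eq dy using s by (simp add: field_simps)
    with D show "(\<Phi> has_vector_derivative d y) (at y)"
      by (simp add: has_real_derivative_iff_has_vector_derivative)
  qed simp
  moreover have "\<Phi> 1 = 0" "\<Phi> 0 = 1 / (2 * s)" by (simp_all add: \<Phi>_def \<Phi>1_def \<Phi>2_def)
  ultimately have d: "(d has_integral (- (1 / (2 * s)))) {0..1}" by simp
  have "((\<lambda>t. t powr (\<beta> - 1) * (1 - t) powr ((2 - 2 * s) - 1)) has_integral Beta \<beta> (2 - 2 * s)) {0..1}"
    using b s by (intro has_integral_Beta_real) auto
  from has_integral_add[OF d has_integral_mult_right[OF this, of "\<beta> / (2 * s)"]]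
  show ?thesis unfolding hardy_const1_Beta[OF s] d_def \<beta>_def by (simp add: algebra_simps)
qed

text \<open>The negated second difference at \<open>1\<close> of the half-line ground state. For \<open>\<beta> = 0\<close> the convention
  \<open>0 powr 0 = 0\<close> makes \<open>max 0 t powr \<beta>\<close> the indicator of \<open>{0<..}\<close>, which is what \<open>s = 1/2\<close> needs.\<close>

definition sdiff :: "real \<Rightarrow> real \<Rightarrow> real" where
  "sdiff \<beta> t = 2 - max 0 (1 + t) powr \<beta> - max 0 (1 - t) powr \<beta>"

lemma sdiff_measurable [measurable]: "sdiff \<beta> \<in> borel_measurable borel"
  unfolding sdiff_def[abs_def] by measurable

lemma sdiff_minus [simp]: "sdiff \<beta> (- t) = sdiff \<beta> t"
  by (simp add: sdiff_def)

lemma powr_le_Bernoulli: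
  assumes "0 \<le> \<beta>" "\<beta> \<le> 1" "t > (-1::real)"
  shows "(1 + t) powr \<beta> \<le> 1 + \<beta> * t"
  using Youngs_inequality_0[of \<beta> "1 - \<beta>" "1 + t" 1] assms by (simp add: algebra_simps)

text \<open>The lower bound is concavity, applied to each power separately. For the upper bound,
  with a and c the two powers, the arithmetic-geometric mean inequality gives (a + c)^2 >= 4ac >=
  4(1 - t^2) >= (2(1 - t^2))^2.\<close>

lemma sdiff_bounds:
  assumes b: "0 \<le> \<beta>" "\<beta> \<le> 1" and t: "\<bar>t\<bar> < 1"
  shows "0 \<le> sdiff \<beta> t" "sdiff \<beta> t \<le> 2 * t\<^sup>2"
proof -
  have p: "1 + t > 0" "1 - t > 0" using t by auto
  define a where "a = (1 + t) powr \<beta>"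
  define c where "c = (1 - t) powr \<beta>"
  have S: "sdiff \<beta> t = 2 - a - c" using p by (simp add: sdiff_def a_def c_def max_def)
  have ac: "a > 0" "c > 0" using p by (auto simp: a_def c_def)
  have "a * c = ((1 + t) * (1 - t)) powr \<beta>" using p by (simp add: a_def c_def powr_mult)
  also have "(1 + t) * (1 - t) = 1 - t\<^sup>2" by (simp add: power2_eq_square algebra_simps)
  finally have acp: "a * c = (1 - t\<^sup>2) powr \<beta>" .
  have t2: "t\<^sup>2 < 1" using t by (simp add: abs_square_less_1)
  have ac1: "1 - t\<^sup>2 \<le> a * c" unfolding acp using one_minus_powr_le[of \<beta> "1 - t\<^sup>2"] b t2 by auto
  have "a \<le> 1 + \<beta> * t" "c \<le> 1 + \<beta> * (- t)"
    unfolding a_def c_def using powr_le_Bernoulli[of \<beta> t] powr_le_Bernoulli[of \<beta> "- t"] b p by auto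
  then show "0 \<le> sdiff \<beta> t" unfolding S by simp
  have "(2 * (1 - t\<^sup>2))\<^sup>2 \<le> 4 * (1 - t\<^sup>2)"
  proof -
    have "(1 - t\<^sup>2) * (1 - t\<^sup>2) \<le> 1 * (1 - t\<^sup>2)" using t2 by (intro mult_right_mono) auto
    then show ?thesis unfolding power2_eq_square by (simp add: algebra_simps)
  qed
  also have "\<dots> \<le> 4 * (a * c)" using ac1 by simp
  also have "\<dots> \<le> (a + c)\<^sup>2" using sum_squares_ge_zero[of "a - c" 0] by (simp add: power2_eq_square algebra_simps)
  finally have "2 * (1 - t\<^sup>2) \<le> a + c" by (rule power2_le_imp_le) (use ac in auto)
  then show "sdiff \<beta> t \<le> 2 * t\<^sup>2" unfolding S by simp
qed

lemma abs_sdiff_le: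
  assumes b: "0 \<le> \<beta>" "\<beta> \<le> 1" and t: "\<bar>t\<bar> \<ge> 1"
  shows "\<bar>sdiff \<beta> t\<bar> \<le> 4 * \<bar>t\<bar> powr \<beta>"
proof -
  have "sdiff \<beta> t = sdiff \<beta> \<bar>t\<bar>" by (simp add: abs_if)
  also have "\<dots> = 2 - (1 + \<bar>t\<bar>) powr \<beta>" using t by (simp add: sdiff_def max_def)
  finally have S: "\<bar>sdiff \<beta> t\<bar> \<le> 2 + (1 + \<bar>t\<bar>) powr \<beta>"
    using abs_triangle_ineq4[of 2 "(1 + \<bar>t\<bar>) powr \<beta>"] by simp
  have "(1 + \<bar>t\<bar>) powr \<beta> \<le> (2 * \<bar>t\<bar>) powr \<beta>" using b t by (intro powr_mono2) auto
  also have "\<dots> = 2 powr \<beta> * \<bar>t\<bar> powr \<beta>" using t by (simp add: powr_mult)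
  also have "\<dots> \<le> 2 powr 1 * \<bar>t\<bar> powr \<beta>" using b by (intro mult_right_mono powr_mono) auto
  finally have 1: "(1 + \<bar>t\<bar>) powr \<beta> \<le> 2 * \<bar>t\<bar> powr \<beta>" by simp
  have "1 \<le> \<bar>t\<bar> powr \<beta>" using b t by (simp add: ge_one_powr_ge_zero)
  with S 1 show ?thesis by simp
qed

lemma integrable_min_1D:
  assumes s: "0 < s" "s < 1"
  shows "integrable lborel (\<lambda>t::real. min (t\<^sup>2) 1 / \<bar>t\<bar> powr (1 + 2 * s))"
proof (rule integrableI_bounded)
  have "(\<integral>\<^sup>+(t::real). ennreal (norm (min (t\<^sup>2) 1 / \<bar>t\<bar> powr (1 + 2 * s))) \<partial>lborel)
     = (\<integral>\<^sup>+t. ennreal (min (t\<^sup>2) 1) * ennreal (1 / \<bar>t\<bar> powr (1 + 2 * s)) \<partial>lborel)"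
    by (intro nn_integral_cong) (simp flip: ennreal_mult)
  then show "(\<integral>\<^sup>+(t::real). ennreal (norm (min (t\<^sup>2) 1 / \<bar>t\<bar> powr (1 + 2 * s))) \<partial>lborel) < \<infinity>"
    using nn_integral_min_1D_finite[OF s] by simp
qed measurable

lemma integrable_sdiff:
  assumes b: "0 \<le> \<beta>" "\<beta> \<le> 1" and s: "\<beta> < 2 * s" "s < 1"
  shows "integrable lborel (\<lambda>t. sdiff \<beta> t / \<bar>t\<bar> powr (1 + 2 * s))"
proof (rule Bochner_Integration.integrable_bound)
  \<comment> \<open>Far out the second difference grows like |t|^\<beta>, which against the kernel
    of order s amounts to the kernel of order s - \<beta>/2; this order is still positive.\<close>
  let ?s = "s - \<beta> / 2"
  show "integrable lborel (\<lambda>t::real. 2 * (min (t\<^sup>2) 1 / \<bar>t\<bar> powr (1 + 2 * s)) + 4 * (min (t\<^sup>2) 1 / \<bar>t\<bar> powr (1 + 2 * ?s)))"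
    using b s by (intro Bochner_Integration.integrable_add integrable_mult_right integrable_min_1D) auto
  show "AE t in lborel. norm (sdiff \<beta> t / \<bar>t\<bar> powr (1 + 2 * s))
      \<le> norm (2 * (min (t\<^sup>2) 1 / \<bar>t\<bar> powr (1 + 2 * s)) + 4 * (min (t\<^sup>2) 1 / \<bar>t\<bar> powr (1 + 2 * ?s)))"
  proof (rule AE_I2)
    fix t :: real
    have nn: "0 \<le> min (t\<^sup>2) 1 / \<bar>t\<bar> powr (1 + 2 * s)" "0 \<le> min (t\<^sup>2) 1 / \<bar>t\<bar> powr (1 + 2 * ?s)" by auto
    have "\<bar>sdiff \<beta> t\<bar> / \<bar>t\<bar> powr (1 + 2 * s) \<le> 2 * (min (t\<^sup>2) 1 / \<bar>t\<bar> powr (1 + 2 * s)) + 4 * (min (t\<^sup>2) 1 / \<bar>t\<bar> powr (1 + 2 * ?s))"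
    proof (cases "\<bar>t\<bar> < 1")
      case True
      then have "min (t\<^sup>2) 1 = t\<^sup>2" by (simp add: abs_square_le_1 less_imp_le)
      then have "\<bar>sdiff \<beta> t\<bar> / \<bar>t\<bar> powr (1 + 2 * s) \<le> 2 * min (t\<^sup>2) 1 / \<bar>t\<bar> powr (1 + 2 * s)"
        using sdiff_bounds[OF b True] by (intro divide_right_mono) auto
      then show ?thesis by (simp add: add_increasing2)
    next
      case False
      then have t: "\<bar>t\<bar> \<ge> 1" by simp
      then have m: "min (t\<^sup>2) 1 = 1" by (metis abs_le_square_iff abs_one min.absorb2 one_power2)
      have "\<bar>sdiff \<beta> t\<bar> / \<bar>t\<bar> powr (1 + 2 * s) \<le> 4 * \<bar>t\<bar> powr \<beta> / \<bar>t\<bar> powr (1 + 2 * s)"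
        using abs_sdiff_le[OF b t] by (intro divide_right_mono) auto
      also have "\<dots> = 4 / \<bar>t\<bar> powr (1 + 2 * ?s)"
      proof -
        have e: "1 + 2 * s = \<beta> + (1 + 2 * ?s)" by (simp add: field_simps)
        show ?thesis using t by (subst e, subst powr_add) simp
      qed
      finally show ?thesis using t m by (simp add: add_increasing)
    qed
    then show "norm (sdiff \<beta> t / \<bar>t\<bar> powr (1 + 2 * s))
      \<le> norm (2 * (min (t\<^sup>2) 1 / \<bar>t\<bar> powr (1 + 2 * s)) + 4 * (min (t\<^sup>2) 1 / \<bar>t\<bar> powr (1 + 2 * ?s)))"
      using nn by simp
  qed
qed measurable

lemma lborel_integral_even:
  fixes F :: "real \<Rightarrow> real"
  assumes int: "integrable lborel F" and even: "\<And>t. F (- t) = F t"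
  shows "(LINT t|lborel. F t) = 2 * (LINT t:{0<..}|lborel. F t)"
proof -
  have [measurable]: "F \<in> borel_measurable borel" using int by auto
  have i1: "integrable lborel (\<lambda>t. indicator {0<..} t *\<^sub>R F t)" and i2: "integrable lborel (\<lambda>t. indicator {..<0} t *\<^sub>R F t)"
    by (rule integrable_mult_indicator[OF _ int], simp)+
  have "(LINT t|lborel. F t) = (LINT t|lborel. indicator {0<..} t *\<^sub>R F t + indicator {..<0} t *\<^sub>R F t)"
    by (rule integral_cong_AE, measurable, use AE_lborel_singleton[of "0::real"] in eventually_elim) (auto simp: indicator_def)
  also have "\<dots> = (LINT t|lborel. indicator {0<..} t *\<^sub>R F t) + (LINT t|lborel. indicator {..<0} t *\<^sub>R F t)"
    by (rule Bochner_Integration.integral_add[OF i1 i2])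
  also have "(LINT t|lborel. indicator {..<0} t *\<^sub>R F t) = (LINT t|lborel. indicator {0<..} t *\<^sub>R F t)"
    by (subst lborel_integral_real_affine[where c="-1" and t=0]) (auto intro!: Bochner_Integration.integral_cong simp: even indicator_def)
  finally show ?thesis by (simp add: set_lebesgue_integral_def)
qed

lemma has_integral_reflect_01:
  fixes f :: "real \<Rightarrow> real"
  assumes "(f has_integral I) {0..1}"
  shows "((\<lambda>x. f (1 - x)) has_integral I) {0..1}"
proof -
  have "((\<lambda>x. f ((-1) *\<^sub>R x + 1)) has_integral (1 / (\<bar>-1\<bar> ^ DIM(real))) *\<^sub>R I) ((\<lambda>x. (1 / (-1)) *\<^sub>R x + - ((1 / (-1)) *\<^sub>R 1)) ` cbox 0 1)"
    using assms by (intro has_integral_affinity) auto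
  moreover have "(\<lambda>x. (1 / (-1)) *\<^sub>R x + - ((1 / (-1)) *\<^sub>R 1)) ` cbox 0 1 = {0..1::real}"
    by (auto simp: image_iff intro!: bexI[of _ "1 - _"])
  ultimately show ?thesis by simp
qed

text \<open>Split the second difference into 1 - (1 - t)_+^\<beta> and (1 + t)^\<beta> - 1; against
  the kernel each part alone diverges at 0, hence the truncation. The substitution t/(1+t) moves the
  second part to (0,1) and turns its integrand into (1 - t)^\<beta> times that of the first, with
  the same kernel. With A = 1 - (1 - t)^\<beta> the difference is A - (1 - t)^\<beta> A = A^2, the
  integrand of \<open>has_integral_hardy_Q\<close> reflected, and the tail beyond 1 returns the
  missing 1/(2s).\<close>

lemma sdiff_truncated_integral:
  assumes s: "1/2 < s" "s < 1" and e: "0 < \<epsilon>" "\<epsilon> < 1"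
  defines "\<beta> \<equiv> s - 1/2"
  shows "\<bar>integral {\<epsilon>..} (\<lambda>t. sdiff \<beta> t * t powr (- 1 - 2 * s)) - hardy_const1 s\<bar> \<le> (4 + 1 / (2 - 2 * s)) * \<epsilon> powr (2 - 2 * s)"
proof -
  have b: "0 < \<beta>" "\<beta> < 1/2" "2 * \<beta> = 2 * s - 1" using s by (auto simp: \<beta>_def)
  \<comment> \<open>The image of \<epsilon> under the substitution. The two truncation points differ
    by at most \<epsilon>^2, so the mismatch interval contributes O(\<epsilon>^2 \<epsilon>^(-2s)),
    which vanishes because s < 1.\<close>
  define \<delta> where "\<delta> = \<epsilon> / (1 + \<epsilon>)"
  have d: "0 < \<delta>" "\<delta> < \<epsilon>" "\<delta> < 1" "\<epsilon> / 2 \<le> \<delta>" "\<epsilon> - \<delta> \<le> \<epsilon>\<^sup>2" using e by (auto simp: \<delta>_def field_simps power2_eq_square)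
  define A where "A = (\<lambda>t. 1 - (1 - t) powr \<beta>)"
  define k where "k = (\<lambda>t::real. t powr (- 1 - 2 * s))"
  define B where "B = (\<lambda>t. (1 - t) powr \<beta> * A t)"
  have A01: "0 \<le> A t" "A t \<le> t" if "0 \<le> t" "t \<le> 1" for t
    using one_minus_powr_le[of \<beta> "1 - t"] that b by (auto simp: A_def)
  have pw: "(1 - t) powr \<beta> \<le> 1" if "0 \<le> t" "t \<le> 1" for t using that b by (simp add: powr_le1)
  have contA: "continuous_on {c..1} (\<lambda>t. A t * k t)" and contB: "continuous_on {c..1} (\<lambda>t. B t * k t)" if "c > 0" for c
    unfolding A_def k_def B_def using b that by (auto intro!: continuous_intros continuous_on_powr')
  have Q: "((\<lambda>t. (A t)\<^sup>2 * k t) has_integral (hardy_const1 s - 1 / (2 * s))) {0..1}"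
    using has_integral_reflect_01[OF has_integral_hardy_Q[OF s]] by (simp add: A_def k_def \<beta>_def)
  have tail: "(k has_integral 1 / (2 * s)) {1..}"
    using has_integral_powr_to_inf[of "- 1 - 2 * s" 1] s by (simp add: k_def)
  have H1: "((\<lambda>t. (1 - max 0 (1 - t) powr \<beta>) * k t) has_integral (integral {\<epsilon>..1} (\<lambda>t. A t * k t) + 1 / (2 * s))) {\<epsilon>..}"
  proof -
    have 1: "((\<lambda>t. (1 - max 0 (1 - t) powr \<beta>) * k t) has_integral (integral {\<epsilon>..1} (\<lambda>t. A t * k t))) {\<epsilon>..1}"
      by (rule has_integral_eq[OF _ integrable_integral]) (auto simp: A_def contA[THEN integrable_continuous_real] e contA[unfolded A_def, THEN integrable_continuous_real])
    have 2: "((\<lambda>t. (1 - max 0 (1 - t) powr \<beta>) * k t) has_integral (1 / (2 * s))) {1..}"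
      by (rule has_integral_eq[OF _ tail]) (auto simp: max_def)
    have "{\<epsilon>..} = {\<epsilon>..1} \<union> {1..}" using e by auto
    moreover have "negligible ({\<epsilon>..1} \<inter> {1..})" by (rule negligible_subset[of "{1}"]) auto
    ultimately show ?thesis using has_integral_Un[OF 1 2] by (simp only:)
  qed
  have H2: "((\<lambda>t. ((1 + t) powr \<beta> - 1) * k t) has_integral (integral {\<delta>..1} (\<lambda>t. B t * k t))) {\<epsilon>..}"
  proof -
    define g where "g = (\<lambda>t::real. t / (1 + t))"
    have im: "g ` {\<epsilon>..} = {\<delta>..<1}"
    proof
      show "g ` {\<epsilon>..} \<subseteq> {\<delta>..<1}" using e by (auto simp: g_def \<delta>_def field_simps)
      show "{\<delta>..<1} \<subseteq> g ` {\<epsilon>..}"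
      proof
        fix y assume y: "y \<in> {\<delta>..<1}"
        have "y / (1 - y) \<ge> \<epsilon>" using y e d by (auto simp: \<delta>_def field_simps)
        moreover have "g (y / (1 - y)) = y" using y by (simp add: g_def field_simps)
        ultimately show "y \<in> g ` {\<epsilon>..}" by (metis atLeast_iff imageI)
      qed
    qed
    have der: "(g has_field_derivative (1 / (1 + t)\<^sup>2)) (at t within {\<epsilon>..})" if "t \<in> {\<epsilon>..}" for t
      using that e unfolding g_def by (auto intro!: derivative_eq_intros simp: power2_eq_square)
    have inj: "inj_on g {\<epsilon>..}" using e by (auto simp: inj_on_def g_def field_simps)
    have abs1: "(\<lambda>t. B t * k t) absolutely_integrable_on {\<delta>..1}"
      by (intro absolutely_integrable_continuous_real contB d)
    have abs2: "(\<lambda>t. B t * k t) absolutely_integrable_on g ` {\<epsilon>..}"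
      unfolding im by (rule set_integrable_subset[OF abs1]) (use d in auto)
    have "integral (g ` {\<epsilon>..}) (\<lambda>t. B t * k t) = integral {\<delta>..1} (\<lambda>t. B t * k t)"
      unfolding im by (rule integral_spike_set) (auto intro: negligible_subset[of "{1}"])
    with abs2 have "(\<lambda>t. \<bar>1 / (1 + t)\<^sup>2\<bar> * (B (g t) * k (g t))) absolutely_integrable_on {\<epsilon>..} \<and>
        integral {\<epsilon>..} (\<lambda>t. \<bar>1 / (1 + t)\<^sup>2\<bar> * (B (g t) * k (g t))) = integral {\<delta>..1} (\<lambda>t. B t * k t)"
      by (subst has_absolute_integral_change_of_variables_1'[OF _ der inj]) auto
    then have "((\<lambda>t. \<bar>1 / (1 + t)\<^sup>2\<bar> * (B (g t) * k (g t))) has_integral integral {\<delta>..1} (\<lambda>t. B t * k t)) {\<epsilon>..}"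
      using set_lebesgue_integral_eq_integral(1) by (auto simp: has_integral_iff absolutely_integrable_on_def)
    then show ?thesis
    proof (rule has_integral_eq[rotated])
      fix t assume "t \<in> {\<epsilon>..}"
      then have t: "t > 0" using e by auto
      define u where "u = 1 + t"
      have u: "u > 0" using t by (simp add: u_def)
      have 1: "1 - g t = 1 / u" using t by (simp add: g_def u_def field_simps)
      have 2: "k (g t) = k t * u powr (1 + 2 * s)"
        using t u by (simp add: g_def k_def powr_divide powr_minus_divide u_def[symmetric] powr_diff powr_add field_simps powr_minus)
      \<comment> \<open>Only for this exponent do the kernel and the Jacobian leave exactly
        u^(2\<beta>), which cancels the denominator of \<open>B (g t)\<close>.\<close>
      have e: "1 + 2 * s = 2 + (\<beta> + \<beta>)" using b(3) by simp
      have 3: "u powr (1 + 2 * s) = u\<^sup>2 * (u powr \<beta> * u powr \<beta>)"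
        unfolding e powr_add using u by simp
      have 4: "B (g t) = (u powr \<beta> - 1) / (u powr \<beta> * u powr \<beta>)"
        using u by (simp add: B_def A_def 1 powr_divide field_simps)
      have up: "u powr \<beta> > 0" using u by simp
      show "\<bar>1 / (1 + t)\<^sup>2\<bar> * (B (g t) * k (g t)) = ((1 + t) powr \<beta> - 1) * k t"
        unfolding 2 3 4 u_def[symmetric] using u up by simp
    qed
  qed
  have "((\<lambda>t. sdiff \<beta> t * k t) has_integral (integral {\<epsilon>..1} (\<lambda>t. A t * k t) + 1 / (2 * s) - integral {\<delta>..1} (\<lambda>t. B t * k t))) {\<epsilon>..}"
  proof (rule has_integral_eq[OF _ has_integral_diff[OF H1 H2]])
    fix t assume "t \<in> {\<epsilon>..}"
    then show "(1 - max 0 (1 - t) powr \<beta>) * k t - ((1 + t) powr \<beta> - 1) * k t = sdiff \<beta> t * k t"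
      using e by (simp add: sdiff_def max_def algebra_simps)
  qed
  then have T: "integral {\<epsilon>..} (\<lambda>t. sdiff \<beta> t * k t) = integral {\<epsilon>..1} (\<lambda>t. A t * k t) + 1 / (2 * s) - integral {\<delta>..1} (\<lambda>t. B t * k t)"
    by (rule integral_unique)
  have B1: "integral {\<delta>..\<epsilon>} (\<lambda>t. B t * k t) + integral {\<epsilon>..1} (\<lambda>t. B t * k t) = integral {\<delta>..1} (\<lambda>t. B t * k t)"
    using d e by (intro Henstock_Kurzweil_Integration.integral_combine integrable_continuous_real contB) auto
  have "integral {\<epsilon>..1} (\<lambda>t. A t * k t) - integral {\<epsilon>..1} (\<lambda>t. B t * k t) = integral {\<epsilon>..1} (\<lambda>t. A t * k t - B t * k t)"
    using e by (intro Henstock_Kurzweil_Integration.integral_diff[symmetric] integrable_continuous_real contA contB) auto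
  also have "\<dots> = integral {\<epsilon>..1} (\<lambda>t. (A t)\<^sup>2 * k t)"
    by (intro Henstock_Kurzweil_Integration.integral_cong) (simp add: B_def A_def power2_eq_square algebra_simps)
  finally have AB: "integral {\<epsilon>..1} (\<lambda>t. A t * k t) - integral {\<epsilon>..1} (\<lambda>t. B t * k t) = integral {\<epsilon>..1} (\<lambda>t. (A t)\<^sup>2 * k t)" .
  have intQ: "(\<lambda>t. (A t)\<^sup>2 * k t) integrable_on {0..1}" using Q by auto
  have A2: "integral {0..\<epsilon>} (\<lambda>t. (A t)\<^sup>2 * k t) + integral {\<epsilon>..1} (\<lambda>t. (A t)\<^sup>2 * k t) = hardy_const1 s - 1 / (2 * s)"
    using e Henstock_Kurzweil_Integration.integral_combine[OF _ _ intQ, of \<epsilon>] integral_unique[OF Q] by simp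
  have kk: "t\<^sup>2 * k t = t powr (1 - 2 * s)" "t * k t = t powr (- (2 * s))" if "t > 0" for t
    using that powr_add[of t 2 "- 1 - 2 * s"] powr_add[of t 1 "- 1 - 2 * s"] by (simp_all add: k_def)
  have pI: "((\<lambda>t. t powr (1 - 2 * s)) has_integral (\<epsilon> powr (2 - 2 * s) / (2 - 2 * s))) {0..\<epsilon>}"
    using has_integral_powr_from_0[of "1 - 2 * s" \<epsilon>] s e by (simp add: algebra_simps)
  have small1: "0 \<le> integral {0..\<epsilon>} (\<lambda>t. (A t)\<^sup>2 * k t)" "integral {0..\<epsilon>} (\<lambda>t. (A t)\<^sup>2 * k t) \<le> \<epsilon> powr (2 - 2 * s) / (2 - 2 * s)"
  proof -
    have i: "(\<lambda>t. (A t)\<^sup>2 * k t) integrable_on {0..\<epsilon>}"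
      using e by (intro integrable_subinterval_real[OF intQ]) auto
    show "0 \<le> integral {0..\<epsilon>} (\<lambda>t. (A t)\<^sup>2 * k t)"
      using i by (rule Henstock_Kurzweil_Integration.integral_nonneg) (simp add: k_def)
    have "(A t)\<^sup>2 * k t \<le> t powr (1 - 2 * s)" if "t \<in> {0..\<epsilon>}" for t
    proof (cases "t = 0")
      case False
      then have t: "t > 0" "t \<le> 1" using that e by auto
      then have "(A t)\<^sup>2 * k t \<le> t\<^sup>2 * k t" using A01[of t] by (intro mult_right_mono power_mono) (auto simp: k_def)
      then show ?thesis using kk t by simp
    qed (simp add: k_def)
    then have "integral {0..\<epsilon>} (\<lambda>t. (A t)\<^sup>2 * k t) \<le> integral {0..\<epsilon>} (\<lambda>t. t powr (1 - 2 * s))"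
      using i pI by (intro integral_le) auto
    then show "integral {0..\<epsilon>} (\<lambda>t. (A t)\<^sup>2 * k t) \<le> \<epsilon> powr (2 - 2 * s) / (2 - 2 * s)"
      using integral_unique[OF pI] by simp
  qed
  have small2: "0 \<le> integral {\<delta>..\<epsilon>} (\<lambda>t. B t * k t)" "integral {\<delta>..\<epsilon>} (\<lambda>t. B t * k t) \<le> 4 * \<epsilon> powr (2 - 2 * s)"
  proof -
    have i: "(\<lambda>t. B t * k t) integrable_on {\<delta>..\<epsilon>}"
      using d e by (intro integrable_continuous_real continuous_on_subset[OF contB[of \<delta>]]) auto
    have B01: "0 \<le> B t" "B t \<le> t" if "0 \<le> t" "t \<le> 1" for t
    proof -
      show "0 \<le> B t" using A01[OF that] by (simp add: B_def)
      have "B t \<le> 1 * t" unfolding B_def using A01[OF that] pw[OF that] by (intro mult_mono) auto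
      then show "B t \<le> t" by simp
    qed
    show "0 \<le> integral {\<delta>..\<epsilon>} (\<lambda>t. B t * k t)"
      using i d e by (intro Henstock_Kurzweil_Integration.integral_nonneg) (auto simp: k_def intro!: mult_nonneg_nonneg B01)
    have "B t * k t \<le> (\<epsilon> / 2) powr (- (2 * s))" if "t \<in> {\<delta>..\<epsilon>}" for t
    proof -
      have t: "t > 0" "t \<le> 1" "\<epsilon> / 2 \<le> t" using that d e by auto
      have "B t * k t \<le> t * k t" using B01[of t] t by (intro mult_right_mono) (auto simp: k_def)
      also have "\<dots> = t powr (- (2 * s))" using kk t by simp
      also have "\<dots> \<le> (\<epsilon> / 2) powr (- (2 * s))" using t e s by (intro powr_mono2') auto
      finally show ?thesis .
    qed
    then have "integral {\<delta>..\<epsilon>} (\<lambda>t. B t * k t) \<le> integral {\<delta>..\<epsilon>} (\<lambda>t. (\<epsilon> / 2) powr (- (2 * s)))"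
      using i by (intro integral_le) auto
    also have "\<dots> = (\<epsilon> - \<delta>) * (\<epsilon> / 2) powr (- (2 * s))" using d by simp
    also have "\<dots> \<le> \<epsilon>\<^sup>2 * (4 * \<epsilon> powr (- (2 * s)))"
    proof (intro mult_mono)
      have "(\<epsilon> / 2) powr (- (2 * s)) = 2 powr (2 * s) * \<epsilon> powr (- (2 * s))"
        using e by (simp add: powr_divide powr_minus field_simps)
      also have "2 powr (2 * s) \<le> 2 powr (2::real)" using s by (intro powr_mono) auto
      finally show "(\<epsilon> / 2) powr (- (2 * s)) \<le> 4 * \<epsilon> powr (- (2 * s))" by (simp add: mult_right_mono)
    qed (use d in auto)
    also have "\<dots> = 4 * \<epsilon> powr (2 - 2 * s)" using e by (simp add: powr_diff powr_minus field_simps)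
    finally show "integral {\<delta>..\<epsilon>} (\<lambda>t. B t * k t) \<le> 4 * \<epsilon> powr (2 - 2 * s)" .
  qed
  have "integral {\<epsilon>..} (\<lambda>t. sdiff \<beta> t * k t) - hardy_const1 s = - integral {0..\<epsilon>} (\<lambda>t. (A t)\<^sup>2 * k t) - integral {\<delta>..\<epsilon>} (\<lambda>t. B t * k t)"
    using T AB A2 B1 by simp
  then have "\<bar>integral {\<epsilon>..} (\<lambda>t. sdiff \<beta> t * k t) - hardy_const1 s\<bar> \<le> \<epsilon> powr (2 - 2 * s) / (2 - 2 * s) + 4 * \<epsilon> powr (2 - 2 * s)"
    using small1 small2 by simp
  then show ?thesis by (simp add: k_def algebra_simps)
qed

text \<open>For s > 1/2 let the truncation tend to 0; the part on (0,\<epsilon>) is bounded through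
  \<open>sdiff_bounds\<close>. For s = 1/2 the convention \<open>0 powr 0 = 0\<close> makes the
  second difference equal to 0 on (0,1) and to 1 from 1 on, so the integral over the half-line is
  that of t^(-2).\<close>

lemma integral_sdiff:
  assumes s: "1/2 \<le> s" "s < 1"
  shows "(LINT t|lborel. sdiff (s - 1/2) t / \<bar>t\<bar> powr (1 + 2 * s)) = 2 * hardy_const1 s"
proof -
  define \<beta> where "\<beta> = s - 1/2"
  have b: "0 \<le> \<beta>" "\<beta> \<le> 1" "\<beta> < 2 * s" using s by (auto simp: \<beta>_def)
  define F where "F = (\<lambda>t. sdiff \<beta> t / \<bar>t\<bar> powr (1 + 2 * s))"
  have F: "integrable lborel F" unfolding F_def by (rule integrable_sdiff) (use b s in auto)
  have Fk: "F t = sdiff \<beta> t * t powr (- 1 - 2 * s)" if "t > 0" for t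
    using that powr_minus_divide[of t "1 + 2 * s"] by (simp add: F_def)
  have sF: "set_integrable lborel X F" if "X \<in> sets lborel" for X
    unfolding set_integrable_def by (rule integrable_mult_indicator[OF that F])
  define L where "L = (LINT t:{0<..}|lborel. F t)"
  have "L = hardy_const1 s"
  proof (cases "s = 1/2")
    case True
    have 1: "((\<lambda>t::real. t powr (-2)) has_integral 1) {1..}"
      using has_integral_powr_to_inf[of "-2" 1] by simp
    have FF: "indicator {0<..} t *\<^sub>R F t = indicator {1..} t *\<^sub>R t powr (-2)" if t0: "t \<noteq> 0" for t
    proof -
      have b0: "\<beta> = 0" "1 + 2 * s = 2" using True by (auto simp: \<beta>_def)
      consider "t < 0" | "0 < t" "t < 1" | "1 \<le> t"
        using t0 by (cases t "0::real" rule: linorder_cases; cases "t < 1") auto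
      then show ?thesis
      proof cases
        case 3
        then have "max 0 (1 - t) = 0" "F t = sdiff \<beta> t * t powr (-2)" using Fk[of t] True by auto
        then show ?thesis using 3 by (simp add: sdiff_def b0)
      qed (simp_all add: F_def sdiff_def b0)
    qed
    have "L = (LINT t:{1..}|lborel. t powr (-2))"
      unfolding L_def set_lebesgue_integral_def
      by (rule integral_cong_AE, simp add: F_def, simp, use AE_lborel_singleton[of "0::real"] in eventually_elim) (rule FF)
    also have "set_integrable lborel {1..} (\<lambda>t::real. t powr (-2))"
    proof -
      have "set_integrable lborel {0<..} F" by (rule sF) simp
      then show ?thesis unfolding set_integrable_def
        by (subst integrable_cong_AE[where g="\<lambda>t. indicator {0<..} t *\<^sub>R F t"]; use AE_lborel_singleton[of "0::real"] in \<open>(simp add: F_def; fail) | eventually_elim\<close>) (metis FF)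
    qed
    then have "(LINT t:{1..}|lborel. t powr (-2)) = (1::real)"
      using set_borel_integral_eq_integral(2) integral_unique[OF 1] by metis
    finally have "L = 1" .
    then show ?thesis using hardy_const1_half by (simp only: True)
  next
    case False
    then have s': "1/2 < s" using s by simp
    define C where "C = 4 + 1 / (2 - 2 * s) + 2 / (2 - 2 * s)"
    have est: "\<bar>L - hardy_const1 s\<bar> \<le> C * \<epsilon> powr (2 - 2 * s)" if e: "0 < \<epsilon>" "\<epsilon> < 1" for \<epsilon>
    proof -
      have "L = (LINT t:{0<..<\<epsilon>}|lborel. F t) + (LINT t:{\<epsilon>..}|lborel. F t)"
      proof -
        have "{0<..} = {0<..<\<epsilon>} \<union> {\<epsilon>..}" using e by auto
        then show ?thesis unfolding L_def by (simp only:) (rule set_integral_Un; (rule sF)?; force)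
      qed
      moreover have "(LINT t:{\<epsilon>..}|lborel. F t) = integral {\<epsilon>..} (\<lambda>t. sdiff \<beta> t * t powr (- 1 - 2 * s))"
        using e by (subst set_borel_integral_eq_integral(2)[OF sF]) (auto intro!: Henstock_Kurzweil_Integration.integral_cong Fk)
      moreover have "\<bar>LINT t:{0<..<\<epsilon>}|lborel. F t\<bar> \<le> 2 * (\<epsilon> powr (2 - 2 * s) / (2 - 2 * s))"
      proof -
        have pI: "((\<lambda>t. t powr (1 - 2 * s)) has_integral (\<epsilon> powr (2 - 2 * s) / (2 - 2 * s))) {0..\<epsilon>}"
          using has_integral_powr_from_0[of "1 - 2 * s" \<epsilon>] s e by (simp add: algebra_simps)
        have bd: "0 \<le> F t \<and> F t \<le> 2 * t powr (1 - 2 * s)" if "t \<in> {0<..<\<epsilon>}" for t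
        proof -
          have t: "t > 0" "\<bar>t\<bar> < 1" using that e by auto
          have "sdiff \<beta> t * t powr (- 1 - 2 * s) \<le> 2 * t\<^sup>2 * t powr (- 1 - 2 * s)"
            using sdiff_bounds[of \<beta> t] b t by (intro mult_right_mono) auto
          also have "\<dots> = 2 * t powr (1 - 2 * s)" using t powr_add[of t 2 "- 1 - 2 * s"] by simp
          finally show ?thesis using sdiff_bounds[of \<beta> t] b t by (simp add: Fk)
        qed
        have pI': "((\<lambda>t. 2 * t powr (1 - 2 * s)) has_integral (2 * (\<epsilon> powr (2 - 2 * s) / (2 - 2 * s)))) {0<..<\<epsilon>}"
          using has_integral_mult_right[OF pI, of 2] by (simp add: has_integral_Icc_iff_Ioo)
        have L1: "(LINT t:{0<..<\<epsilon>}|lborel. F t) = integral {0<..<\<epsilon>} F" "F integrable_on {0<..<\<epsilon>}"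
          using set_borel_integral_eq_integral[OF sF[of "{0<..<\<epsilon>}"]] by auto
        have "integral {0<..<\<epsilon>} F \<le> 2 * (\<epsilon> powr (2 - 2 * s) / (2 - 2 * s))"
          using L1(2) bd by (intro has_integral_le[OF integrable_integral pI']) auto
        moreover have "0 \<le> integral {0<..<\<epsilon>} F"
          using L1(2) bd by (intro Henstock_Kurzweil_Integration.integral_nonneg) auto
        ultimately show ?thesis unfolding L1(1) by simp
      qed
      ultimately have "\<bar>L - hardy_const1 s\<bar> \<le> (4 + 1 / (2 - 2 * s)) * \<epsilon> powr (2 - 2 * s) + 2 * (\<epsilon> powr (2 - 2 * s) / (2 - 2 * s))"
        using sdiff_truncated_integral[OF s' s(2) e] unfolding \<beta>_def[symmetric] by linarith
      then show ?thesis by (simp add: C_def distrib_right)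
    qed
    have "((\<lambda>\<epsilon>. C * \<epsilon> powr (2 - 2 * s)) \<longlongrightarrow> C * 0) (at_right 0)"
      using s by (intro tendsto_mult tendsto_const) real_asymp
    moreover have "eventually (\<lambda>\<epsilon>. \<bar>L - hardy_const1 s\<bar> \<le> C * \<epsilon> powr (2 - 2 * s)) (at_right 0)"
      using eventually_at_right_less[of 0] eventually_at_rightI[of 0 1, OF est] by (auto elim: eventually_mono intro!: eventually_at_rightI[of 0 1] est)
    ultimately have "\<bar>L - hardy_const1 s\<bar> \<le> C * 0"
      by (intro tendsto_lowerbound) auto
    then show ?thesis by simp
  qed
  then show ?thesis
    using lborel_integral_even[OF F] unfolding L_def F_def \<beta>_def[symmetric] by simp
qed

section \<open>The sharp constants in both normalisations\<close>

lemma k_const_eq: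
  assumes "0 < s" "s < 1" "0 < n"
  shows "k_const n s = 2 * marg_const n s * hardy_const1 s"
proof -
  have 1: "2 powr (1 - 2 * s) = 2 * 2 powr (- (2 * s))" by (simp add: powr_diff powr_minus divide_inverse)
  have e: "(real n - 1) / 2 = (real n - 2) / 2 + 1 / 2" by (simp add: field_simps)
  have 2: "pi powr ((real n - 1) / 2) = pi powr ((real n - 2) / 2) * sqrt pi"
    unfolding e powr_add by (simp add: powr_half_sqrt)
  show ?thesis unfolding k_const_def marg_const_def hardy_const1_def 1 2 by (simp add: power2_eq_square mult_ac)
qed

lemma frac_const_pos: "0 < s \<Longrightarrow> s < 1 \<Longrightarrow> 0 < frac_const n s"
  unfolding frac_const_def by (intro divide_pos_pos mult_pos_pos Gamma_real_pos) auto

text \<open>All dependence on the dimension cancels. Hence each bound for \<open>gagliardo\<close>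
  is equivalent to the one for \<open>frac_form\<close>, and sharpness carries over with it.\<close>

lemma frac_const_k_const:
  assumes "0 < s" "s < 1"
  shows "frac_const n s / 2 * k_const n s = (Gamma (s + 1 / 2))\<^sup>2 / pi"
proof -
  have 1: "2 powr (2 * s) * 2 powr (1 - 2 * s) = (2::real)" unfolding powr_add[symmetric] by simp
  have e: "real n / 2 = (real n - 2) / 2 + 1" by (simp add: field_simps)
  have 2: "pi powr (real n / 2) = pi powr ((real n - 2) / 2) * pi" unfolding e powr_add by simp
  define G where "G = Gamma ((real n + 2 * s) / 2)"
  define H where "H = Gamma (1 - s)"
  define A where "A = pi powr ((real n - 2) / 2)"
  define x where "x = 2 powr (2 * s)"
  define y where "y = 2 powr (1 - 2 * s)"
  have xy: "x * y = 2" using 1 by (simp add: x_def y_def)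
  have pos: "G > 0" "H > 0" "A > 0" unfolding G_def H_def A_def using assms by (auto intro!: Gamma_real_pos)
  have "frac_const n s / 2 * k_const n s = (s * x * G / (H * (A * pi))) / 2 * (y * A * H * (Gamma (s + 1/2))\<^sup>2 / (s * G))"
    unfolding frac_const_def k_const_def 2 G_def H_def A_def x_def y_def ..
  also have "\<dots> = (x * y) / 2 * (Gamma (s + 1/2))\<^sup>2 / pi"
    using pos assms by (simp add: field_simps)
  finally show ?thesis by (simp add: xy)
qed

section \<open>Energies of test functions\<close>

lemma nn_integral_lborel_shift:
  fixes F :: "'a::euclidean_space \<Rightarrow> ennreal"
  assumes [measurable]: "F \<in> borel_measurable borel"
  shows "(\<integral>\<^sup>+x. F (t + x) \<partial>lborel) = (\<integral>\<^sup>+x. F x \<partial>lborel)"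
  using nn_integral_lborel_scaleR[of F 1 t] by simp

lemma nn_integral_lborel_minus:
  fixes F :: "'a::euclidean_space \<Rightarrow> ennreal"
  assumes [measurable]: "F \<in> borel_measurable borel"
  shows "(\<integral>\<^sup>+x. F (- x) \<partial>lborel) = (\<integral>\<^sup>+x. F x \<partial>lborel)"
  using nn_integral_lborel_scaleR[of F "-1" 0] by simp

lemma integral_lborel_scaleR:
  fixes F :: "'a::euclidean_space \<Rightarrow> real"
  assumes [measurable]: "F \<in> borel_measurable borel" and c: "c \<noteq> 0"
  shows "(LINT x|lborel. F x) = \<bar>c\<bar> ^ DIM('a) * (LINT x|lborel. F (t + c *\<^sub>R x))"
proof -
  have "(LINT x|lborel. F x) = (LINT x|density (distr lborel borel (\<lambda>x. t + c *\<^sub>R x)) (\<lambda>_. ennreal (\<bar>c\<bar> ^ DIM('a))). F x)"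
    using lborel_affine[OF c, of t] by simp
  also have "\<dots> = (LINT x|distr lborel borel (\<lambda>x. t + c *\<^sub>R x). \<bar>c\<bar> ^ DIM('a) * F x)"
    by (subst integral_density) auto
  also have "\<dots> = (LINT x|lborel. \<bar>c\<bar> ^ DIM('a) * F (t + c *\<^sub>R x))"
    by (rule integral_distr) auto
  finally show ?thesis by simp
qed

lemma integral_lborel_minus:
  fixes F :: "'a::euclidean_space \<Rightarrow> real"
  assumes [measurable]: "F \<in> borel_measurable borel"
  shows "(LINT x|lborel. F (- x)) = (LINT x|lborel. F x)"
  using integral_lborel_scaleR[of F "-1" 0] by simp

lemma integral_lborel_shift:
  fixes F :: "'a::euclidean_space \<Rightarrow> real"
  assumes [measurable]: "F \<in> borel_measurable borel"
  shows "(LINT x|lborel. F (t + x)) = (LINT x|lborel. F x)"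
  using integral_lborel_scaleR[of F 1 t] by simp

lemma test_functionD:
  assumes "f \<in> test_functions \<Omega>"
  shows "continuous_on UNIV f" "f \<in> borel_measurable borel"
    "\<And>x. f x \<noteq> 0 \<Longrightarrow> x \<in> \<Omega>" "compact (closure {x. f x \<noteq> 0})" "closure {x. f x \<noteq> 0} \<subseteq> \<Omega>"
proof -
  have "C_diff 0 f" using assms unfolding test_functions_def by blast
  then show 1: "continuous_on UNIV f" by simp
  then show "f \<in> borel_measurable borel" by (rule borel_measurable_continuous_onI)
  show c: "compact (closure {x. f x \<noteq> 0})" "closure {x. f x \<noteq> 0} \<subseteq> \<Omega>" using assms by (auto simp: test_functions_def)
  show "x \<in> \<Omega>" if "f x \<noteq> 0" for x using c(2) closure_subset[of "{x. f x \<noteq> 0}"] that by auto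
qed

lemma continuous_compact_support_bounded:
  fixes f :: "'a::euclidean_space \<Rightarrow> real"
  assumes "continuous_on UNIV f" "compact (closure {x. f x \<noteq> 0})"
  obtains M where "M > 0" "\<And>x. \<bar>f x\<bar> \<le> M"
proof -
  have "compact (f ` closure {x. f x \<noteq> 0})"
    using assms by (intro compact_continuous_image continuous_on_subset[OF assms(1)]) auto
  then have "bounded (f ` closure {x. f x \<noteq> 0})" by (rule compact_imp_bounded)
  then obtain B where B: "\<And>y. y \<in> f ` closure {x. f x \<noteq> 0} \<Longrightarrow> \<bar>y\<bar> \<le> B"
    unfolding bounded_iff real_norm_def by blast
  show ?thesis
  proof (rule that[of "max B 1"])
    show "\<bar>f x\<bar> \<le> max B 1" for x
    proof (cases "f x = 0")
      case False
      then have "f x \<in> f ` closure {x. f x \<noteq> 0}" using closure_subset[of "{x. f x \<noteq> 0}"] by blast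
      then show ?thesis using B[of "f x"] by auto
    qed auto
  qed auto
qed

lemma C1_compact_support_Lipschitz:
  fixes f :: "'a::euclidean_space \<Rightarrow> real"
  assumes C1: "C_diff 1 f" and c: "compact (closure {x. f x \<noteq> 0})"
  obtains L where "L > 0" "\<And>x y. \<bar>f x - f y\<bar> \<le> L * norm (x - y)"
proof -
  let ?D = "\<lambda>b x. frechet_derivative f (at x) b"
  have d: "f differentiable (at x)" for x using C1 by simp
  have zero: "?D b x = 0" if "x \<notin> closure {x. f x \<noteq> 0}" for b x
  proof -
    have "((\<lambda>_. 0) has_derivative (\<lambda>_. 0)) (at x)" by simp
    then have "(f has_derivative (\<lambda>_. 0)) (at x)"
      by (rule has_derivative_transform_within_open[OF _ open_Compl[OF closed_closure[of "{x. f x \<noteq> 0}"]]])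
        (use that closure_subset[of "{x. f x \<noteq> 0}"] in auto)
    then show ?thesis using frechet_derivative_at[of f "\<lambda>_. 0" x] by (simp add: fun_eq_iff)
  qed
  have "\<exists>M>0. \<forall>x. \<bar>?D b x\<bar> \<le> M" if "b \<in> Basis" for b
  proof -
    have "{x. ?D b x \<noteq> 0} \<subseteq> closure {x. f x \<noteq> 0}" using zero by auto
    then have "closure {x. ?D b x \<noteq> 0} \<subseteq> closure {x. f x \<noteq> 0}" by (simp add: closure_minimal)
    then have "compact (closure {x. ?D b x \<noteq> 0})" using c by (meson bounded_subset closed_closure compact_eq_bounded_closed)
    moreover have "continuous_on UNIV (?D b)" using C1 that by simp
    ultimately obtain M where "M > 0" "\<And>x. \<bar>?D b x\<bar> \<le> M"
      using continuous_compact_support_bounded[of "?D b"] by blast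
    then show ?thesis by blast
  qed
  then have "\<forall>b\<in>Basis. \<exists>M. M > 0 \<and> (\<forall>x. \<bar>?D b x\<bar> \<le> M)" by blast
  then obtain M where "\<forall>b\<in>Basis. M b > 0 \<and> (\<forall>x. \<bar>?D b x\<bar> \<le> M b)"
    unfolding bchoice_iff by blast
  then have M: "\<And>b. b \<in> Basis \<Longrightarrow> M b > 0" "\<And>b x. b \<in> Basis \<Longrightarrow> \<bar>?D b x\<bar> \<le> M b" by auto
  define L where "L = (\<Sum>b\<in>Basis. M b)"
  have "L > 0" unfolding L_def using M(1) by (intro sum_pos) auto
  moreover have "\<bar>f x - f y\<bar> \<le> L * norm (x - y)" for x y
  proof -
    have "norm (f x - f y) \<le> L * norm (x - y)"
    proof (rule differentiable_bound[where S=UNIV and f'="\<lambda>x. frechet_derivative f (at x)"])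
      show "(f has_derivative frechet_derivative f (at x)) (at x)" for x using d frechet_derivative_works by blast
      show "onorm (frechet_derivative f (at x)) \<le> L" for x
      proof (rule onorm_le)
        fix h
        have lin: "linear (frechet_derivative f (at x))" using d linear_frechet_derivative by blast
        have "frechet_derivative f (at x) h = (\<Sum>b\<in>Basis. (h \<bullet> b) * ?D b x)"
          by (subst (1) euclidean_representation[of h, symmetric]) (simp add: linear_sum[OF lin] linear_scale[OF lin])
        also have "\<bar>\<dots>\<bar> \<le> (\<Sum>b\<in>Basis. \<bar>(h \<bullet> b) * ?D b x\<bar>)" by (rule sum_abs)
        also have "\<dots> \<le> (\<Sum>b\<in>Basis. norm h * M b)"
          unfolding abs_mult using M by (intro sum_mono mult_mono) (auto simp: Basis_le_norm)
        also have "\<dots> = L * norm h" by (simp add: L_def sum_distrib_left mult.commute)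
        finally show "norm (frechet_derivative f (at x) h) \<le> L * norm h" by simp
      qed
    qed auto
    then show ?thesis by simp
  qed
  ultimately show ?thesis by (rule that)
qed

text \<open>The squared increment is O(min(|h|^2, 1)), by the Lipschitz bound for small h and the
  sup bound for large h. It vanishes unless x or x + h lies in the compact support, so the
  x-integral costs at most twice the measure of the support.\<close>

lemma integrable_increment_riesz:
  fixes f :: "'a::euclidean_space \<Rightarrow> real"
  assumes s: "0 < s" "s < 1" and C1: "C_diff 1 f" and c: "compact (closure {x. f x \<noteq> 0})"
  shows "integrable (lborel \<Otimes>\<^sub>M lborel) (\<lambda>(x, h). (f (x + h) - f x)\<^sup>2 * riesz s h)"
proof -
  have cont: "continuous_on UNIV f"
    using C1 by (auto intro!: continuous_at_imp_continuous_on differentiable_imp_continuous_within)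
  have [measurable]: "f \<in> borel_measurable borel" using cont by (rule borel_measurable_continuous_onI)
  obtain M where M: "M > 0" "\<And>x. \<bar>f x\<bar> \<le> M" using continuous_compact_support_bounded[OF cont c] by blast
  obtain L where L: "L > 0" "\<And>x y. \<bar>f x - f y\<bar> \<le> L * norm (x - y)" using C1_compact_support_Lipschitz[OF C1 c] by blast
  define K where "K = closure {x. f x \<noteq> 0}"
  have [measurable]: "K \<in> sets borel" by (simp add: K_def)
  have Kf: "x \<in> K" if "f x \<noteq> 0" for x using that closure_subset[of "{x. f x \<noteq> 0}"] by (auto simp: K_def)
  have Kfin: "emeasure lborel K < \<infinity>" using c unfolding K_def by (rule emeasure_compact_finite)
  define C where "C = max (L\<^sup>2) (4 * M\<^sup>2)"
  have C: "C \<ge> 0" unfolding C_def by (rule max.coboundedI1) simp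
  have bound: "(f (x + h) - f x)\<^sup>2 * riesz s h \<le> (indicator K x + indicator K (x + h)) * (C * (min ((norm h)\<^sup>2) 1 * riesz s h))" for x h
  proof -
    have "(f (x + h) - f x)\<^sup>2 \<le> (L * norm h)\<^sup>2"
      using L(2)[of "x + h" x] L(1) by (intro abs_le_square_iff[THEN iffD1]) auto
    also have "\<dots> \<le> C * (norm h)\<^sup>2" by (simp add: C_def power_mult_distrib mult_right_mono)
    finally have 1: "(f (x + h) - f x)\<^sup>2 \<le> C * (norm h)\<^sup>2" .
    have "\<bar>f (x + h) - f x\<bar> \<le> \<bar>2 * M\<bar>" using M(2)[of x] M(2)[of "x + h"] M(1) by linarith
    then have "(f (x + h) - f x)\<^sup>2 \<le> (2 * M)\<^sup>2" by (rule abs_le_square_iff[THEN iffD1])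
    then have 2: "(f (x + h) - f x)\<^sup>2 \<le> C * 1" by (simp add: C_def power_mult_distrib)
    have 3: "(f (x + h) - f x)\<^sup>2 \<le> C * min ((norm h)\<^sup>2) 1" using 1 2 by (simp add: min_def)
    show ?thesis
    proof (cases "f x = 0 \<and> f (x + h) = 0")
      case True
      then show ?thesis using C by (auto intro!: mult_nonneg_nonneg add_nonneg_nonneg)
    next
      case False
      then have ind: "1 \<le> indicator K x + (indicator K (x + h)::real)" using Kf[of x] Kf[of "x + h"] by (auto simp: indicator_def)
      have "(f (x + h) - f x)\<^sup>2 * riesz s h \<le> 1 * (C * (min ((norm h)\<^sup>2) 1 * riesz s h))"
        using mult_right_mono[OF 3, of "riesz s h"] by (simp add: mult.assoc)
      also have "\<dots> \<le> (indicator K x + indicator K (x + h)) * (C * (min ((norm h)\<^sup>2) 1 * riesz s h))"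
        using ind C by (intro mult_right_mono) auto
      finally show ?thesis .
    qed
  qed
  show ?thesis
  proof (rule integrableI_bounded)
    have "(\<integral>\<^sup>+p. ennreal (norm (case p of (x, h) \<Rightarrow> (f (x + h) - f x)\<^sup>2 * riesz s h)) \<partial>(lborel \<Otimes>\<^sub>M lborel))
       = (\<integral>\<^sup>+h. \<integral>\<^sup>+x. ennreal ((f (x + h) - f x)\<^sup>2 * riesz s h) \<partial>lborel \<partial>lborel)"
      by (subst lborel_pair.nn_integral_snd[symmetric]) (auto intro!: nn_integral_cong)
    also have "\<dots> \<le> (\<integral>\<^sup>+(h::'a). 2 * emeasure lborel K * (ennreal C * ennreal (min ((norm h)\<^sup>2) 1 * riesz s h)) \<partial>lborel)"
    proof (rule nn_integral_mono)
      fix h :: 'a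
      have "(\<integral>\<^sup>+x. ennreal ((f (x + h) - f x)\<^sup>2 * riesz s h) \<partial>lborel)
        \<le> (\<integral>\<^sup>+x. (indicator K x + indicator K (h + x)) * (ennreal C * ennreal (min ((norm h)\<^sup>2) 1 * riesz s h)) \<partial>lborel)"
      proof (rule nn_integral_mono)
        fix x
        show "ennreal ((f (x + h) - f x)\<^sup>2 * riesz s h) \<le> (indicator K x + indicator K (h + x)) * (ennreal C * ennreal (min ((norm h)\<^sup>2) 1 * riesz s h))"
          using ennreal_leI[OF bound[of x h]] C
          by (simp add: ennreal_mult ennreal_indicator add.commute[of h])
      qed
      also have "\<dots> = (\<integral>\<^sup>+x. indicator K x + indicator K (h + x) \<partial>lborel) * (ennreal C * ennreal (min ((norm h)\<^sup>2) 1 * riesz s h))"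
        by (rule nn_integral_multc) measurable
      also have "(\<integral>\<^sup>+x. indicator K x + indicator K (h + x) \<partial>lborel) = 2 * emeasure lborel K"
        by (subst nn_integral_add) (auto simp: nn_integral_lborel_shift[of "indicator K"] mult_2)
      finally show "(\<integral>\<^sup>+x. ennreal ((f (x + h) - f x)\<^sup>2 * riesz s h) \<partial>lborel)
        \<le> 2 * emeasure lborel K * (ennreal C * ennreal (min ((norm h)\<^sup>2) 1 * riesz s h))" .
    qed
    also have "\<dots> = 2 * emeasure lborel K * (ennreal C * (\<integral>\<^sup>+(h::'a). ennreal (min ((norm h)\<^sup>2) 1 * riesz s h) \<partial>lborel))"
      by (subst nn_integral_cmult, measurable, subst nn_integral_cmult) auto
    also have "\<dots> < \<infinity>"
      using nn_integral_min_riesz_finite[OF s, where 'a='a] Kfin by (simp add: ennreal_mult_less_top)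
    finally show "(\<integral>\<^sup>+p. ennreal (norm (case p of (x, h) \<Rightarrow> (f (x + h) - f x)\<^sup>2 * riesz s h)) \<partial>(lborel \<Otimes>\<^sub>M lborel)) < \<infinity>" .
  qed measurable
qed

text \<open>\<open>gagliardo\<close> is an iterated Bochner integral and would silently be 0 for a
  non-integrable integrand. Integrability identifies it with the genuine energy, both as an integral
  over the product space in the coordinates (x, h) and as a nonnegative integral.\<close>

lemma gagliardo_eq:
  fixes f :: "'a::euclidean_space \<Rightarrow> real"
  assumes s: "0 < s" "s < 1" and C1: "C_diff 1 f" and c: "compact (closure {x. f x \<noteq> 0})"
  shows "gagliardo s f = (LINT p|(lborel \<Otimes>\<^sub>M lborel). (case p of (x, h) \<Rightarrow> (f (x + h) - f x)\<^sup>2 * riesz s h))"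
    and "ennreal (gagliardo s f) = (\<integral>\<^sup>+h. \<integral>\<^sup>+x. ennreal ((f (x + h) - f x)\<^sup>2 * riesz s h) \<partial>lborel \<partial>lborel)"
proof -
  have cont: "continuous_on UNIV f"
    using C1 by (auto intro!: continuous_at_imp_continuous_on differentiable_imp_continuous_within)
  have [measurable]: "f \<in> borel_measurable borel" using cont by (rule borel_measurable_continuous_onI)
  note int = integrable_increment_riesz[OF assms]
  have "gagliardo s f = (LINT \<xi>|lborel. LINT h|lborel. (f (\<xi> + h) - f \<xi>)\<^sup>2 * riesz s h)"
    unfolding gagliardo_def
  proof (rule Bochner_Integration.integral_cong[OF refl])
    fix \<xi> :: 'a
    have "(LINT x|lborel. \<bar>f x - f \<xi>\<bar>\<^sup>2 / norm (x - \<xi>) powr (real DIM('a) + 2 * s)) =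
        (LINT x|lborel. \<bar>f (\<xi> + x) - f \<xi>\<bar>\<^sup>2 / norm (\<xi> + x - \<xi>) powr (real DIM('a) + 2 * s))"
      by (rule integral_lborel_shift[symmetric]) measurable
    then show "(LINT x|lborel. \<bar>f x - f \<xi>\<bar>\<^sup>2 / norm (x - \<xi>) powr (real DIM('a) + 2 * s)) = (LINT h|lborel. (f (\<xi> + h) - f \<xi>)\<^sup>2 * riesz s h)"
      by (simp add: riesz_def)
  qed
  also have "\<dots> = (LINT p|(lborel \<Otimes>\<^sub>M lborel). (case p of (x, h) \<Rightarrow> (f (x + h) - f x)\<^sup>2 * riesz s h))"
    using lborel_pair.integral_fst'[OF int] by simp
  finally show 1: "gagliardo s f = (LINT p|(lborel \<Otimes>\<^sub>M lborel). (case p of (x, h) \<Rightarrow> (f (x + h) - f x)\<^sup>2 * riesz s h))" .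
  have "ennreal (gagliardo s f) = (\<integral>\<^sup>+p. ennreal (case p of (x, h) \<Rightarrow> (f (x + h) - f x)\<^sup>2 * riesz s h) \<partial>(lborel \<Otimes>\<^sub>M lborel))"
    unfolding 1 by (rule nn_integral_eq_integral[symmetric, OF int]) (auto split: prod.splits)
  also have "\<dots> = (\<integral>\<^sup>+h. \<integral>\<^sup>+x. ennreal ((f (x + h) - f x)\<^sup>2 * riesz s h) \<partial>lborel \<partial>lborel)"
    by (subst lborel_pair.nn_integral_snd[symmetric]) (auto intro!: nn_integral_cong)
  finally show "ennreal (gagliardo s f) = (\<integral>\<^sup>+h. \<integral>\<^sup>+x. ennreal ((f (x + h) - f x)\<^sup>2 * riesz s h) \<partial>lborel \<partial>lborel)" .
qed

section \<open>Distance to the boundary and supporting half-spaces\<close>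

lemma bdist_continuous: "continuous_on UNIV (bdist \<Omega>)"
  unfolding bdist_def[abs_def] by (intro continuous_intros)

lemma bdist_measurable [measurable]: "bdist \<Omega> \<in> borel_measurable borel"
  by (rule borel_measurable_continuous_onI[OF bdist_continuous])

lemma bdist_nonneg [simp]: "0 \<le> bdist \<Omega> x"
  by (simp add: bdist_def infdist_nonneg)

lemma bdist_pos:
  assumes "open \<Omega>" "\<Omega> \<noteq> UNIV" "x \<in> \<Omega>"
  shows "0 < bdist \<Omega> x"
proof -
  have "frontier \<Omega> \<noteq> {}" using assms by (auto simp: frontier_eq_empty)
  moreover have "x \<notin> frontier \<Omega>" using assms frontier_disjoint_eq[of \<Omega>] by auto
  ultimately show ?thesis unfolding bdist_def
    by (metis frontier_closed in_closed_iff_infdist_zero infdist_nonneg order_less_le)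
qed

lemma bdist_le_dist_outside:
  assumes "x \<in> \<Omega>" "z \<notin> \<Omega>"
  shows "bdist \<Omega> x \<le> dist x z"
proof -
  have "closed_segment x z \<inter> frontier \<Omega> \<noteq> {}"
    using assms by (intro connected_Int_frontier) auto
  then obtain q where q: "q \<in> closed_segment x z" "q \<in> frontier \<Omega>" by auto
  have "bdist \<Omega> x \<le> dist x q" unfolding bdist_def using q(2) by (rule infdist_le)
  also have "\<dots> \<le> dist x z" using dist_in_closed_segment[OF q(1)] by (simp add: dist_commute)
  finally show ?thesis .
qed

text \<open>Take the supporting hyperplane at a boundary point p nearest to x, with inner unit
  normal e. The projection of a point y of the open set onto this hyperplane lies outside, so d(y)
  <= e . (y - p); at x itself e . (x - p) <= |x - p| = d(x).\<close>

lemma convex_bdist_supporting: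
  assumes \<Omega>: "open \<Omega>" "convex \<Omega>" "\<Omega> \<noteq> UNIV" and x: "x \<in> \<Omega>"
  obtains e where "norm e = 1" "\<And>h. x + h \<in> \<Omega> \<Longrightarrow> bdist \<Omega> (x + h) \<le> bdist \<Omega> x + h \<bullet> e"
proof -
  have "frontier \<Omega> \<noteq> {}" using assms by (auto simp: frontier_eq_empty)
  then obtain p where p: "p \<in> frontier \<Omega>" "bdist \<Omega> x = dist x p"
    unfolding bdist_def using infdist_attains_inf[OF frontier_closed, of \<Omega> x] by blast
  have "p \<in> closure \<Omega>" "p \<notin> rel_interior \<Omega>" using p(1) \<Omega>(1) frontier_disjoint_eq[of \<Omega>]
    by (auto simp: rel_interior_open frontier_def)
  then obtain a where a: "a \<noteq> 0" "\<And>y. y \<in> \<Omega> \<Longrightarrow> a \<bullet> p < a \<bullet> y"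
    using supporting_hyperplane_relative_frontier[OF \<Omega>(2)] unfolding rel_interior_open[OF \<Omega>(1)] by blast
  define e where "e = a /\<^sub>R norm a"
  have e: "norm e = 1" using a by (simp add: e_def)
  then have "e \<bullet> e = 1" by (simp add: norm_eq_1)
  note e = \<open>norm e = 1\<close> this
  have ae: "e \<bullet> p < e \<bullet> y" if "y \<in> \<Omega>" for y using a(1) a(2)[OF that] by (simp add: e_def)
  have le: "bdist \<Omega> y \<le> e \<bullet> (y - p)" if y: "y \<in> \<Omega>" for y
  proof -
    define z where "z = y - (e \<bullet> (y - p)) *\<^sub>R e"
    have "e \<bullet> z = e \<bullet> p" by (simp add: z_def inner_diff_right e)
    then have "z \<notin> \<Omega>" using ae[of z] by auto
    then have "bdist \<Omega> y \<le> dist y z" by (rule bdist_le_dist_outside[OF y])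
    also have "\<dots> = \<bar>e \<bullet> (y - p)\<bar>" by (simp add: z_def dist_norm e)
    also have "\<dots> = e \<bullet> (y - p)" using ae[OF y] by (simp add: inner_diff_right)
    finally show ?thesis .
  qed
  show ?thesis
  proof (rule that[OF e(1)])
    fix h assume "x + h \<in> \<Omega>"
    then have "bdist \<Omega> (x + h) \<le> e \<bullet> (x + h - p)" by (rule le)
    also have "\<dots> = e \<bullet> (x - p) + h \<bullet> e" by (simp add: inner_diff_right inner_add_right inner_commute)
    also have "e \<bullet> (x - p) \<le> norm e * norm (x - p)" by (rule norm_cauchy_schwarz)
    finally show "bdist \<Omega> (x + h) \<le> bdist \<Omega> x + h \<bullet> e" by (simp add: p(2) dist_norm e(1))
  qed
qed

text \<open>The kernel without the ball |h| <= \<epsilon>. It is integrable and even, so principal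
  values become ordinary integrals and odd parts cancel by h -> -h.\<close>

definition riesz_trunc :: "real \<Rightarrow> real \<Rightarrow> 'a::euclidean_space \<Rightarrow> real" where
  "riesz_trunc s \<epsilon> h = indicator {h. \<epsilon> < norm h} h * riesz s h"

lemma riesz_trunc_measurable [measurable]: "riesz_trunc s \<epsilon> \<in> borel_measurable borel"
  unfolding riesz_trunc_def[abs_def] by measurable

lemma riesz_trunc_nonneg [simp]: "0 \<le> riesz_trunc s \<epsilon> h" by (simp add: riesz_trunc_def)

lemma riesz_trunc_minus [simp]: "riesz_trunc s \<epsilon> (- h) = riesz_trunc s \<epsilon> h"
  by (simp add: riesz_trunc_def indicator_def)

lemma integrable_riesz_trunc:
  "0 < s \<Longrightarrow> s < 1 \<Longrightarrow> 0 < \<epsilon> \<Longrightarrow> integrable lborel (riesz_trunc s \<epsilon>)"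
  using integrable_riesz_outside[of s \<epsilon>] by (simp add: riesz_trunc_def[abs_def])

text \<open>The extra growth |h|^\<beta> only lowers the order of the kernel from s to s -
  \<beta>/2. This is the integrability at infinity of a weight that grows like |h|^\<beta>.\<close>

lemma integrable_powr_riesz_trunc:
  assumes "0 \<le> \<beta>" "\<beta> < 2 * s" "s < 1" "0 < \<epsilon>"
  shows "integrable lborel (\<lambda>h::'a::euclidean_space. norm h powr \<beta> * riesz_trunc s \<epsilon> h)"
proof -
  have "norm h powr \<beta> * riesz_trunc s \<epsilon> h = riesz_trunc (s - \<beta> / 2) \<epsilon> h" for h :: 'a
  proof (cases "h = 0")
    case False
    have e: "real DIM('a) + 2 * s = \<beta> + (real DIM('a) + 2 * (s - \<beta> / 2))" by (simp add: field_simps)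
    have "norm h powr (real DIM('a) + 2 * s) = norm h powr \<beta> * norm h powr (real DIM('a) + 2 * (s - \<beta> / 2))"
      by (subst e) (rule powr_add)
    then show ?thesis using False by (simp add: riesz_trunc_def riesz_def)
  qed (use assms in \<open>simp add: riesz_trunc_def\<close>)
  then show ?thesis using integrable_riesz_trunc[of "s - \<beta> / 2" \<epsilon>] assms by simp
qed

lemma integrable_tail_1D:
  assumes s: "0 < s" "s < 1" and a: "a > 0"
  shows "integrable lborel (\<lambda>t::real. indicator {a..} t / \<bar>t\<bar> powr (1 + 2 * s))"
proof (rule Bochner_Integration.integrable_bound)
  show "integrable lborel (\<lambda>t::real. (1 / min (a\<^sup>2) 1) * (min (t\<^sup>2) 1 / \<bar>t\<bar> powr (1 + 2 * s)))"
    by (intro integrable_mult_right integrable_min_1D s)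
  show "AE t in lborel. norm (indicator {a..} t / \<bar>t\<bar> powr (1 + 2 * s)) \<le> norm ((1 / min (a\<^sup>2) 1) * (min (t\<^sup>2) 1 / \<bar>t\<bar> powr (1 + 2 * s)))"
  proof (rule AE_I2)
    fix t :: real
    show "norm (indicator {a..} t / \<bar>t\<bar> powr (1 + 2 * s)) \<le> norm ((1 / min (a\<^sup>2) 1) * (min (t\<^sup>2) 1 / \<bar>t\<bar> powr (1 + 2 * s)))"
    proof (cases "a \<le> t")
      case True
      then have "a\<^sup>2 \<le> t\<^sup>2" using a by (intro power_mono) auto
      then have "1 \<le> min (t\<^sup>2) 1 / min (a\<^sup>2) 1" using a by (simp add: min.coboundedI1)
      then have "1 * (1 / \<bar>t\<bar> powr (1 + 2 * s)) \<le> min (t\<^sup>2) 1 / min (a\<^sup>2) 1 * (1 / \<bar>t\<bar> powr (1 + 2 * s))"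
        by (intro mult_right_mono) auto
      then show ?thesis using True a by simp
    qed auto
  qed
qed measurable

definition tail_const :: "real \<Rightarrow> real \<Rightarrow> real" where
  "tail_const s a = (LINT t|lborel. indicator {a..} t / \<bar>t\<bar> powr (1 + 2 * s))"

lemma tail_const_pos:
  assumes s: "0 < s" "s < 1" and a: "a > 0"
  shows "tail_const s a > 0"
proof -
  have "0 < (LINT t|lborel. indicator {a..a+1} t * (1 / (a + 1) powr (1 + 2 * s)))"
    using a by simp
  also have "\<dots> \<le> tail_const s a" unfolding tail_const_def
  proof (rule integral_mono)
    show "integrable lborel (\<lambda>t::real. indicator {a..} t / \<bar>t\<bar> powr (1 + 2 * s))" by (rule integrable_tail_1D[OF s a])
    show "indicator {a..a + 1} t * (1 / (a + 1) powr (1 + 2 * s)) \<le> indicator {a..} t / \<bar>t\<bar> powr (1 + 2 * s)" for t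
    proof (cases "t \<in> {a..a+1}")
      case True
      then have "1 / (a + 1) powr (1 + 2 * s) \<le> 1 / t powr (1 + 2 * s)"
        using a s by (intro divide_left_mono powr_mono2 mult_pos_pos) auto
      then show ?thesis using True a by simp
    qed auto
  qed auto
  finally show ?thesis .
qed

text \<open>Measures what truncation loses: second differences bounded by a multiple of |h|^2 lose
  at most that multiple of this quantity, which tends to 0 with \<epsilon> by dominated convergence.
  The type argument fixes the space of the bound variable.\<close>

definition near_mass :: "'a::euclidean_space itself \<Rightarrow> real \<Rightarrow> real \<Rightarrow> real" where
  "near_mass _ s \<epsilon> = (LINT h|lborel. indicator {h::'a. norm h \<le> \<epsilon>} h * (min ((norm h)\<^sup>2) 1 * riesz s h))"

lemma near_mass_tendsto:
  assumes s: "0 < s" "s < 1"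
  shows "(\<lambda>m. near_mass TYPE('a::euclidean_space) s (inverse (real (Suc m)))) \<longlonglongrightarrow> 0"
proof -
  have "(\<lambda>m. near_mass TYPE('a) s (inverse (real (Suc m)))) \<longlonglongrightarrow> (LINT h::'a|lborel. 0)"
    unfolding near_mass_def
  proof (rule integral_dominated_convergence[where w="\<lambda>h. min ((norm h)\<^sup>2) 1 * riesz s h"])
    show "AE h::'a in lborel. (\<lambda>m. indicator {h. norm h \<le> inverse (real (Suc m))} h * (min ((norm h)\<^sup>2) 1 * riesz s h)) \<longlonglongrightarrow> 0"
      using AE_lborel_singleton[of "0::'a"]
    proof eventually_elim
      fix h :: 'a assume h: "h \<noteq> 0"
      have "(\<lambda>m. inverse (real (Suc m))) \<longlonglongrightarrow> 0" by (rule LIMSEQ_inverse_real_of_nat)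
      then have "eventually (\<lambda>m. inverse (real (Suc m)) < norm h) sequentially"
        using h by (intro order_tendstoD(2)) auto
      then have "eventually (\<lambda>m. indicator {h. norm h \<le> inverse (real (Suc m))} h * (min ((norm h)\<^sup>2) 1 * riesz s h) = 0) sequentially"
        by eventually_elim auto
      then show "(\<lambda>m. indicator {h. norm h \<le> inverse (real (Suc m))} h * (min ((norm h)\<^sup>2) 1 * riesz s h)) \<longlonglongrightarrow> 0"
        by (rule tendsto_eventually)
    qed
    show "integrable lborel (\<lambda>h::'a. min ((norm h)\<^sup>2) 1 * riesz s h)" by (rule integrable_min_riesz[OF s])
    show "AE h::'a in lborel. norm (indicator {h. norm h \<le> inverse (real (Suc m))} h * (min ((norm h)\<^sup>2) 1 * riesz s h)) \<le> min ((norm h)\<^sup>2) 1 * riesz s h" for m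
      by (rule AE_I2) (auto simp: indicator_def)
  qed measurable
  then show ?thesis by simp
qed

lemma integrable_near_mass:
  assumes s: "0 < s" "s < 1"
  shows "integrable lborel (\<lambda>h::'a::euclidean_space. indicator {h. norm h \<le> \<epsilon>} h * (min ((norm h)\<^sup>2) 1 * riesz s h))"
  by (rule Bochner_Integration.integrable_bound[OF integrable_min_riesz[OF s]]) (auto simp: indicator_def)

text \<open>Scaling by d produces d^(-2s), and the marginal of the kernel produces the constant. On
  the removed ball |h . e / d| <= |h|/\<delta> < 1, so the quadratic bound on \<open>sdiff\<close>
  applies. The loss depends on \<delta> only and is therefore uniform over all points at distance at
  least \<delta> from the boundary.\<close>

lemma integral_sdiff_trunc_ge:
  fixes e :: "'a::euclidean_space"
  assumes s: "1/2 \<le> s" "s < 1" and e: "norm e = 1" and d: "0 < \<delta>" "\<delta> \<le> d" and \<epsilon>: "0 < \<epsilon>" "\<epsilon> < \<delta>" "\<epsilon> < 1"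
  defines "\<beta> \<equiv> s - 1/2"
  shows "integrable lborel (\<lambda>h. sdiff \<beta> (h \<bullet> e / d) * riesz_trunc s \<epsilon> h)" (is ?A)
    and "k_const DIM('a) s / d powr (2 * s) - 2 / \<delta>\<^sup>2 * near_mass TYPE('a) s \<epsilon>
      \<le> (LINT h|lborel. sdiff \<beta> (h \<bullet> e / d) * riesz_trunc s \<epsilon> h)" (is ?B)
proof -
  have s0: "0 < s" using s by simp
  have dp: "d > 0" using d by simp
  have b: "0 \<le> \<beta>" "\<beta> \<le> 1" "\<beta> < 2 * s" using s by (auto simp: \<beta>_def)
  let ?g = "\<lambda>t. sdiff \<beta> (t / d)"
  have int: "integrable lborel (\<lambda>t. ?g t / \<bar>t\<bar> powr (1 + 2 * s))"
    and val: "(LINT t|lborel. ?g t / \<bar>t\<bar> powr (1 + 2 * s)) = 2 * hardy_const1 s / d powr (2 * s)"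
  proof -
    have eq: "?g (0 + d * t) / \<bar>0 + d * t\<bar> powr (1 + 2 * s) = (1 / d powr (1 + 2 * s)) * (sdiff \<beta> t / \<bar>t\<bar> powr (1 + 2 * s))" for t
      using dp by (simp add: abs_mult powr_mult)
    have "integrable lborel (\<lambda>t. ?g (0 + d * t) / \<bar>0 + d * t\<bar> powr (1 + 2 * s))"
      unfolding eq by (intro integrable_mult_right integrable_sdiff) (use b s in auto)
    then show int: "integrable lborel (\<lambda>t. ?g t / \<bar>t\<bar> powr (1 + 2 * s))"
      using lborel_integrable_real_affine_iff[of d "\<lambda>t. ?g t / \<bar>t\<bar> powr (1 + 2 * s)" 0] dp by simp
    have "(LINT t|lborel. ?g t / \<bar>t\<bar> powr (1 + 2 * s)) = d * (LINT t|lborel. ?g (0 + d * t) / \<bar>0 + d * t\<bar> powr (1 + 2 * s))"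
      using lborel_integral_real_affine[of d "\<lambda>t. ?g t / \<bar>t\<bar> powr (1 + 2 * s)" 0] dp by simp
    also have "\<dots> = d * ((1 / d powr (1 + 2 * s)) * (2 * hardy_const1 s))"
      unfolding eq integral_mult_right_zero using integral_sdiff[OF s] by (simp add: \<beta>_def)
    also have "\<dots> = 2 * hardy_const1 s / d powr (2 * s)"
      using dp by (simp add: powr_add)
    finally show "(LINT t|lborel. ?g t / \<bar>t\<bar> powr (1 + 2 * s)) = 2 * hardy_const1 s / d powr (2 * s)" .
  qed
  have full: "integrable lborel (\<lambda>h. ?g (h \<bullet> e) * riesz s h)"
    "(LINT h|lborel. ?g (h \<bullet> e) * riesz s h) = k_const DIM('a) s / d powr (2 * s)"
    using integral_inner_riesz[OF e s0 _ int] k_const_eq[of s "DIM('a)"] s0 s(2) by (auto simp: val)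
  let ?N = "\<lambda>h. indicator {h. norm h \<le> \<epsilon>} h * (?g (h \<bullet> e) * riesz s h)"
  have intN: "integrable lborel ?N"
    using integrable_mult_indicator[OF _ full(1), of "{h. norm h \<le> \<epsilon>}"] by simp
  have split: "sdiff \<beta> (h \<bullet> e / d) * riesz_trunc s \<epsilon> h = ?g (h \<bullet> e) * riesz s h - ?N h" for h
    by (auto simp: riesz_trunc_def indicator_def)
  show ?A unfolding split by (intro Bochner_Integration.integrable_diff full intN)
  have "(LINT h|lborel. ?N h) \<le> (LINT h|lborel. 2 / \<delta>\<^sup>2 * (indicator {h::'a. norm h \<le> \<epsilon>} h * (min ((norm h)\<^sup>2) 1 * riesz s h)))"
  proof (rule integral_mono[OF intN])
    show "integrable lborel (\<lambda>h::'a. 2 / \<delta>\<^sup>2 * (indicator {h. norm h \<le> \<epsilon>} h * (min ((norm h)\<^sup>2) 1 * riesz s h)))"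
      by (intro integrable_mult_right integrable_near_mass s0 s)
    fix h :: 'a
    show "?N h \<le> 2 / \<delta>\<^sup>2 * (indicator {h. norm h \<le> \<epsilon>} h * (min ((norm h)\<^sup>2) 1 * riesz s h))"
    proof (cases "norm h \<le> \<epsilon>")
      case True
      have he: "\<bar>h \<bullet> e\<bar> \<le> norm h" using Cauchy_Schwarz_ineq2[of h e] e by simp
      have "\<bar>h \<bullet> e / d\<bar> \<le> norm h / \<delta>"
        unfolding abs_divide using he d dp by (intro frac_le) auto
      also have "\<dots> < 1" using True \<epsilon> d by simp
      finally have lt: "\<bar>h \<bullet> e / d\<bar> < 1" .
      have "?g (h \<bullet> e) \<le> 2 * (h \<bullet> e / d)\<^sup>2" using sdiff_bounds(2)[OF b(1,2) lt] .
      also have "\<dots> \<le> 2 * (norm h / \<delta>)\<^sup>2"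
        using \<open>\<bar>h \<bullet> e / d\<bar> \<le> norm h / \<delta>\<close> d by (intro mult_left_mono abs_le_square_iff[THEN iffD1]) auto
      also have "\<dots> = 2 / \<delta>\<^sup>2 * min ((norm h)\<^sup>2) 1"
        using True \<epsilon> by (simp add: power_divide min_absorb1 abs_square_le_1)
      finally have "?g (h \<bullet> e) * riesz s h \<le> 2 / \<delta>\<^sup>2 * min ((norm h)\<^sup>2) 1 * riesz s h" by (rule mult_right_mono) simp
      then show ?thesis using True by (simp add: mult.assoc)
    qed simp
  qed
  also have "\<dots> = 2 / \<delta>\<^sup>2 * near_mass TYPE('a) s \<epsilon>" by (simp add: near_mass_def)
  finally show ?B unfolding split using Bochner_Integration.integral_diff[OF full(1) intN] full(2) by simp
qed

section \<open>The ground-state substitution on convex domains\<close>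

locale convex_hardy =
  fixes \<Omega> :: "'a::euclidean_space set" and s :: real
  assumes s: "1/2 \<le> s" "s < 1" and \<Omega>: "open \<Omega>" "convex \<Omega>" "\<Omega> \<noteq> UNIV"
begin

definition \<beta> :: real where "\<beta> = s - 1/2"

text \<open>The indicator is essential: \<open>bdist\<close> is the distance to the frontier and is
  positive outside the closure as well.\<close>

definition w :: "'a \<Rightarrow> real" where "w x = indicator \<Omega> x * bdist \<Omega> x powr \<beta>"

lemma \<Omega>_measurable [measurable]: "\<Omega> \<in> sets borel" using \<Omega> by simp

lemma w_measurable [measurable]: "w \<in> borel_measurable borel"
  unfolding w_def[abs_def] by measurable

lemma weight_exponent_bounds: "0 \<le> \<beta>" "\<beta> \<le> 1" "\<beta> < 2 * s" "0 < s"
  using s by (auto simp: \<beta>_def)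

lemma w_nonneg [simp]: "0 \<le> w x" by (simp add: w_def)

lemma w_pos: "x \<in> \<Omega> \<Longrightarrow> 0 < w x"
  using bdist_pos[OF \<Omega>(1,3)] by (simp add: w_def less_imp_neq[symmetric])

lemma w_shift_le:
  assumes x: "x \<in> \<Omega>"
  obtains e where "norm e = 1" "\<And>h. w (x + h) \<le> max 0 (bdist \<Omega> x + h \<bullet> e) powr \<beta>"
proof -
  obtain e where e: "norm e = 1" "\<And>h. x + h \<in> \<Omega> \<Longrightarrow> bdist \<Omega> (x + h) \<le> bdist \<Omega> x + h \<bullet> e"
    using convex_bdist_supporting[OF \<Omega> x] by blast
  have "w (x + h) \<le> max 0 (bdist \<Omega> x + h \<bullet> e) powr \<beta>" for h
  proof (cases "x + h \<in> \<Omega>")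
    case True
    then have "bdist \<Omega> (x + h) \<le> max 0 (bdist \<Omega> x + h \<bullet> e)" using e(2) by fastforce
    then show ?thesis using True weight_exponent_bounds by (simp add: w_def powr_mono2)
  qed (simp add: w_def)
  then show ?thesis using that e(1) by blast
qed

lemma halfspace_weight_growth:
  assumes "norm e = 1" "0 < d"
  shows "max 0 (d + h \<bullet> e) powr \<beta> \<le> 2 * (d powr \<beta> + norm h powr \<beta>)"
proof -
  have he: "h \<bullet> e \<le> norm h" using norm_cauchy_schwarz[of h e] assms by simp
  define m where "m = max d (norm h)"
  have m: "m > 0" "m powr \<beta> \<le> d powr \<beta> + norm h powr \<beta>" using assms by (auto simp: m_def max_def)
  have "max 0 (d + h \<bullet> e) powr \<beta> \<le> (2 * m) powr \<beta>"
    using he assms weight_exponent_bounds by (intro powr_mono2) (auto simp: m_def)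
  also have "\<dots> = 2 powr \<beta> * m powr \<beta>" using m by (simp add: powr_mult)
  also have "\<dots> \<le> 2 powr 1 * m powr \<beta>" using weight_exponent_bounds by (intro mult_right_mono powr_mono) auto
  finally show ?thesis using m(2) by simp
qed

text \<open>With W the half-space weight in increment form, W(0) = w(x), so w(x) - w(x + h) = (W(0)
  - W(h)) + (W(h) - w(x + h)). Evenness of the kernel replaces the first bracket by half a second
  difference of W, which is homogeneous and evaluated by \<open>integral_sdiff_trunc_ge\<close>. The
  second bracket is nonnegative and provides the gain \<open>c1\<close>.\<close>

lemma truncated_potential_ge:
  assumes x: "x \<in> \<Omega>" and d: "0 < \<delta>" "\<delta> \<le> bdist \<Omega> x" and \<epsilon>: "0 < \<epsilon>" "\<epsilon> < \<delta>" "\<epsilon> < 1"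
    and c1: "c1 = 0 \<or> (\<exists>R>0. (\<forall>y\<in>\<Omega>. bdist \<Omega> y \<le> R) \<and> \<epsilon> < 2 * R \<and>
        c1 = ((2 * R) powr \<beta> - R powr \<beta>) * (marg_const DIM('a) s * tail_const s (2 * R)))"
  shows "integrable lborel (\<lambda>h. w (x + h) * riesz_trunc s \<epsilon> h)"
    and "bdist \<Omega> x powr \<beta> / 2 * (k_const DIM('a) s / bdist \<Omega> x powr (2 * s) - 2 / \<delta>\<^sup>2 * near_mass TYPE('a) s \<epsilon>) + c1
      \<le> (LINT h|lborel. (w x - w (x + h)) * riesz_trunc s \<epsilon> h)"
proof -
  define dx where "dx = bdist \<Omega> x"
  have dx: "dx > 0" using d by (simp add: dx_def)
  have wx: "w x = dx powr \<beta>" using x by (simp add: w_def dx_def)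
  obtain e where e: "norm e = 1" "\<And>h. w (x + h) \<le> max 0 (dx + h \<bullet> e) powr \<beta>"
    using w_shift_le[OF x] unfolding dx_def by blast
  define W where "W = (\<lambda>h. max 0 (dx + h \<bullet> e) powr \<beta>)"
  have [measurable]: "W \<in> borel_measurable borel" unfolding W_def by measurable
  have W0: "0 \<le> W h" for h by (simp add: W_def)
  let ?k = "riesz_trunc s \<epsilon> :: 'a \<Rightarrow> real"
  have ik: "integrable lborel ?k" using weight_exponent_bounds s \<epsilon> by (intro integrable_riesz_trunc) auto
  have iW: "integrable lborel (\<lambda>h. W h * ?k h)"
  proof (rule Bochner_Integration.integrable_bound)
    show "integrable lborel (\<lambda>h. 2 * (dx powr \<beta> * ?k h + norm h powr \<beta> * ?k h))"
      using weight_exponent_bounds s \<epsilon> by (intro integrable_mult_right Bochner_Integration.integrable_add ik integrable_powr_riesz_trunc) auto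
    show "AE h in lborel. norm (W h * ?k h) \<le> norm (2 * (dx powr \<beta> * ?k h + norm h powr \<beta> * ?k h))"
    proof (rule AE_I2)
      fix h
      have "W h * ?k h \<le> 2 * (dx powr \<beta> + norm h powr \<beta>) * ?k h"
        unfolding W_def using halfspace_weight_growth[OF e(1) dx] by (rule mult_right_mono) simp
      then show "norm (W h * ?k h) \<le> norm (2 * (dx powr \<beta> * ?k h + norm h powr \<beta> * ?k h))"
        using W0[of h] by (simp add: algebra_simps)
    qed
  qed measurable
  show iw: "integrable lborel (\<lambda>h. w (x + h) * ?k h)"
    by (rule Bochner_Integration.integrable_bound[OF iW]) (use e(2) W0 in \<open>auto simp: W_def intro!: mult_right_mono AE_I2\<close>)
  have iWm: "integrable lborel (\<lambda>h. W (- h) * ?k h)"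
  proof -
    have "integrable (distr lborel borel uminus) (\<lambda>h. W (- h) * ?k h)"
      by (subst integrable_distr_eq) (use iW in auto)
    moreover have "distr lborel borel uminus = (lborel :: 'a measure)"
      by (rule distr_lborel_reflection) (auto intro: linear_uminus)
    ultimately show ?thesis by simp
  qed
  have gain: "c1 \<le> (LINT h|lborel. (W h - w (x + h)) * ?k h)"
  proof (cases "c1 = 0")
    case True
    have "0 \<le> (LINT h|lborel. (W h - w (x + h)) * ?k h)"
      by (rule Bochner_Integration.integral_nonneg) (use e(2) in \<open>auto simp: W_def intro!: mult_nonneg_nonneg\<close>)
    then show ?thesis using True by simp
  next
    case False
    then obtain R where R: "R > 0" "\<And>y. y \<in> \<Omega> \<Longrightarrow> bdist \<Omega> y \<le> R" "\<epsilon> < 2 * R"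
      "c1 = ((2 * R) powr \<beta> - R powr \<beta>) * (marg_const DIM('a) s * tail_const s (2 * R))" using c1 by blast
    define g where "g = (indicator {2 * R..} :: real \<Rightarrow> real)"
    have g: "integrable lborel (\<lambda>h. g (h \<bullet> e) * riesz s h)" "(LINT h|lborel. g (h \<bullet> e) * riesz s h) = marg_const DIM('a) s * tail_const s (2 * R)"
      unfolding g_def tail_const_def using integral_inner_riesz[OF e(1) weight_exponent_bounds(4) _ integrable_tail_1D[OF weight_exponent_bounds(4) s(2), of "2 * R"]] R(1) by auto
    have "c1 = (LINT h|lborel. ((2 * R) powr \<beta> - R powr \<beta>) * (g (h \<bullet> e) * riesz s h))"
      using g R(4) by simp
    also have "\<dots> \<le> (LINT h|lborel. (W h - w (x + h)) * ?k h)"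
    proof (rule integral_mono)
      show "integrable lborel (\<lambda>h. ((2 * R) powr \<beta> - R powr \<beta>) * (g (h \<bullet> e) * riesz s h))" using g by simp
      show "integrable lborel (\<lambda>h. (W h - w (x + h)) * ?k h)"
        using Bochner_Integration.integrable_diff[OF iW iw] by (simp add: left_diff_distrib)
      fix h
      show "((2 * R) powr \<beta> - R powr \<beta>) * (g (h \<bullet> e) * riesz s h) \<le> (W h - w (x + h)) * ?k h"
      proof (cases "2 * R \<le> h \<bullet> e")
        case True
        \<comment> \<open>Here \<open>\<epsilon> < 2 * R\<close> matters: the region of gain lies
          beyond the truncation, where the kernel is complete.\<close>
        have "2 * R \<le> norm h" using True norm_cauchy_schwarz[of h e] e by simp
        then have k: "?k h = riesz s h" using R(3) by (simp add: riesz_trunc_def)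
        have "(2 * R) powr \<beta> \<le> W h" unfolding W_def using True dx R(1) weight_exponent_bounds by (intro powr_mono2) auto
        moreover have "w (x + h) \<le> R powr \<beta>"
          using R weight_exponent_bounds by (auto simp: w_def indicator_def intro!: powr_mono2)
        ultimately show ?thesis using True by (simp add: k g_def mult_right_mono)
      next
        case False
        then show ?thesis using e(2)[of h] by (auto simp: g_def W_def intro!: mult_nonneg_nonneg)
      qed
    qed
    finally show ?thesis .
  qed
  have sym: "(LINT h|lborel. W (- h) * ?k h) = (LINT h|lborel. W h * ?k h)"
    using integral_lborel_minus[of "\<lambda>h. W h * ?k h"] by simp
  have sd: "dx powr \<beta> * sdiff \<beta> (h \<bullet> e / dx) = 2 * dx powr \<beta> - W h - W (- h)" for h
  proof -
    have "W (c *\<^sub>R h) = dx powr \<beta> * max 0 (1 + c * (h \<bullet> e / dx)) powr \<beta>" for c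
    proof -
      have "dx + c *\<^sub>R h \<bullet> e = dx * (1 + c * (h \<bullet> e / dx))" using dx by (simp add: field_simps)
      then have "max 0 (dx + c *\<^sub>R h \<bullet> e) = dx * max 0 (1 + c * (h \<bullet> e / dx))"
        using dx by (simp add: max_mult_distrib_left)
      then show ?thesis unfolding W_def using dx by (simp add: powr_mult)
    qed
    from this[of 1] this[of "-1"] show ?thesis by (simp add: sdiff_def algebra_simps)
  qed
  have "dx powr \<beta> / 2 * (k_const DIM('a) s / dx powr (2 * s) - 2 / \<delta>\<^sup>2 * near_mass TYPE('a) s \<epsilon>)
     \<le> dx powr \<beta> / 2 * (LINT h|lborel. sdiff \<beta> (h \<bullet> e / dx) * ?k h)"
    using integral_sdiff_trunc_ge(2)[OF s e(1) d[folded dx_def] \<epsilon>] unfolding \<beta>_def by (intro mult_left_mono) auto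
  also have "\<dots> = (LINT h|lborel. (dx powr \<beta> * sdiff \<beta> (h \<bullet> e / dx)) * ?k h) / 2"
    by (simp add: mult.assoc)
  also have "\<dots> = (LINT h|lborel. 2 * (dx powr \<beta> * ?k h) - W h * ?k h - W (- h) * ?k h) / 2"
    unfolding sd by (simp add: algebra_simps)
  also have "\<dots> = (LINT h|lborel. dx powr \<beta> * ?k h) - (LINT h|lborel. W h * ?k h)"
    using ik iW iWm sym by simp
  also have "\<dots> = (LINT h|lborel. dx powr \<beta> * ?k h - W h * ?k h)"
    using ik iW by simp
  finally have main: "dx powr \<beta> / 2 * (k_const DIM('a) s / dx powr (2 * s) - 2 / \<delta>\<^sup>2 * near_mass TYPE('a) s \<epsilon>) \<le> (LINT h|lborel. dx powr \<beta> * ?k h - W h * ?k h)" .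
  have "(LINT h|lborel. (w x - w (x + h)) * ?k h) = (LINT h|lborel. (dx powr \<beta> * ?k h - W h * ?k h) + (W h - w (x + h)) * ?k h)"
    by (rule Bochner_Integration.integral_cong) (auto simp: wx algebra_simps)
  also have "\<dots> = (LINT h|lborel. dx powr \<beta> * ?k h - W h * ?k h) + (LINT h|lborel. (W h - w (x + h)) * ?k h)"
  proof (rule Bochner_Integration.integral_add)
    show "integrable lborel (\<lambda>h. dx powr \<beta> * ?k h - W h * ?k h)" using ik iW by simp
    show "integrable lborel (\<lambda>h. (W h - w (x + h)) * ?k h)"
      using Bochner_Integration.integrable_diff[OF iW iw] by (simp add: left_diff_distrib)
  qed
  finally show "bdist \<Omega> x powr \<beta> / 2 * (k_const DIM('a) s / bdist \<Omega> x powr (2 * s) - 2 / \<delta>\<^sup>2 * near_mass TYPE('a) s \<epsilon>) + c1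
      \<le> (LINT h|lborel. (w x - w (x + h)) * ?k h)"
    using main gain unfolding dx_def by linarith
qed

end

text \<open>In increment coordinates this is the exchange of the endpoints x and y = x + h.\<close>

lemma distr_pair_shift_flip:
  "distr (lborel \<Otimes>\<^sub>M lborel) (lborel \<Otimes>\<^sub>M lborel) (\<lambda>(x, h). (x + h, - h)) = (lborel \<Otimes>\<^sub>M lborel :: ('a::euclidean_space \<times> 'a) measure)"
    (is "?D = ?M")
proof (rule measure_eqI)
  fix A assume "A \<in> sets ?D"
  then have A[measurable]: "A \<in> sets (borel \<Otimes>\<^sub>M borel)" by simp
  have "emeasure ?D A = (\<integral>\<^sup>+p. indicator A p \<partial>?D)" by simp
  also have "\<dots> = (\<integral>\<^sup>+p. indicator A (case p of (x, h) \<Rightarrow> (x + h, - h)) \<partial>?M)"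
    by (rule nn_integral_distr) measurable
  also have "\<dots> = (\<integral>\<^sup>+h. \<integral>\<^sup>+x. indicator A (x + h, - h) \<partial>lborel \<partial>lborel)"
    by (subst lborel_pair.nn_integral_snd[symmetric]) auto
  also have "\<dots> = (\<integral>\<^sup>+h. \<integral>\<^sup>+x. indicator A (x, - h) \<partial>lborel \<partial>lborel)"
  proof (rule nn_integral_cong)
    fix h :: 'a
    show "(\<integral>\<^sup>+x. indicator A (x + h, - h) \<partial>lborel) = (\<integral>\<^sup>+x. indicator A (x, - h) \<partial>lborel)"
      using nn_integral_lborel_shift[of "\<lambda>x. indicator A (x, - h)" h] by (simp add: add.commute)
  qed
  also have "\<dots> = (\<integral>\<^sup>+h. \<integral>\<^sup>+x. indicator A (x, h) \<partial>lborel \<partial>lborel)"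
    by (rule nn_integral_lborel_minus[of "\<lambda>h. \<integral>\<^sup>+x. indicator A (x, h) \<partial>lborel"]) measurable
  also have "\<dots> = emeasure ?M A"
    by (subst lborel_pair.nn_integral_snd) auto
  finally show "emeasure ?D A = emeasure ?M A" .
qed simp

lemma integrable_pair_shift_flip:
  fixes F :: "'a::euclidean_space \<times> 'a \<Rightarrow> real"
  assumes F: "integrable (lborel \<Otimes>\<^sub>M lborel) F"
  shows "integrable (lborel \<Otimes>\<^sub>M lborel) (\<lambda>(x, h). F (x + h, - h))"
    and "(LINT p|(lborel \<Otimes>\<^sub>M lborel). (case p of (x, h) \<Rightarrow> F (x + h, - h))) = (LINT p|(lborel \<Otimes>\<^sub>M lborel). F p)"
proof -
  let ?\<Phi> = "\<lambda>(x, h). (x + h, - h) :: 'a \<times> 'a"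
  have [measurable]: "F \<in> borel_measurable (lborel \<Otimes>\<^sub>M lborel)" using F by auto
  have eq: "F (?\<Phi> p) = (case p of (x, h) \<Rightarrow> F (x + h, - h))" for p by (simp split: prod.splits)
  have "integrable (distr (lborel \<Otimes>\<^sub>M lborel) (lborel \<Otimes>\<^sub>M lborel) ?\<Phi>) F"
    unfolding distr_pair_shift_flip by (rule F)
  then have "integrable (lborel \<Otimes>\<^sub>M lborel) (\<lambda>p. F (?\<Phi> p))"
    by (subst (asm) integrable_distr_eq) auto
  then show "integrable (lborel \<Otimes>\<^sub>M lborel) (\<lambda>(x, h). F (x + h, - h))" unfolding eq .
  have "(LINT p|distr (lborel \<Otimes>\<^sub>M lborel) (lborel \<Otimes>\<^sub>M lborel) ?\<Phi>. F p) = (LINT p|(lborel \<Otimes>\<^sub>M lborel). F (?\<Phi> p))"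
    by (rule integral_distr) auto
  then show "(LINT p|(lborel \<Otimes>\<^sub>M lborel). (case p of (x, h) \<Rightarrow> F (x + h, - h))) = (LINT p|(lborel \<Otimes>\<^sub>M lborel). F p)"
    unfolding distr_pair_shift_flip eq by simp
qed

lemma integrable_pair_times:
  fixes f g :: "'a::euclidean_space \<Rightarrow> real"
  assumes f: "integrable lborel f" and g: "integrable lborel g"
  shows "integrable (lborel \<Otimes>\<^sub>M lborel) (\<lambda>(x, h). f x * g h)"
proof (rule lborel_pair.Fubini_integrable)
  have [measurable]: "f \<in> borel_measurable borel" "g \<in> borel_measurable borel" using f g by auto
  show "(\<lambda>(x, h). f x * g h) \<in> borel_measurable (lborel \<Otimes>\<^sub>M lborel)" by measurable
  show "integrable lborel (\<lambda>x. LINT y|lborel. norm (case (x, y) of (x, h) \<Rightarrow> f x * g h))"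
    using f g by (simp add: abs_mult)
  show "AE x in lborel. integrable lborel (\<lambda>y. case (x, y) of (x, h) \<Rightarrow> f x * g h)"
    using g by simp
qed

context convex_hardy
begin

text \<open>Where \<open>h \<bullet> e \<ge> 2 * R\<close> the half-space weight is at least \<open>(2 * R) powr \<beta>\<close> while \<open>w\<close> is at most
  \<open>R powr \<beta>\<close>; the excess is what remains for the Sobolev term.\<close>

definition gain_const :: "real \<Rightarrow> bool" where
  "gain_const c1 \<longleftrightarrow> c1 = 0 \<or> (\<exists>R>0. (\<forall>y\<in>\<Omega>. bdist \<Omega> y \<le> R) \<and>
        c1 = ((2 * R) powr \<beta> - R powr \<beta>) * (marg_const DIM('a) s * tail_const s (2 * R)))"

lemma test_function_bounds:
  assumes f: "f \<in> test_functions \<Omega>"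
  shows "\<exists>K \<delta> M D. compact K \<and> (\<forall>x. f x \<noteq> 0 \<longrightarrow> x \<in> K) \<and> K \<subseteq> \<Omega> \<and> 0 < \<delta> \<and> 0 < M
    \<and> (\<forall>x\<in>K. \<delta> \<le> bdist \<Omega> x \<and> bdist \<Omega> x \<le> D) \<and> (\<forall>x. \<bar>f x\<bar> \<le> M)"
proof -
  define K where "K = closure {x. f x \<noteq> 0}"
  note t = test_functionD[OF f]
  obtain M where M: "M > 0" "\<And>x. \<bar>f x\<bar> \<le> M" using continuous_compact_support_bounded[OF t(1,4)] by blast
  have c: "continuous_on K (bdist \<Omega>)" using bdist_continuous by (rule continuous_on_subset) simp
  have K: "compact K" "\<And>x. f x \<noteq> 0 \<Longrightarrow> x \<in> K" "K \<subseteq> \<Omega>"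
    using t closure_subset[of "{x. f x \<noteq> 0}"] by (auto simp: K_def)
  show ?thesis
  proof (cases "K = {}")
    case True
    have "f x = 0" for x using K(2)[of x] True by auto
    then show ?thesis using M(1) by (intro exI[of _ K] exI[of _ 1] exI[of _ M]) (simp add: True)
  next
    case False
    obtain a where a: "a \<in> K" "\<And>x. x \<in> K \<Longrightarrow> bdist \<Omega> a \<le> bdist \<Omega> x"
      using continuous_attains_inf[OF K(1) False c] by blast
    obtain a' where a': "a' \<in> K" "\<And>x. x \<in> K \<Longrightarrow> bdist \<Omega> x \<le> bdist \<Omega> a'"
      using continuous_attains_sup[OF K(1) False c] by blast
    have "0 < bdist \<Omega> a" using bdist_pos[OF \<Omega>(1,3)] a(1) K by auto
    then show ?thesis
      by (intro exI[of _ K] exI[of _ "bdist \<Omega> a"] exI[of _ M] exI[of _ "bdist \<Omega> a'"]) (use K M a a' in simp)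
  qed
qed

text \<open>For the truncated kernel every term of the substitution identity is integrable. The two
  potential terms have equal integrals by exchange of endpoints and are bounded below by
  \<open>truncated_potential_ge\<close>, with an error proportional to \<open>near_mass\<close>. The
  second claim retains the weighted energy instead of discarding it; the Sobolev remainder is built
  from it.\<close>

lemma ground_state:
  assumes f: "f \<in> test_functions \<Omega>" and c1: "gain_const c1"
  defines "\<psi> \<equiv> \<lambda>x. f x / w x"
  defines "A \<equiv> k_const DIM('a) s * hardy_integral s \<Omega> f + 2 * c1 * (LINT x|lborel. f x * \<psi> x)"
  shows "A \<le> gagliardo s f"
    and "(\<integral>\<^sup>+x. \<integral>\<^sup>+h. ennreal (w x * w (x + h) * (\<psi> (x + h) - \<psi> x)\<^sup>2 * riesz s h) \<partial>lborel \<partial>lborel) \<le> ennreal (gagliardo s f - A)"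
proof -
  note t = test_functionD[OF f]
  have C1: "C_diff 1 f" using f unfolding test_functions_def by blast
  have [measurable]: "f \<in> borel_measurable borel" by (rule t)
  have [measurable]: "\<psi> \<in> borel_measurable borel" unfolding \<psi>_def by measurable
  obtain K \<delta> M D where KD: "compact K \<and> (\<forall>x. f x \<noteq> 0 \<longrightarrow> x \<in> K) \<and> K \<subseteq> \<Omega> \<and> 0 < \<delta> \<and> 0 < M
    \<and> (\<forall>x\<in>K. \<delta> \<le> bdist \<Omega> x \<and> bdist \<Omega> x \<le> D) \<and> (\<forall>x. \<bar>f x\<bar> \<le> M)"
    using test_function_bounds[OF f] by blast
  then have K: "compact K" "\<And>x. f x \<noteq> 0 \<Longrightarrow> x \<in> K" "K \<subseteq> \<Omega>" and \<delta>: "0 < \<delta>" and M: "0 < M"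
    and bd: "\<And>x. x \<in> K \<Longrightarrow> \<delta> \<le> bdist \<Omega> x" "\<And>x. x \<in> K \<Longrightarrow> bdist \<Omega> x \<le> D" and fM: "\<And>x. \<bar>f x\<bar> \<le> M"
    by simp_all
  have [measurable]: "K \<in> sets borel" using K(1) by (simp add: compact_imp_closed)
  have intK: "integrable lborel (indicator K :: 'a \<Rightarrow> real)"
    using emeasure_compact_finite[OF K(1)] by simp
  have intbd: "integrable lborel F" if "F \<in> borel_measurable borel" "\<And>x. x \<in> K \<Longrightarrow> \<bar>F x\<bar> \<le> C" "\<And>x. x \<notin> K \<Longrightarrow> F x = 0" for F :: "'a \<Rightarrow> real" and C
    by (rule Bochner_Integration.integrable_bound[OF integrable_mult_right[OF intK, of C]])
       (use that in \<open>auto simp: indicator_def intro!: AE_I2 order_trans[OF that(2)]\<close>)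
  have wK: "w x = bdist \<Omega> x powr \<beta>" "0 < w x" "\<delta> powr \<beta> \<le> w x" if "x \<in> K" for x
  proof -
    have x: "x \<in> \<Omega>" using that K(3) by auto
    then show 1: "w x = bdist \<Omega> x powr \<beta>" "0 < w x" using w_pos by (simp_all add: w_def)
    show "\<delta> powr \<beta> \<le> w x" unfolding 1(1) using bd(1)[OF that] weight_exponent_bounds \<delta> by (intro powr_mono2) auto
  qed
  \<comment> \<open>This is f^2/w, the density that multiplies the potential of \<open>w\<close>.
    Since q d^\<beta> = f^2 on the support, a potential of order d^(\<beta> - 2s) yields exactly the
    Hardy density.\<close>
  define q where "q = (\<lambda>x. f x * \<psi> x)"
  have [measurable]: "q \<in> borel_measurable borel" unfolding q_def by measurable
  have q0: "q x = 0" if "x \<notin> K" for x using K(2)[of x] that by (auto simp: q_def)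
  have qnn: "0 \<le> q x" for x by (simp add: q_def \<psi>_def)
  define C where "C = M\<^sup>2 / \<delta> powr \<beta>"
  have f2: "(f x)\<^sup>2 \<le> M\<^sup>2" for x using fM[of x] M by (intro abs_le_square_iff[THEN iffD1]) auto
  have qC: "q x \<le> C" if "x \<in> K" for x
  proof -
    have "q x = (f x)\<^sup>2 / w x" by (simp add: q_def \<psi>_def power2_eq_square)
    also have "\<dots> \<le> C" unfolding C_def using f2 wK[OF that] \<delta> by (intro frac_le) auto
    finally show ?thesis .
  qed
  have intq: "integrable lborel q" by (rule intbd[of _ C]) (use qC q0 qnn in auto)
  define H where "H = (\<lambda>x. (f x)\<^sup>2 / bdist \<Omega> x powr (2 * s))"
  have [measurable]: "H \<in> borel_measurable borel" unfolding H_def by measurable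
  have intH: "integrable lborel H"
  proof (rule intbd[of _ "M\<^sup>2 / \<delta> powr (2 * s)"])
    show "\<bar>H x\<bar> \<le> M\<^sup>2 / \<delta> powr (2 * s)" if "x \<in> K" for x
      using f2[of x] bd(1)[OF that] \<delta> weight_exponent_bounds by (auto simp: H_def intro!: frac_le powr_mono2)
    show "H x = 0" if "x \<notin> K" for x using K(2)[of x] that by (auto simp: H_def)
  qed simp
  have hardyH: "hardy_integral s \<Omega> f = (LINT x|lborel. H x)"
    unfolding hardy_integral_def set_lebesgue_integral_def H_def
    by (rule Bochner_Integration.integral_cong) (use t(3) in \<open>auto simp: indicator_def\<close>)
  have intf2: "integrable lborel (\<lambda>x. (f x)\<^sup>2)"
    by (rule intbd[of _ "M\<^sup>2"]) (use f2 K(2) in auto)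
  define G where "G = (\<lambda>(x, h). (f (x + h) - f x)\<^sup>2 * riesz s h)"
  have intG: "integrable (lborel \<Otimes>\<^sub>M lborel) G"
    unfolding G_def by (rule integrable_increment_riesz[OF weight_exponent_bounds(4) s(2) C1 t(4)])
  have EG: "gagliardo s f = (LINT p|(lborel \<Otimes>\<^sub>M lborel). G p)"
    unfolding G_def by (rule gagliardo_eq(1)[OF weight_exponent_bounds(4) s(2) C1 t(4)])
  define T2 where "T2 = (\<lambda>\<epsilon> (x, h). w x * w (x + h) * (\<psi> (x + h) - \<psi> x)\<^sup>2 * riesz_trunc s \<epsilon> h)"
  have [measurable]: "T2 \<epsilon> \<in> borel_measurable (lborel \<Otimes>\<^sub>M lborel)" for \<epsilon> unfolding T2_def by measurable
  have main: "integrable (lborel \<Otimes>\<^sub>M lborel) (T2 \<epsilon>) \<and>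
     (LINT p|(lborel \<Otimes>\<^sub>M lborel). T2 \<epsilon> p) + A - 2 / \<delta>\<^sup>2 * near_mass TYPE('a) s \<epsilon> * (LINT x|lborel. (f x)\<^sup>2) \<le> gagliardo s f"
    if \<epsilon>: "0 < \<epsilon>" "\<epsilon> < \<delta>" "\<epsilon> < 1" and cc: "c1 = 0 \<or> (\<exists>R>0. (\<forall>y\<in>\<Omega>. bdist \<Omega> y \<le> R) \<and> \<epsilon> < 2 * R \<and>
        c1 = ((2 * R) powr \<beta> - R powr \<beta>) * (marg_const DIM('a) s * tail_const s (2 * R)))" for \<epsilon>
  proof -
    let ?k = "riesz_trunc s \<epsilon> :: 'a \<Rightarrow> real"
    let ?\<tau> = "near_mass TYPE('a) s \<epsilon>"
    define T1 where "T1 = (\<lambda>(x, h). (f (x + h) - f x)\<^sup>2 * ?k h)"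
    define T3 where "T3 = (\<lambda>(x, h). q x * ((w x - w (x + h)) * ?k h))"
    \<comment> \<open>\<open>T3\<close> seen from the other endpoint.\<close>
    define T4 where "T4 = (\<lambda>(x, h). T3 (x + h, - h))"
    have T1G: "T1 p \<le> G p" "0 \<le> T1 p" for p
      by (auto simp: T1_def G_def riesz_trunc_def indicator_def split: prod.splits)
    have intT1: "integrable (lborel \<Otimes>\<^sub>M lborel) T1"
    proof (rule Bochner_Integration.integrable_bound[OF intG])
      show "T1 \<in> borel_measurable (lborel \<Otimes>\<^sub>M lborel)" unfolding T1_def by measurable
      have "norm (T1 p) \<le> norm (G p)" for p using T1G[of p] unfolding real_norm_def by linarith
      then show "AE p in lborel \<Otimes>\<^sub>M lborel. norm (T1 p) \<le> norm (G p)" by simp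
    qed
    have ik: "integrable lborel ?k" using weight_exponent_bounds s \<epsilon> by (intro integrable_riesz_trunc) auto
    have ikb: "integrable lborel (\<lambda>h. norm h powr \<beta> * ?k h)"
      using weight_exponent_bounds s \<epsilon> by (intro integrable_powr_riesz_trunc) auto
    \<comment> \<open>Dominated by a tensor product: q lives on the compact set K, where
      \<open>w\<close> is at most \<open>D powr \<beta>\<close>, and w(x + h) grows at most like
      |h|^\<beta> by comparison with the half-space weight.\<close>
    have intT3: "integrable (lborel \<Otimes>\<^sub>M lborel) T3"
    proof (rule Bochner_Integration.integrable_bound)
      show "integrable (lborel \<Otimes>\<^sub>M lborel) (\<lambda>(x, h). (C * indicator K x) * (3 * D powr \<beta> * ?k h + 2 * (norm h powr \<beta> * ?k h)))"
        by (intro integrable_pair_times integrable_mult_right intK Bochner_Integration.integrable_add ik ikb)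
      show "T3 \<in> borel_measurable (lborel \<Otimes>\<^sub>M lborel)" unfolding T3_def by measurable
      show "AE p in lborel \<Otimes>\<^sub>M lborel. norm (T3 p) \<le> norm (case p of (x, h) \<Rightarrow> (C * indicator K x) * (3 * D powr \<beta> * ?k h + 2 * (norm h powr \<beta> * ?k h)))"
      proof (rule AE_I2)
        fix p :: "'a \<times> 'a"
        obtain x h where p: "p = (x, h)" by (cases p)
        show "norm (T3 p) \<le> norm (case p of (x, h) \<Rightarrow> (C * indicator K x) * (3 * D powr \<beta> * ?k h + 2 * (norm h powr \<beta> * ?k h)))"
        proof (cases "x \<in> K")
          case True
          then have x: "x \<in> \<Omega>" using K by auto
          have dp: "bdist \<Omega> x > 0" using bdist_pos[OF \<Omega>(1,3) x] .
          obtain e where e: "norm e = 1" "\<And>h. w (x + h) \<le> max 0 (bdist \<Omega> x + h \<bullet> e) powr \<beta>"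
            using w_shift_le[OF x] by blast
          have dD: "bdist \<Omega> x powr \<beta> \<le> D powr \<beta>" using bd(2)[OF True] weight_exponent_bounds by (intro powr_mono2) auto
          have "w (x + h) \<le> 2 * (bdist \<Omega> x powr \<beta> + norm h powr \<beta>)"
            by (rule order_trans[OF e(2) halfspace_weight_growth[OF e(1) dp]])
          also have "\<dots> \<le> 2 * (D powr \<beta> + norm h powr \<beta>)"
            by (intro mult_left_mono add_right_mono dD) simp
          finally have "w (x + h) \<le> 2 * (D powr \<beta> + norm h powr \<beta>)" .
          moreover have "w x \<le> D powr \<beta>" using wK[OF True] dD by simp
          ultimately have "\<bar>w x - w (x + h)\<bar> \<le> 3 * D powr \<beta> + 2 * norm h powr \<beta>"
            using w_nonneg[of x] w_nonneg[of "x + h"] powr_ge_zero[of D \<beta>] powr_ge_zero[of "norm h" \<beta>]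
            unfolding abs_le_iff by argo
          then have wk: "\<bar>w x - w (x + h)\<bar> * ?k h \<le> (3 * D powr \<beta> + 2 * norm h powr \<beta>) * ?k h"
            by (rule mult_right_mono) simp
          have "0 \<le> C" using qC[OF True] qnn[of x] by simp
          then have "q x * (\<bar>w x - w (x + h)\<bar> * ?k h) \<le> C * ((3 * D powr \<beta> + 2 * norm h powr \<beta>) * ?k h)"
            by (intro mult_mono[OF qC[OF True] wk]) auto
          also have "\<dots> \<le> norm (C * ((3 * D powr \<beta> + 2 * norm h powr \<beta>) * ?k h))" by simp
          finally show ?thesis using True qnn[of x] by (simp add: p T3_def abs_mult distrib_right mult.assoc)
        qed (simp add: p T3_def q0)
      qed
    qed
    note T4 = integrable_pair_shift_flip[OF intT3, folded T4_def]
    have intT4: "integrable (lborel \<Otimes>\<^sub>M lborel) T4" using T4(1) unfolding T4_def .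
    have LT4: "(LINT p|(lborel \<Otimes>\<^sub>M lborel). T4 p) = (LINT p|(lborel \<Otimes>\<^sub>M lborel). T3 p)"
      using integrable_pair_shift_flip(2)[OF intT3] by (simp add: T4_def case_prod_beta')
    have fw: "f x = w x * \<psi> x" for x
      using K(2)[of x] wK(2)[of x] by (cases "f x = 0") (auto simp: \<psi>_def)
    have ident: "T2 \<epsilon> p = T1 p - T3 p - T4 p" for p
    proof -
      obtain x h where p: "p = (x, h)" by (cases p)
      have "x + h + - h = x" by simp
      then show ?thesis
        unfolding p T1_def T2_def T3_def T4_def q_def prod.case riesz_trunc_minus
        unfolding fw[of x] fw[of "x + h"]
        by (simp only:) (simp add: algebra_simps power2_eq_square)
    qed
    have intT2: "integrable (lborel \<Otimes>\<^sub>M lborel) (T2 \<epsilon>)"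
      unfolding ident[abs_def] by (intro Bochner_Integration.integrable_diff intT1 intT3 intT4)
    have "(LINT p|(lborel \<Otimes>\<^sub>M lborel). T2 \<epsilon> p) = (LINT p|(lborel \<Otimes>\<^sub>M lborel). T1 p) - 2 * (LINT p|(lborel \<Otimes>\<^sub>M lborel). T3 p)"
      unfolding ident using intT1 intT3 intT4 LT4 by simp
    moreover have "(LINT p|(lborel \<Otimes>\<^sub>M lborel). T1 p) \<le> gagliardo s f"
      unfolding EG by (rule integral_mono[OF intT1 intG T1G(1)])
    moreover have "k_const DIM('a) s / 2 * (LINT x|lborel. H x) - ?\<tau> / \<delta>\<^sup>2 * (LINT x|lborel. (f x)\<^sup>2) + c1 * (LINT x|lborel. q x)
       \<le> (LINT p|(lborel \<Otimes>\<^sub>M lborel). T3 p)"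
    proof -
      have "k_const DIM('a) s / 2 * (LINT x|lborel. H x) - ?\<tau> / \<delta>\<^sup>2 * (LINT x|lborel. (f x)\<^sup>2) + c1 * (LINT x|lborel. q x)
        = (LINT x|lborel. k_const DIM('a) s / 2 * H x - ?\<tau> / \<delta>\<^sup>2 * (f x)\<^sup>2 + c1 * q x)"
        using intH intf2 intq by simp
      also have "\<dots> \<le> (LINT x|lborel. LINT h|lborel. T3 (x, h))"
      proof (rule integral_mono)
        show "integrable lborel (\<lambda>x. k_const DIM('a) s / 2 * H x - ?\<tau> / \<delta>\<^sup>2 * (f x)\<^sup>2 + c1 * q x)"
          using intH intf2 intq by simp
        show "integrable lborel (\<lambda>x. LINT h|lborel. T3 (x, h))" by (rule lborel_pair.integrable_fst'[OF intT3])
        fix x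
        have T3x: "(LINT h|lborel. T3 (x, h)) = q x * (LINT h|lborel. (w x - w (x + h)) * ?k h)"
          by (simp add: T3_def)
        show "k_const DIM('a) s / 2 * H x - ?\<tau> / \<delta>\<^sup>2 * (f x)\<^sup>2 + c1 * q x \<le> (LINT h|lborel. T3 (x, h))"
        proof (cases "x \<in> K")
          case False
          then have "f x = 0" using K(2) by auto
          then show ?thesis using False by (simp add: T3x q0 H_def)
        next
          case True
          then have x: "x \<in> \<Omega>" using K by auto
          have qd: "q x * bdist \<Omega> x powr \<beta> = (f x)\<^sup>2"
            using wK[OF True] by (simp add: q_def \<psi>_def power2_eq_square)
          have "q x * (bdist \<Omega> x powr \<beta> / 2 * (k_const DIM('a) s / bdist \<Omega> x powr (2 * s) - 2 / \<delta>\<^sup>2 * ?\<tau>) + c1) \<le> (LINT h|lborel. T3 (x, h))"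
            unfolding T3x by (intro mult_left_mono truncated_potential_ge(2)[OF x \<delta> bd(1)[OF True] \<epsilon> cc] qnn)
          moreover have "q x * (bdist \<Omega> x powr \<beta> / 2 * (k_const DIM('a) s / bdist \<Omega> x powr (2 * s) - 2 / \<delta>\<^sup>2 * ?\<tau>) + c1)
             = (q x * bdist \<Omega> x powr \<beta>) / 2 * (k_const DIM('a) s / bdist \<Omega> x powr (2 * s) - 2 / \<delta>\<^sup>2 * ?\<tau>) + c1 * q x"
            by (simp add: algebra_simps)
          moreover have "(f x)\<^sup>2 / 2 * (k_const DIM('a) s / bdist \<Omega> x powr (2 * s) - 2 / \<delta>\<^sup>2 * ?\<tau>)
             = k_const DIM('a) s / 2 * H x - ?\<tau> / \<delta>\<^sup>2 * (f x)\<^sup>2"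
            by (simp add: H_def algebra_simps)
          ultimately show ?thesis unfolding qd by linarith
        qed
      qed
      also have "\<dots> = (LINT p|(lborel \<Otimes>\<^sub>M lborel). T3 p)" by (rule lborel_pair.integral_fst'[OF intT3])
      finally show ?thesis .
    qed
    ultimately show ?thesis using intT2 unfolding A_def hardyH q_def[symmetric] by (simp add: algebra_simps)
  qed
  define e where "e = (\<lambda>m. inverse (real (Suc m)))"
  have e0: "e \<longlonglongrightarrow> 0" unfolding e_def by (rule LIMSEQ_inverse_real_of_nat)
  have epos: "0 < e m" for m by (simp add: e_def)
  have ev: "eventually (\<lambda>m. integrable (lborel \<Otimes>\<^sub>M lborel) (T2 (e m)) \<and>
     (LINT p|(lborel \<Otimes>\<^sub>M lborel). T2 (e m) p) + A - 2 / \<delta>\<^sup>2 * near_mass TYPE('a) s (e m) * (LINT x|lborel. (f x)\<^sup>2) \<le> gagliardo s f) sequentially"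
  proof -
    have small: "eventually (\<lambda>m. e m < r) sequentially" if "r > 0" for r using e0 that by (rule order_tendstoD(2))
    show ?thesis
    proof (cases "c1 = 0")
      case True
      have "eventually (\<lambda>m. e m < \<delta> \<and> e m < 1) sequentially" using small[OF \<delta>] small[of 1] by (simp add: eventually_conj)
      then show ?thesis by eventually_elim (use main epos True in blast)
    next
      case False
      then obtain R where R: "R > 0" "\<forall>y\<in>\<Omega>. bdist \<Omega> y \<le> R"
        "c1 = ((2 * R) powr \<beta> - R powr \<beta>) * (marg_const DIM('a) s * tail_const s (2 * R))" using c1 unfolding gain_const_def by blast
      have "eventually (\<lambda>m. e m < \<delta> \<and> e m < 1 \<and> e m < 2 * R) sequentially"
        using small[OF \<delta>] small[of 1] small[of "2 * R"] R(1) by (simp add: eventually_conj)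
      then show ?thesis by eventually_elim (use main epos R in blast)
    qed
  qed
  define F2 where "F2 = (LINT x|lborel. (f x)\<^sup>2)"
  have lim: "(\<lambda>m. gagliardo s f - A + 2 / \<delta>\<^sup>2 * near_mass TYPE('a) s (e m) * F2) \<longlonglongrightarrow> gagliardo s f - A + 2 / \<delta>\<^sup>2 * 0 * F2"
    unfolding e_def by (intro tendsto_intros near_mass_tendsto weight_exponent_bounds s)
  have T2nn: "0 \<le> T2 \<epsilon> p" for \<epsilon> p by (simp add: T2_def split: prod.splits)
  have "0 \<le> gagliardo s f - A + 2 / \<delta>\<^sup>2 * 0 * F2"
  proof (rule tendsto_lowerbound[OF lim])
    show "eventually (\<lambda>m. 0 \<le> gagliardo s f - A + 2 / \<delta>\<^sup>2 * near_mass TYPE('a) s (e m) * F2) sequentially"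
      using ev
    proof eventually_elim
      case (elim m)
      have "0 \<le> (LINT p|(lborel \<Otimes>\<^sub>M lborel). T2 (e m) p)" by (rule Bochner_Integration.integral_nonneg) (rule T2nn)
      then show ?case using elim by (simp add: F2_def)
    qed
  qed simp
  then show "A \<le> gagliardo s f" by simp
  \<comment> \<open>The truncated weighted energies increase as the truncation shrinks, so monotone
    convergence recovers the one with the full kernel; its finiteness is a result here and not an
    assumption.\<close>
  define T where "T = (\<lambda>(x, h). w x * w (x + h) * (\<psi> (x + h) - \<psi> x)\<^sup>2 * riesz s h)"
  have lim2: "(\<lambda>m. \<integral>\<^sup>+p. ennreal (T2 (e m) p) \<partial>(lborel \<Otimes>\<^sub>M lborel)) \<longlonglongrightarrow> (\<integral>\<^sup>+p. ennreal (T p) \<partial>(lborel \<Otimes>\<^sub>M lborel))"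
  proof (rule nn_integral_LIMSEQ)
    show "incseq (\<lambda>m p. ennreal (T2 (e m) p))"
    proof (rule incseq_SucI, rule le_funI)
      fix m and p :: "'a \<times> 'a"
      have "e (Suc m) \<le> e m" by (simp add: e_def field_simps)
      then show "ennreal (T2 (e m) p) \<le> ennreal (T2 (e (Suc m)) p)"
        by (intro ennreal_leI) (auto simp: T2_def riesz_trunc_def indicator_def split: prod.splits)
    qed
    show "(\<lambda>m. ennreal (T2 (e m) p)) \<longlonglongrightarrow> ennreal (T p)" for p
    proof -
      obtain x h where p: "p = (x, h)" by (cases p)
      show ?thesis
      proof (cases "h = 0")
        case True
        then show ?thesis by (simp add: p T2_def T_def riesz_trunc_def riesz_def)
      next
        case False
        then have "eventually (\<lambda>m. e m < norm h) sequentially" using e0 by (intro order_tendstoD(2)) auto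
        then have "eventually (\<lambda>m. ennreal (T2 (e m) p) = ennreal (T p)) sequentially"
          by eventually_elim (simp add: p T2_def T_def riesz_trunc_def)
        then show ?thesis by (rule tendsto_eventually)
      qed
    qed
  qed simp
  have "(\<integral>\<^sup>+p. ennreal (T p) \<partial>(lborel \<Otimes>\<^sub>M lborel)) \<le> ennreal (gagliardo s f - A + 2 / \<delta>\<^sup>2 * 0 * F2)"
  proof (rule tendsto_le[OF _ tendsto_ennrealI[OF lim] lim2])
    show "eventually (\<lambda>m. (\<integral>\<^sup>+p. ennreal (T2 (e m) p) \<partial>(lborel \<Otimes>\<^sub>M lborel)) \<le> ennreal (gagliardo s f - A + 2 / \<delta>\<^sup>2 * near_mass TYPE('a) s (e m) * F2)) sequentially"
      using ev
    proof eventually_elim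
      case (elim m)
      have "(\<integral>\<^sup>+p. ennreal (T2 (e m) p) \<partial>(lborel \<Otimes>\<^sub>M lborel)) = ennreal (LINT p|(lborel \<Otimes>\<^sub>M lborel). T2 (e m) p)"
        using elim T2nn by (intro nn_integral_eq_integral) auto
      also have "\<dots> \<le> ennreal (gagliardo s f - A + 2 / \<delta>\<^sup>2 * near_mass TYPE('a) s (e m) * F2)"
        using elim by (intro ennreal_leI) (simp add: F2_def)
      finally show ?case .
    qed
  qed simp
  moreover have "(\<integral>\<^sup>+p. ennreal (T p) \<partial>(lborel \<Otimes>\<^sub>M lborel)) = (\<integral>\<^sup>+x. \<integral>\<^sup>+h. ennreal (w x * w (x + h) * (\<psi> (x + h) - \<psi> x)\<^sup>2 * riesz s h) \<partial>lborel \<partial>lborel)"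
    unfolding T_def by (subst lborel.nn_integral_fst[symmetric]) auto
  ultimately show "(\<integral>\<^sup>+x. \<integral>\<^sup>+h. ennreal (w x * w (x + h) * (\<psi> (x + h) - \<psi> x)\<^sup>2 * riesz s h) \<partial>lborel \<partial>lborel) \<le> ennreal (gagliardo s f - A)"
    by simp
qed

lemma hardy:
  "f \<in> test_functions \<Omega> \<Longrightarrow> k_const DIM('a) s * hardy_integral s \<Omega> f \<le> gagliardo s f"
  using ground_state(1)[of f 0] by (simp add: gain_const_def)

end

section \<open>The Sobolev remainder\<close>

lemma bdist_ge:
  assumes \<Omega>: "open \<Omega>" "\<Omega> \<noteq> UNIV" "\<Omega> \<noteq> {}" and "ball y \<tau> \<subseteq> \<Omega>"
  shows "\<tau> \<le> bdist \<Omega> y"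
proof -
  have "frontier \<Omega> \<noteq> {}" using \<Omega> by (auto simp: frontier_eq_empty)
  then obtain p where p: "p \<in> frontier \<Omega>" "bdist \<Omega> y = dist y p"
    unfolding bdist_def using infdist_attains_inf[OF frontier_closed, of \<Omega> y] by blast
  then have "p \<notin> \<Omega>" using \<Omega>(1) frontier_disjoint_eq[of \<Omega>] by auto
  then have "\<not> dist y p < \<tau>" using assms(4) by auto
  then show ?thesis using p by simp
qed

text \<open>An interior ball of fixed size within fixed distance of every point is the form in which
  the boundary regularity enters the Sobolev bound. Far from the boundary the point itself is the
  centre; near it, moving up by \<epsilon>/2 along the axis of the chart clears the graph.\<close>

lemma uniformly_Lipschitz_inner_ball:
  fixes \<Omega> :: "'a::euclidean_space set"
  assumes \<Omega>: "open \<Omega>" "\<Omega> \<noteq> UNIV" and UL: "uniformly_Lipschitz \<Omega>"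
  shows "\<exists>\<rho>>0. \<exists>D>0. \<forall>x\<in>\<Omega>. \<exists>z. dist x z \<le> D \<and> ball z \<rho> \<subseteq> \<Omega>"
proof -
  from UL obtain \<epsilon> L M and \<U> :: "'a set set" where \<epsilon>: "\<epsilon> > 0" and L: "L > 0" and
    cov: "\<forall>x\<in>frontier \<Omega>. \<exists>U\<in>\<U>. ball x \<epsilon> \<subseteq> U" and
    gr: "\<forall>U\<in>\<U>. \<exists>\<nu> g. norm \<nu> = 1 \<and> L-lipschitz_on {y. y \<bullet> \<nu> = 0} g \<and> U \<inter> \<Omega> = U \<inter> above_graph \<nu> g"
    unfolding uniformly_Lipschitz_def by (elim exE conjE) metis
  \<comment> \<open>The first bound keeps the ball inside the chart: \<epsilon>/4 + \<epsilon>/2 +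
    \<epsilon>/4 = \<epsilon>. The second makes the lift \<epsilon>/2 exceed the loss of height
    \<rho> plus the rise L \<rho> of the graph.\<close>
  define \<rho> where "\<rho> = min (\<epsilon> / 4) (\<epsilon> / (2 * (1 + L)))"
  have "\<rho> > 0" using \<epsilon> L by (auto simp: \<rho>_def)
  moreover have "\<rho> \<le> \<epsilon> / 4" unfolding \<rho>_def by (rule min.cobounded1)
  ultimately have \<rho>: "\<rho> > 0" "\<rho> \<le> \<epsilon> / 4" .
  have "\<rho> \<le> \<epsilon> / (2 * (1 + L))" by (simp add: \<rho>_def)
  then have \<rho>L: "(1 + L) * \<rho> \<le> \<epsilon> / 2" using L by (simp add: field_simps)
  have "\<exists>z. dist x z \<le> \<epsilon> \<and> ball z \<rho> \<subseteq> \<Omega>" if x: "x \<in> \<Omega>" for x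
  proof (cases "\<epsilon> / 4 \<le> bdist \<Omega> x")
    case True
    have "ball x \<rho> \<subseteq> \<Omega>"
    proof
      fix y assume "y \<in> ball x \<rho>"
      then have "dist x y < bdist \<Omega> x" using \<rho> True by simp
      then show "y \<in> \<Omega>" using bdist_le_dist_outside[OF x, of y] by fastforce
    qed
    then show ?thesis using \<epsilon> by (intro exI[of _ x]) auto
  next
    case False
    have "frontier \<Omega> \<noteq> {}" using \<Omega> x by (auto simp: frontier_eq_empty)
    then obtain p where p: "p \<in> frontier \<Omega>" "bdist \<Omega> x = dist x p"
      unfolding bdist_def using infdist_attains_inf[OF frontier_closed, of \<Omega> x] by blast
    obtain U where U: "U \<in> \<U>" "ball p \<epsilon> \<subseteq> U" using cov p(1) by blast
    obtain \<nu> g where g: "norm \<nu> = 1" "L-lipschitz_on {y. y \<bullet> \<nu> = 0} g" "U \<inter> \<Omega> = U \<inter> above_graph \<nu> g"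
      using gr U(1) by blast
    have \<nu>: "\<nu> \<bullet> \<nu> = 1" using g(1) by (simp add: norm_eq_1)
    have xp: "dist p x < \<epsilon> / 4" using False p(2) by (simp add: dist_commute)
    then have "x \<in> U" using U(2) \<epsilon> by auto
    then have xg: "x \<bullet> \<nu> > g (hproj \<nu> x)" using g(3) x by (auto simp: above_graph_def)
    define z where "z = x + (\<epsilon> / 2) *\<^sub>R \<nu>"
    have hz: "hproj \<nu> z = hproj \<nu> x" by (simp add: z_def hproj_def inner_add_left \<nu> algebra_simps)
    have zn: "z \<bullet> \<nu> = x \<bullet> \<nu> + \<epsilon> / 2" by (simp add: z_def inner_add_left \<nu>)
    have xz: "dist x z = \<epsilon> / 2" using \<epsilon> by (simp add: z_def dist_norm g(1))
    have "ball z \<rho> \<subseteq> \<Omega>"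
    proof
      fix y assume "y \<in> ball z \<rho>"
      then have y: "norm (y - z) < \<rho>" by (simp add: dist_norm norm_minus_commute)
      have "dist p y \<le> dist p x + dist x z + dist z y"
        using dist_triangle[of p y x] dist_triangle[of x y z] by linarith
      then have "dist p y < \<epsilon>" using xp xz y \<rho>(2) by (simp add: dist_norm norm_minus_commute)
      then have yU: "y \<in> U" using U(2) by auto
      define v where "v = y - z"
      have nv: "norm (hproj \<nu> v) \<le> norm v"
      proof -
        have "(norm (hproj \<nu> v))\<^sup>2 = (norm v)\<^sup>2 - (v \<bullet> \<nu>)\<^sup>2"
          unfolding power2_norm_eq_inner by (simp add: hproj_def inner_diff_left inner_diff_right \<nu> inner_commute power2_eq_square)
        then have "(norm (hproj \<nu> v))\<^sup>2 \<le> (norm v)\<^sup>2" by simp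
        then show ?thesis by (rule power2_le_imp_le) simp
      qed
      have hy: "hproj \<nu> y - hproj \<nu> x = hproj \<nu> v"
        unfolding hz[symmetric] by (simp add: v_def hproj_def inner_diff_left algebra_simps)
      have h0: "hproj \<nu> u \<bullet> \<nu> = 0" for u by (simp add: hproj_def inner_diff_left \<nu>)
      have "dist (g (hproj \<nu> y)) (g (hproj \<nu> x)) \<le> L * dist (hproj \<nu> y) (hproj \<nu> x)"
        using lipschitz_onD[OF g(2)] h0 by auto
      also have "\<dots> \<le> L * \<rho>" using nv y L by (simp add: dist_norm hy v_def)
      finally have gy: "g (hproj \<nu> y) \<le> g (hproj \<nu> x) + L * \<rho>" by (simp add: dist_real_def abs_le_iff)
      have "\<bar>v \<bullet> \<nu>\<bar> \<le> norm v" using Cauchy_Schwarz_ineq2[of v \<nu>] g(1) by simp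
      then have "z \<bullet> \<nu> - \<rho> < y \<bullet> \<nu>" using y by (simp add: v_def inner_diff_left abs_le_iff)
      then have "y \<bullet> \<nu> > g (hproj \<nu> y)" using gy xg zn \<rho>L by (simp add: algebra_simps)
      then have "y \<in> U \<inter> above_graph \<nu> g" using yU by (simp add: above_graph_def)
      then show "y \<in> \<Omega>" using g(3) by auto
    qed
    then show ?thesis using xz \<epsilon> by (intro exI[of _ z]) auto
  qed
  then show ?thesis using \<epsilon> \<rho>(1) by blast
qed

context convex_hardy
begin

text \<open>By convexity the set contains the convex hull of the balls of radius d(x) about x and
  \<rho> about z. At parameter t on the segment this hull contains a ball of radius (1 - t) d(x) + t
  \<rho>, and moving the centre by less than t \<rho>/2 costs at most that much.\<close>

lemma interior_ball_bdist:
  assumes x: "x \<in> \<Omega>" and z: "ball z \<rho> \<subseteq> \<Omega>" and \<rho>: "0 < \<rho>" and t: "0 < t" "t \<le> 1"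
    and y: "norm (y - (x + t *\<^sub>R (z - x))) < t * \<rho> / 2"
  shows "(1 - t) * bdist \<Omega> x + t * \<rho> / 2 \<le> bdist \<Omega> y"
proof (rule bdist_ge)
  show "open \<Omega>" "\<Omega> \<noteq> UNIV" "\<Omega> \<noteq> {}" using \<Omega> x by auto
  define d where "d = bdist \<Omega> x"
  have d: "d > 0" unfolding d_def by (rule bdist_pos[OF \<Omega>(1,3) x])
  define \<sigma> where "\<sigma> = (1 - t) * d + t * \<rho>"
  have \<sigma>: "\<sigma> > 0" unfolding \<sigma>_def using d t \<rho> by (intro add_nonneg_pos mult_nonneg_nonneg mult_pos_pos) auto
  show "ball y ((1 - t) * bdist \<Omega> x + t * \<rho> / 2) \<subseteq> \<Omega>"
  proof
    fix p assume "p \<in> ball y ((1 - t) * bdist \<Omega> x + t * \<rho> / 2)"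
    then have p: "norm (p - y) < (1 - t) * d + t * \<rho> / 2" by (simp add: dist_norm norm_minus_commute d_def)
    define u where "u = p - (x + t *\<^sub>R (z - x))"
    have "norm u \<le> norm (p - y) + norm (y - (x + t *\<^sub>R (z - x)))"
      unfolding u_def by (rule norm_diff_triangle_le[OF order_refl order_refl])
    then have u: "norm u < \<sigma>" using p y by (simp add: \<sigma>_def)
    define c where "c = u /\<^sub>R \<sigma>"
    have c: "norm c < 1" using u \<sigma> by (simp add: c_def field_simps)
    have uc: "u = \<sigma> *\<^sub>R c" using \<sigma> by (simp add: c_def)
    have 1: "x + d *\<^sub>R c \<in> \<Omega>"
    proof (rule ccontr)
      assume "x + d *\<^sub>R c \<notin> \<Omega>"
      then have "d \<le> dist x (x + d *\<^sub>R c)" unfolding d_def by (rule bdist_le_dist_outside[OF x])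
      then show False using d c by (simp add: dist_norm)
    qed
    have 2: "z + \<rho> *\<^sub>R c \<in> \<Omega>" using z \<rho> c by (auto simp: dist_norm subset_iff)
    have "(1 - t) *\<^sub>R (x + d *\<^sub>R c) + t *\<^sub>R (z + \<rho> *\<^sub>R c) \<in> \<Omega>"
      using \<Omega>(2) 1 2 t by (intro convexD) auto
    also have "(1 - t) *\<^sub>R (x + d *\<^sub>R c) + t *\<^sub>R (z + \<rho> *\<^sub>R c) = x + t *\<^sub>R (z - x) + \<sigma> *\<^sub>R c"
      by (simp add: \<sigma>_def algebra_simps)
    also have "\<dots> = p" unfolding uc[symmetric] u_def by simp
    finally show "p \<in> \<Omega>" .
  qed
qed

text \<open>Move from x the fraction t = r/(D + \<rho>) of the way to the centre of an inner ball
  and take the ball of radius t \<rho>/2 there. It lies within r of x, its volume is proportional to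
  r^n, and \<open>interior_ball_bdist\<close> bounds \<open>w\<close> on it from below by a multiple
  of \<open>w x\<close>, with constants that do not deteriorate as x approaches the
  boundary.\<close>

lemma exists_plump_subset:
  assumes R: "0 < R" "\<And>y. y \<in> \<Omega> \<Longrightarrow> bdist \<Omega> y \<le> R" and \<rho>: "0 < \<rho>" and D: "0 < D"
    and inner: "\<And>x. x \<in> \<Omega> \<Longrightarrow> \<exists>z. dist x z \<le> D \<and> ball z \<rho> \<subseteq> \<Omega>"
  shows "\<exists>v>0. \<exists>\<kappa>>0. \<forall>x\<in>\<Omega>. \<forall>r. 0 < r \<and> r \<le> D + \<rho> \<longrightarrow>
    (\<exists>A\<in>sets borel. emeasure lborel A = ennreal (v * r ^ DIM('a)) \<and> A \<subseteq> \<Omega> \<and> (\<forall>y\<in>A. norm (y - x) \<le> r \<and> w x \<le> \<kappa> * w y))"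
proof -
  define v where "v = unit_ball_vol (real DIM('a)) * (\<rho> / (2 * (D + \<rho>))) ^ DIM('a)"
  \<comment> \<open>With m <= 1 and m R <= \<rho>/2, splitting m d(x) in the ratio (1 - t) : t gives
    m d(x) <= (1 - t) d(x) + t \<rho>/2. This is why the weights compare with the factor
    m^(-\<beta>).\<close>
  define m where "m = min 1 (\<rho> / (2 * R))"
  have m: "0 < m" "m \<le> 1" "m * R \<le> \<rho> / 2" using R(1) \<rho> by (auto simp: m_def min_def field_simps)
  have v: "v > 0" using \<rho> D by (auto simp: v_def intro!: mult_pos_pos)
  show ?thesis
  proof (rule exI[of _ v], rule conjI[OF v], rule exI[of _ "1 / m powr \<beta>"], intro conjI ballI allI impI)
    show "0 < 1 / m powr \<beta>" using m by simp
    fix x r assume x: "x \<in> \<Omega>" and r: "0 < r \<and> r \<le> D + \<rho>"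
    obtain z where z: "dist x z \<le> D" "ball z \<rho> \<subseteq> \<Omega>" using inner[OF x] by blast
    define t where "t = r / (D + \<rho>)"
    have t: "0 < t" "t \<le> 1" using r \<rho> D by (auto simp: t_def)
    have tr: "t * (D + \<rho>) = r" using \<rho> D by (simp add: t_def)
    define A where "A = ball (x + t *\<^sub>R (z - x)) (t * \<rho> / 2)"
    have yA: "norm (y - (x + t *\<^sub>R (z - x))) < t * \<rho> / 2" if "y \<in> A" for y
      using that by (simp add: A_def dist_norm norm_minus_commute)
    have dA: "m * bdist \<Omega> x \<le> bdist \<Omega> y" if "y \<in> A" for y
    proof -
      have "m * bdist \<Omega> x = (1 - t) * (m * bdist \<Omega> x) + t * (m * bdist \<Omega> x)" by (simp add: algebra_simps)
      also have "\<dots> \<le> (1 - t) * (1 * bdist \<Omega> x) + t * (m * R)"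
        using t m R(2)[OF x] by (intro add_mono mult_left_mono mult_right_mono) auto
      also have "\<dots> \<le> (1 - t) * bdist \<Omega> x + t * (\<rho> / 2)" using t m by (intro add_mono mult_left_mono) auto
      also have "\<dots> \<le> bdist \<Omega> y" using interior_ball_bdist[OF x z(2) \<rho> t yA[OF that]] by simp
      finally show ?thesis .
    qed
    have A\<Omega>: "A \<subseteq> \<Omega>"
    proof
      fix y assume y: "y \<in> A"
      define u where "u = (y - (x + t *\<^sub>R (z - x))) /\<^sub>R t"
      have "norm (y - (x + t *\<^sub>R (z - x))) < t * \<rho>" using yA[OF y] mult_pos_pos[OF t(1) \<rho>] by linarith
      moreover have "norm u = norm (y - (x + t *\<^sub>R (z - x))) / t"
        unfolding u_def norm_scaleR using t by (simp add: divide_inverse mult.commute)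
      ultimately have "norm u < \<rho>" using t by (simp add: pos_divide_less_eq mult.commute)
      then have "z + u \<in> \<Omega>" using z(2) by (auto simp: dist_norm subset_iff)
      then have "(1 - t) *\<^sub>R x + t *\<^sub>R (z + u) \<in> \<Omega>" using \<Omega>(2) x t by (intro convexD) auto
      also have "(1 - t) *\<^sub>R x + t *\<^sub>R (z + u) = y" using t by (simp add: u_def algebra_simps)
      finally show "y \<in> \<Omega>" .
    qed
    show "\<exists>A\<in>sets borel. emeasure lborel A = ennreal (v * r ^ DIM('a)) \<and> A \<subseteq> \<Omega> \<and> (\<forall>y\<in>A. norm (y - x) \<le> r \<and> w x \<le> 1 / m powr \<beta> * w y)"
    proof (rule bexI[of _ A], intro conjI ballI)
      have "t * \<rho> / 2 = \<rho> / (2 * (D + \<rho>)) * r" using \<rho> D by (simp add: t_def field_simps)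
      then have "(t * \<rho> / 2) ^ DIM('a) = (\<rho> / (2 * (D + \<rho>))) ^ DIM('a) * r ^ DIM('a)"
        by (simp only: power_mult_distrib)
      then show "emeasure lborel A = ennreal (v * r ^ DIM('a))"
        unfolding A_def using t \<rho> by (subst emeasure_ball) (auto simp: v_def mult.assoc)
      show "A \<subseteq> \<Omega>" by (rule A\<Omega>)
      show "A \<in> sets borel" by (simp add: A_def)
      fix y assume y: "y \<in> A"
      have "norm (y - x) \<le> norm (y - (x + t *\<^sub>R (z - x))) + norm (t *\<^sub>R (z - x))"
        using norm_triangle_ineq[of "y - (x + t *\<^sub>R (z - x))" "t *\<^sub>R (z - x)"] by simp
      also have "\<dots> \<le> t * \<rho> / 2 + t * D"
        using yA[OF y] z(1) t by (intro add_mono) (auto simp: dist_norm norm_minus_commute)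
      also have "\<dots> \<le> t * (D + \<rho>)" using t \<rho> by (simp add: algebra_simps)
      finally show "norm (y - x) \<le> r" by (simp add: tr)
      have "m powr \<beta> * w x = (m * bdist \<Omega> x) powr \<beta>" using x m by (simp add: w_def powr_mult)
      also have "\<dots> \<le> bdist \<Omega> y powr \<beta>" using dA[OF y] weight_exponent_bounds m by (intro powr_mono2) auto
      also have "\<dots> = w y" using y A\<Omega> by (auto simp: w_def)
      finally show "w x \<le> 1 / m powr \<beta> * w y" using m by (simp add: field_simps)
    qed
  qed
qed

text \<open>Otherwise the integral over A would be at least 3. The bound 2 is meant for a sum of two
  quantities normalised to integral at most 1, so that a single point is good for both.\<close>

lemma exists_le_of_nn_integral_le:
  fixes A :: "'a set" and S :: "'a \<Rightarrow> real"
  assumes [measurable]: "A \<in> sets borel" "S \<in> borel_measurable borel" and A: "emeasure lborel A = ennreal a" "a > 0"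
    and I: "(\<integral>\<^sup>+y. ennreal (S y) * indicator A y \<partial>lborel) \<le> 2"
  shows "\<exists>y\<in>A. S y \<le> 3 / a"
proof (rule ccontr)
  assume "\<not> ?thesis"
  then have S: "3 / a \<le> S y" if "y \<in> A" for y using that by fastforce
  have "3 = ennreal (3 / a) * emeasure lborel A"
    using A by (simp flip: ennreal_mult)
  also have "\<dots> = (\<integral>\<^sup>+y. ennreal (3 / a) * indicator A y \<partial>lborel)" by (subst nn_integral_cmult) auto
  also have "\<dots> \<le> (\<integral>\<^sup>+y. ennreal (S y) * indicator A y \<partial>lborel)"
    by (intro nn_integral_mono) (auto simp: indicator_def intro!: ennreal_leI S)
  also have "\<dots> \<le> 2" by (rule I)
  finally show False by simp
qed

text \<open>Hedberg-type argument: compare \<open>f x / w x\<close> with its value at a good point of a subset of measure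
  \<open>v * r ^ n\<close> near \<open>x\<close>, and optimise over \<open>r\<close>.\<close>

lemma weighted_Sobolev:
  assumes R: "0 < R" "\<And>y. y \<in> \<Omega> \<Longrightarrow> bdist \<Omega> y \<le> R" and \<rho>: "0 < \<rho>" and D: "0 < D"
    and inner: "\<And>x. x \<in> \<Omega> \<Longrightarrow> \<exists>z. dist x z \<le> D \<and> ball z \<rho> \<subseteq> \<Omega>"
    and \<mu>: "0 < \<mu>" and n2s: "2 * s < real DIM('a)"
  shows "\<exists>C>0. \<forall>f\<in>test_functions \<Omega>. ennreal (sobolev_term s \<Omega> f) \<le> ennreal C *
     ((\<integral>\<^sup>+x. \<integral>\<^sup>+h. ennreal (w x * w (x + h) * (f (x + h) / w (x + h) - f x / w x)\<^sup>2 * riesz s h) \<partial>lborel \<partial>lborel)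
       + (\<integral>\<^sup>+x. ennreal (\<mu> * (f x)\<^sup>2) \<partial>lborel))"
proof -
  define n where "n = real DIM('a)"
  define q where "q = 2 * n / (n - 2 * s)"
  have n: "n > 0" "2 * s < n" using n2s by (auto simp: n_def)
  have "2 / q = 2 * (n - 2 * s) / (2 * n)" by (simp add: q_def)
  also have "\<dots> = (n - 2 * s) / n" by (rule mult_divide_mult_cancel_left) simp
  finally have q: "2 / q = (n - 2 * s) / n" .
  have "q > 0" using n by (simp add: q_def)
  note q = this q
  obtain v \<kappa> where v: "v > 0" and \<kappa>: "\<kappa> > 0" and pl: "\<And>x r. x \<in> \<Omega> \<Longrightarrow> 0 < r \<Longrightarrow> r \<le> D + \<rho> \<Longrightarrow>
    \<exists>A\<in>sets borel. emeasure lborel A = ennreal (v * r ^ DIM('a)) \<and> A \<subseteq> \<Omega> \<and> (\<forall>y\<in>A. norm (y - x) \<le> r \<and> w x \<le> \<kappa> * w y)"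
    using exists_plump_subset[OF R \<rho> D inner] by blast
  define r0 where "r0 = D + \<rho>"
  have r0: "r0 > 0" using D \<rho> by (simp add: r0_def)
  \<comment> \<open>The three summands serve, in this order, the oscillation of \<psi> between x and
    the good point, the size of f at the good point, and scales larger than
    \<open>r0\<close>.\<close>
  define C0 where "C0 = sqrt (3 * \<kappa> / v) + \<kappa> * (3 / v) powr (1 / q) + sqrt (1 / (\<mu> * r0 powr (2 * s)))"
  have C0: "C0 > 0" unfolding C0_def using v \<kappa> \<mu> r0 by (intro add_nonneg_pos add_nonneg_nonneg mult_nonneg_nonneg) auto
  show ?thesis
  proof (intro exI[of _ "C0 powr q"] conjI ballI)
    show "0 < C0 powr q" using C0 by simp
    fix f assume f: "f \<in> test_functions \<Omega>"
    note t = test_functionD[OF f]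
    have [measurable]: "f \<in> borel_measurable borel" by (rule t)
    define \<psi> where "\<psi> = (\<lambda>x. f x / w x)"
    have [measurable]: "\<psi> \<in> borel_measurable borel" unfolding \<psi>_def by measurable
    have fw: "f x = w x * \<psi> x" for x using t(3)[of x] w_pos[of x] by (cases "f x = 0") (auto simp: \<psi>_def)
    define g2 where "g2 = (\<lambda>x. \<integral>\<^sup>+h. ennreal (w x * w (x + h) * (\<psi> (x + h) - \<psi> x)\<^sup>2 * riesz s h) \<partial>lborel)"
    have [measurable]: "g2 \<in> borel_measurable borel" unfolding g2_def by measurable
    define G2 where "G2 = (\<lambda>x. g2 x + ennreal (\<mu> * (f x)\<^sup>2))"
    have [measurable]: "G2 \<in> borel_measurable borel" unfolding G2_def by measurable
    define Fq where "Fq = (\<lambda>x. \<bar>f x\<bar> powr q)"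
    have [measurable]: "Fq \<in> borel_measurable borel" unfolding Fq_def by measurable
    obtain K \<delta> M D' where KD: "compact K \<and> (\<forall>x. f x \<noteq> 0 \<longrightarrow> x \<in> K) \<and> K \<subseteq> \<Omega> \<and> 0 < \<delta> \<and> 0 < M
      \<and> (\<forall>x\<in>K. \<delta> \<le> bdist \<Omega> x \<and> bdist \<Omega> x \<le> D') \<and> (\<forall>x. \<bar>f x\<bar> \<le> M)"
      using test_function_bounds[OF f] by blast
    then have K: "compact K" "\<And>x. f x \<noteq> 0 \<Longrightarrow> x \<in> K" and fM: "\<And>x. \<bar>f x\<bar> \<le> M" by simp_all
    have [measurable]: "K \<in> sets borel" using K(1) by (simp add: compact_imp_closed)
    have intK: "integrable lborel (indicator K :: 'a \<Rightarrow> real)"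
      using emeasure_compact_finite[OF K(1)] by simp
    have intF: "integrable lborel Fq"
    proof (rule Bochner_Integration.integrable_bound[OF integrable_mult_right[OF intK, of "M powr q"]])
      show "AE x in lborel. norm (Fq x) \<le> norm (M powr q * indicator K x)"
      proof (rule AE_I2)
        fix x
        show "norm (Fq x) \<le> norm (M powr q * indicator K x)"
        proof (cases "f x = 0")
          case False
          then show ?thesis using K(2)[OF False] fM[of x] q by (auto simp: Fq_def intro!: powr_mono2)
        qed (simp add: Fq_def)
      qed
    qed simp
    define N where "N = (LINT x|lborel. Fq x)"
    have N0: "0 \<le> N" unfolding N_def by (rule Bochner_Integration.integral_nonneg) (simp add: Fq_def)
    have NF: "(\<integral>\<^sup>+x. ennreal (Fq x) \<partial>lborel) = ennreal N"
      unfolding N_def by (rule nn_integral_eq_integral[OF intF]) (simp add: Fq_def)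
    have sob: "sobolev_term s \<Omega> f = N powr (2 / q)"
    proof -
      have "(LINT x:\<Omega>|lborel. \<bar>f x\<bar> powr q) = N"
        unfolding set_lebesgue_integral_def N_def Fq_def
        by (rule Bochner_Integration.integral_cong) (use t(3) in \<open>auto simp: indicator_def\<close>)
      then show ?thesis unfolding sobolev_term_def n_def[symmetric] q_def[symmetric] q(2) by (simp only:)
    qed
    have "ennreal (N powr (2 / q)) \<le> ennreal (C0 powr q) * (\<integral>\<^sup>+x. G2 x \<partial>lborel)"
    proof (cases "N = 0")
      case False
      then have N: "N > 0" using N0 by simp
      \<comment> \<open>The critical exponent q makes the pointwise bound linear in
        \<open>G2\<close>. Integrating it and dividing by N^(1 - 2/q) gives the Sobolev
        inequality.\<close>
      have point: "ennreal (Fq x) \<le> ennreal (C0 powr q * N powr (1 - 2 / q)) * G2 x" for x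
      proof (cases "f x = 0 \<or> G2 x = \<infinity>")
        case True
        then show ?thesis using C0 N by (auto simp: Fq_def ennreal_mult_top)
      next
        case fx: False
        then have x: "x \<in> \<Omega>" using t(3) by auto
        define \<gamma> where "\<gamma> = enn2real (G2 x)"
        have G\<gamma>: "G2 x = ennreal \<gamma>" unfolding \<gamma>_def using fx by (simp add: less_top)
        have \<gamma>f: "\<mu> * (f x)\<^sup>2 \<le> \<gamma>"
        proof -
          have "ennreal (\<mu> * (f x)\<^sup>2) \<le> ennreal \<gamma>" unfolding G\<gamma>[symmetric] G2_def by simp
          moreover have "0 \<le> \<gamma>" by (simp add: \<gamma>_def)
          ultimately show ?thesis by (simp add: ennreal_le_iff)
        qed
        then have \<gamma>: "\<gamma> > 0" using \<mu> fx by (smt (verit) mult_pos_pos zero_less_power2)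
        have g\<gamma>: "g2 x \<le> ennreal \<gamma>" unfolding G\<gamma>[symmetric] G2_def by simp
        \<comment> \<open>The scale at which the oscillation bound \<gamma> r^(2s) equals
          (N/r^n)^(2/q), the bound coming from the average of |f|^q; the common value is the square
          of \<open>B\<close>.\<close>
        define r where "r = (N powr (2 / q) / \<gamma>) powr (1 / n)"
        have r: "r > 0" using N \<gamma> by (simp add: r_def)
        have rn: "r powr n = N powr (2 / q) / \<gamma>" using n N \<gamma> by (simp add: r_def powr_powr)
        have rnp: "r ^ DIM('a) = r powr n" using r by (simp add: n_def powr_realpow)
        have key: "\<gamma> * r powr (2 * s) = (N / r powr n) powr (2 / q)"
        proof -
          have "\<gamma> = N powr (2 / q) / r powr n" using rn N \<gamma> r by (simp add: field_simps)
          moreover have "(r powr n) powr (2 / q) = r powr n / r powr (2 * s)"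
            using n by (simp add: powr_powr q(2) powr_diff)
          ultimately show ?thesis using r N by (simp add: powr_divide)
        qed
        define B where "B = (N / r powr n) powr (1 / q)"
        have B: "B > 0" "B\<^sup>2 = (N / r powr n) powr (2 / q)"
        proof -
          show "B > 0" using N r by (simp add: B_def)
          have "B\<^sup>2 = B powr 2" using \<open>B > 0\<close> by simp
          also have "\<dots> = (N / r powr n) powr (2 / q)" unfolding B_def powr_powr by simp
          finally show "B\<^sup>2 = (N / r powr n) powr (2 / q)" .
        qed
        \<comment> \<open>For r > r0 no subset of the required size is available. Then the
          zero-order part \<mu> f^2 <= \<gamma> suffices, since (r/r0)^(2s) >= 1 may be
          inserted.\<close>
        have "\<bar>f x\<bar> \<le> C0 * B"
        proof (cases "r \<le> r0")
          case False
          have "(f x)\<^sup>2 \<le> \<gamma> / \<mu>" using \<gamma>f \<mu> by (simp add: field_simps)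
          also have "\<dots> \<le> \<gamma> / \<mu> * (r powr (2 * s) / r0 powr (2 * s))"
          proof -
            have "r0 powr (2 * s) \<le> r powr (2 * s)" using False r0 weight_exponent_bounds by (intro powr_mono2) auto
            then have "1 \<le> r powr (2 * s) / r0 powr (2 * s)" using r0 by simp
            then have "\<gamma> / \<mu> * 1 \<le> \<gamma> / \<mu> * (r powr (2 * s) / r0 powr (2 * s))" using \<gamma> \<mu> by (intro mult_left_mono) auto
            then show ?thesis by simp
          qed
          also have "\<dots> = (1 / (\<mu> * r0 powr (2 * s))) * B\<^sup>2" unfolding B(2) key[symmetric] by simp
          also have "\<dots> = (sqrt (1 / (\<mu> * r0 powr (2 * s))) * B)\<^sup>2" using \<mu> by (simp add: power_mult_distrib)
          finally have "\<bar>f x\<bar> \<le> sqrt (1 / (\<mu> * r0 powr (2 * s))) * B"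
            using \<mu> B(1) by (intro power2_le_imp_le[of "\<bar>f x\<bar>"]) auto
          also have "\<dots> \<le> C0 * B" unfolding C0_def using v \<kappa> B(1) by (intro mult_right_mono) auto
          finally show ?thesis .
        next
          case True
          obtain A where A: "A \<in> sets borel" "emeasure lborel A = ennreal (v * r ^ DIM('a))" "A \<subseteq> \<Omega>"
            "\<And>y. y \<in> A \<Longrightarrow> norm (y - x) \<le> r" "\<And>y. y \<in> A \<Longrightarrow> w x \<le> \<kappa> * w y"
            using pl[OF x r] True unfolding r0_def by blast
          note [measurable] = A(1)
          define a where "a = v * r ^ DIM('a)"
          have a: "a > 0" "a = v * r powr n" using v r by (auto simp: a_def rnp)
          define F1 where "F1 = (\<lambda>y. w x * w y * (\<psi> y - \<psi> x)\<^sup>2)"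
          define P where "P = r powr (n + 2 * s)"
          have P: "P > 0" using r by (simp add: P_def)
          have F1nn: "0 \<le> F1 y" for y by (simp add: F1_def)
          have [measurable]: "F1 \<in> borel_measurable borel" unfolding F1_def by measurable
          have I1: "(\<integral>\<^sup>+y. ennreal (F1 y) * indicator A y \<partial>lborel) \<le> ennreal (P * \<gamma>)"
          proof -
            have "(\<integral>\<^sup>+y. ennreal (F1 y) * indicator A y \<partial>lborel) \<le> (\<integral>\<^sup>+y. ennreal P * ennreal (F1 y * riesz s (y - x)) \<partial>lborel)"
            proof (rule nn_integral_mono)
              fix y
              show "ennreal (F1 y) * indicator A y \<le> ennreal P * ennreal (F1 y * riesz s (y - x))"
              proof (cases "y \<in> A \<and> y \<noteq> x")
                case True
                then have "norm (y - x) powr (n + 2 * s) \<le> P"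
                  unfolding P_def using A(4)[of y] n weight_exponent_bounds by (intro powr_mono2) auto
                then have "1 \<le> P * riesz s (y - x)" using True by (simp add: riesz_def n_def[symmetric])
                then have "F1 y * 1 \<le> F1 y * (P * riesz s (y - x))" using F1nn by (intro mult_left_mono) auto
                then have "F1 y \<le> P * (F1 y * riesz s (y - x))" by (simp add: mult_ac)
                from ennreal_leI[OF this] show ?thesis using True P by (simp add: ennreal_mult')
              next
                case False
                then show ?thesis by (auto simp: F1_def)
              qed
            qed
            also have "\<dots> = ennreal P * (\<integral>\<^sup>+y. ennreal (F1 y * riesz s (y - x)) \<partial>lborel)" by (rule nn_integral_cmult) measurable
            also have "(\<integral>\<^sup>+y. ennreal (F1 y * riesz s (y - x)) \<partial>lborel) = g2 x"
              using nn_integral_lborel_shift[of "\<lambda>y. ennreal (F1 y * riesz s (y - x))" x]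
              by (simp add: g2_def F1_def)
            also have "ennreal P * g2 x \<le> ennreal P * ennreal \<gamma>" by (intro mult_left_mono g\<gamma>) simp
            also have "\<dots> = ennreal (P * \<gamma>)" using P by (simp add: ennreal_mult')
            finally show ?thesis .
          qed
          have I2: "(\<integral>\<^sup>+y. ennreal (Fq y) * indicator A y \<partial>lborel) \<le> ennreal N"
            unfolding NF[symmetric] by (intro nn_integral_mono) (auto simp: indicator_def)
          define S where "S = (\<lambda>y. F1 y / (P * \<gamma>) + Fq y / N)"
          have "(\<integral>\<^sup>+y. ennreal (S y) * indicator A y \<partial>lborel)
            = (\<integral>\<^sup>+y. ennreal (1 / (P * \<gamma>)) * (ennreal (F1 y) * indicator A y) + ennreal (1 / N) * (ennreal (Fq y) * indicator A y) \<partial>lborel)"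
          proof (rule nn_integral_cong)
            fix y
            have "ennreal (S y) = ennreal (1 / (P * \<gamma>)) * ennreal (F1 y) + ennreal (1 / N) * ennreal (Fq y)"
              unfolding S_def using P \<gamma> N F1nn[of y] by (simp add: Fq_def flip: ennreal_mult ennreal_plus)
            then show "ennreal (S y) * indicator A y = ennreal (1 / (P * \<gamma>)) * (ennreal (F1 y) * indicator A y) + ennreal (1 / N) * (ennreal (Fq y) * indicator A y)"
              by (simp add: distrib_right mult.assoc)
          qed
          also have "\<dots> = ennreal (1 / (P * \<gamma>)) * (\<integral>\<^sup>+y. ennreal (F1 y) * indicator A y \<partial>lborel) + ennreal (1 / N) * (\<integral>\<^sup>+y. ennreal (Fq y) * indicator A y \<partial>lborel)"
            by (subst nn_integral_add) (auto simp: nn_integral_cmult)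
          also have "\<dots> \<le> ennreal (1 / (P * \<gamma>)) * ennreal (P * \<gamma>) + ennreal (1 / N) * ennreal N"
            by (intro add_mono mult_left_mono I1 I2) auto
          also have "\<dots> = 2" using P \<gamma> N by (simp flip: ennreal_mult)
          finally have "\<exists>y\<in>A. S y \<le> 3 / a"
            by (intro exists_le_of_nn_integral_le) (use A a in \<open>auto simp: S_def a_def\<close>)
          then obtain y where y: "y \<in> A" "S y \<le> 3 / a" by blast
          have nn1: "0 \<le> F1 y / (P * \<gamma>)" "0 \<le> Fq y / N" using F1nn P \<gamma> N by (auto simp: Fq_def)
          have "F1 y / (P * \<gamma>) \<le> 3 / a" using y(2) nn1 unfolding S_def by linarith
          then have "F1 y \<le> 3 / a * (P * \<gamma>)" using P \<gamma> by (simp add: pos_divide_le_eq)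
          also have "\<dots> = 3 / v * B\<^sup>2"
            unfolding B(2) key[symmetric] a(2) P_def powr_add using r v by (simp add: field_simps)
          finally have F1y: "F1 y \<le> 3 / v * B\<^sup>2" .
          have "Fq y / N \<le> 3 / a" using y(2) nn1 unfolding S_def by linarith
          then have Fqy: "\<bar>f y\<bar> powr q \<le> 3 / v * (N / r powr n)" using N a v r by (simp add: Fq_def field_simps)
          have fy: "\<bar>f y\<bar> \<le> (3 / v) powr (1 / q) * B"
          proof -
            have "\<bar>f y\<bar> = (\<bar>f y\<bar> powr q) powr (1 / q)" using q by (simp add: powr_powr)
            also have "\<dots> \<le> (3 / v * (N / r powr n)) powr (1 / q)" using Fqy q by (intro powr_mono2) auto
            also have "\<dots> = (3 / v) powr (1 / q) * B" unfolding B_def using v N r by (intro powr_mult)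
            finally show ?thesis .
          qed
          have wxy: "w x \<le> \<kappa> * w y" using A(5) y(1) by simp
          \<comment> \<open>One factor \<open>w x\<close> is traded for
            \<open>\<kappa> * w y\<close>, which produces the product weight of the ground-state
            energy.\<close>
          have "(w x * \<bar>\<psi> x - \<psi> y\<bar>)\<^sup>2 = w x * (w x * (\<psi> y - \<psi> x)\<^sup>2)" by (simp add: power2_eq_square algebra_simps)
          also have "\<dots> \<le> (\<kappa> * w y) * (w x * (\<psi> y - \<psi> x)\<^sup>2)" using wxy by (intro mult_right_mono) auto
          also have "\<dots> = \<kappa> * F1 y" by (simp add: F1_def)
          also have "\<dots> \<le> \<kappa> * (3 / v * B\<^sup>2)" using F1y \<kappa> by (intro mult_left_mono) auto
          also have "\<dots> = (sqrt (3 * \<kappa> / v) * B)\<^sup>2" using \<kappa> v by (simp add: power_mult_distrib)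
          finally have t1: "w x * \<bar>\<psi> x - \<psi> y\<bar> \<le> sqrt (3 * \<kappa> / v) * B"
            using \<kappa> v B(1) by (intro power2_le_imp_le[of "w x * \<bar>\<psi> x - \<psi> y\<bar>"]) auto
          have "w x * \<bar>\<psi> y\<bar> \<le> \<kappa> * w y * \<bar>\<psi> y\<bar>" using wxy by (intro mult_right_mono) auto
          also have "\<dots> = \<kappa> * \<bar>f y\<bar>" unfolding fw[of y] by (simp add: abs_mult)
          also have "\<dots> \<le> \<kappa> * ((3 / v) powr (1 / q) * B)" using fy \<kappa> by (intro mult_left_mono) auto
          finally have t2: "w x * \<bar>\<psi> y\<bar> \<le> \<kappa> * (3 / v) powr (1 / q) * B" by simp
          have "\<bar>f x\<bar> = w x * \<bar>\<psi> x\<bar>" unfolding fw[of x] by (simp add: abs_mult)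
          also have "\<dots> \<le> w x * (\<bar>\<psi> x - \<psi> y\<bar> + \<bar>\<psi> y\<bar>)" by (intro mult_left_mono) auto
          also have "\<dots> \<le> (sqrt (3 * \<kappa> / v) + \<kappa> * (3 / v) powr (1 / q)) * B"
            using t1 t2 by (simp add: distrib_left distrib_right)
          also have "\<dots> \<le> C0 * B" unfolding C0_def using \<mu> B(1) by (intro mult_right_mono) auto
          finally show ?thesis .
        qed
        then have "Fq x \<le> (C0 * B) powr q" unfolding Fq_def using q by (intro powr_mono2) auto
        also have "\<dots> = C0 powr q * (N / r powr n)"
          unfolding B_def using C0 N r q by (subst powr_mult) (simp add: powr_powr)
        also have "N / r powr n = N powr (1 - 2 / q) * \<gamma>"
          unfolding rn using N \<gamma> by (simp add: powr_diff)
        finally have "Fq x \<le> C0 powr q * N powr (1 - 2 / q) * \<gamma>" by (simp add: mult.assoc)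
        then show ?thesis unfolding G\<gamma> using \<gamma> C0 by (simp add: ennreal_leI flip: ennreal_mult)
      qed
      have "ennreal N \<le> (\<integral>\<^sup>+x. ennreal (C0 powr q * N powr (1 - 2 / q)) * G2 x \<partial>lborel)"
        unfolding NF[symmetric] by (intro nn_integral_mono point)
      also have "\<dots> = ennreal (C0 powr q * N powr (1 - 2 / q)) * (\<integral>\<^sup>+x. G2 x \<partial>lborel)" by (rule nn_integral_cmult) measurable
      \<comment> \<open>Division by N^(1 - 2/q), legitimate because N is finite and
        positive.\<close>
      finally have "ennreal (N powr (2 / q - 1)) * ennreal N \<le> ennreal (N powr (2 / q - 1)) * (ennreal (C0 powr q * N powr (1 - 2 / q)) * (\<integral>\<^sup>+x. G2 x \<partial>lborel))"
        by (intro mult_left_mono) auto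
      moreover have "ennreal (N powr (2 / q - 1)) * ennreal N = ennreal (N powr (2 / q))"
        using N by (simp add: powr_diff flip: ennreal_mult)
      moreover have "ennreal (N powr (2 / q - 1)) * ennreal (C0 powr q * N powr (1 - 2 / q)) = ennreal (C0 powr q)"
      proof -
        have "N powr (2 / q - 1) * N powr (1 - 2 / q) = 1" unfolding powr_add[symmetric] using N by simp
        then show ?thesis by (simp add: mult.left_commute flip: ennreal_mult)
      qed
      ultimately show ?thesis by (simp add: mult.assoc[symmetric])
    qed (simp add: N0)
    also have "(\<integral>\<^sup>+x. G2 x \<partial>lborel) = (\<integral>\<^sup>+x. g2 x \<partial>lborel) + (\<integral>\<^sup>+x. ennreal (\<mu> * (f x)\<^sup>2) \<partial>lborel)"
      unfolding G2_def by (rule nn_integral_add) measurable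
    finally show "ennreal (sobolev_term s \<Omega> f) \<le> ennreal (C0 powr q) *
     ((\<integral>\<^sup>+x. \<integral>\<^sup>+h. ennreal (w x * w (x + h) * (f (x + h) / w (x + h) - f x / w x)\<^sup>2 * riesz s h) \<partial>lborel \<partial>lborel)
       + (\<integral>\<^sup>+x. ennreal (\<mu> * (f x)\<^sup>2) \<partial>lborel))"
      unfolding sob g2_def \<psi>_def .
  qed
qed

text \<open>The assumption s > 1/2 makes \<beta> positive, so that (2R)^\<beta> - R^\<beta>, and
  with it the gain, is strictly positive. The gain supplies the zero-order term and the ground-state
  remainder the weighted energy that \<open>weighted_Sobolev\<close> asks for.\<close>

lemma hardy_Sobolev:
  assumes s': "1/2 < s" and R: "0 < R" "\<And>y. y \<in> \<Omega> \<Longrightarrow> bdist \<Omega> y \<le> R" and n2s: "2 * s < real DIM('a)"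
    and UL: "uniformly_Lipschitz \<Omega>"
  shows "\<exists>c>0. \<forall>f\<in>test_functions \<Omega>. k_const DIM('a) s * hardy_integral s \<Omega> f + c * sobolev_term s \<Omega> f \<le> gagliardo s f"
proof -
  have b': "\<beta> > 0" using s' by (simp add: \<beta>_def)
  define c1 where "c1 = ((2 * R) powr \<beta> - R powr \<beta>) * (marg_const DIM('a) s * tail_const s (2 * R))"
  have "R powr \<beta> < (2 * R) powr \<beta>" using R(1) b' by (intro powr_less_mono2) auto
  then have c1: "c1 > 0" unfolding c1_def using marg_const_pos[OF weight_exponent_bounds(4)] tail_const_pos[OF weight_exponent_bounds(4) s(2)] R(1) by simp
  have gc: "gain_const c1" unfolding gain_const_def using R by (auto simp: c1_def)
  \<comment> \<open>Since w <= R^\<beta> on the domain, \<mu> f^2 <= 2 c1 f^2/w, which is the gain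
    term.\<close>
  define \<mu> where "\<mu> = 2 * c1 / R powr \<beta>"
  have \<mu>: "\<mu> > 0" using c1 R(1) by (simp add: \<mu>_def)
  obtain \<rho> D where \<rho>: "0 < \<rho>" and D: "0 < D" and inner: "\<And>x. x \<in> \<Omega> \<Longrightarrow> \<exists>z. dist x z \<le> D \<and> ball z \<rho> \<subseteq> \<Omega>"
    using uniformly_Lipschitz_inner_ball[OF \<Omega>(1,3) UL] by blast
  obtain C where C: "C > 0" and ws: "\<And>f. f \<in> test_functions \<Omega> \<Longrightarrow> ennreal (sobolev_term s \<Omega> f) \<le> ennreal C *
     ((\<integral>\<^sup>+x. \<integral>\<^sup>+h. ennreal (w x * w (x + h) * (f (x + h) / w (x + h) - f x / w x)\<^sup>2 * riesz s h) \<partial>lborel \<partial>lborel)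
       + (\<integral>\<^sup>+x. ennreal (\<mu> * (f x)\<^sup>2) \<partial>lborel))"
    using weighted_Sobolev[OF R \<rho> D inner \<mu> n2s] by blast
  show ?thesis
  proof (intro exI[of _ "1 / C"] conjI ballI)
    show "1 / C > 0" using C by simp
    fix f assume f: "f \<in> test_functions \<Omega>"
    note t = test_functionD[OF f]
    have [measurable]: "f \<in> borel_measurable borel" by (rule t)
    define q where "q = (\<lambda>x. f x * (f x / w x))"
    have [measurable]: "q \<in> borel_measurable borel" unfolding q_def by measurable
    define A where "A = k_const DIM('a) s * hardy_integral s \<Omega> f + 2 * c1 * (LINT x|lborel. q x)"
    note gs = ground_state[OF f gc, folded q_def, folded A_def]
    obtain K \<delta> M D' where KD: "compact K \<and> (\<forall>x. f x \<noteq> 0 \<longrightarrow> x \<in> K) \<and> K \<subseteq> \<Omega> \<and> 0 < \<delta> \<and> 0 < M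
      \<and> (\<forall>x\<in>K. \<delta> \<le> bdist \<Omega> x \<and> bdist \<Omega> x \<le> D') \<and> (\<forall>x. \<bar>f x\<bar> \<le> M)"
      using test_function_bounds[OF f] by blast
    then have K: "compact K" "\<And>x. f x \<noteq> 0 \<Longrightarrow> x \<in> K" "K \<subseteq> \<Omega>" and fM: "\<And>x. \<bar>f x\<bar> \<le> M"
      and \<delta>: "\<delta> > 0" "\<And>x. x \<in> K \<Longrightarrow> \<delta> \<le> bdist \<Omega> x" and M: "M > 0" by simp_all
    have [measurable]: "K \<in> sets borel" using K(1) by (simp add: compact_imp_closed)
    have intK: "integrable lborel (indicator K :: 'a \<Rightarrow> real)"
      using emeasure_compact_finite[OF K(1)] by simp
    have f2: "(f x)\<^sup>2 \<le> M\<^sup>2" for x using fM[of x] M by (intro abs_le_square_iff[THEN iffD1]) auto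
    have qq: "\<mu> * (f x)\<^sup>2 \<le> 2 * c1 * q x \<and> 0 \<le> q x \<and> q x \<le> M\<^sup>2 / \<delta> powr \<beta> * indicator K x" for x
    proof (cases "f x = 0")
      case True
      then show ?thesis using M \<delta> by (simp add: q_def)
    next
      case False
      then have x: "x \<in> K" "x \<in> \<Omega>" using K by auto
      have w: "0 < w x" "w x \<le> R powr \<beta>" "\<delta> powr \<beta> \<le> w x"
        using w_pos[OF x(2)] R x \<delta> weight_exponent_bounds by (auto simp: w_def intro!: powr_mono2)
      have q: "q x = (f x)\<^sup>2 / w x" by (simp add: q_def power2_eq_square)
      have "(f x)\<^sup>2 / R powr \<beta> \<le> q x" unfolding q using w R(1) by (intro divide_left_mono mult_pos_pos) auto
      then have "2 * c1 * ((f x)\<^sup>2 / R powr \<beta>) \<le> 2 * c1 * q x" using c1 by (intro mult_left_mono) auto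
      moreover have "q x \<le> M\<^sup>2 / \<delta> powr \<beta>" unfolding q using f2 w \<delta> by (intro frac_le) auto
      ultimately show ?thesis using w x by (simp add: \<mu>_def q)
    qed
    have intq: "integrable lborel q"
    proof (rule Bochner_Integration.integrable_bound[OF integrable_mult_right[OF intK, of "M\<^sup>2 / \<delta> powr \<beta>"]])
      have "norm (q x) \<le> norm (M\<^sup>2 / \<delta> powr \<beta> * indicator K x)" for x
        using qq[of x] unfolding real_norm_def by linarith
      then show "AE x in lborel. norm (q x) \<le> norm (M\<^sup>2 / \<delta> powr \<beta> * indicator K x)" by simp
    qed simp
    have L: "(\<integral>\<^sup>+x. ennreal (\<mu> * (f x)\<^sup>2) \<partial>lborel) \<le> ennreal (2 * c1 * (LINT x|lborel. q x))"
    proof -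
      have "(\<integral>\<^sup>+x. ennreal (\<mu> * (f x)\<^sup>2) \<partial>lborel) \<le> (\<integral>\<^sup>+x. ennreal (2 * c1 * q x) \<partial>lborel)"
        using qq by (intro nn_integral_mono ennreal_leI) auto
      also have "\<dots> = ennreal (LINT x|lborel. 2 * c1 * q x)"
        using qq c1 by (intro nn_integral_eq_integral integrable_mult_right intq) auto
      finally show ?thesis by simp
    qed
    have Iq: "0 \<le> (LINT x|lborel. q x)" using qq by (intro Bochner_Integration.integral_nonneg) auto
    have "ennreal (sobolev_term s \<Omega> f) \<le> ennreal C * (ennreal (gagliardo s f - A) + ennreal (2 * c1 * (LINT x|lborel. q x)))"
      by (rule order_trans[OF ws[OF f]]) (intro mult_left_mono add_mono gs(2) L; simp)
    also have "\<dots> = ennreal (C * (gagliardo s f - A + 2 * c1 * (LINT x|lborel. q x)))"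
      using C gs(1) c1 Iq by (simp flip: ennreal_mult ennreal_plus)
    finally have "sobolev_term s \<Omega> f \<le> C * (gagliardo s f - A + 2 * c1 * (LINT x|lborel. q x))"
      using C gs(1) c1 Iq by (subst (asm) ennreal_le_iff) auto
    \<comment> \<open>\<open>A\<close> contains the gain with a positive sign and is subtracted, so
      the gain cancels against the term added here. What remains is the plain Hardy deficit.\<close>
    then have "sobolev_term s \<Omega> f / C \<le> gagliardo s f - k_const DIM('a) s * hardy_integral s \<Omega> f"
      using C by (simp add: A_def field_simps)
    then show "k_const DIM('a) s * hardy_integral s \<Omega> f + 1 / C * sobolev_term s \<Omega> f \<le> gagliardo s f" by simp
  qed
qed

end

section \<open>Smooth cut-offs\<close>

lemma C_diff_SucI:
  assumes "\<And>x. (f has_derivative F x) (at x)" "\<And>b. b \<in> Basis \<Longrightarrow> C_diff k (\<lambda>x. F x b)"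
  shows "C_diff (Suc k) f"
proof -
  have "frechet_derivative f (at x) = F x" for x using frechet_derivative_at[OF assms(1)] by simp
  then show ?thesis using assms by (auto simp: differentiable_def)
qed

lemma C_diff_SucD: "C_diff (Suc k) f \<Longrightarrow> (f has_derivative frechet_derivative f (at x)) (at x)"
  using frechet_derivative_works by auto

lemma C_diff_mono: "C_diff (Suc k) f \<Longrightarrow> C_diff k f"
proof (induction k arbitrary: f)
  case 0
  then show ?case by (auto intro!: continuous_at_imp_continuous_on differentiable_imp_continuous_within)
next
  case (Suc k)
  from Suc.prems have d: "\<And>x. f differentiable (at x)" "\<And>b. b \<in> Basis \<Longrightarrow> C_diff (Suc k) (\<lambda>x. frechet_derivative f (at x) b)" by auto
  then show ?case using Suc.IH[OF d(2)] by simp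
qed

lemma C_diff_const: "C_diff k (\<lambda>_. c)"
proof (induction k arbitrary: c)
  case (Suc k)
  show ?case by (rule C_diff_SucI[where F="\<lambda>_ _. 0"]) (auto intro: Suc)
qed simp

lemma C_diff_add:
  assumes "C_diff k f" "C_diff k g" shows "C_diff k (\<lambda>x. f x + g x)"
  using assms
proof (induction k arbitrary: f g)
  case 0
  then show ?case by (auto intro!: continuous_intros)
next
  case (Suc k)
  show ?case
    by (rule C_diff_SucI[OF has_derivative_add[OF C_diff_SucD[OF Suc.prems(1)] C_diff_SucD[OF Suc.prems(2)]]])
      (use Suc in auto)
qed

lemma C_diff_mult:
  assumes "C_diff k f" "C_diff k g" shows "C_diff k (\<lambda>x. f x * g x)"
  using assms
proof (induction k arbitrary: f g)
  case 0
  then show ?case by (auto intro!: continuous_intros)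
next
  case (Suc k)
  show ?case
  proof (rule C_diff_SucI[OF has_derivative_mult[OF C_diff_SucD[OF Suc.prems(1)] C_diff_SucD[OF Suc.prems(2)]]])
    fix b :: 'a assume b: "b \<in> Basis"
    show "C_diff k (\<lambda>x. f x * frechet_derivative g (at x) b + frechet_derivative f (at x) b * g x)"
      using Suc.prems b by (intro C_diff_add Suc.IH) (auto intro: C_diff_mono)
  qed
qed

lemma C_diff_sum:
  "(\<And>i. i \<in> I \<Longrightarrow> C_diff k (f i)) \<Longrightarrow> C_diff k (\<lambda>x. \<Sum>i\<in>I. f i x)"
  by (induction I rule: infinite_finite_induct) (auto intro: C_diff_const C_diff_add)

lemma C_diff_prod:
  "(\<And>i. i \<in> I \<Longrightarrow> C_diff k (f i)) \<Longrightarrow> C_diff k (\<lambda>x. \<Prod>i\<in>I. f i x)"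
  by (induction I rule: infinite_finite_induct) (auto intro: C_diff_const C_diff_mult)

text \<open>For an affine inner map the derivative is a combination, with constant coefficients, of
  partial derivatives taken at the image point, so the induction hypothesis applies to each of them.
  This covers translations, dilations, reflections and coordinate functionals.\<close>

lemma C_diff_affine_compose:
  fixes f :: "'b::euclidean_space \<Rightarrow> real" and A :: "'a::euclidean_space \<Rightarrow> 'b"
  assumes A: "linear A" and f: "C_diff k f"
  shows "C_diff k (\<lambda>x. f (A x + c))"
  using f
proof (induction k arbitrary: f)
  case 0
  have "continuous_on UNIV (\<lambda>x. A x + c)"
    using A by (intro continuous_intros linear_continuous_on) (simp add: linear_linear)
  then show ?case using 0 continuous_on_compose2[of UNIV f UNIV "\<lambda>x. A x + c"] by simp
next
  case (Suc k)
  have dA: "((\<lambda>x. A x + c) has_derivative A) (at x)" for x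
    using has_derivative_add[OF linear_imp_has_derivative[OF A] has_derivative_const] by simp
  show ?case
  proof (rule C_diff_SucI)
    show "((\<lambda>x. f (A x + c)) has_derivative (\<lambda>h. frechet_derivative f (at (A x + c)) (A h))) (at x)" for x
      using has_derivative_compose[OF dA C_diff_SucD[OF Suc.prems]] by simp
    fix b :: 'a assume "b \<in> Basis"
    have "frechet_derivative f (at y) (A b) = (\<Sum>d\<in>Basis. (A b \<bullet> d) * frechet_derivative f (at y) d)" for y
    proof -
      have lin: "linear (frechet_derivative f (at y))" using Suc.prems linear_frechet_derivative by auto
      show ?thesis
        by (subst (1) euclidean_representation[of "A b", symmetric]) (simp add: linear_sum[OF lin] linear_scale[OF lin])
    qed
    then have "(\<lambda>x. frechet_derivative f (at (A x + c)) (A b)) = (\<lambda>x. \<Sum>d\<in>Basis. (A b \<bullet> d) * frechet_derivative f (at (A x + c)) d)"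
      by simp
    moreover have "C_diff k \<dots>"
      by (intro C_diff_sum C_diff_mult C_diff_const Suc.IH[of "\<lambda>y. frechet_derivative f (at y) _"]) (use Suc.prems in auto)
    ultimately show "C_diff k (\<lambda>x. frechet_derivative f (at (A x + c)) (A b))" by simp
  qed
qed

lemma C_diff_Suc_real:
  fixes g :: "real \<Rightarrow> real"
  assumes "\<And>x. (g has_real_derivative g' x) (at x)" "C_diff k g'"
  shows "C_diff (Suc k) g"
  by (rule C_diff_SucI[where F="\<lambda>x. (*) (g' x)"]) (use assms in \<open>auto simp: has_field_derivative_def\<close>)

lemma C_diff_SucD_real:
  fixes g :: "real \<Rightarrow> real"
  assumes "C_diff (Suc k) g"
  shows "(g has_real_derivative frechet_derivative g (at x) 1) (at x)" "C_diff k (\<lambda>x. frechet_derivative g (at x) 1)"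
proof -
  have lin: "linear (frechet_derivative g (at x))" using assms linear_frechet_derivative by auto
  have "frechet_derivative g (at x) = (*) (frechet_derivative g (at x) 1)"
  proof
    fix h :: real
    show "frechet_derivative g (at x) h = frechet_derivative g (at x) 1 * h"
      using linear_scale[OF lin, of h 1] by (simp add: mult.commute)
  qed
  then show "(g has_real_derivative frechet_derivative g (at x) 1) (at x)"
    using C_diff_SucD[OF assms, of x] by (simp add: has_field_derivative_def)
  show "C_diff k (\<lambda>x. frechet_derivative g (at x) 1)" using assms by simp
qed

text \<open>The functions \<open>exp (- 1 / t) / t ^ j\<close> are closed under differentiation up to linear combinations,
  so their smoothness follows by one induction over all \<open>j\<close>.\<close>

definition flat_exp :: "nat \<Rightarrow> real \<Rightarrow> real" where
  "flat_exp j t = (if t > 0 then exp (- 1 / t) / t ^ j else 0)"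

text \<open>The single term of order j + 2 in the series of exp(1/t) gives exp(-1/t) <= (j + 2)!
  t^(j + 2). After division by t^j two powers of t remain, so the difference quotient at 0 tends to
  0.\<close>

lemma flat_exp_le: "\<bar>flat_exp j t\<bar> \<le> fact (j + 2) * t\<^sup>2"
proof (cases "t > 0")
  case True
  have "(1 / t) ^ (j + 2) / fact (j + 2) \<le> exp (1 / t)"
  proof -
    have s: "summable (\<lambda>n. (1 / t) ^ n /\<^sub>R fact n)" by (rule summable_exp_generic)
    have "(\<Sum>n\<in>{j+2}. (1 / t) ^ n /\<^sub>R fact n) \<le> (\<Sum>n. (1 / t) ^ n /\<^sub>R fact n)"
      by (rule sum_le_suminf[OF s]) (use True in auto)
    then show ?thesis by (simp add: exp_def divide_inverse mult.commute)
  qed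
  then have "1 / (t ^ (j + 2) * fact (j + 2)) \<le> exp (1 / t)" by (simp only: power_one_over power_divide divide_divide_eq_left power_one)
  moreover have "0 < t ^ (j + 2) * fact (j + 2)" using True by (intro mult_pos_pos) auto
  ultimately have "1 \<le> exp (1 / t) * (t ^ (j + 2) * fact (j + 2))" by (simp only: pos_divide_le_eq)
  then have "exp (- (1 / t)) * 1 \<le> exp (- (1 / t)) * (exp (1 / t) * (t ^ (j + 2) * fact (j + 2)))"
    by (intro mult_left_mono) auto
  also have "\<dots> = fact (j + 2) * t ^ (j + 2)"
    by (simp only: mult.assoc[symmetric] exp_add[symmetric]) simp
  finally have "exp (- 1 / t) \<le> fact (j + 2) * t ^ (j + 2)" by simp
  then have "flat_exp j t \<le> fact (j + 2) * t ^ (j + 2) / t ^ j" using True divide_right_mono[of "exp (- 1 / t)" "fact (j + 2) * t ^ (j + 2)" "t ^ j"]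
    by (simp only: flat_exp_def if_True) (simp del: fact_Suc)
  also have "\<dots> = fact (j + 2) * t\<^sup>2" using True by (simp add: power_add power2_eq_square)
  finally show ?thesis using True by (simp add: flat_exp_def)
qed (simp add: flat_exp_def)

lemma DERIV_flat_exp: "(flat_exp j has_real_derivative (flat_exp (j + 2) t - real j * flat_exp (j + 1) t)) (at t)"
proof -
  consider "t > 0" | "t < 0" | "t = 0" by linarith
  then show ?thesis
  proof cases
    case 1
    have "((\<lambda>t. exp (- 1 / t) / t ^ j) has_real_derivative (flat_exp (j + 2) t - real j * flat_exp (j + 1) t)) (at t)"
    proof -
      have d1: "((\<lambda>t. exp (- 1 / t)) has_real_derivative exp (- 1 / t) / t\<^sup>2) (at t)"
        using 1 by (auto intro!: derivative_eq_intros simp: power2_eq_square)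
      define E where "E = exp (- 1 / t)"
      show ?thesis
      proof (cases j)
        case 0
        then show ?thesis using 1 d1 by (simp add: flat_exp_def power2_eq_square)
      next
        case (Suc i)
        define p where "p = t ^ i"
        have p: "p > 0" using 1 by (simp add: p_def)
        show ?thesis
        proof (rule DERIV_cong[OF DERIV_divide[OF d1 DERIV_pow]])
          show "t ^ j \<noteq> 0" using 1 by simp
          have "t ^ j = t * p" "t ^ (j - Suc 0) = p" "t ^ (j + 1) = t * (t * p)" "t ^ (j + 2) = t * (t * (t * p))"
            by (simp_all add: Suc p_def)
          then show "(exp (- 1 / t) / t\<^sup>2 * t ^ j - exp (- 1 / t) * (real j * t ^ (j - Suc 0))) / (t ^ j * t ^ j)
              = flat_exp (j + 2) t - real j * flat_exp (j + 1) t"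
            unfolding flat_exp_def E_def[symmetric] using 1 p by (simp add: field_simps power2_eq_square)
        qed
      qed
    qed
    then show ?thesis
      by (rule has_field_derivative_transform_within_open[where S="{0<..}"]) (use 1 in \<open>auto simp: flat_exp_def\<close>)
  next
    case 2
    have "((\<lambda>_. 0) has_real_derivative 0) (at t)" by simp
    then have "(flat_exp j has_real_derivative 0) (at t)"
      by (rule has_field_derivative_transform_within_open[where S="{..<0}"]) (use 2 in \<open>auto simp: flat_exp_def\<close>)
    then show ?thesis using 2 by (simp add: flat_exp_def)
  next
    case 3
    have "((\<lambda>h. (flat_exp j (0 + h) - flat_exp j 0) / h) \<longlongrightarrow> 0) (at 0)"
    proof (rule Lim_null_comparison)
      show "((\<lambda>h. fact (j + 2) * \<bar>h\<bar>) \<longlongrightarrow> 0) (at (0::real))" by (auto intro!: tendsto_eq_intros)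
      show "\<forall>\<^sub>F h in at 0. norm ((flat_exp j (0 + h) - flat_exp j 0) / h) \<le> fact (j + 2) * \<bar>h\<bar>"
      proof (rule eventually_at_filter[THEN iffD2], rule always_eventually, intro allI impI)
        fix h :: real assume "h \<noteq> 0"
        then have "\<bar>flat_exp j h\<bar> / \<bar>h\<bar> \<le> fact (j + 2) * h\<^sup>2 / \<bar>h\<bar>"
          using flat_exp_le[of j h] by (intro divide_right_mono) auto
        also have "\<dots> = fact (j + 2) * \<bar>h\<bar>" using \<open>h \<noteq> 0\<close> by (simp add: power2_eq_square abs_if)
        finally show "norm ((flat_exp j (0 + h) - flat_exp j 0) / h) \<le> fact (j + 2) * \<bar>h\<bar>" by (simp add: flat_exp_def)
      qed
    qed
    then show ?thesis using 3 unfolding DERIV_def by (simp add: flat_exp_def)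
  qed
qed

lemma C_diff_flat_exp: "C_diff k (flat_exp j)"
proof (induction k arbitrary: j)
  case 0
  show ?case using DERIV_isCont[OF DERIV_flat_exp] by (simp add: continuous_at_imp_continuous_on)
next
  case (Suc k)
  show ?case
  proof (rule C_diff_Suc_real[OF DERIV_flat_exp])
    have "C_diff k (\<lambda>t. flat_exp (j + 2) t + (- real j) * flat_exp (j + 1) t)"
      by (intro C_diff_add C_diff_mult C_diff_const Suc)
    then show "C_diff k (\<lambda>t. flat_exp (j + 2) t - real j * flat_exp (j + 1) t)" by simp
  qed
qed

text \<open>On (-1,1) this is exp(-2/(1 - t^2)), the classical bump function.\<close>

definition bump :: "real \<Rightarrow> real" where
  "bump t = flat_exp 0 (1 + t) * flat_exp 0 (1 - t)"

lemma C_diff_bump: "C_diff k bump"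
proof -
  have "C_diff k (\<lambda>t. flat_exp 0 (t + 1))" "C_diff k (\<lambda>t. flat_exp 0 (- t + 1))"
    by (rule C_diff_affine_compose[of "\<lambda>t. t" k "flat_exp 0" 1]; simp add: C_diff_flat_exp linear_ident)
       (rule C_diff_affine_compose[of "\<lambda>t. - t" k "flat_exp 0" 1]; simp add: C_diff_flat_exp linear_uminus)
  from C_diff_mult[OF this] show ?thesis by (simp add: bump_def[abs_def] add.commute)
qed

lemma bump_bounds: "0 \<le> bump t" "bump t \<le> 1" "bump t \<noteq> 0 \<Longrightarrow> \<bar>t\<bar> < 1" "\<bar>t\<bar> \<le> 1/2 \<Longrightarrow> exp (-4) \<le> bump t"
proof -
  have f: "0 \<le> flat_exp 0 x" "flat_exp 0 x \<le> 1" for x by (auto simp: flat_exp_def)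
  show "0 \<le> bump t" "bump t \<le> 1" using f[of "1 + t"] f[of "1 - t"] by (auto simp: bump_def intro: mult_le_one)
  show "bump t \<noteq> 0 \<Longrightarrow> \<bar>t\<bar> < 1" by (auto simp: bump_def flat_exp_def split: if_splits)
  assume t: "\<bar>t\<bar> \<le> 1/2"
  have g: "exp (-2) \<le> flat_exp 0 x" if "x \<ge> 1/2" for x
    using that by (simp add: flat_exp_def field_simps)
  have "exp (-4) = exp (-2) * exp (-2::real)" by (simp add: exp_add[symmetric])
  also have "\<dots> \<le> bump t" unfolding bump_def using g[of "1 + t"] g[of "1 - t"] t f(1)[of "1 + t"] by (intro mult_mono) auto
  finally show "exp (-4) \<le> bump t" .
qed

lemma bump_Lipschitz: "\<exists>L>0. \<forall>x y. \<bar>bump x - bump y\<bar> \<le> L * \<bar>x - y\<bar>"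
proof -
  have "{x. bump x \<noteq> 0} \<subseteq> {-1..1}" using bump_bounds(3) by fastforce
  then have "bounded {x. bump x \<noteq> 0}" by (rule bounded_subset[OF bounded_closed_interval])
  then have "compact (closure {x. bump x \<noteq> 0})" by (simp add: compact_closure)
  from C1_compact_support_Lipschitz[OF C_diff_bump this] show ?thesis by (metis real_norm_def)
qed

text \<open>With \<open>a = \<beta>\<close> and a dilated bump for \<theta> this is the ground state
  cut off on a logarithmic scale. General a and \<theta> are allowed because differentiation only
  replaces them by a - 1 and a \<theta> + \<theta>'.\<close>

definition log_profile :: "real \<Rightarrow> (real \<Rightarrow> real) \<Rightarrow> real \<Rightarrow> real" where
  "log_profile a \<theta> t = (if t > 0 then t powr a * \<theta> (ln t) else 0)"

lemma log_profile_zero: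
  assumes "\<And>x. x < - M \<Longrightarrow> \<theta> x = 0" "t < exp (- M)"
  shows "log_profile a \<theta> t = 0"
proof (cases "t > 0")
  case True
  have "ln t < ln (exp (- M))" using True assms(2) by (subst ln_less_cancel_iff) auto
  then show ?thesis using assms(1) by (simp add: log_profile_def)
qed (simp add: log_profile_def)

lemma DERIV_log_profile:
  assumes "\<And>x. (\<theta> has_real_derivative \<theta>' x) (at x)" and "\<And>x. x < - M \<Longrightarrow> \<theta> x = 0"
    and "\<And>x. x < - M \<Longrightarrow> \<theta>' x = 0"
  shows "(log_profile a \<theta> has_real_derivative log_profile (a - 1) (\<lambda>x. a * \<theta> x + \<theta>' x) t) (at t)"
proof (cases "t > 0")
  case True
  have "((\<lambda>t. \<theta> (ln t)) has_real_derivative \<theta>' (ln t) * (1 / t)) (at t)"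
    using DERIV_chain2[OF assms(1) DERIV_ln_divide[OF True]] .
  from DERIV_mult[OF has_real_derivative_powr[OF True, of a] this]
  have "((\<lambda>t. t powr a * \<theta> (ln t)) has_real_derivative log_profile (a - 1) (\<lambda>x. a * \<theta> x + \<theta>' x) t) (at t)"
    by (rule DERIV_cong) (use True in \<open>simp add: log_profile_def powr_diff algebra_simps\<close>)
  then show ?thesis
    by (rule has_field_derivative_transform_within_open[where S="{0<..}"]) (use True in \<open>auto simp: log_profile_def\<close>)
next
  case False
  then have t: "t < exp (- M)" using exp_gt_zero[of "- M"] by linarith
  have "((\<lambda>_. 0) has_real_derivative 0) (at t)" by simp
  then have "(log_profile a \<theta> has_real_derivative 0) (at t)"
    by (rule has_field_derivative_transform_within_open[where S="{..<exp (- M)}"])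
      (use t log_profile_zero[of M \<theta>] assms(2) in auto)
  then show ?thesis using False by (simp add: log_profile_def)
qed

text \<open>Induction with a and \<theta> arbitrary, the class being closed under differentiation.
  Vanishing of \<theta> below -M passes to its derivatives and makes every profile vanish for t <
  exp(-M), so the origin causes no trouble.\<close>

lemma C_diff_log_profile:
  assumes "\<And>k. C_diff k \<theta>" and "\<And>x. x < - M \<Longrightarrow> \<theta> x = 0"
  shows "C_diff k (log_profile a \<theta>)"
  using assms
proof (induction k arbitrary: a \<theta>)
  case (0 a \<theta>)
  have d: "(\<theta> has_real_derivative frechet_derivative \<theta> (at x) 1) (at x)" for x
    using C_diff_SucD_real(1)[OF 0(1)] .
  have "frechet_derivative \<theta> (at x) 1 = 0" if "x < - M" for x
  proof -
    have "((\<lambda>_. 0) has_real_derivative 0) (at x)" by simp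
    then have "(\<theta> has_real_derivative 0) (at x)"
      by (rule has_field_derivative_transform_within_open[where S="{..<-M}"]) (use that 0(2) in auto)
    then show ?thesis using d DERIV_unique by blast
  qed
  from DERIV_isCont[OF DERIV_log_profile[OF d 0(2) this]] show ?case
    by (simp add: continuous_at_imp_continuous_on)
next
  case (Suc k a \<theta>)
  define \<theta>' where "\<theta>' = (\<lambda>x. frechet_derivative \<theta> (at x) 1)"
  have d: "(\<theta> has_real_derivative \<theta>' x) (at x)" "C_diff j \<theta>'" for x j
    using C_diff_SucD_real[OF Suc.prems(1)[of "Suc j"]] by (auto simp: \<theta>'_def)
  have \<theta>'0: "\<theta>' x = 0" if "x < - M" for x
  proof -
    have "((\<lambda>_. 0) has_real_derivative 0) (at x)" by simp
    then have "(\<theta> has_real_derivative 0) (at x)"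
      by (rule has_field_derivative_transform_within_open[where S="{..<-M}"]) (use that Suc.prems(2) in auto)
    then show ?thesis using d(1) DERIV_unique by blast
  qed
  show ?case
  proof (rule C_diff_Suc_real[OF DERIV_log_profile[OF d(1) Suc.prems(2) \<theta>'0]])
    show "C_diff k (log_profile (a - 1) (\<lambda>x. a * \<theta> x + \<theta>' x))"
      by (intro Suc.IH C_diff_add C_diff_mult C_diff_const Suc.prems(1) d(2)) (simp add: Suc.prems(2) \<theta>'0)
  qed
qed

text \<open>Extends the evaluation of Q to s = 1/2, where the integrand is 0 on (0,1) and the
  constant equals 1/(2s).\<close>

lemma nn_integral_hardy_Q:
  assumes s: "1/2 \<le> s" "s < 1"
  shows "0 \<le> hardy_const1 s - 1 / (2 * s)"
    and "(\<integral>\<^sup>+r. ennreal ((1 - r powr (s - 1/2))\<^sup>2 * (1 - r) powr (- 1 - 2 * s)) * indicator {0<..<1} r \<partial>lborel) \<le> ennreal (hardy_const1 s - 1 / (2 * s))"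
proof -
  have "0 \<le> hardy_const1 s - 1 / (2 * s) \<and>
    (\<integral>\<^sup>+r. ennreal ((1 - r powr (s - 1/2))\<^sup>2 * (1 - r) powr (- 1 - 2 * s)) * indicator {0<..<1} r \<partial>lborel) \<le> ennreal (hardy_const1 s - 1 / (2 * s))"
  proof (cases "s = 1/2")
    case True
    have "hardy_const1 s - 1 / (2 * s) = 0" using hardy_const1_half by (simp only: True)
    moreover have "(\<integral>\<^sup>+r. ennreal ((1 - r powr (s - 1/2))\<^sup>2 * (1 - r) powr (- 1 - 2 * s)) * indicator {0<..<1} r \<partial>lborel) = (\<integral>\<^sup>+(r::real). 0 \<partial>lborel)"
      by (rule nn_integral_cong) (auto simp: True indicator_def)
    ultimately show ?thesis by simp
  next
    case False
    then have s': "1/2 < s" using s by simp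
    note Q = has_integral_hardy_Q[OF s' s(2)]
    have "0 \<le> hardy_const1 s - 1 / (2 * s)" by (rule has_integral_nonneg[OF Q]) auto
    moreover have "(\<integral>\<^sup>+r. ennreal ((1 - r powr (s - 1/2))\<^sup>2 * (1 - r) powr (- 1 - 2 * s)) * indicator {0<..<1} r \<partial>lborel)
      \<le> (\<integral>\<^sup>+r. ennreal ((1 - r powr (s - 1/2))\<^sup>2 * (1 - r) powr (- 1 - 2 * s)) * indicator {0..1} r \<partial>lborel)"
      by (rule nn_integral_mono) (auto simp: indicator_def)
    moreover have "\<dots> = ennreal (hardy_const1 s - 1 / (2 * s))"
      by (rule nn_integral_has_integral_lebesgue'[OF _ Q]) auto
    ultimately show ?thesis by simp
  qed
  then show "0 \<le> hardy_const1 s - 1 / (2 * s)"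
    "(\<integral>\<^sup>+r. ennreal ((1 - r powr (s - 1/2))\<^sup>2 * (1 - r) powr (- 1 - 2 * s)) * indicator {0<..<1} r \<partial>lborel) \<le> ennreal (hardy_const1 s - 1 / (2 * s))"
    by auto
qed

section \<open>Trial functions on a half-space\<close>

definition energy1 :: "real \<Rightarrow> (real \<Rightarrow> real) \<Rightarrow> ennreal" where
  "energy1 s u = (\<integral>\<^sup>+x. \<integral>\<^sup>+t. ennreal ((u (x + t) - u x)\<^sup>2 / \<bar>t\<bar> powr (1 + 2 * s)) \<partial>lborel \<partial>lborel)"

lemma square_add_le:
  fixes a b :: real
  assumes "\<delta> > 0"
  shows "(a + b)\<^sup>2 \<le> (1 + \<delta>) * a\<^sup>2 + (1 + 1 / \<delta>) * b\<^sup>2"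
proof -
  have "0 \<le> (\<delta> * a - b)\<^sup>2 / \<delta>" using assms by simp
  also have "\<dots> = \<delta> * a\<^sup>2 + b\<^sup>2 / \<delta> - 2 * a * b"
    using assms by (simp add: power2_eq_square field_simps)
  finally show ?thesis by (simp add: power2_eq_square algebra_simps)
qed

text \<open>Apply ln p <= p - 1 to p = r^(-1/4). The factor (1 - r)^2 removes the singularity of the
  kernel at r = 1, and r^(-1/2) is still integrable at 0, so the cut-off error becomes a finite Beta
  integral.\<close>

lemma abs_ln_le:
  fixes r :: real
  assumes r: "0 < r" "r < 1"
  shows "(ln r)\<^sup>2 \<le> 16 * (r powr (-1/2) * (1 - r)\<^sup>2)"
proof -
  define p where "p = r powr (-1/4)"
  have "r powr (1/4) \<le> 1" "0 < r powr (1/4)" using r by (auto simp: powr_le1)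
  then have p1: "p \<ge> 1" by (simp add: p_def powr_minus one_le_inverse)
  have "- ln r = 4 * ln p" using r by (simp add: p_def ln_powr)
  also have "\<dots> \<le> 4 * (p - 1)" using p1 ln_le_minus_one[of p] by simp
  also have "p - 1 = p * (1 - r powr (1/4))"
    using r by (simp add: p_def right_diff_distrib powr_add[symmetric])
  also have "\<dots> \<le> p * (1 - r)"
    using one_minus_powr_le[of "1/4" r] r p1 by (intro mult_left_mono) auto
  finally have "- ln r \<le> 4 * (p * (1 - r))" by simp
  moreover have "0 \<le> - ln r" using r by simp
  ultimately have "(- ln r)\<^sup>2 \<le> (4 * (p * (1 - r)))\<^sup>2" by (intro power_mono)
  also have "\<dots> = 16 * (p\<^sup>2 * (1 - r)\<^sup>2)" by (simp add: power_mult_distrib)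
  also have "p\<^sup>2 = r powr (-1/2)" unfolding p_def using r by (simp add: powr_power)
  finally show ?thesis by simp
qed

lemma nn_integral_inverse_exp_interval:
  assumes "R > 0"
  shows "(\<integral>\<^sup>+x. ennreal (1 / x) * indicator {exp (- R)..exp R} x \<partial>lborel) = ennreal (2 * R)"
proof -
  have le: "exp (- R) \<le> exp R" using assms by simp
  have "((\<lambda>x. 1 / x) has_integral (ln (exp R) - ln (exp (- R)))) {exp (- R)..exp R}"
  proof (rule fundamental_theorem_of_calculus[OF le])
    fix x assume "x \<in> {exp (- R)..exp R}"
    then have "x > 0" using exp_gt_zero[of "- R"] unfolding atLeastAtMost_iff by linarith
    then have "(ln has_real_derivative 1 / x) (at x within {exp (- R)..exp R})"
      using DERIV_ln_divide has_field_derivative_at_within by blast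
    then show "(ln has_vector_derivative 1 / x) (at x within {exp (- R)..exp R})"
      unfolding has_real_derivative_iff_has_vector_derivative .
  qed
  then have "(\<integral>\<^sup>+x. ennreal (1 / x) * indicator {exp (- R)..exp R} x \<partial>lborel) = ennreal (ln (exp R) - ln (exp (- R)))"
  proof (rule nn_integral_has_integral_lebesgue'[rotated])
    fix x assume "x \<in> {exp (- R)..exp R}"
    then have "x > 0" using exp_gt_zero[of "- R"] unfolding atLeastAtMost_iff by linarith
    then show "0 \<le> 1 / x" by simp
  qed
  then show ?thesis by simp
qed

definition log_bump :: "real \<Rightarrow> real \<Rightarrow> real" where
  "log_bump R x = bump (ln x / R)"

lemma log_bump_support:
  assumes "R > 0" "x > 0" "log_bump R x \<noteq> 0"
  shows "exp (- R) < x" "x < exp R"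
proof -
  have "\<bar>ln x\<bar> < R" using bump_bounds(3)[of "ln x / R"] assms by (simp add: log_bump_def)
  then have "- R < ln x" "ln x < R" by auto
  then have "exp (- R) < exp (ln x)" "exp (ln x) < exp R" by (simp_all only: exp_less_cancel_iff)
  then show "exp (- R) < x" "x < exp R" unfolding exp_ln[OF assms(2)] .
qed

lemma log_bump_bounds: "0 \<le> log_bump R x" "log_bump R x \<le> 1"
  using bump_bounds by (auto simp: log_bump_def)

lemma bump_measurable [measurable]: "bump \<in> borel_measurable borel"
  using C_diff_bump[of 0] by (intro borel_measurable_continuous_onI) simp

lemma log_bump_measurable [measurable]: "log_bump R \<in> borel_measurable borel"
  unfolding log_bump_def[abs_def] by measurable

lemma log_profile_measurable [measurable]:
  assumes [measurable]: "\<theta> \<in> borel_measurable borel"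
  shows "log_profile a \<theta> \<in> borel_measurable borel"
  unfolding log_profile_def[abs_def] by measurable

text \<open>Because 2\<beta> - 2s = -1, this is the one-dimensional Hardy integral of the trial
  profile.\<close>

definition log_mass :: "real \<Rightarrow> ennreal" where
  "log_mass R = (\<integral>\<^sup>+x. indicator {0<..} x * ennreal ((log_bump R x)\<^sup>2 / x) \<partial>lborel)"

text \<open>On |ln x| <= R/2, an interval of length R for dx/x, the bump is at least exp(-4). What
  matters later is growth of exact order R, against which the 1/R error is negligible.\<close>

lemma log_mass_bounds:
  assumes R: "R > 0"
  shows "ennreal (exp (-8) * R) \<le> log_mass R" "log_mass R \<le> ennreal (2 * R)"
proof -
  have "ennreal (exp (-8) * R) = ennreal (exp (-8)) * ennreal (2 * (R / 2))" by (simp add: ennreal_mult')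
  also have "\<dots> = (\<integral>\<^sup>+x. ennreal (exp (-8)) * (ennreal (1 / x) * indicator {exp (- (R / 2))..exp (R / 2)} x) \<partial>lborel)"
    using R by (subst nn_integral_cmult, measurable) (subst nn_integral_inverse_exp_interval, auto)
  also have "\<dots> \<le> log_mass R" unfolding log_mass_def
  proof (rule nn_integral_mono)
    fix x :: real
    show "ennreal (exp (-8)) * (ennreal (1 / x) * indicator {exp (- (R / 2))..exp (R / 2)} x) \<le> indicator {0<..} x * ennreal ((log_bump R x)\<^sup>2 / x)"
    proof (cases "x \<in> {exp (- (R / 2))..exp (R / 2)}")
      case True
      then have x: "x > 0" using exp_gt_zero[of "- (R / 2)"] unfolding atLeastAtMost_iff by linarith
      have "ln (exp (- (R / 2))) \<le> ln x" "ln x \<le> ln (exp (R / 2))" using True x by (auto simp del: ln_exp)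
      then have "\<bar>ln x / R\<bar> \<le> 1/2" using R by (simp add: abs_le_iff field_simps)
      then have "exp (-4) \<le> log_bump R x" unfolding log_bump_def by (rule bump_bounds(4))
      then have "(exp (-4))\<^sup>2 \<le> (log_bump R x)\<^sup>2" by (intro power_mono) auto
      moreover have "(exp (-4))\<^sup>2 = exp (-8::real)" by (simp add: power2_eq_square exp_add[symmetric])
      ultimately have "exp (-8) * (1 / x) \<le> (log_bump R x)\<^sup>2 / x" using x by (simp add: divide_right_mono)
      then show ?thesis using True x by (simp add: ennreal_leI flip: ennreal_mult')
    qed simp
  qed
  finally show "ennreal (exp (-8) * R) \<le> log_mass R" .
  have "log_mass R \<le> (\<integral>\<^sup>+x. ennreal (1 / x) * indicator {exp (- R)..exp R} x \<partial>lborel)"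
    unfolding log_mass_def
  proof (rule nn_integral_mono)
    fix x :: real
    show "indicator {0<..} x * ennreal ((log_bump R x)\<^sup>2 / x) \<le> ennreal (1 / x) * indicator {exp (- R)..exp R} x"
    proof (cases "x > 0 \<and> log_bump R x \<noteq> 0")
      case True
      then have "x \<in> {exp (- R)..exp R}" using log_bump_support[OF R, of x] by auto
      moreover have "(log_bump R x)\<^sup>2 / x \<le> 1 / x"
        using True log_bump_bounds[of R x] by (intro divide_right_mono) (auto simp: power_le_one)
      ultimately show ?thesis using True by (simp add: ennreal_leI)
    qed auto
  qed
  then show "log_mass R \<le> ennreal (2 * R)" using nn_integral_inverse_exp_interval[OF R] by simp
qed

text \<open>Substituting \<open>y = r * x\<close> with \<open>0 < r < 1\<close> turns the energy into
  \<open>1 / s * log_mass R\<close> plus twice an integral over \<open>r\<close> in which the cut-off enters only through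
  \<open>ln x\<close> and \<open>ln x + ln r\<close>, whence an error of order \<open>1 / R\<close>.\<close>

lemma energy1_log_profile_le:
  assumes s: "1/2 \<le> s" "s < 1" and \<delta>: "\<delta> > 0"
  shows "\<exists>C\<ge>0. \<forall>R>0. energy1 s (log_profile (s - 1/2) (\<lambda>a. bump (a / R)))
    \<le> ennreal (1 / s + 2 * (1 + \<delta>) * (hardy_const1 s - 1 / (2 * s))) * log_mass R + ennreal (C / R)"
proof -
  obtain L where L: "L > 0" "\<And>x y. \<bar>bump x - bump y\<bar> \<le> L * \<bar>x - y\<bar>" using bump_Lipschitz by blast
  define \<beta> where "\<beta> = s - 1/2"
  have b: "0 \<le> \<beta>" "\<beta> \<le> 1" "0 < s" using s by (auto simp: \<beta>_def)
  define Q where "Q = hardy_const1 s - 1 / (2 * s)"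
  have Q: "0 \<le> Q" unfolding Q_def by (rule nn_integral_hardy_Q(1)[OF s])
  define B where "B = Beta (1/2) (2 - 2 * s)"
  have Bint: "((\<lambda>t. t powr (1/2 - 1) * (1 - t) powr ((2 - 2 * s) - 1)) has_integral B) {0..1}"
    unfolding B_def using s by (intro has_integral_Beta_real) auto
  have B: "0 \<le> B" by (rule has_integral_nonneg[OF Bint]) auto
  show ?thesis
  \<comment> \<open>128 = 2 * 16 * 4: exchange of the two points, the constant of
    \<open>abs_ln_le\<close>, and two logarithmic windows of length 2R each.\<close>
  proof (intro exI[of _ "128 * (1 + 1 / \<delta>) * L\<^sup>2 * B"] conjI allI impI)
    show "0 \<le> 128 * (1 + 1 / \<delta>) * L\<^sup>2 * B" using \<delta> B by simp
    fix R :: real assume R: "R > 0"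
    define u where "u = log_profile \<beta> (\<lambda>a. bump (a / R))"
    define v where "v = log_bump R"
    have [measurable]: "v \<in> borel_measurable borel" by (simp add: v_def)
    have [measurable]: "u \<in> borel_measurable borel" unfolding u_def by measurable
    have up: "u x = x powr \<beta> * v x" if "x > 0" for x using that by (simp add: u_def log_profile_def v_def log_bump_def)
    have u0: "u x = 0" if "x \<le> 0" for x using that by (simp add: u_def log_profile_def)
    have powx: "x powr \<beta> * x powr \<beta> * x powr (- (2 * s)) = 1 / x" if "x > 0" for x :: real
    proof -
      have e: "\<beta> + \<beta> + - (2 * s) = -1" by (simp add: \<beta>_def)
      show ?thesis unfolding powr_add[symmetric] e using that by (simp add: powr_minus divide_inverse)
    qed
    define \<Phi> where "\<Phi> = (\<lambda>x y. ennreal ((u y - u x)\<^sup>2 / \<bar>y - x\<bar> powr (1 + 2 * s)))"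
    have \<Phi>_sym: "\<Phi> x y = \<Phi> y x" for x y by (simp add: \<Phi>_def power2_commute abs_minus_commute)
    have [measurable]: "case_prod \<Phi> \<in> borel_measurable (borel \<Otimes>\<^sub>M borel)" unfolding \<Phi>_def by measurable
    \<comment> \<open>\<open>A\<close> collects pairs with one point on the negative side, where
      \<open>u\<close> is 0; \<open>D\<close> collects pairs 0 < y < x. Symmetry doubles both, and
      the diagonal contributes nothing.\<close>
    define A where "A = (\<lambda>x y. indicator {0<..} x * indicator {..0} y * \<Phi> x y)"
    define D where "D = (\<lambda>x y. indicator {0<..} x * (indicator {0<..<x} y * \<Phi> x y))"
    have [measurable]: "case_prod A \<in> borel_measurable (borel \<Otimes>\<^sub>M borel)" unfolding A_def by measurable
    have D_alt: "D x y = (if 0 < x \<and> 0 < y \<and> y < x then \<Phi> x y else 0)" for x y by (auto simp: D_def indicator_def)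
    have [measurable]: "case_prod D \<in> borel_measurable (borel \<Otimes>\<^sub>M borel)" unfolding D_alt[abs_def] by measurable
    have "energy1 s u = (\<integral>\<^sup>+x. \<integral>\<^sup>+y. \<Phi> x y \<partial>lborel \<partial>lborel)" unfolding energy1_def
    proof (rule nn_integral_cong)
      fix x :: real
      show "(\<integral>\<^sup>+t. ennreal ((u (x + t) - u x)\<^sup>2 / \<bar>t\<bar> powr (1 + 2 * s)) \<partial>lborel) = (\<integral>\<^sup>+y. \<Phi> x y \<partial>lborel)"
        using nn_integral_lborel_shift[of "\<Phi> x" x] by (simp add: \<Phi>_def)
    qed
    also have "\<dots> \<le> (\<integral>\<^sup>+x. \<integral>\<^sup>+y. A x y + A y x + (D x y + D y x) \<partial>lborel \<partial>lborel)"
    proof (intro nn_integral_mono)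
      fix x y :: real
      consider "x \<le> 0" "y \<le> 0" | "x > 0" "y \<le> 0" | "x \<le> 0" "y > 0" | "x > 0" "y > 0" "y < x" | "x > 0" "y > 0" "x < y" | "x = y" by linarith
      then show "\<Phi> x y \<le> A x y + A y x + (D x y + D y x)"
        by cases (auto simp: A_def D_alt u0 \<Phi>_sym[of x y], auto simp: \<Phi>_def u0)
    qed
    also have "\<dots> = (\<integral>\<^sup>+x. \<integral>\<^sup>+y. A x y \<partial>lborel \<partial>lborel) + (\<integral>\<^sup>+x. \<integral>\<^sup>+y. A y x \<partial>lborel \<partial>lborel)
      + ((\<integral>\<^sup>+x. \<integral>\<^sup>+y. D x y \<partial>lborel \<partial>lborel) + (\<integral>\<^sup>+x. \<integral>\<^sup>+y. D y x \<partial>lborel \<partial>lborel))"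
      by (simp add: nn_integral_add)
    also have "(\<integral>\<^sup>+x. \<integral>\<^sup>+y. A y x \<partial>lborel \<partial>lborel) = (\<integral>\<^sup>+x. \<integral>\<^sup>+y. A x y \<partial>lborel \<partial>lborel)"
      by (rule lborel_pair.Fubini') measurable
    also have "(\<integral>\<^sup>+x. \<integral>\<^sup>+y. D y x \<partial>lborel \<partial>lborel) = (\<integral>\<^sup>+x. \<integral>\<^sup>+y. D x y \<partial>lborel \<partial>lborel)"
      by (rule lborel_pair.Fubini') measurable
    finally have split: "energy1 s u \<le> 2 * (\<integral>\<^sup>+x. \<integral>\<^sup>+y. A x y \<partial>lborel \<partial>lborel) + 2 * (\<integral>\<^sup>+x. \<integral>\<^sup>+y. D x y \<partial>lborel \<partial>lborel)"
      by (simp add: mult_2)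
    \<comment> \<open>The kernel integrated over the negative half-line is x^(-2s)/(2s); doubled,
      this gives the coefficient 1/s of \<open>log_mass R\<close>.\<close>
    have "(\<integral>\<^sup>+x. \<integral>\<^sup>+y. A x y \<partial>lborel \<partial>lborel) = (\<integral>\<^sup>+x. ennreal (1 / (2 * s)) * (indicator {0<..} x * ennreal ((v x)\<^sup>2 / x)) \<partial>lborel)"
    proof (rule nn_integral_cong)
      fix x :: real
      show "(\<integral>\<^sup>+y. A x y \<partial>lborel) = ennreal (1 / (2 * s)) * (indicator {0<..} x * ennreal ((v x)\<^sup>2 / x))"
      proof (cases "x > 0")
        case True
        have "(\<integral>\<^sup>+y. A x y \<partial>lborel) = (\<integral>\<^sup>+t. A x (x + (-1) * t) \<partial>lborel)"
          by (subst nn_integral_real_affine[where c="-1" and t=x]) auto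
        also have "\<dots> = (\<integral>\<^sup>+t. ennreal ((u x)\<^sup>2) * (ennreal (t powr (- 1 - 2 * s)) * indicator {x..} t) \<partial>lborel)"
        proof (rule nn_integral_cong)
          fix t :: real
          show "A x (x + (-1) * t) = ennreal ((u x)\<^sup>2) * (ennreal (t powr (- 1 - 2 * s)) * indicator {x..} t)"
          proof (cases "x \<le> t")
            case True
            then have "1 / \<bar>t\<bar> powr (1 + 2 * s) = t powr (- 1 - 2 * s)"
              using \<open>x > 0\<close> powr_minus_divide[of t "1 + 2 * s"] by simp
            then have "(u x)\<^sup>2 / \<bar>t\<bar> powr (1 + 2 * s) = (u x)\<^sup>2 * t powr (- 1 - 2 * s)" by (metis times_divide_eq_right mult.right_neutral)
            then show ?thesis using True \<open>x > 0\<close> by (simp add: A_def \<Phi>_def u0 ennreal_mult')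
          qed (simp add: A_def)
        qed
        also have "\<dots> = ennreal ((u x)\<^sup>2) * (\<integral>\<^sup>+t. ennreal (t powr (- 1 - 2 * s)) * indicator {x..} t \<partial>lborel)"
          by (rule nn_integral_cmult) measurable
        also have "(\<integral>\<^sup>+t. ennreal (t powr (- 1 - 2 * s)) * indicator {x..} t \<partial>lborel) = ennreal (x powr (- (2 * s)) / (2 * s))"
        proof (rule nn_integral_has_integral_lebesgue')
          show "((\<lambda>t. t powr (- 1 - 2 * s)) has_integral (x powr (- (2 * s)) / (2 * s))) {x..}"
            using has_integral_powr_to_inf[of "- 1 - 2 * s" x] b True by simp
        qed simp
        also have "ennreal ((u x)\<^sup>2) * ennreal (x powr (- (2 * s)) / (2 * s)) = ennreal ((u x)\<^sup>2 * (x powr (- (2 * s)) / (2 * s)))"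
          by (rule ennreal_mult'[symmetric]) simp
        also have "(u x)\<^sup>2 * (x powr (- (2 * s)) / (2 * s)) = 1 / (2 * s) * ((v x)\<^sup>2 / x)"
        proof -
          have "(u x)\<^sup>2 * x powr (- (2 * s)) = (v x)\<^sup>2 * (x powr \<beta> * x powr \<beta> * x powr (- (2 * s)))"
            unfolding up[OF True] by (simp add: power2_eq_square)
          then show ?thesis unfolding powx[OF True] by simp
        qed
        also have "ennreal (1 / (2 * s) * ((v x)\<^sup>2 / x)) = ennreal (1 / (2 * s)) * ennreal ((v x)\<^sup>2 / x)"
          by (rule ennreal_mult') (use b in simp)
        also have "\<dots> = ennreal (1 / (2 * s)) * (indicator {0<..} x * ennreal ((v x)\<^sup>2 / x))"
          using True by (simp only: indicator_simps greaterThan_iff mult_1)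
        finally show ?thesis .
      qed (simp add: A_def)
    qed
    also have "\<dots> = ennreal (1 / (2 * s)) * log_mass R"
      unfolding log_mass_def v_def by (rule nn_integral_cmult) measurable
    finally have IA: "(\<integral>\<^sup>+x. \<integral>\<^sup>+y. A x y \<partial>lborel \<partial>lborel) = ennreal (1 / (2 * s)) * log_mass R" .
    define J where "J = {exp (- R)..exp R}"
    define E where "E = (1 + 1 / \<delta>) * (16 * L\<^sup>2 / R\<^sup>2)"
    have E: "0 \<le> E" using \<delta> by (simp add: E_def)
    define q where "q = (\<lambda>r::real. (1 - r powr \<beta>)\<^sup>2 * (1 - r) powr (- 1 - 2 * s))"
    define p where "p = (\<lambda>r::real. r powr (1/2 - 1) * (1 - r) powr ((2 - 2 * s) - 1))"
    have qp: "0 \<le> q r" "0 \<le> p r" for r by (auto simp: q_def p_def)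
    have [measurable]: "q \<in> borel_measurable borel" "p \<in> borel_measurable borel" by (auto simp: q_def p_def)
    have [measurable]: "J \<in> sets borel" by (simp add: J_def)
    define M where "M = (\<lambda>x. indicator {0<..} x * ennreal ((v x)\<^sup>2 / x))"
    define N where "N = (\<lambda>x. ennreal (1 / x) * (indicator J x :: ennreal))"
    have [measurable]: "M \<in> borel_measurable borel" "N \<in> borel_measurable borel" by (auto simp: M_def N_def)
    have IN: "(\<integral>\<^sup>+x. N x \<partial>lborel) = ennreal (2 * R)"
      unfolding N_def J_def by (rule nn_integral_inverse_exp_interval[OF R])
    have "(\<integral>\<^sup>+x. \<integral>\<^sup>+y. D x y \<partial>lborel \<partial>lborel) \<le> (\<integral>\<^sup>+x. \<integral>\<^sup>+r. ennreal (1 + \<delta>) * (M x * (ennreal (q r) * indicator {0<..<1} r))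
         + ennreal E * ((ennreal (p r) * indicator {0<..<1} r) * (N x + ennreal r * N (r * x))) \<partial>lborel \<partial>lborel)"
    proof (rule nn_integral_mono)
      fix x :: real
      show "(\<integral>\<^sup>+y. D x y \<partial>lborel) \<le> (\<integral>\<^sup>+r. ennreal (1 + \<delta>) * (M x * (ennreal (q r) * indicator {0<..<1} r))
         + ennreal E * ((ennreal (p r) * indicator {0<..<1} r) * (N x + ennreal r * N (r * x))) \<partial>lborel)"
      proof (cases "x > 0")
        case x: True
        have "(\<integral>\<^sup>+y. D x y \<partial>lborel) = ennreal x * (\<integral>\<^sup>+r. D x (0 + x * r) \<partial>lborel)"
          using x by (subst nn_integral_real_affine[where c=x and t=0]) auto
        also have "\<dots> = (\<integral>\<^sup>+r. ennreal x * D x (0 + x * r) \<partial>lborel)" by (rule nn_integral_cmult[symmetric]) measurable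
        also have "\<dots> \<le> (\<integral>\<^sup>+r. ennreal (1 + \<delta>) * (M x * (ennreal (q r) * indicator {0<..<1} r))
         + ennreal E * ((ennreal (p r) * indicator {0<..<1} r) * (N x + ennreal r * N (r * x))) \<partial>lborel)"
        proof (rule nn_integral_mono)
          fix r :: real
          show "ennreal x * D x (0 + x * r) \<le> ennreal (1 + \<delta>) * (M x * (ennreal (q r) * indicator {0<..<1} r))
            + ennreal E * ((ennreal (p r) * indicator {0<..<1} r) * (N x + ennreal r * N (r * x)))"
          proof (cases "0 < r \<and> r < 1")
            case False
            then have "D x (0 + x * r) = 0" using x by (auto simp: D_alt zero_less_mult_iff mult_less_cancel_left1)
            then show ?thesis by simp
          next
            case r: True
            have rx: "0 < x * r" "x * r < x" using r x by auto
            define W where "W = (1 - r) powr (- 1 - 2 * s)"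
            have W: "0 \<le> W" by (simp add: W_def)
            have "u (x * r) - u x = x powr \<beta> * (r powr \<beta> * v (x * r) - v x)"
              using rx x r by (simp add: up powr_mult algebra_simps)
            then have "(u (x * r) - u x)\<^sup>2 = (x powr \<beta> * x powr \<beta>) * (r powr \<beta> * v (x * r) - v x)\<^sup>2"
              by (simp add: power2_eq_square)
            moreover have "1 / \<bar>x * r - x\<bar> powr (1 + 2 * s) = (1 / x) * x powr (- (2 * s)) * W"
            proof -
              have "\<bar>x * r - x\<bar> = x * (1 - r)" using r x by (simp add: abs_if algebra_simps)
              then have "1 / \<bar>x * r - x\<bar> powr (1 + 2 * s) = (x * (1 - r)) powr (- (1 + 2 * s))"
                by (simp only: powr_minus_divide)
              also have "\<dots> = x powr (- (1 + 2 * s)) * W" using x r by (simp add: powr_mult W_def)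
              also have "x powr (- (1 + 2 * s)) = x powr (-1) * x powr (- (2 * s))" unfolding powr_add[symmetric] by simp
              also have "x powr (-1) = 1 / x" using x by (simp add: powr_minus divide_inverse)
              finally show ?thesis .
            qed
            ultimately have "x * ((u (x * r) - u x)\<^sup>2 * (1 / \<bar>x * r - x\<bar> powr (1 + 2 * s)))
               = (x * (1 / x)) * (x powr \<beta> * x powr \<beta> * x powr (- (2 * s))) * (r powr \<beta> * v (x * r) - v x)\<^sup>2 * W"
              by (simp add: mult_ac)
            then have D1: "x * ((u (x * r) - u x)\<^sup>2 / \<bar>x * r - x\<bar> powr (1 + 2 * s)) = (v x - r powr \<beta> * v (x * r))\<^sup>2 * W / x"
              unfolding powx[OF x] using x by (simp add: power2_commute)
            have rb: "r powr \<beta> \<le> 1" "0 \<le> r powr \<beta>" using r b by (auto simp: powr_le1)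
            \<comment> \<open>The first square is the exact ground state with a frozen cut-off and
              yields Q; the second contains only the variation of the cut-off.\<close>
            have v1: "(v x - r powr \<beta> * v (x * r))\<^sup>2 \<le> (1 + \<delta>) * ((1 - r powr \<beta>) * v x)\<^sup>2 + (1 + 1 / \<delta>) * (r powr \<beta> * (v x - v (x * r)))\<^sup>2"
              using square_add_le[OF \<delta>, of "(1 - r powr \<beta>) * v x" "r powr \<beta> * (v x - v (x * r))"] by (simp add: algebra_simps)
            \<comment> \<open>The cut-off depends on ln x / R, so its variation is at most L |ln r|
              / R. It vanishes unless one of the two points lies in the logarithmic window, hence
              the two indicators.\<close>
            have v2: "(r powr \<beta> * (v x - v (x * r)))\<^sup>2 \<le> 16 * L\<^sup>2 / R\<^sup>2 * (r powr (-1/2) * (1 - r)\<^sup>2) * (indicator J x + indicator J (r * x))"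
            proof (cases "v x = 0 \<and> v (x * r) = 0")
              case True
              then show ?thesis by (simp add: add_nonneg_nonneg)
            next
              case False
              have 1: "1 \<le> indicator J x + (indicator J (r * x) :: real)"
                using False log_bump_support[OF R x] log_bump_support[OF R rx(1)] unfolding v_def J_def
                by (auto simp: indicator_def mult.commute)
              have "\<bar>v x - v (x * r)\<bar> \<le> L * \<bar>ln x / R - ln (x * r) / R\<bar>"
                unfolding v_def log_bump_def by (rule L(2))
              also have "ln x / R - ln (x * r) / R = - ln r / R" using x r by (simp add: ln_mult diff_divide_distrib add_divide_distrib)
              finally have "\<bar>v x - v (x * r)\<bar> \<le> \<bar>L / R * ln r\<bar>" using L(1) R by (simp add: abs_mult)
              then have "(v x - v (x * r))\<^sup>2 \<le> (L / R * ln r)\<^sup>2" by (rule abs_le_square_iff[THEN iffD1])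
              also have "\<dots> = L\<^sup>2 / R\<^sup>2 * (ln r)\<^sup>2" by (simp add: power_mult_distrib power_divide)
              also have "\<dots> \<le> L\<^sup>2 / R\<^sup>2 * (16 * (r powr (-1/2) * (1 - r)\<^sup>2))"
                using r by (intro mult_left_mono abs_ln_le) auto
              finally have 2: "(v x - v (x * r))\<^sup>2 \<le> 16 * L\<^sup>2 / R\<^sup>2 * (r powr (-1/2) * (1 - r)\<^sup>2)" by (simp add: mult_ac)
              have "(r powr \<beta> * (v x - v (x * r)))\<^sup>2 \<le> 1 * (v x - v (x * r))\<^sup>2"
                unfolding power_mult_distrib using rb by (intro mult_right_mono) (auto simp: power_le_one)
              also have "\<dots> \<le> 16 * L\<^sup>2 / R\<^sup>2 * (r powr (-1/2) * (1 - r)\<^sup>2) * 1" using 2 by simp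
              also have "\<dots> \<le> 16 * L\<^sup>2 / R\<^sup>2 * (r powr (-1/2) * (1 - r)\<^sup>2) * (indicator J x + indicator J (r * x))"
                using 1 by (intro mult_left_mono) auto
              finally show ?thesis .
            qed
            have pW: "r powr (-1/2) * (1 - r)\<^sup>2 * W = p r"
            proof -
              have "(1 - r)\<^sup>2 * W = (1 - r) powr 2 * W" using r by simp
              also have "\<dots> = (1 - r) powr (1 - 2 * s)" unfolding W_def powr_add[symmetric] by simp
              finally show ?thesis by (simp add: p_def mult.assoc)
            qed
            have "(v x - r powr \<beta> * v (x * r))\<^sup>2 \<le> (1 + \<delta>) * ((1 - r powr \<beta>)\<^sup>2 * (v x)\<^sup>2) + E * (r powr (-1/2) * (1 - r)\<^sup>2 * (indicator J x + indicator J (r * x)))"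
              using order_trans[OF v1 add_left_mono[OF mult_left_mono[OF v2, of "1 + 1 / \<delta>"]]] \<delta>
              by (simp add: E_def power_mult_distrib mult.assoc)
            then have "(v x - r powr \<beta> * v (x * r))\<^sup>2 * (W / x) \<le> ((1 + \<delta>) * ((1 - r powr \<beta>)\<^sup>2 * (v x)\<^sup>2) + E * (r powr (-1/2) * (1 - r)\<^sup>2 * (indicator J x + indicator J (r * x)))) * (W / x)"
              using W x by (intro mult_right_mono) auto
            also have "\<dots> = (1 + \<delta>) * ((v x)\<^sup>2 / x * q r) + E * ((r powr (-1/2) * (1 - r)\<^sup>2 * W) * (1 / x * indicator J x + r * (1 / (r * x) * indicator J (r * x))))"
              unfolding q_def W_def[symmetric] using r x by (simp add: field_simps)
            finally have "x * ((u (x * r) - u x)\<^sup>2 / \<bar>x * r - x\<bar> powr (1 + 2 * s)) \<le> (1 + \<delta>) * ((v x)\<^sup>2 / x * q r) + E * (p r * (1 / x * indicator J x + r * (1 / (r * x) * indicator J (r * x))))"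
              unfolding D1 pW by simp
            note le = ennreal_leI[OF this]
            have lhs: "ennreal x * D x (0 + x * r) = ennreal (x * ((u (x * r) - u x)\<^sup>2 / \<bar>x * r - x\<bar> powr (1 + 2 * s)))"
            proof -
              have "D x (0 + x * r) = ennreal ((u (x * r) - u x)\<^sup>2 / \<bar>x * r - x\<bar> powr (1 + 2 * s))"
                using rx x by (simp only: D_alt \<Phi>_def add_0_left) simp
              then show ?thesis using x by (simp only: ennreal_mult' less_imp_le)
            qed
            define a where "a = 1 / x * indicator J x"
            define c where "c = r * (1 / (r * x) * indicator J (r * x))"
            have ac: "0 \<le> a" "0 \<le> c" using r x by (auto simp: a_def c_def)
            have n1: "ennreal a = N x" unfolding N_def a_def by (cases "x \<in> J") simp_all
            have n2: "ennreal c = ennreal r * N (r * x)" unfolding N_def c_def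
              using r by (cases "r * x \<in> J") (simp_all only: indicator_simps mult_1_right mult_zero_right ennreal_0 ennreal_mult' less_imp_le if_False simp_thms)
            have m1: "ennreal ((v x)\<^sup>2 / x * q r) = M x * ennreal (q r)"
              using x by (simp only: M_def indicator_simps greaterThan_iff mult_1) (simp only: ennreal_mult' divide_nonneg_nonneg zero_le_power2 less_imp_le)
            have pp: "0 \<le> (1 + \<delta>) * ((v x)\<^sup>2 / x * q r)" "0 \<le> E * (p r * (a + c))"
              using ac E qp[of r] \<delta> x by auto
            have "ennreal ((1 + \<delta>) * ((v x)\<^sup>2 / x * q r) + E * (p r * (a + c)))
              = ennreal ((1 + \<delta>) * ((v x)\<^sup>2 / x * q r)) + ennreal (E * (p r * (a + c)))"
              by (rule ennreal_plus[OF pp])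
            also have "ennreal ((1 + \<delta>) * ((v x)\<^sup>2 / x * q r)) = ennreal (1 + \<delta>) * ennreal ((v x)\<^sup>2 / x * q r)"
              by (rule ennreal_mult') (use \<delta> in simp)
            also have "ennreal (E * (p r * (a + c))) = ennreal E * (ennreal (p r) * (ennreal a + ennreal c))"
              by (simp only: ennreal_mult'[OF E] ennreal_mult'[OF qp(2)] ennreal_plus[OF ac])
            finally have "ennreal ((1 + \<delta>) * ((v x)\<^sup>2 / x * q r) + E * (p r * (a + c)))
              = ennreal (1 + \<delta>) * ennreal ((v x)\<^sup>2 / x * q r) + ennreal E * (ennreal (p r) * (ennreal a + ennreal c))" .
            then show ?thesis using le unfolding lhs[symmetric] m1 n1 n2 a_def[symmetric] c_def[symmetric] r
              using r by (simp only: indicator_simps greaterThanLessThan_iff mult_1_right)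
          qed
        qed
        finally show ?thesis .
      qed (simp add: D_def)
    qed
    also have "\<dots> = (\<integral>\<^sup>+r. \<integral>\<^sup>+x. ennreal (1 + \<delta>) * (M x * (ennreal (q r) * indicator {0<..<1} r))
         + ennreal E * ((ennreal (p r) * indicator {0<..<1} r) * (N x + ennreal r * N (r * x))) \<partial>lborel \<partial>lborel)"
      by (rule lborel_pair.Fubini') measurable
    also have "\<dots> = (\<integral>\<^sup>+r. (ennreal (1 + \<delta>) * log_mass R) * (ennreal (q r) * indicator {0<..<1} r) + (ennreal E * ennreal (4 * R)) * (ennreal (p r) * indicator {0<..<1} r) \<partial>lborel)"
    proof (rule nn_integral_cong)
      fix r :: real
      have IM: "(\<integral>\<^sup>+x. M x \<partial>lborel) = log_mass R" unfolding M_def log_mass_def v_def ..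
      show "(\<integral>\<^sup>+x. ennreal (1 + \<delta>) * (M x * (ennreal (q r) * indicator {0<..<1} r))
         + ennreal E * ((ennreal (p r) * indicator {0<..<1} r) * (N x + ennreal r * N (r * x))) \<partial>lborel)
         = (ennreal (1 + \<delta>) * log_mass R) * (ennreal (q r) * indicator {0<..<1} r) + (ennreal E * ennreal (4 * R)) * (ennreal (p r) * indicator {0<..<1} r)"
      proof (cases "0 < r \<and> r < 1")
        case r: True
        have "(\<integral>\<^sup>+x. ennreal r * N (r * x) \<partial>lborel) = ennreal r * (\<integral>\<^sup>+x. N (0 + r * x) \<partial>lborel)"
          by (subst nn_integral_cmult) auto
        also have "\<dots> = (\<integral>\<^sup>+x. N x \<partial>lborel)" using nn_integral_real_affine[of N r 0] r by simp
        finally have I2: "(\<integral>\<^sup>+x. ennreal r * N (r * x) \<partial>lborel) = ennreal (2 * R)" using IN by simp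
        have "ennreal (2 * R) + ennreal (2 * R) = ennreal (4 * R)" using R by (simp flip: ennreal_plus)
        then have I3: "(\<integral>\<^sup>+x. N x + ennreal r * N (r * x) \<partial>lborel) = ennreal (4 * R)"
          by (subst nn_integral_add) (auto simp: IN I2)
        define k1 where "k1 = ennreal (q r) * indicator {0<..<1} r"
        define k2 where "k2 = ennreal (p r) * indicator {0<..<1} r"
        have c1: "(\<integral>\<^sup>+x. ennreal (1 + \<delta>) * (M x * k1) \<partial>lborel) = ennreal (1 + \<delta>) * (log_mass R * k1)"
          unfolding IM[symmetric] by (simp add: nn_integral_cmult nn_integral_multc)
        have c2: "(\<integral>\<^sup>+x. ennreal E * (k2 * (N x + ennreal r * N (r * x))) \<partial>lborel) = ennreal E * (k2 * ennreal (4 * R))"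
          unfolding I3[symmetric] by (simp add: nn_integral_cmult)
        have "(\<integral>\<^sup>+x. ennreal (1 + \<delta>) * (M x * k1) + ennreal E * (k2 * (N x + ennreal r * N (r * x))) \<partial>lborel)
          = (\<integral>\<^sup>+x. ennreal (1 + \<delta>) * (M x * k1) \<partial>lborel) + (\<integral>\<^sup>+x. ennreal E * (k2 * (N x + ennreal r * N (r * x))) \<partial>lborel)"
          by (rule nn_integral_add) measurable
        then show ?thesis unfolding c1 c2 unfolding k1_def[symmetric] k2_def[symmetric] by (simp only: mult_ac)
      qed simp
    qed
    also have "\<dots> = (ennreal (1 + \<delta>) * log_mass R) * (\<integral>\<^sup>+r. ennreal (q r) * indicator {0<..<1} r \<partial>lborel) + (ennreal E * ennreal (4 * R)) * (\<integral>\<^sup>+r. ennreal (p r) * indicator {0<..<1} r \<partial>lborel)"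
      by (subst nn_integral_add) (auto simp: nn_integral_cmult)
    also have "\<dots> \<le> (ennreal (1 + \<delta>) * log_mass R) * ennreal Q + (ennreal E * ennreal (4 * R)) * ennreal B"
    proof (intro add_mono mult_left_mono)
      show "(\<integral>\<^sup>+r. ennreal (q r) * indicator {0<..<1} r \<partial>lborel) \<le> ennreal Q"
        using nn_integral_hardy_Q(2)[OF s] by (simp add: q_def Q_def \<beta>_def)
      have "(\<integral>\<^sup>+r. ennreal (p r) * indicator {0<..<1} r \<partial>lborel) \<le> (\<integral>\<^sup>+r. ennreal (p r) * indicator {0..1} r \<partial>lborel)"
        by (rule nn_integral_mono) (auto simp: indicator_def)
      also have "\<dots> = ennreal B" by (rule nn_integral_has_integral_lebesgue'[OF _ Bint[folded p_def]]) (auto simp: qp)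
      finally show "(\<integral>\<^sup>+r. ennreal (p r) * indicator {0<..<1} r \<partial>lborel) \<le> ennreal B" .
    qed auto
    finally have ID: "(\<integral>\<^sup>+x. \<integral>\<^sup>+y. D x y \<partial>lborel \<partial>lborel) \<le> ennreal ((1 + \<delta>) * Q) * log_mass R + ennreal (E * (4 * R) * B)"
      using \<delta> Q E R B by (simp add: ennreal_mult' mult_ac)
    have "energy1 s u \<le> 2 * (ennreal (1 / (2 * s)) * log_mass R) + 2 * (ennreal ((1 + \<delta>) * Q) * log_mass R + ennreal (E * (4 * R) * B))"
      using order_trans[OF split add_left_mono[OF mult_left_mono[OF ID]]] unfolding IA by simp
    also have "\<dots> = (ennreal (2 * (1 / (2 * s))) + ennreal (2 * ((1 + \<delta>) * Q))) * log_mass R + ennreal (2 * (E * (4 * R) * B))"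
    proof -
      have two: "ennreal (2 * t) = 2 * ennreal t" for t by (simp add: ennreal_mult')
      show ?thesis
        unfolding two[of "1 / (2 * s)"] two[of "(1 + \<delta>) * Q"] two[of "E * (4 * R) * B"]
        by (simp only: distrib_left distrib_right mult.assoc add.assoc)
    qed
    also have "ennreal (2 * (1 / (2 * s))) + ennreal (2 * ((1 + \<delta>) * Q)) = ennreal (1 / s + 2 * (1 + \<delta>) * Q)"
      using b Q \<delta> by (simp add: mult.assoc flip: ennreal_plus)
    also have "2 * (E * (4 * R) * B) = 128 * (1 + 1 / \<delta>) * L\<^sup>2 * B / R"
      using R by (simp add: E_def power2_eq_square)
    finally show "energy1 s (log_profile (s - 1/2) (\<lambda>a. bump (a / R)))
      \<le> ennreal (1 / s + 2 * (1 + \<delta>) * (hardy_const1 s - 1 / (2 * s))) * log_mass R + ennreal (128 * (1 + 1 / \<delta>) * L\<^sup>2 * B / R)"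
      unfolding u_def \<beta>_def Q_def .
  qed
qed

section \<open>From the line to the half-space\<close>

lemma nn_integral_Basis_split:
  fixes b0 :: "'a::euclidean_space" and f g :: "real \<Rightarrow> ennreal"
  assumes b0: "b0 \<in> Basis" and [measurable]: "f \<in> borel_measurable borel" "g \<in> borel_measurable borel"
  shows "(\<integral>\<^sup>+x. f (x \<bullet> b0) * (\<Prod>b\<in>Basis - {b0}. g (x \<bullet> b)) \<partial>lborel) = (\<integral>\<^sup>+t. f t \<partial>lborel) * (\<integral>\<^sup>+t. g t \<partial>lborel) ^ (DIM('a) - 1)"
proof -
  define F where "F = (\<lambda>b. if b = b0 then f else g)"
  have [measurable]: "F b \<in> borel_measurable borel" for b by (simp add: F_def)
  have "(\<Prod>b\<in>Basis. F b (x \<bullet> b)) = f (x \<bullet> b0) * (\<Prod>b\<in>Basis - {b0}. g (x \<bullet> b))" for x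
    using b0 by (subst prod.remove[of _ b0]) (auto simp: F_def intro!: prod.cong)
  then have "(\<integral>\<^sup>+x. f (x \<bullet> b0) * (\<Prod>b\<in>Basis - {b0}. g (x \<bullet> b)) \<partial>lborel) = (\<integral>\<^sup>+x. (\<Prod>b\<in>Basis. F b (x \<bullet> b)) \<partial>lborel)"
    by simp
  also have "\<dots> = (\<Prod>b\<in>Basis. \<integral>\<^sup>+t. F b t \<partial>lborel)"
    by (rule nn_integral_lborel_prod) simp_all
  also have "\<dots> = (\<integral>\<^sup>+t. F b0 t \<partial>lborel) * (\<Prod>b\<in>Basis - {b0}. \<integral>\<^sup>+t. F b t \<partial>lborel)"
    using b0 by (subst prod.remove[of _ b0]) auto
  also have "(\<Prod>b\<in>Basis - {b0}. \<integral>\<^sup>+t. F b t \<partial>lborel) = (\<Prod>b\<in>Basis - {b0}. \<integral>\<^sup>+t. g t \<partial>lborel)"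
    by (rule prod.cong) (auto simp: F_def)
  finally show ?thesis using b0 by (simp add: F_def card_Diff_singleton)
qed

definition tang_bump :: "real \<Rightarrow> 'a::euclidean_space \<Rightarrow> 'a \<Rightarrow> real" where
  "tang_bump r b0 x = (\<Prod>b\<in>Basis - {b0}. bump (x \<bullet> b / r))"

lemma tang_bump_measurable [measurable]: "tang_bump r b0 \<in> borel_measurable borel"
  unfolding tang_bump_def[abs_def] by measurable

lemma tang_bump_bounds: "0 \<le> tang_bump r b0 x" "tang_bump r b0 x \<le> 1"
  unfolding tang_bump_def using bump_bounds by (auto intro!: prod_nonneg prod_le_1)

lemma tang_bump_support:
  assumes "r > 0" "tang_bump r b0 x \<noteq> 0" "b \<in> Basis - {b0}"
  shows "\<bar>x \<bullet> b\<bar> < r"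
proof -
  have "bump (x \<bullet> b / r) \<noteq> 0" using assms unfolding tang_bump_def by (auto simp: prod_zero_iff)
  from bump_bounds(3)[OF this] show ?thesis using assms(1) by simp
qed

definition bump_mass :: "real \<Rightarrow> ennreal" where
  "bump_mass r = (\<integral>\<^sup>+t. ennreal ((bump (t / r))\<^sup>2) \<partial>lborel)"

lemma bump_mass_bounds:
  assumes r: "r > 0"
  shows "ennreal (exp (-8) * r) \<le> bump_mass r" "bump_mass r \<le> ennreal (2 * r)"
proof -
  have "ennreal (exp (-8) * r) = ennreal (exp (-8)) * emeasure lborel {- (r / 2)..r / 2}"
    using r by (simp add: ennreal_mult')
  also have "\<dots> = (\<integral>\<^sup>+t. ennreal (exp (-8)) * indicator {- (r / 2)..r / 2} t \<partial>lborel)"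
    by (subst nn_integral_cmult) auto
  also have "\<dots> \<le> bump_mass r" unfolding bump_mass_def
  proof (rule nn_integral_mono)
    fix t :: real
    show "ennreal (exp (-8)) * indicator {- (r / 2)..r / 2} t \<le> ennreal ((bump (t / r))\<^sup>2)"
    proof (cases "t \<in> {- (r / 2)..r / 2}")
      case True
      then have "\<bar>t / r\<bar> \<le> 1/2" using r by (auto simp: abs_le_iff field_simps)
      then have "exp (-4) \<le> bump (t / r)" by (rule bump_bounds(4))
      then have "(exp (-4))\<^sup>2 \<le> (bump (t / r))\<^sup>2" by (intro power_mono) auto
      moreover have "(exp (-4))\<^sup>2 = exp (-8::real)" by (simp add: power2_eq_square exp_add[symmetric])
      ultimately show ?thesis using True by (simp add: ennreal_leI)
    qed simp
  qed
  finally show "ennreal (exp (-8) * r) \<le> bump_mass r" .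
  have "bump_mass r \<le> (\<integral>\<^sup>+t. indicator {- r..r} t \<partial>lborel)" unfolding bump_mass_def
  proof (rule nn_integral_mono)
    fix t :: real
    show "ennreal ((bump (t / r))\<^sup>2) \<le> indicator {- r..r} t"
    proof (cases "bump (t / r) = 0")
      case False
      then have "\<bar>t\<bar> < r" using bump_bounds(3)[OF False] r by simp
      then have "t \<in> {- r..r}" by auto
      moreover have "(bump (t / r))\<^sup>2 \<le> 1" using bump_bounds(1,2)[of "t / r"] by (simp add: power_le_one)
      ultimately show ?thesis by simp
    qed simp
  qed
  also have "\<dots> = ennreal (2 * r)" using r by simp
  finally show "bump_mass r \<le> ennreal (2 * r)" .
qed

text \<open>The increment of the product is the increment of \<open>u\<close> times the tangential
  bump plus \<open>u\<close> times the increment of the bump, separated by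
  \<open>square_add_le\<close>. The first part integrates, by the marginal of the kernel, to the
  one-dimensional energy. In the second the bump varies by O(min(|h|/r, 1)), and scaling gives
  r^(-2s) times a cross-section of volume r^(n - 1): negligible against
  \<open>bump_mass r ^ (DIM('a) - 1)\<close> for large r.\<close>

lemma energy_product_le:
  fixes b0 :: "'a::euclidean_space" and u :: "real \<Rightarrow> real"
  assumes s: "0 < s" "s < 1" and b0: "b0 \<in> Basis" and [measurable]: "u \<in> borel_measurable borel"
    and U: "(\<integral>\<^sup>+t. ennreal ((u t)\<^sup>2) \<partial>lborel) < \<infinity>" and \<delta>: "\<delta> > 0"
  shows "\<exists>Z\<ge>0. \<forall>r>0. (\<integral>\<^sup>+h. \<integral>\<^sup>+x. ennreal ((u ((x + h) \<bullet> b0) * tang_bump r b0 (x + h) - u (x \<bullet> b0) * tang_bump r b0 x)\<^sup>2 * riesz s h) \<partial>lborel \<partial>lborel)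
    \<le> ennreal ((1 + \<delta>) * marg_const DIM('a) s) * energy1 s u * bump_mass r ^ (DIM('a) - 1) + ennreal (Z * r powr (- (2 * s)) * r ^ (DIM('a) - 1))"
proof -
  obtain L where L: "L > 0" "\<And>x y. \<bar>bump x - bump y\<bar> \<le> L * \<bar>x - y\<bar>" using bump_Lipschitz by blast
  obtain U2 where U2: "(\<integral>\<^sup>+t. ennreal ((u t)\<^sup>2) \<partial>lborel) = ennreal U2" "0 \<le> U2"
    using U by (cases "(\<integral>\<^sup>+t. ennreal ((u t)\<^sup>2) \<partial>lborel)") auto
  obtain m where m: "(\<integral>\<^sup>+(h::'a). ennreal (min ((norm h)\<^sup>2) 1 * riesz s h) \<partial>lborel) = ennreal m" "0 \<le> m"
    using nn_integral_min_riesz_finite[OF s, where 'a='a]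
    by (cases "(\<integral>\<^sup>+(h::'a). ennreal (min ((norm h)\<^sup>2) 1 * riesz s h) \<partial>lborel)") auto
  \<comment> \<open>One constant for both bounds on the increment of the bump: at most 1, and at
    most n L |h|/r.\<close>
  define N where "N = max 1 ((real DIM('a) * L)\<^sup>2)"
  have N: "0 \<le> N" "1 \<le> N" "(real DIM('a) * L)\<^sup>2 \<le> N" by (auto simp: N_def)
  define d where "d = DIM('a) - 1"
  define Z where "Z = (1 + 1 / \<delta>) * (N * (2 * (U2 * 2 ^ d)) * m)"
  have Z: "Z \<ge> 0" using \<delta> N U2 m by (simp add: Z_def)
  show ?thesis
  proof (intro exI[of _ Z] conjI allI impI Z)
    fix r :: real assume r: "r > 0"
    define tb where "tb = tang_bump r b0"
    have [measurable]: "tb \<in> borel_measurable borel" by (simp add: tb_def)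
    \<comment> \<open>Records the tangential support as a product of indicators, so that the
      x-integral of the error term is finite and splits over the coordinates.\<close>
    define Qr where "Qr = (\<lambda>x::'a. \<Prod>b\<in>Basis - {b0}. indicator {- r..r} (x \<bullet> b) :: ennreal)"
    have [measurable]: "Qr \<in> borel_measurable borel" unfolding Qr_def by measurable
    have Q1: "Qr x = 1" if "tb x \<noteq> 0" for x
      unfolding Qr_def
    proof (rule prod.neutral, rule ballI)
      fix b assume "b \<in> Basis - {b0}"
      then have "\<bar>x \<bullet> b\<bar> < r" using tang_bump_support[OF r] that by (auto simp: tb_def)
      then have "x \<bullet> b \<in> {- r..r}" unfolding atLeastAtMost_iff by linarith
      then show "indicator {- r..r} (x \<bullet> b) = (1::ennreal)" by (rule indicator_simps(1))
    qed
    have dchi: "(tb (x + h) - tb x)\<^sup>2 \<le> N * min ((norm ((1 / r) *\<^sub>R h))\<^sup>2) 1" for x h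
    proof -
      have "norm (tb (x + h) - tb x) \<le> (\<Sum>b\<in>Basis - {b0}. norm (bump ((x + h) \<bullet> b / r) - bump (x \<bullet> b / r)))"
        unfolding tb_def tang_bump_def using bump_bounds by (intro norm_prod_diff) auto
      also have "\<dots> \<le> (\<Sum>b\<in>(Basis::'a set) - {b0}. L * norm ((1 / r) *\<^sub>R h))"
      proof (rule sum_mono)
        fix b assume "b \<in> Basis - {b0}"
        then have b: "b \<in> Basis" by auto
        have "norm (bump ((x + h) \<bullet> b / r) - bump (x \<bullet> b / r)) \<le> L * \<bar>(x + h) \<bullet> b / r - x \<bullet> b / r\<bar>"
          using L(2) by simp
        also have "(x + h) \<bullet> b / r - x \<bullet> b / r = (h \<bullet> b) / r" by (simp add: inner_add_left add_divide_distrib)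
        also have "L * \<bar>(h \<bullet> b) / r\<bar> \<le> L * norm ((1 / r) *\<^sub>R h)"
          using L(1) r Basis_le_norm[OF b, of h] by (intro mult_left_mono) (auto simp: divide_right_mono)
        finally show "norm (bump ((x + h) \<bullet> b / r) - bump (x \<bullet> b / r)) \<le> L * norm ((1 / r) *\<^sub>R h)" .
      qed
      also have "\<dots> \<le> real DIM('a) * (L * norm ((1 / r) *\<^sub>R h))"
      proof -
        have "0 \<le> L * norm ((1 / r) *\<^sub>R h)" using L(1) by simp
        moreover have "real (card (Basis - {b0})) \<le> real DIM('a)" by (intro of_nat_mono card_mono) auto
        ultimately show ?thesis unfolding sum_constant by (rule mult_right_mono[rotated])
      qed
      finally have "\<bar>tb (x + h) - tb x\<bar> \<le> \<bar>real DIM('a) * L * norm ((1 / r) *\<^sub>R h)\<bar>" using L(1) by (simp add: mult.assoc)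
      then have "(tb (x + h) - tb x)\<^sup>2 \<le> (real DIM('a) * L * norm ((1 / r) *\<^sub>R h))\<^sup>2" by (rule abs_le_square_iff[THEN iffD1])
      also have "\<dots> = (real DIM('a) * L)\<^sup>2 * (norm ((1 / r) *\<^sub>R h))\<^sup>2" by (rule power_mult_distrib)
      also have "\<dots> \<le> N * (norm ((1 / r) *\<^sub>R h))\<^sup>2" using N(3) by (rule mult_right_mono) simp
      finally have 1: "(tb (x + h) - tb x)\<^sup>2 \<le> N * (norm ((1 / r) *\<^sub>R h))\<^sup>2" .
      have "\<bar>tb (x + h) - tb x\<bar> \<le> 1"
        using tang_bump_bounds[of r b0 x] tang_bump_bounds[of r b0 "x + h"] unfolding tb_def by (simp add: abs_le_iff)
      then have "(tb (x + h) - tb x)\<^sup>2 \<le> 1" by (simp add: abs_square_le_1)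
      then have 2: "(tb (x + h) - tb x)\<^sup>2 \<le> N * 1" using N(2) by simp
      show ?thesis using 1 2 by (simp add: min_def)
    qed
    have pt: "ennreal ((u ((x + h) \<bullet> b0) * tb (x + h) - u (x \<bullet> b0) * tb x)\<^sup>2 * riesz s h)
      \<le> ennreal ((1 + \<delta>) * riesz s h) * (ennreal ((u (x \<bullet> b0 + h \<bullet> b0) - u (x \<bullet> b0))\<^sup>2) * ennreal ((tb x)\<^sup>2))
       + ennreal ((1 + 1 / \<delta>) * (N * min ((norm ((1 / r) *\<^sub>R h))\<^sup>2) 1) * riesz s h) * (ennreal ((u ((x + h) \<bullet> b0))\<^sup>2) * (Qr x + Qr (x + h)))" for x h
    proof -
      define A where "A = u (x \<bullet> b0 + h \<bullet> b0) - u (x \<bullet> b0)"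
      define B where "B = u ((x + h) \<bullet> b0)"
      define c where "c = N * min ((norm ((1 / r) *\<^sub>R h))\<^sup>2) 1"
      have c: "0 \<le> c" using N by (simp add: c_def)
      have "u ((x + h) \<bullet> b0) * tb (x + h) - u (x \<bullet> b0) * tb x = A * tb x + B * (tb (x + h) - tb x)"
        by (simp add: A_def B_def inner_add_left algebra_simps)
      then have "(u ((x + h) \<bullet> b0) * tb (x + h) - u (x \<bullet> b0) * tb x)\<^sup>2 \<le> (1 + \<delta>) * (A * tb x)\<^sup>2 + (1 + 1 / \<delta>) * (B * (tb (x + h) - tb x))\<^sup>2"
        using square_add_le[OF \<delta>] by simp
      then have "(u ((x + h) \<bullet> b0) * tb (x + h) - u (x \<bullet> b0) * tb x)\<^sup>2 * riesz s h
        \<le> ((1 + \<delta>) * (A * tb x)\<^sup>2 + (1 + 1 / \<delta>) * (B * (tb (x + h) - tb x))\<^sup>2) * riesz s h"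
        by (rule mult_right_mono) simp
      also have "\<dots> = (1 + \<delta>) * riesz s h * (A\<^sup>2 * (tb x)\<^sup>2) + (1 + 1 / \<delta>) * riesz s h * (B\<^sup>2 * (tb (x + h) - tb x)\<^sup>2)"
      proof -
        have gen: "(p * X + q * Y) * k = p * k * X + q * k * Y" for p q k X Y :: real by (simp add: algebra_simps)
        show ?thesis unfolding power_mult_distrib by (rule gen)
      qed
      finally have "ennreal ((u ((x + h) \<bullet> b0) * tb (x + h) - u (x \<bullet> b0) * tb x)\<^sup>2 * riesz s h)
        \<le> ennreal ((1 + \<delta>) * riesz s h * (A\<^sup>2 * (tb x)\<^sup>2) + (1 + 1 / \<delta>) * riesz s h * (B\<^sup>2 * (tb (x + h) - tb x)\<^sup>2))"
        by (rule ennreal_leI)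
      also have "\<dots> = ennreal ((1 + \<delta>) * riesz s h) * (ennreal (A\<^sup>2) * ennreal ((tb x)\<^sup>2)) + ennreal ((1 + 1 / \<delta>) * riesz s h * (B\<^sup>2 * (tb (x + h) - tb x)\<^sup>2))"
        using \<delta> by (subst ennreal_plus) (auto simp: ennreal_mult)
      also have "\<dots> \<le> ennreal ((1 + \<delta>) * riesz s h) * (ennreal (A\<^sup>2) * ennreal ((tb x)\<^sup>2)) + ennreal ((1 + 1 / \<delta>) * c * riesz s h) * (ennreal (B\<^sup>2) * (Qr x + Qr (x + h)))"
      proof (rule add_left_mono)
        show "ennreal ((1 + 1 / \<delta>) * riesz s h * (B\<^sup>2 * (tb (x + h) - tb x)\<^sup>2)) \<le> ennreal ((1 + 1 / \<delta>) * c * riesz s h) * (ennreal (B\<^sup>2) * (Qr x + Qr (x + h)))"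
        proof (cases "tb x = 0 \<and> tb (x + h) = 0")
          case False
          have one: "1 \<le> Qr x + Qr (x + h)"
          proof (cases "tb x = 0")
            case True
            then have "Qr (x + h) = 1" using False Q1 by blast
            then show ?thesis by (simp add: add_increasing)
          next
            case False
            then have "Qr x = 1" by (rule Q1)
            then show ?thesis by (simp add: add_increasing2)
          qed
          have "(1 + 1 / \<delta>) * riesz s h * (B\<^sup>2 * (tb (x + h) - tb x)\<^sup>2) \<le> (1 + 1 / \<delta>) * riesz s h * (B\<^sup>2 * c)"
            using \<delta> dchi[of x h] unfolding c_def by (intro mult_left_mono) auto
          then have "ennreal ((1 + 1 / \<delta>) * riesz s h * (B\<^sup>2 * (tb (x + h) - tb x)\<^sup>2)) \<le> ennreal ((1 + 1 / \<delta>) * riesz s h * (B\<^sup>2 * c))"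
            by (rule ennreal_leI)
          also have "(1 + 1 / \<delta>) * riesz s h * (B\<^sup>2 * c) = (1 + 1 / \<delta>) * c * riesz s h * B\<^sup>2" by (simp add: mult_ac)
          also have "ennreal \<dots> = ennreal ((1 + 1 / \<delta>) * c * riesz s h) * (ennreal (B\<^sup>2) * 1)"
            using \<delta> c by (subst ennreal_mult) auto
          also have "\<dots> \<le> ennreal ((1 + 1 / \<delta>) * c * riesz s h) * (ennreal (B\<^sup>2) * (Qr x + Qr (x + h)))"
            by (intro mult_left_mono one) auto
          finally show ?thesis .
        qed simp
      qed
      finally show ?thesis by (simp add: A_def B_def c_def mult.assoc)
    qed
    have [measurable]: "(\<lambda>t. indicator {- r..r} t :: ennreal) \<in> borel_measurable borel" by measurable
    have IQ: "(\<integral>\<^sup>+t. indicator {- r..r} t \<partial>lborel) = ennreal (2 * r)" using r by simp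
    have shiftu: "(\<integral>\<^sup>+t. ennreal ((u (t + a))\<^sup>2) \<partial>lborel) = ennreal U2" for a
      using nn_integral_lborel_shift[of "\<lambda>t. ennreal ((u t)\<^sup>2)" a] U2(1) by (simp add: add.commute)
    have Qint: "(\<integral>\<^sup>+x. ennreal ((u ((x + h) \<bullet> b0))\<^sup>2) * (Qr x + Qr (x + h)) \<partial>lborel) = ennreal (2 * (U2 * (2 * r) ^ d))" for h
    proof -
      have 1: "(\<integral>\<^sup>+x. ennreal ((u (x \<bullet> b0 + a))\<^sup>2) * Qr x \<partial>lborel) = ennreal (U2 * (2 * r) ^ d)" for a
      proof -
        have "(\<integral>\<^sup>+x. ennreal ((u (x \<bullet> b0 + a))\<^sup>2) * Qr x \<partial>lborel) = (\<integral>\<^sup>+t. ennreal ((u (t + a))\<^sup>2) \<partial>lborel) * (\<integral>\<^sup>+t. indicator {- r..r} t \<partial>lborel) ^ (DIM('a) - 1)"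
          unfolding Qr_def by (rule nn_integral_Basis_split[OF b0, of "\<lambda>t. ennreal ((u (t + a))\<^sup>2)" "indicator {- r..r}"]) measurable
        moreover have "ennreal (2 * r) ^ d = ennreal ((2 * r) ^ d)" using r by (intro ennreal_power) simp
        ultimately show ?thesis by (simp only: shiftu IQ d_def[symmetric] ennreal_mult'[OF U2(2)])
      qed
      have "(\<integral>\<^sup>+x. ennreal ((u ((x + h) \<bullet> b0))\<^sup>2) * (Qr x + Qr (x + h)) \<partial>lborel)
        = (\<integral>\<^sup>+x. ennreal ((u (x \<bullet> b0 + h \<bullet> b0))\<^sup>2) * Qr x \<partial>lborel) + (\<integral>\<^sup>+x. ennreal ((u ((h + x) \<bullet> b0))\<^sup>2) * Qr (h + x) \<partial>lborel)"
        by (subst nn_integral_add[symmetric]) (auto simp: distrib_left inner_add_left add.commute)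
      also have "(\<integral>\<^sup>+x. ennreal ((u ((h + x) \<bullet> b0))\<^sup>2) * Qr (h + x) \<partial>lborel) = (\<integral>\<^sup>+x. ennreal ((u (x \<bullet> b0))\<^sup>2) * Qr x \<partial>lborel)"
        by (rule nn_integral_lborel_shift[of "\<lambda>x. ennreal ((u (x \<bullet> b0))\<^sup>2) * Qr x"]) measurable
      also have "\<dots> = ennreal (U2 * (2 * r) ^ d)" using 1[of 0] by simp
      also have "(\<integral>\<^sup>+x. ennreal ((u (x \<bullet> b0 + h \<bullet> b0))\<^sup>2) * Qr x \<partial>lborel) = ennreal (U2 * (2 * r) ^ d)" by (rule 1)
      also have "ennreal (U2 * (2 * r) ^ d) + ennreal (U2 * (2 * r) ^ d) = ennreal (2 * (U2 * (2 * r) ^ d))"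
        unfolding mult_2[of "U2 * (2 * r) ^ d"] using U2(2) r by (intro ennreal_plus[symmetric]) auto
      finally show ?thesis .
    qed
    define g1 where "g1 = (\<lambda>a. \<integral>\<^sup>+t. ennreal ((u (t + a) - u t)\<^sup>2) \<partial>lborel)"
    have [measurable]: "g1 \<in> borel_measurable borel" unfolding g1_def by measurable
    have chi2: "ennreal ((tb x)\<^sup>2) = (\<Prod>b\<in>Basis - {b0}. ennreal ((bump (x \<bullet> b / r))\<^sup>2))" for x
      unfolding tb_def tang_bump_def by (simp add: prod_ennreal prod_power_distrib)
    have Gint: "(\<integral>\<^sup>+x. ennreal ((u (x \<bullet> b0 + h \<bullet> b0) - u (x \<bullet> b0))\<^sup>2) * ennreal ((tb x)\<^sup>2) \<partial>lborel) = g1 (h \<bullet> b0) * bump_mass r ^ d" for h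
      unfolding chi2 g1_def bump_mass_def d_def
      by (rule nn_integral_Basis_split[OF b0, of "\<lambda>t. ennreal ((u (t + h \<bullet> b0) - u t)\<^sup>2)" "\<lambda>t. ennreal ((bump (t / r))\<^sup>2)"]) measurable
    have E1: "(\<integral>\<^sup>+a. g1 a * ennreal (1 / \<bar>a\<bar> powr (1 + 2 * s)) \<partial>lborel) = energy1 s u"
    proof -
      have "(\<integral>\<^sup>+a. g1 a * ennreal (1 / \<bar>a\<bar> powr (1 + 2 * s)) \<partial>lborel) = (\<integral>\<^sup>+a. \<integral>\<^sup>+t. ennreal ((u (t + a) - u t)\<^sup>2 / \<bar>a\<bar> powr (1 + 2 * s)) \<partial>lborel \<partial>lborel)"
        unfolding g1_def by (subst nn_integral_multc[symmetric], measurable) (simp flip: ennreal_mult')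
      also have "\<dots> = energy1 s u" unfolding energy1_def by (rule lborel_pair.Fubini') measurable
      finally show ?thesis .
    qed
    have "(\<integral>\<^sup>+h. \<integral>\<^sup>+x. ennreal ((u ((x + h) \<bullet> b0) * tb (x + h) - u (x \<bullet> b0) * tb x)\<^sup>2 * riesz s h) \<partial>lborel \<partial>lborel)
      \<le> (\<integral>\<^sup>+h. \<integral>\<^sup>+x. ennreal ((1 + \<delta>) * riesz s h) * (ennreal ((u (x \<bullet> b0 + h \<bullet> b0) - u (x \<bullet> b0))\<^sup>2) * ennreal ((tb x)\<^sup>2))
       + ennreal ((1 + 1 / \<delta>) * (N * min ((norm ((1 / r) *\<^sub>R h))\<^sup>2) 1) * riesz s h) * (ennreal ((u ((x + h) \<bullet> b0))\<^sup>2) * (Qr x + Qr (x + h))) \<partial>lborel \<partial>lborel)"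
      by (intro nn_integral_mono pt)
    also have "\<dots> = (\<integral>\<^sup>+h. (ennreal (1 + \<delta>) * bump_mass r ^ d) * (g1 (h \<bullet> b0) * ennreal (riesz s h))
       + ennreal ((1 + 1 / \<delta>) * N * (2 * (U2 * (2 * r) ^ d))) * (ennreal (min ((norm ((1 / r) *\<^sub>R h))\<^sup>2) 1) * ennreal (riesz s h)) \<partial>lborel)"
    proof (rule nn_integral_cong)
      fix h :: 'a
      have e1: "ennreal ((1 + \<delta>) * riesz s h) * (g1 (h \<bullet> b0) * bump_mass r ^ d) = (ennreal (1 + \<delta>) * bump_mass r ^ d) * (g1 (h \<bullet> b0) * ennreal (riesz s h))"
        using \<delta> by (simp add: ennreal_mult mult_ac)
      have e2: "ennreal ((1 + 1 / \<delta>) * (N * min ((norm ((1 / r) *\<^sub>R h))\<^sup>2) 1) * riesz s h) * ennreal (2 * (U2 * (2 * r) ^ d))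
        = ennreal ((1 + 1 / \<delta>) * N * (2 * (U2 * (2 * r) ^ d))) * (ennreal (min ((norm ((1 / r) *\<^sub>R h))\<^sup>2) 1) * ennreal (riesz s h))"
      proof -
        have nn: "0 \<le> (1 + 1 / \<delta>) * N * (2 * (U2 * (2 * r) ^ d))" "0 \<le> (1 + 1 / \<delta>) * (N * min ((norm ((1 / r) *\<^sub>R h))\<^sup>2) 1) * riesz s h"
          "0 \<le> min ((norm ((1 / r) *\<^sub>R h))\<^sup>2) 1 * riesz s h" using \<delta> N U2(2) r by auto
        have "ennreal ((1 + 1 / \<delta>) * (N * min ((norm ((1 / r) *\<^sub>R h))\<^sup>2) 1) * riesz s h) * ennreal (2 * (U2 * (2 * r) ^ d))
          = ennreal ((1 + 1 / \<delta>) * (N * min ((norm ((1 / r) *\<^sub>R h))\<^sup>2) 1) * riesz s h * (2 * (U2 * (2 * r) ^ d)))"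
          by (rule ennreal_mult'[symmetric]) (rule nn(2))
        also have "(1 + 1 / \<delta>) * (N * min ((norm ((1 / r) *\<^sub>R h))\<^sup>2) 1) * riesz s h * (2 * (U2 * (2 * r) ^ d))
          = ((1 + 1 / \<delta>) * N * (2 * (U2 * (2 * r) ^ d))) * (min ((norm ((1 / r) *\<^sub>R h))\<^sup>2) 1 * riesz s h)" by (simp only: mult_ac)
        also have "ennreal \<dots> = ennreal ((1 + 1 / \<delta>) * N * (2 * (U2 * (2 * r) ^ d))) * ennreal (min ((norm ((1 / r) *\<^sub>R h))\<^sup>2) 1 * riesz s h)"
          by (rule ennreal_mult'[OF nn(1)])
        also have "ennreal (min ((norm ((1 / r) *\<^sub>R h))\<^sup>2) 1 * riesz s h) = ennreal (min ((norm ((1 / r) *\<^sub>R h))\<^sup>2) 1) * ennreal (riesz s h)"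
          by (rule ennreal_mult') simp
        finally show ?thesis .
      qed
      show "(\<integral>\<^sup>+x. ennreal ((1 + \<delta>) * riesz s h) * (ennreal ((u (x \<bullet> b0 + h \<bullet> b0) - u (x \<bullet> b0))\<^sup>2) * ennreal ((tb x)\<^sup>2))
       + ennreal ((1 + 1 / \<delta>) * (N * min ((norm ((1 / r) *\<^sub>R h))\<^sup>2) 1) * riesz s h) * (ennreal ((u ((x + h) \<bullet> b0))\<^sup>2) * (Qr x + Qr (x + h))) \<partial>lborel)
       = (ennreal (1 + \<delta>) * bump_mass r ^ d) * (g1 (h \<bullet> b0) * ennreal (riesz s h))
       + ennreal ((1 + 1 / \<delta>) * N * (2 * (U2 * (2 * r) ^ d))) * (ennreal (min ((norm ((1 / r) *\<^sub>R h))\<^sup>2) 1) * ennreal (riesz s h))"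
        unfolding e1[symmetric] e2[symmetric] Gint[symmetric] Qint[symmetric, of h]
        by (subst nn_integral_add, measurable) (subst nn_integral_cmult, measurable, subst nn_integral_cmult, measurable)
    qed
    also have "\<dots> = (ennreal (1 + \<delta>) * bump_mass r ^ d) * (\<integral>\<^sup>+h. g1 (h \<bullet> b0) * ennreal (riesz s h) \<partial>lborel)
       + ennreal ((1 + 1 / \<delta>) * N * (2 * (U2 * (2 * r) ^ d))) * (\<integral>\<^sup>+(h::'a). ennreal (min ((norm ((1 / r) *\<^sub>R h))\<^sup>2) 1) * ennreal (riesz s h) \<partial>lborel)"
      by (subst nn_integral_add, measurable) (subst nn_integral_cmult, measurable, subst nn_integral_cmult, measurable)
    also have "(\<integral>\<^sup>+h. g1 (h \<bullet> b0) * ennreal (riesz s h) \<partial>lborel) = ennreal (marg_const DIM('a) s) * energy1 s u"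
      using nn_integral_inner_riesz_Basis[OF b0 _ s(1), of g1] E1 by simp
    also have "(\<integral>\<^sup>+(h::'a). ennreal (min ((norm ((1 / r) *\<^sub>R h))\<^sup>2) 1) * ennreal (riesz s h) \<partial>lborel) = ennreal (r powr (- (2 * s)) * m)"
    proof -
      have "(\<integral>\<^sup>+(h::'a). ennreal (min ((norm ((1 / r) *\<^sub>R h))\<^sup>2) 1) * ennreal (riesz s h) \<partial>lborel)
        = ennreal ((1 / r) powr (2 * s)) * (\<integral>\<^sup>+(h::'a). ennreal (min ((norm h)\<^sup>2) 1) * ennreal (riesz s h) \<partial>lborel)"
        using r by (intro nn_integral_riesz_scale[of "\<lambda>h. ennreal (min ((norm h)\<^sup>2) 1)"]) auto
      also have "(\<integral>\<^sup>+(h::'a). ennreal (min ((norm h)\<^sup>2) 1) * ennreal (riesz s h) \<partial>lborel) = ennreal m"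
        unfolding m(1)[symmetric] by (simp add: ennreal_mult)
      also have "(1 / r) powr (2 * s) = r powr (- (2 * s))"
        using r by (subst powr_divide) (auto simp: powr_minus inverse_eq_divide)
      finally show ?thesis by (simp add: ennreal_mult')
    qed
    also have "ennreal ((1 + 1 / \<delta>) * N * (2 * (U2 * (2 * r) ^ d))) * ennreal (r powr (- (2 * s)) * m) = ennreal (Z * r powr (- (2 * s)) * r ^ d)"
      using \<delta> N U2(2) r by (subst ennreal_mult'[symmetric]) (auto simp: Z_def power_mult_distrib mult_ac)
    also have "(ennreal (1 + \<delta>) * bump_mass r ^ d) * (ennreal (marg_const DIM('a) s) * energy1 s u) = ennreal ((1 + \<delta>) * marg_const DIM('a) s) * energy1 s u * bump_mass r ^ d"
      using \<delta> by (simp add: ennreal_mult' mult_ac)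
    finally show "(\<integral>\<^sup>+h. \<integral>\<^sup>+x. ennreal ((u ((x + h) \<bullet> b0) * tang_bump r b0 (x + h) - u (x \<bullet> b0) * tang_bump r b0 x)\<^sup>2 * riesz s h) \<partial>lborel \<partial>lborel)
    \<le> ennreal ((1 + \<delta>) * marg_const DIM('a) s) * energy1 s u * bump_mass r ^ (DIM('a) - 1) + ennreal (Z * r powr (- (2 * s)) * r ^ (DIM('a) - 1))"
      unfolding tb_def d_def .
  qed
qed

text \<open>The slack \<eta> between C and the sharp constant is spent in three steps: \<eta>/2 on
  the splitting parameter \<delta>, \<eta>/8 on the logarithmic length R, \<eta>/8 on the tangential
  width r. The order matters: the error constant \<open>Ca\<close> depends on \<delta>, and
  \<open>Z\<close> depends on the profile and hence on R.\<close>

lemma halfspace_trial_function: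
  fixes b0 :: "'a::euclidean_space"
  assumes s: "1/2 \<le> s" "s < 1" and b0: "b0 \<in> Basis" and C: "k_const DIM('a) s < C"
  shows "\<exists>\<phi>::'a \<Rightarrow> real. (\<forall>k. C_diff k \<phi>) \<and> (\<exists>m>0. \<exists>M>0. \<forall>x. \<phi> x \<noteq> 0 \<longrightarrow> m \<le> x \<bullet> b0 \<and> norm x \<le> M) \<and>
    (\<exists>E H. (\<integral>\<^sup>+h. \<integral>\<^sup>+x. ennreal ((\<phi> (x + h) - \<phi> x)\<^sup>2 * riesz s h) \<partial>lborel \<partial>lborel) \<le> ennreal E \<and> 0 \<le> E \<and>
      (\<integral>\<^sup>+x. ennreal ((\<phi> x)\<^sup>2 / (x \<bullet> b0) powr (2 * s)) \<partial>lborel) = ennreal H \<and> 0 \<le> H \<and> E < C * H)"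
proof -
  define hc where "hc = hardy_const1 s"
  define Q where "Q = hc - 1 / (2 * s)"
  define K where "K = marg_const DIM('a) s"
  define \<beta> where "\<beta> = s - 1/2"
  have s0: "0 < s" using s by simp
  have Q: "0 \<le> Q" unfolding Q_def hc_def by (rule nn_integral_hardy_Q(1)[OF s])
  have hcQ: "1 / s + 2 * Q = 2 * hc" using s0 by (simp add: Q_def field_simps)
  have "0 < 1 / s" using s0 by simp
  then have hc: "0 < hc" using Q hcQ by linarith
  have K: "0 < K" unfolding K_def by (rule marg_const_pos[OF s0])
  \<comment> \<open>Dividing by the marginal constant K reduces everything to the one-dimensional
    constant 2 hc = 1/s + 2Q.\<close>
  define \<eta> where "\<eta> = C / K - 2 * hc"
  have "k_const DIM('a) s = K * (2 * hc)" using k_const_eq[of s "DIM('a)"] s s0 by (simp add: K_def hc_def)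
  then have "2 * hc < C / K" using C K by (simp add: field_simps)
  then have \<eta>: "\<eta> > 0" by (simp add: \<eta>_def)
  have CK: "C = K * (2 * hc + \<eta>)" using K by (simp add: \<eta>_def)
  \<comment> \<open>The factor 1 + \<delta> is paid twice, in the one-dimensional energy and in the
    product estimate. For \<delta> <= 1, (1 + \<delta>)^2 2 hc <= 2 hc + 6 hc \<delta>, and the
    excess is at most \<eta>/2.\<close>
  define \<delta> where "\<delta> = min 1 (\<eta> / (12 * hc))"
  have \<delta>: "0 < \<delta>" "\<delta> \<le> 1" using \<eta> hc by (auto simp: \<delta>_def)
  have "\<delta> \<le> \<eta> / (12 * hc)" by (simp add: \<delta>_def)
  then have \<delta>hc: "6 * hc * \<delta> \<le> \<eta> / 2" using hc by (simp add: field_simps)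
  obtain Ca where Ca: "Ca \<ge> 0" and en: "\<And>R. R > 0 \<Longrightarrow> energy1 s (log_profile \<beta> (\<lambda>a. bump (a / R)))
    \<le> ennreal (1 / s + 2 * (1 + \<delta>) * Q) * log_mass R + ennreal (Ca / R)"
    using energy1_log_profile_le[OF s \<delta>(1)] unfolding \<beta>_def Q_def hc_def by blast
  \<comment> \<open>Makes (1 + \<delta>) Ca <= (\<eta>/8) exp(-8) R, which is at most \<eta>/8 times
    the Hardy mass; R >= 1 allows Ca / R to be bounded by Ca.\<close>
  define R where "R = 1 + (1 + \<delta>) * Ca * 8 / (\<eta> * exp (-8))"
  have R1: "R \<ge> 1" using \<delta> Ca \<eta> by (simp add: R_def)
  then have R: "R > 0" by simp
  have "\<eta> * exp (-8) * R = \<eta> * exp (-8) + (1 + \<delta>) * Ca * 8" using \<eta> by (simp add: R_def distrib_left)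
  then have RC: "(1 + \<delta>) * Ca \<le> \<eta> / 8 * (exp (-8) * R)"
    using mult_pos_pos[OF \<eta> exp_gt_zero[of "-8 :: real"]] by (simp add: algebra_simps)
  have RC': "(1 + \<delta>) * (Ca / R) \<le> (1 + \<delta>) * Ca"
    using R1 Ca \<delta> by (intro mult_left_mono) (auto simp: divide_le_eq mult_left_le mult_le_cancel_left1)
  define u where "u = log_profile \<beta> (\<lambda>a. bump (a / R))"
  define i where "i = enn2real (log_mass R)"
  have I: "log_mass R = ennreal i" "exp (-8) * R \<le> i"
  proof -
    have lt: "log_mass R < \<top>" using log_mass_bounds(2)[OF R] by (rule le_less_trans) simp
    then show 1: "log_mass R = ennreal i" by (simp add: i_def)
    have "ennreal (exp (-8) * R) \<le> ennreal i" using log_mass_bounds(1)[OF R] 1 by simp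
    then show "exp (-8) * R \<le> i" by (subst (asm) ennreal_le_iff) (simp_all add: i_def)
  qed
  have "0 < exp (-8) * R" using R by simp
  then have i: "i > 0" using I(2) by linarith
  define e1 where "e1 = (1 / s + 2 * (1 + \<delta>) * Q) * i + Ca / R"
  have cc: "0 \<le> 1 / s + 2 * (1 + \<delta>) * Q" using s0 Q \<delta> by simp
  have e1: "energy1 s u \<le> ennreal e1" "0 \<le> e1"
  proof -
    have "energy1 s u \<le> ennreal (1 / s + 2 * (1 + \<delta>) * Q) * ennreal i + ennreal (Ca / R)"
      using en[OF R] unfolding u_def I(1) .
    also have "\<dots> = ennreal e1" unfolding e1_def using cc i Ca R by (simp add: ennreal_mult' ennreal_plus)
    finally show "energy1 s u \<le> ennreal e1" .
    show "0 \<le> e1" unfolding e1_def using cc i Ca R by simp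
  qed
  have e1le: "(1 + \<delta>) * e1 \<le> (2 * hc + \<eta> / 2 + \<eta> / 8) * i"
  proof -
    have "1 * (1 / s) \<le> (1 + \<delta>) * (1 / s)" using \<delta> s0 by (intro mult_right_mono) auto
    moreover have "2 * (1 + \<delta>) * Q = (1 + \<delta>) * (2 * Q)" by simp
    ultimately have "1 / s + 2 * (1 + \<delta>) * Q \<le> (1 + \<delta>) * (1 / s + 2 * Q)"
      unfolding distrib_left[of "1 + \<delta>"] by linarith
    then have "(1 + \<delta>) * (1 / s + 2 * (1 + \<delta>) * Q) \<le> (1 + \<delta>) * ((1 + \<delta>) * (2 * hc))"
      unfolding hcQ using \<delta> by (intro mult_left_mono) auto
    also have "\<dots> = 2 * hc + (4 * hc * \<delta> + 2 * hc * (\<delta> * \<delta>))" by (simp add: algebra_simps)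
    also have "\<dots> \<le> 2 * hc + (4 * hc * \<delta> + 2 * hc * (\<delta> * 1))"
      using \<delta> hc by (intro add_left_mono mult_left_mono) auto
    also have "\<dots> \<le> 2 * hc + \<eta> / 2" using \<delta>hc by (simp add: mult.commute)
    finally have "(1 + \<delta>) * (1 / s + 2 * (1 + \<delta>) * Q) * i \<le> (2 * hc + \<eta> / 2) * i" using i by (intro mult_right_mono) auto
    moreover have "(1 + \<delta>) * (Ca / R) \<le> \<eta> / 8 * i"
      using order_trans[OF RC' order_trans[OF RC mult_left_mono[OF I(2), of "\<eta> / 8"]]] \<eta> by simp
    ultimately have "(1 + \<delta>) * (1 / s + 2 * (1 + \<delta>) * Q) * i + (1 + \<delta>) * (Ca / R)
      \<le> (2 * hc + \<eta> / 2) * i + \<eta> / 8 * i" by (rule add_mono)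
    then show ?thesis
      unfolding e1_def distrib_left[of "1 + \<delta>" "(1 / s + 2 * (1 + \<delta>) * Q) * i" "Ca / R"]
        distrib_right[of "2 * hc + \<eta> / 2" "\<eta> / 8" i] by (simp only: mult.assoc)
  qed
  have \<theta>C: "C_diff k (\<lambda>a. bump (a / R))" for k
    using C_diff_affine_compose[OF bounded_linear.linear[OF bounded_linear_scaleR_right[of "1 / R"]] C_diff_bump, of k 0] by simp
  have \<theta>0: "bump (x / R) = 0" if "x < - R" for x
  proof (rule ccontr)
    assume "bump (x / R) \<noteq> 0"
    then have "\<bar>x / R\<bar> < 1" by (rule bump_bounds(3))
    then have "- 1 < x / R" unfolding abs_less_iff by linarith
    then show False using that R by (simp add: field_simps)
  qed
  have uC: "C_diff k u" for k unfolding u_def by (rule C_diff_log_profile[of _ R]) (use \<theta>C \<theta>0 in auto)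
  have [measurable]: "u \<in> borel_measurable borel" using uC[of 0] by (intro borel_measurable_continuous_onI) simp
  have u_pos: "u t = t powr \<beta> * log_bump R t" if "t > 0" for t using that by (simp add: u_def log_profile_def log_bump_def)
  have u_neg: "u t = 0" if "t \<le> 0" for t using that by (simp add: u_def log_profile_def)
  have u2: "ennreal ((u t)\<^sup>2 / t powr (2 * s)) = indicator {0<..} t * ennreal ((log_bump R t)\<^sup>2 / t)" for t
  proof (cases "t > 0")
    case True
    have e: "2 * s = \<beta> + \<beta> + 1" by (simp add: \<beta>_def)
    have "t powr (2 * s) = t powr \<beta> * t powr \<beta> * t" unfolding e powr_add using True by simp
    then show ?thesis using True by (simp add: u_pos power2_eq_square)
  qed (simp add: u_neg)
  have Iu: "(\<integral>\<^sup>+t. ennreal ((u t)\<^sup>2 / t powr (2 * s)) \<partial>lborel) = ennreal i"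
    unfolding u2 I(1)[symmetric] log_mass_def ..
  have U: "(\<integral>\<^sup>+t. ennreal ((u t)\<^sup>2) \<partial>lborel) < \<infinity>"
  proof -
    have "(\<integral>\<^sup>+t. ennreal ((u t)\<^sup>2) \<partial>lborel) \<le> (\<integral>\<^sup>+t. ennreal (exp R powr (2 * s)) * ennreal ((u t)\<^sup>2 / t powr (2 * s)) \<partial>lborel)"
    proof (rule nn_integral_mono)
      fix t :: real
      show "ennreal ((u t)\<^sup>2) \<le> ennreal (exp R powr (2 * s)) * ennreal ((u t)\<^sup>2 / t powr (2 * s))"
      proof (cases "t > 0 \<and> log_bump R t \<noteq> 0")
        case True
        then have "t < exp R" using log_bump_support(2)[OF R, of t] by simp
        then have "t powr (2 * s) \<le> exp R powr (2 * s)" using True s0 by (intro powr_mono2) auto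
        then have "(u t)\<^sup>2 / t powr (2 * s) * t powr (2 * s) \<le> (u t)\<^sup>2 / t powr (2 * s) * exp R powr (2 * s)"
          by (intro mult_left_mono) auto
        then have "(u t)\<^sup>2 \<le> exp R powr (2 * s) * ((u t)\<^sup>2 / t powr (2 * s))" using True by (simp add: mult.commute)
        then show ?thesis by (simp add: ennreal_leI flip: ennreal_mult')
      next
        case False
        then have "u t = 0" using u_pos[of t] u_neg[of t] by (cases "t > 0") auto
        then show ?thesis by simp
      qed
    qed
    also have "\<dots> = ennreal (exp R powr (2 * s)) * ennreal i" unfolding Iu[symmetric] by (rule nn_integral_cmult) measurable
    also have "\<dots> < \<infinity>" by (simp add: ennreal_mult_less_top)
    finally show ?thesis .
  qed
  define d where "d = DIM('a) - 1"
  obtain Z where Z: "Z \<ge> 0" and prodle: "\<And>r. r > 0 \<Longrightarrow> (\<integral>\<^sup>+h. \<integral>\<^sup>+x. ennreal ((u ((x + h) \<bullet> b0) * tang_bump r b0 (x + h) - u (x \<bullet> b0) * tang_bump r b0 x)\<^sup>2 * riesz s h) \<partial>lborel \<partial>lborel)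
    \<le> ennreal ((1 + \<delta>) * K) * energy1 s u * bump_mass r ^ d + ennreal (Z * r powr (- (2 * s)) * r ^ d)"
    using energy_product_le[OF s0 s(2) b0 _ U \<delta>(1)] unfolding K_def d_def by auto
  \<comment> \<open>The admissible tangential error per unit of r^d, computed from the lower bound
    exp(-8) r on the one-dimensional bump mass.\<close>
  define \<zeta> where "\<zeta> = K * (\<eta> / 8) * i * exp (-8) ^ d"
  have \<zeta>: "\<zeta> > 0" using K \<eta> i by (simp add: \<zeta>_def)
  \<comment> \<open>Since 2s >= 1 and r >= 1, r^(-2s) <= 1/r, so Z r^(-2s) <= Z/r <=
    \<zeta>.\<close>
  define r where "r = 1 + Z / \<zeta>"
  have r1: "r \<ge> 1" using Z \<zeta> by (simp add: r_def)
  then have r: "r > 0" by simp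
  have "Z \<le> \<zeta> * r" using \<zeta> by (simp add: r_def distrib_left)
  moreover have "r powr (- (2 * s)) \<le> r powr (-1)" using r1 s by (intro powr_mono) auto
  moreover have "r powr (-1) = 1 / r" using r by (simp add: powr_minus divide_inverse)
  ultimately have "Z * r powr (- (2 * s)) \<le> \<zeta> * r * (1 / r)" using Z \<zeta> r by (intro mult_mono) auto
  then have Zr: "Z * r powr (- (2 * s)) \<le> \<zeta>" using r by simp
  define x1 where "x1 = enn2real (bump_mass r)"
  have x1: "bump_mass r = ennreal x1" "exp (-8) * r \<le> x1"
  proof -
    have lt: "bump_mass r < \<top>" using bump_mass_bounds(2)[OF r] by (rule le_less_trans) simp
    then show 1: "bump_mass r = ennreal x1" by (simp add: x1_def)
    have "ennreal (exp (-8) * r) \<le> ennreal x1" using bump_mass_bounds(1)[OF r] 1 by simp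
    then show "exp (-8) * r \<le> x1" by (subst (asm) ennreal_le_iff) (simp_all add: x1_def)
  qed
  have "0 < exp (-8) * r" using r by simp
  then have x1p: "x1 > 0" using x1(2) by linarith
  define X where "X = x1 ^ d"
  have X: "X > 0" using x1p by (simp add: X_def)
  have bm: "bump_mass r ^ d = ennreal X" unfolding x1(1) X_def using x1p by (simp add: ennreal_power)
  have Xge: "exp (-8) ^ d * r ^ d \<le> X"
    unfolding X_def power_mult_distrib[symmetric] using x1(2) r by (intro power_mono) auto
  define \<phi> where "\<phi> = (\<lambda>x. u (x \<bullet> b0) * tang_bump r b0 x)"
  define E where "E = (1 + \<delta>) * K * e1 * X + Z * r powr (- (2 * s)) * r ^ d"
  have E0: "0 \<le> E" unfolding E_def using \<delta> K e1(2) X Z r by simp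
  have Ele: "(\<integral>\<^sup>+h. \<integral>\<^sup>+x. ennreal ((\<phi> (x + h) - \<phi> x)\<^sup>2 * riesz s h) \<partial>lborel \<partial>lborel) \<le> ennreal E"
  proof -
    have "(\<integral>\<^sup>+h. \<integral>\<^sup>+x. ennreal ((\<phi> (x + h) - \<phi> x)\<^sup>2 * riesz s h) \<partial>lborel \<partial>lborel)
      \<le> ennreal ((1 + \<delta>) * K) * energy1 s u * ennreal X + ennreal (Z * r powr (- (2 * s)) * r ^ d)"
      using prodle[OF r] unfolding bm \<phi>_def .
    also have "\<dots> \<le> ennreal ((1 + \<delta>) * K) * ennreal e1 * ennreal X + ennreal (Z * r powr (- (2 * s)) * r ^ d)"
      by (intro add_right_mono mult_right_mono mult_left_mono e1) auto
    also have "\<dots> = ennreal ((1 + \<delta>) * K * e1 * X) + ennreal (Z * r powr (- (2 * s)) * r ^ d)"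
      using \<delta> K e1(2) X by (simp only: ennreal_mult' mult_nonneg_nonneg add_nonneg_nonneg zero_le_one less_imp_le)
    also have "\<dots> = ennreal E" unfolding E_def using \<delta> K e1(2) X Z r by (intro ennreal_plus[symmetric]) auto
    finally show ?thesis .
  qed
  have H: "(\<integral>\<^sup>+x. ennreal ((\<phi> x)\<^sup>2 / (x \<bullet> b0) powr (2 * s)) \<partial>lborel) = ennreal (i * X)"
  proof -
    have t2: "ennreal ((tang_bump r b0 x)\<^sup>2) = (\<Prod>b\<in>Basis - {b0}. ennreal ((bump (x \<bullet> b / r))\<^sup>2))" for x
      unfolding tang_bump_def by (simp add: prod_ennreal prod_power_distrib)
    have "(\<integral>\<^sup>+x. ennreal ((\<phi> x)\<^sup>2 / (x \<bullet> b0) powr (2 * s)) \<partial>lborel)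
      = (\<integral>\<^sup>+x. ennreal ((u (x \<bullet> b0))\<^sup>2 / (x \<bullet> b0) powr (2 * s)) * (\<Prod>b\<in>Basis - {b0}. ennreal ((bump (x \<bullet> b / r))\<^sup>2)) \<partial>lborel)"
      unfolding t2[symmetric] by (rule nn_integral_cong) (simp add: \<phi>_def power_mult_distrib flip: ennreal_mult')
    also have "\<dots> = ennreal i * bump_mass r ^ d"
      unfolding Iu[symmetric] bump_mass_def d_def
      by (rule nn_integral_Basis_split[OF b0, of "\<lambda>t. ennreal ((u t)\<^sup>2 / t powr (2 * s))" "\<lambda>t. ennreal ((bump (t / r))\<^sup>2)"]) measurable
    finally show ?thesis unfolding bm using i by (simp add: ennreal_mult')
  qed
  have lt: "E < C * (i * X)"
  proof -
    have "(1 + \<delta>) * K * e1 * X = ((1 + \<delta>) * e1) * (K * X)" by simp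
    also have "\<dots> \<le> ((2 * hc + \<eta> / 2 + \<eta> / 8) * i) * (K * X)" using e1le K X by (intro mult_right_mono) auto
    finally have 1: "(1 + \<delta>) * K * e1 * X \<le> ((2 * hc + \<eta> / 2 + \<eta> / 8) * i) * (K * X)" .
    have "Z * r powr (- (2 * s)) * r ^ d \<le> \<zeta> * r ^ d" using Zr r by (intro mult_right_mono) auto
    also have "\<dots> = K * (\<eta> / 8) * i * (exp (-8) ^ d * r ^ d)" by (simp add: \<zeta>_def)
    also have "\<dots> \<le> K * (\<eta> / 8) * i * X" using Xge K \<eta> i by (intro mult_left_mono) auto
    finally have "E \<le> ((2 * hc + \<eta> / 2 + \<eta> / 8) * i) * (K * X) + K * (\<eta> / 8) * i * X" using 1 unfolding E_def by linarith
    also have "\<dots> = (K * i * X) * (2 * hc + 3 / 4 * \<eta>)" by (simp add: algebra_simps)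
    also have "\<dots> < (K * i * X) * (2 * hc + \<eta>)" using K i X \<eta> by (intro mult_strict_left_mono) auto
    also have "\<dots> = C * (i * X)" by (simp add: CK)
    finally show ?thesis .
  qed
  have C\<phi>: "C_diff k \<phi>" for k
    unfolding \<phi>_def tang_bump_def
  proof (intro C_diff_mult C_diff_prod)
    show "C_diff k (\<lambda>x. u (x \<bullet> b0))"
      using C_diff_affine_compose[OF _ uC, of "\<lambda>x. x \<bullet> b0" k 0] by (simp add: bounded_linear.linear bounded_linear_inner_left)
    show "C_diff k (\<lambda>x. bump (x \<bullet> b / r))" for b
    proof -
      have "linear (\<lambda>x. (1 / r) *\<^sub>R (x \<bullet> b))"
        by (intro linear_compose_scale_right bounded_linear.linear bounded_linear_inner_left)
      from C_diff_affine_compose[OF this C_diff_bump, of k 0] show ?thesis by simp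
    qed
  qed
  have supp: "exp (- R) \<le> x \<bullet> b0 \<and> norm x \<le> real DIM('a) * (exp R + r)" if nz: "\<phi> x \<noteq> 0" for x
  proof -
    have un: "u (x \<bullet> b0) \<noteq> 0" and tn: "tang_bump r b0 x \<noteq> 0" using nz by (auto simp: \<phi>_def)
    then have p: "x \<bullet> b0 > 0" using u_neg[of "x \<bullet> b0"] by (meson not_less)
    then have "log_bump R (x \<bullet> b0) \<noteq> 0" using un u_pos by auto
    note lb = log_bump_support[OF R p this]
    have "norm x \<le> (\<Sum>b\<in>Basis. \<bar>x \<bullet> b\<bar>)" by (rule norm_le_l1)
    also have "\<dots> \<le> (\<Sum>b\<in>(Basis :: 'a set). exp R + r)"
    proof (rule sum_mono)
      fix b :: 'a assume b: "b \<in> Basis"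
      show "\<bar>x \<bullet> b\<bar> \<le> exp R + r"
      proof (cases "b = b0")
        case True
        then show ?thesis using lb p r by simp
      next
        case False
        then have "\<bar>x \<bullet> b\<bar> < r" using tang_bump_support[OF r tn] b by simp
        then show ?thesis using exp_gt_zero[of R] by linarith
      qed
    qed
    also have "\<dots> = real DIM('a) * (exp R + r)" by simp
    finally show ?thesis using lb by simp
  qed
  have Mp: "0 < real DIM('a) * (exp R + r)" using add_pos_pos[OF exp_gt_zero[of R] r] by (intro mult_pos_pos) auto
  have iX: "0 \<le> i * X" using i X by simp
  have "\<exists>m>0. \<exists>M>0. \<forall>x. \<phi> x \<noteq> 0 \<longrightarrow> m \<le> x \<bullet> b0 \<and> norm x \<le> M"
    using supp Mp exp_gt_zero[of "- R"] by blast
  moreover have "\<exists>E H. (\<integral>\<^sup>+h. \<integral>\<^sup>+x. ennreal ((\<phi> (x + h) - \<phi> x)\<^sup>2 * riesz s h) \<partial>lborel \<partial>lborel) \<le> ennreal E \<and> 0 \<le> E \<and>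
      (\<integral>\<^sup>+x. ennreal ((\<phi> x)\<^sup>2 / (x \<bullet> b0) powr (2 * s)) \<partial>lborel) = ennreal H \<and> 0 \<le> H \<and> E < C * H"
    using Ele E0 H iX lt by blast
  ultimately show ?thesis using C\<phi> by blast
qed

section \<open>Optimality\<close>

text \<open>Near \<open>p\<close> the domain is \<open>{x. 0 < G x}\<close> with \<open>G\<close> differentiable at \<open>p\<close>, and \<open>e\<close> is the normalised gradient.\<close>

lemma C1_boundary_blow_up:
  fixes \<Omega> :: "'a::euclidean_space set"
  assumes \<Omega>: "open \<Omega>" and p: "p \<in> frontier \<Omega>" and r: "0 < r" and \<nu>: "norm \<nu> = 1" and g: "C_diff 1 g"
    and fr: "ball p r \<inter> frontier \<Omega> = ball p r \<inter> graph_over \<nu> g"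
    and ab: "ball p r \<inter> \<Omega> = ball p r \<inter> above_graph \<nu> g"
  shows "\<exists>e. norm e = 1 \<and> (\<forall>m>0. \<forall>M>0. \<forall>\<kappa>>0. \<exists>\<epsilon>>0. \<forall>h. norm h \<le> M \<longrightarrow> m \<le> h \<bullet> e \<longrightarrow>
    p + \<epsilon> *\<^sub>R h \<in> \<Omega> \<and> bdist \<Omega> (p + \<epsilon> *\<^sub>R h) \<le> \<epsilon> * ((1 + \<kappa>) * (h \<bullet> e)))"
proof -
  have \<nu>\<nu>: "\<nu> \<bullet> \<nu> = 1" using \<nu> by (simp add: norm_eq_1)
  define G where "G = (\<lambda>x. x \<bullet> \<nu> - g (hproj \<nu> x))"
  define g' where "g' = frechet_derivative g (at (hproj \<nu> p))"
  have dg: "(g has_derivative g') (at (hproj \<nu> p))" unfolding g'_def using g by (intro C_diff_SucD[of 0]) simp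
  have lin: "linear (hproj \<nu>)" by (rule linearI) (simp_all add: hproj_def inner_add_left algebra_simps)
  define A where "A = (\<lambda>h. h \<bullet> \<nu> - g' (hproj \<nu> h))"
  have dG: "(G has_derivative A) (at p)"
    unfolding G_def A_def
    by (intro has_derivative_diff has_derivative_inner_left has_derivative_ident
        has_derivative_compose[OF linear_imp_has_derivative[OF lin] dg])
  have linA: "linear A" using dG has_derivative_bounded_linear bounded_linear.linear by blast
  define a where "a = (\<Sum>b\<in>Basis. A b *\<^sub>R b)"
  have Aa: "A h = h \<bullet> a" for h
  proof -
    have "A h = A (\<Sum>b\<in>Basis. (h \<bullet> b) *\<^sub>R b)" by (simp add: euclidean_representation)
    also have "\<dots> = (\<Sum>b\<in>Basis. (h \<bullet> b) * A b)" by (simp add: linear_sum[OF linA] linear_scale[OF linA])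
    finally show ?thesis by (simp add: a_def inner_sum_right mult.commute)
  qed
  have "hproj \<nu> \<nu> = 0" by (simp add: hproj_def \<nu>\<nu>)
  \<comment> \<open>The graph function is constant along \<nu>, so the derivative of G in this
    direction is 1 and its gradient cannot vanish.\<close>
  then have "A \<nu> = 1" using linear_0[OF has_derivative_linear[OF dg]] by (simp add: A_def \<nu>\<nu>)
  then have a: "norm a > 0" using Aa[of \<nu>] by auto
  define e where "e = a /\<^sub>R norm a"
  have e: "norm e = 1" using a by (simp add: e_def)
  then have ee: "e \<bullet> e = 1" by (simp add: norm_eq_1)
  have Ae: "A h = norm a * (h \<bullet> e)" for h using a by (simp add: Aa e_def)
  have "p \<in> ball p r \<inter> frontier \<Omega>" using p r by simp
  then have "p \<in> graph_over \<nu> g" unfolding fr by blast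
  then have Gp: "G p = 0" by (simp add: G_def graph_over_def)
  show ?thesis
  proof (intro exI[of _ e] conjI e allI impI)
    fix m M \<kappa> :: real assume m: "0 < m" and M: "0 < M" and \<kappa>: "0 < \<kappa>"
    \<comment> \<open>Bounds both h and the point reached from h by descending (1 + \<kappa>)(h . e)
      along e.\<close>
    define M' where "M' = M + (1 + \<kappa>) * M"
    have M': "M' > 0" "M \<le> M'" using M \<kappa> by (auto simp: M'_def intro!: add_pos_nonneg)
    \<comment> \<open>The linearisation error then stays at half of |a| m min(1, \<kappa>), too
      small to change the sign of G at either of the two points compared below.\<close>
    define \<tau> where "\<tau> = norm a * m * min 1 \<kappa> / (2 * M')"
    have \<tau>: "\<tau> > 0" using a m \<kappa> M' by (simp add: \<tau>_def)
    have \<tau>M: "\<tau> * M' = norm a * m * min 1 \<kappa> / 2" using M' by (simp add: \<tau>_def)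
    obtain \<rho> where \<rho>: "\<rho> > 0" and lin_err: "\<And>y. norm (y - p) < \<rho> \<Longrightarrow> norm (G y - G p - A (y - p)) \<le> \<tau> * norm (y - p)"
      using dG \<tau> unfolding has_derivative_at_alt by blast
    define \<epsilon> where "\<epsilon> = min \<rho> r / (2 * M')"
    have \<epsilon>: "\<epsilon> > 0" using \<rho> r M' by (simp add: \<epsilon>_def)
    have \<epsilon>M: "\<epsilon> * M' < \<rho>" "\<epsilon> * M' < r"
    proof -
      have "\<epsilon> * M' = min \<rho> r / 2" using M' by (simp add: \<epsilon>_def)
      then show "\<epsilon> * M' < \<rho>" "\<epsilon> * M' < r" using \<rho> r by auto
    qed
    have near: "p + \<epsilon> *\<^sub>R v \<in> ball p r \<and> \<bar>G (p + \<epsilon> *\<^sub>R v) - \<epsilon> * (norm a * (v \<bullet> e))\<bar> \<le> \<epsilon> * (\<tau> * M')"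
      if v: "norm v \<le> M'" for v
    proof -
      have nv: "norm (\<epsilon> *\<^sub>R v) \<le> \<epsilon> * M'" using v \<epsilon> by simp
      then have "norm (p + \<epsilon> *\<^sub>R v - p) < \<rho>" using \<epsilon>M(1) by simp
      from lin_err[OF this] have "\<bar>G (p + \<epsilon> *\<^sub>R v) - A (\<epsilon> *\<^sub>R v)\<bar> \<le> \<tau> * norm (\<epsilon> *\<^sub>R v)" by (simp add: Gp)
      also have "\<dots> \<le> \<tau> * (\<epsilon> * M')" using nv \<tau> by (intro mult_left_mono) auto
      finally have "\<bar>G (p + \<epsilon> *\<^sub>R v) - \<epsilon> * (norm a * (v \<bullet> e))\<bar> \<le> \<epsilon> * (\<tau> * M')"
        by (simp add: Ae mult_ac)
      moreover have "dist p (p + \<epsilon> *\<^sub>R v) < r" using nv \<epsilon>M(2) by (simp add: dist_norm)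
      ultimately show ?thesis by simp
    qed
    show "\<exists>\<epsilon>>0. \<forall>h. norm h \<le> M \<longrightarrow> m \<le> h \<bullet> e \<longrightarrow>
      p + \<epsilon> *\<^sub>R h \<in> \<Omega> \<and> bdist \<Omega> (p + \<epsilon> *\<^sub>R h) \<le> \<epsilon> * ((1 + \<kappa>) * (h \<bullet> e))"
    proof (intro exI[of _ \<epsilon>] conjI \<epsilon> allI impI)
      fix h assume h: "norm h \<le> M" "m \<le> h \<bullet> e"
      have he: "h \<bullet> e \<le> M" using norm_cauchy_schwarz[of h e] e h(1) by simp
      have am: "norm a * m > 0" using a m by simp
      have "norm h \<le> M'" using h(1) M'(2) by simp
      note n1 = near[OF this]
      have "norm a * m * min 1 \<kappa> \<le> norm a * m * 1" using am by (intro mult_left_mono) auto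
      then have "\<tau> * M' < norm a * m" using am \<tau>M by linarith
      also have "\<dots> \<le> norm a * (h \<bullet> e)" using a h(2) by (intro mult_left_mono) auto
      finally have "\<epsilon> * (\<tau> * M') < \<epsilon> * (norm a * (h \<bullet> e))" using \<epsilon> by (rule mult_strict_left_mono)
      then have "G (p + \<epsilon> *\<^sub>R h) > 0" using n1 by linarith
      then have "p + \<epsilon> *\<^sub>R h \<in> ball p r \<inter> above_graph \<nu> g" using n1 by (simp add: G_def above_graph_def)
      then show in\<Omega>: "p + \<epsilon> *\<^sub>R h \<in> \<Omega>" unfolding ab[symmetric] by blast
      \<comment> \<open>Descending by slightly more than the height h . e gives v with v . e =
        -\<kappa> (h . e) < 0. There G is negative, so the rescaled point lies outside the domain,
        and the length of the descent bounds the distance to the boundary.\<close>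
      define t where "t = (1 + \<kappa>) * (h \<bullet> e)"
      have t: "0 \<le> t" "t \<le> (1 + \<kappa>) * M" unfolding t_def using h(2) m \<kappa> he by (auto intro!: mult_left_mono)
      define v where "v = h - t *\<^sub>R e"
      have "norm v \<le> norm h + norm (t *\<^sub>R e)" unfolding v_def by (rule norm_triangle_ineq4)
      also have "\<dots> \<le> M'" using h(1) t by (simp add: e M'_def)
      finally have vM: "norm v \<le> M'" .
      note n2 = near[OF this]
      have "v \<bullet> e = - (\<kappa> * (h \<bullet> e))" by (simp add: v_def inner_diff_left ee t_def algebra_simps)
      then have "norm a * (v \<bullet> e) = - (norm a * (\<kappa> * (h \<bullet> e)))" by simp
      moreover have "norm a * (\<kappa> * m) \<le> norm a * (\<kappa> * (h \<bullet> e))" using a \<kappa> h(2) by (intro mult_left_mono) auto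
      moreover have "\<tau> * M' < norm a * (\<kappa> * m)"
      proof -
        have "norm a * m * min 1 \<kappa> \<le> norm a * m * \<kappa>" using am by (intro mult_left_mono) auto
        moreover have "0 < norm a * m * \<kappa>" using am \<kappa> by simp
        ultimately show ?thesis using \<tau>M by (simp add: mult_ac)
      qed
      ultimately have "norm a * (v \<bullet> e) < - (\<tau> * M')" by linarith
      then have "\<epsilon> * (norm a * (v \<bullet> e)) < \<epsilon> * (- (\<tau> * M'))" using \<epsilon> by (rule mult_strict_left_mono)
      then have "G (p + \<epsilon> *\<^sub>R v) < 0" using conjunct2[OF n2] unfolding mult_minus_right by linarith
      then have "p + \<epsilon> *\<^sub>R v \<notin> above_graph \<nu> g" by (simp add: G_def above_graph_def)
      then have "p + \<epsilon> *\<^sub>R v \<notin> \<Omega>" using ab n2 by blast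
      then have "bdist \<Omega> (p + \<epsilon> *\<^sub>R h) \<le> dist (p + \<epsilon> *\<^sub>R h) (p + \<epsilon> *\<^sub>R v)" by (rule bdist_le_dist_outside[OF in\<Omega>])
      also have "\<dots> = norm (\<epsilon> *\<^sub>R (t *\<^sub>R e))" by (simp add: dist_norm v_def scaleR_diff_right[symmetric] del: norm_scaleR)
      also have "\<dots> = \<epsilon> * t" using \<epsilon> t(1) e by simp
      finally show "bdist \<Omega> (p + \<epsilon> *\<^sub>R h) \<le> \<epsilon> * ((1 + \<kappa>) * (h \<bullet> e))" by (simp add: t_def)
    qed
  qed
qed

text \<open>The support is a compact subset of the open set, so the density is continuous on it and
  the Bochner integral is the true integral and not the default 0.\<close>

lemma ennreal_hardy_integral:
  fixes \<Omega> :: "'a::euclidean_space set"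
  assumes \<Omega>: "open \<Omega>" "\<Omega> \<noteq> UNIV" and f: "f \<in> test_functions \<Omega>"
  shows "ennreal (hardy_integral s \<Omega> f) = (\<integral>\<^sup>+x. ennreal ((f x)\<^sup>2 / bdist \<Omega> x powr (2 * s)) \<partial>lborel)"
proof -
  note t = test_functionD[OF f]
  define K where "K = closure {x. f x \<noteq> 0}"
  define H where "H = (\<lambda>x. (f x)\<^sup>2 / bdist \<Omega> x powr (2 * s))"
  have K: "compact K" "K \<subseteq> \<Omega>" "\<And>x. x \<notin> K \<Longrightarrow> f x = 0" using t closure_subset[of "{x. f x \<noteq> 0}"] by (auto simp: K_def)
  have pos: "bdist \<Omega> x > 0" if "x \<in> K" for x using bdist_pos[OF \<Omega>] K(2) that by auto
  have "continuous_on K H" unfolding H_def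
    by (intro continuous_intros continuous_on_subset[OF t(1)] continuous_on_subset[OF bdist_continuous]) (auto dest: pos)
  then have "integrable lborel (\<lambda>x. indicator K x *\<^sub>R H x)" by (rule borel_integrable_compact[OF K(1)])
  moreover have "(\<lambda>x. indicator K x *\<^sub>R H x) = H"
  proof
    show "indicator K x *\<^sub>R H x = H x" for x using K(3)[of x] by (cases "x \<in> K") (auto simp: H_def)
  qed
  ultimately have int: "integrable lborel H" by (simp only:)
  have "hardy_integral s \<Omega> f = (LINT x|lborel. H x)"
    unfolding hardy_integral_def set_lebesgue_integral_def H_def
    by (rule Bochner_Integration.integral_cong) (use t(3) in \<open>auto simp: indicator_def\<close>)
  then show ?thesis using nn_integral_eq_integral[OF int] by (simp add: H_def)
qed

lemma nn_integral_lborel_reflection_affine: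
  fixes T :: "'a::euclidean_space \<Rightarrow> 'a" and F :: "'a \<Rightarrow> ennreal"
  assumes T: "linear T" "\<And>x. norm (T x) = norm x" "\<And>x. T (T x) = x"
    and [measurable]: "F \<in> borel_measurable borel" and \<epsilon>: "\<epsilon> > 0"
  shows "(\<integral>\<^sup>+x. F x \<partial>lborel) = ennreal (\<epsilon> ^ DIM('a)) * (\<integral>\<^sup>+y. F (p + \<epsilon> *\<^sub>R T y) \<partial>lborel)"
proof -
  have "(\<integral>\<^sup>+x. F x \<partial>lborel) = ennreal (\<epsilon> ^ DIM('a)) * (\<integral>\<^sup>+y. F (p + \<epsilon> *\<^sub>R y) \<partial>lborel)"
    using nn_integral_lborel_scaleR[of F \<epsilon> p] \<epsilon> by simp
  also have "(\<integral>\<^sup>+y. F (p + \<epsilon> *\<^sub>R y) \<partial>lborel) = (\<integral>\<^sup>+y. F (p + \<epsilon> *\<^sub>R T y) \<partial>lborel)"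
    by (rule nn_integral_reflection[OF T, of "\<lambda>y. F (p + \<epsilon> *\<^sub>R y)", symmetric]) measurable
  finally show ?thesis .
qed

text \<open>The trial function of the half-space is turned by a reflection so that its normal
  direction becomes e, shrunk by \<epsilon> and placed at p. The energy scales exactly by
  \<epsilon>^(n - 2s), while the Hardy integral loses at most the further factor (1 +
  \<kappa>)^(-2s), because the rescaled distance to the boundary is at most 1 + \<kappa> times the
  height.\<close>

lemma hardy_constant_optimal:
  fixes \<Omega> :: "'a::euclidean_space set"
  assumes s: "1/2 \<le> s" "s < 1" and \<Omega>: "open \<Omega>" "\<Omega> \<noteq> UNIV" and p: "p \<in> frontier \<Omega>"
    and C1: "C1_regular \<Omega> {p}" and C: "k_const DIM('a) s < C"
  shows "\<exists>f\<in>test_functions \<Omega>. gagliardo s f < C * hardy_integral s \<Omega> f"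
proof -
  have s0: "0 < s" using s by simp
  obtain r \<nu> g where "0 < r" "norm \<nu> = 1" "C_diff 1 g" "ball p r \<inter> frontier \<Omega> = ball p r \<inter> graph_over \<nu> g"
    "ball p r \<inter> \<Omega> = ball p r \<inter> above_graph \<nu> g" using C1 unfolding C1_regular_def by blast
  from C1_boundary_blow_up[OF \<Omega>(1) p this] obtain e where e: "norm e = 1" and
    bl: "\<And>m M \<kappa>. 0 < m \<Longrightarrow> 0 < M \<Longrightarrow> 0 < \<kappa> \<Longrightarrow> \<exists>\<epsilon>>0. \<forall>h. norm h \<le> M \<longrightarrow> m \<le> h \<bullet> e \<longrightarrow>
    p + \<epsilon> *\<^sub>R h \<in> \<Omega> \<and> bdist \<Omega> (p + \<epsilon> *\<^sub>R h) \<le> \<epsilon> * ((1 + \<kappa>) * (h \<bullet> e))" by blast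
  obtain b0 :: 'a where b0: "b0 \<in> Basis" using nonempty_Basis by blast
  obtain T where T: "linear T" "\<And>x. norm (T x) = norm x" "\<And>x. T (T x) = x" "T b0 = e"
    using reflection_exists[of b0 e] b0 e by auto
  have Tm [measurable]: "T \<in> borel_measurable borel"
    using linear_continuous_on[of T] T(1) by (intro borel_measurable_continuous_onI) (simp add: linear_linear)
  have Te: "T y \<bullet> e = y \<bullet> b0" for y using inner_reflection[OF T(1-3), of y e] T(3)[of b0] T(4) by simp
  obtain \<phi> :: "'a \<Rightarrow> real" and m M E H where \<phi>: "\<And>k. C_diff k \<phi>" and m: "0 < m" and M: "0 < M"
    and supp: "\<And>x. \<phi> x \<noteq> 0 \<Longrightarrow> m \<le> x \<bullet> b0 \<and> norm x \<le> M"
    and E: "(\<integral>\<^sup>+h. \<integral>\<^sup>+x. ennreal ((\<phi> (x + h) - \<phi> x)\<^sup>2 * riesz s h) \<partial>lborel \<partial>lborel) \<le> ennreal E" "0 \<le> E"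
    and H: "(\<integral>\<^sup>+x. ennreal ((\<phi> x)\<^sup>2 / (x \<bullet> b0) powr (2 * s)) \<partial>lborel) = ennreal H" "0 \<le> H" and lt: "E < C * H"
    using halfspace_trial_function[OF s b0 C] by blast
  have [measurable]: "\<phi> \<in> borel_measurable borel" using \<phi>[of 0] by (intro borel_measurable_continuous_onI) simp
  \<comment> \<open>The strict inequality E < C H leaves room for the factor (1 + \<kappa>)^(-2s).
    The value of \<kappa> is fixed before \<epsilon>, which depends on it.\<close>
  have "((\<lambda>\<kappa>. C * (H / (1 + \<kappa>) powr (2 * s))) \<longlongrightarrow> C * (H / (1 + 0) powr (2 * s))) (at_right 0)"
    by (intro tendsto_intros) auto
  then have "((\<lambda>\<kappa>. C * (H / (1 + \<kappa>) powr (2 * s))) \<longlongrightarrow> C * H) (at_right 0)" by simp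
  then have "eventually (\<lambda>\<kappa>. E < C * (H / (1 + \<kappa>) powr (2 * s))) (at_right 0)" using lt by (rule order_tendstoD(1))
  then have "eventually (\<lambda>\<kappa>. 0 < \<kappa> \<and> E < C * (H / (1 + \<kappa>) powr (2 * s))) (at_right 0)"
    using eventually_at_right_less[of "0::real"] by eventually_elim auto
  then obtain \<kappa> where \<kappa>: "0 < \<kappa>" "E < C * (H / (1 + \<kappa>) powr (2 * s))"
    using eventually_happens[of _ "at_right (0::real)"] by auto
  obtain \<epsilon> where \<epsilon>: "\<epsilon> > 0" and close: "\<And>h. norm h \<le> M \<Longrightarrow> m \<le> h \<bullet> e \<Longrightarrow>
    p + \<epsilon> *\<^sub>R h \<in> \<Omega> \<and> bdist \<Omega> (p + \<epsilon> *\<^sub>R h) \<le> \<epsilon> * ((1 + \<kappa>) * (h \<bullet> e))" using bl[OF m M \<kappa>(1)] by blast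
  define f where "f = (\<lambda>x. \<phi> (T ((1 / \<epsilon>) *\<^sub>R (x - p))))"
  have f_at: "f (p + \<epsilon> *\<^sub>R T y) = \<phi> y" for y using \<epsilon> by (simp add: f_def linear_scale[OF T(1)] T(3))
  have [measurable]: "f \<in> borel_measurable borel" unfolding f_def by measurable
  \<comment> \<open>A compact subset of the domain that contains the set where f is nonzero, hence
    also its closure.\<close>
  define S where "S = (\<lambda>h. p + \<epsilon> *\<^sub>R h) ` {h. norm h \<le> M \<and> m \<le> h \<bullet> e}"
  have compS: "compact S"
  proof -
    have "{h. norm h \<le> M \<and> m \<le> h \<bullet> e} = cball 0 M \<inter> {h. e \<bullet> h \<ge> m}" by (auto simp: inner_commute)
    then have "compact {h. norm h \<le> M \<and> m \<le> h \<bullet> e}" by (simp add: compact_Int_closed closed_halfspace_ge)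
    then show ?thesis unfolding S_def by (intro compact_continuous_image continuous_intros)
  qed
  have S\<Omega>: "S \<subseteq> \<Omega>" using close by (auto simp: S_def)
  have fS: "{x. f x \<noteq> 0} \<subseteq> S"
  proof
    fix x assume "x \<in> {x. f x \<noteq> 0}"
    then have nz: "\<phi> (T ((1 / \<epsilon>) *\<^sub>R (x - p))) \<noteq> 0" by (simp add: f_def)
    define h where "h = (1 / \<epsilon>) *\<^sub>R (x - p)"
    have "m \<le> T h \<bullet> b0 \<and> norm (T h) \<le> M" using supp[OF nz] by (simp only: h_def)
    moreover have "T h \<bullet> b0 = h \<bullet> e" using Te[of "T h"] T(3)[of h] by simp
    ultimately have "norm h \<le> M \<and> m \<le> h \<bullet> e" by (simp add: T(2))
    moreover have "x = p + \<epsilon> *\<^sub>R h" using \<epsilon> by (simp add: h_def)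
    ultimately show "x \<in> S" unfolding S_def by blast
  qed
  have clS: "closure {x. f x \<noteq> 0} \<subseteq> S" using fS compact_imp_closed[OF compS] by (rule closure_minimal)
  have Cf: "C_diff k f" for k
  proof -
    have "linear (\<lambda>x. (1 / \<epsilon>) *\<^sub>R T x)" by (rule linear_compose_scale_right[OF T(1)])
    from C_diff_affine_compose[OF this \<phi>, of k "- ((1 / \<epsilon>) *\<^sub>R T p)"] show ?thesis
      by (simp add: f_def linear_scale[OF T(1)] linear_diff[OF T(1)] scaleR_diff_right)
  qed
  have f: "f \<in> test_functions \<Omega>"
    unfolding test_functions_def
    using Cf clS S\<Omega> compact_imp_bounded[OF compS] by (auto simp: compact_eq_bounded_closed intro: bounded_subset)
  define \<Psi> where "\<Psi> = (\<lambda>h. \<integral>\<^sup>+y. ennreal ((\<phi> (y + h) - \<phi> y)\<^sup>2) \<partial>lborel)"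
  have [measurable]: "\<Psi> \<in> borel_measurable borel" unfolding \<Psi>_def by measurable
  define n where "n = DIM('a)"
  have "ennreal (gagliardo s f) = (\<integral>\<^sup>+h. \<integral>\<^sup>+x. ennreal ((f (x + h) - f x)\<^sup>2 * riesz s h) \<partial>lborel \<partial>lborel)"
    by (rule gagliardo_eq(2)[OF s0 s(2) Cf]) (use f in \<open>simp add: test_functions_def\<close>)
  also have "\<dots> = (\<integral>\<^sup>+h. ennreal (\<epsilon> ^ n) * (\<Psi> (T ((1 / \<epsilon>) *\<^sub>R h)) * ennreal (riesz s (T h))) \<partial>lborel)"
  proof (rule nn_integral_cong)
    fix h :: 'a
    have "(\<integral>\<^sup>+x. ennreal ((f (x + h) - f x)\<^sup>2 * riesz s h) \<partial>lborel)
      = ennreal (\<epsilon> ^ n) * (\<integral>\<^sup>+y. ennreal ((f (p + \<epsilon> *\<^sub>R T y + h) - f (p + \<epsilon> *\<^sub>R T y))\<^sup>2 * riesz s h) \<partial>lborel)"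
      unfolding n_def by (rule nn_integral_lborel_reflection_affine[OF T(1-3) _ \<epsilon>]) measurable
    also have "(\<integral>\<^sup>+y. ennreal ((f (p + \<epsilon> *\<^sub>R T y + h) - f (p + \<epsilon> *\<^sub>R T y))\<^sup>2 * riesz s h) \<partial>lborel)
      = (\<integral>\<^sup>+y. ennreal ((\<phi> (y + T ((1 / \<epsilon>) *\<^sub>R h)) - \<phi> y)\<^sup>2) * ennreal (riesz s (T h)) \<partial>lborel)"
    proof (rule nn_integral_cong)
      fix y
      have "p + \<epsilon> *\<^sub>R T y + h = p + \<epsilon> *\<^sub>R T (y + T ((1 / \<epsilon>) *\<^sub>R h))"
        using \<epsilon> by (simp add: linear_add[OF T(1)] T(3) scaleR_add_right)
      then have 1: "f (p + \<epsilon> *\<^sub>R T y + h) = \<phi> (y + T ((1 / \<epsilon>) *\<^sub>R h))" by (simp only: f_at)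
      have 2: "riesz s (T h) = riesz s h" by (simp add: riesz_def T(2))
      show "ennreal ((f (p + \<epsilon> *\<^sub>R T y + h) - f (p + \<epsilon> *\<^sub>R T y))\<^sup>2 * riesz s h) = ennreal ((\<phi> (y + T ((1 / \<epsilon>) *\<^sub>R h)) - \<phi> y)\<^sup>2) * ennreal (riesz s (T h))"
        unfolding 1 2 f_at by (rule ennreal_mult') simp
    qed
    also have "\<dots> = \<Psi> (T ((1 / \<epsilon>) *\<^sub>R h)) * ennreal (riesz s (T h))" unfolding \<Psi>_def by (rule nn_integral_multc) measurable
    finally show "(\<integral>\<^sup>+x. ennreal ((f (x + h) - f x)\<^sup>2 * riesz s h) \<partial>lborel) = ennreal (\<epsilon> ^ n) * (\<Psi> (T ((1 / \<epsilon>) *\<^sub>R h)) * ennreal (riesz s (T h)))" .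
  qed
  also have "\<dots> = ennreal (\<epsilon> ^ n) * (\<integral>\<^sup>+h. \<Psi> (T ((1 / \<epsilon>) *\<^sub>R h)) * ennreal (riesz s (T h)) \<partial>lborel)"
    by (rule nn_integral_cmult) measurable
  also have "(\<integral>\<^sup>+h. \<Psi> (T ((1 / \<epsilon>) *\<^sub>R h)) * ennreal (riesz s (T h)) \<partial>lborel) = (\<integral>\<^sup>+h. \<Psi> ((1 / \<epsilon>) *\<^sub>R h) * ennreal (riesz s h) \<partial>lborel)"
    using nn_integral_reflection[OF T(1-3), of "\<lambda>h. \<Psi> ((1 / \<epsilon>) *\<^sub>R h) * ennreal (riesz s h)"] by (simp add: linear_scale[OF T(1)])
  also have "\<dots> = ennreal ((1 / \<epsilon>) powr (2 * s)) * (\<integral>\<^sup>+h. \<Psi> h * ennreal (riesz s h) \<partial>lborel)"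
    using \<epsilon> by (intro nn_integral_riesz_scale) auto
  also have "(\<integral>\<^sup>+h. \<Psi> h * ennreal (riesz s h) \<partial>lborel) \<le> ennreal E"
  proof -
    have "(\<integral>\<^sup>+h. \<Psi> h * ennreal (riesz s h) \<partial>lborel) = (\<integral>\<^sup>+h. \<integral>\<^sup>+x. ennreal ((\<phi> (x + h) - \<phi> x)\<^sup>2 * riesz s h) \<partial>lborel \<partial>lborel)"
    proof (rule nn_integral_cong)
      fix h :: 'a
      have "\<Psi> h * ennreal (riesz s h) = (\<integral>\<^sup>+x. ennreal ((\<phi> (x + h) - \<phi> x)\<^sup>2) * ennreal (riesz s h) \<partial>lborel)"
        unfolding \<Psi>_def by (rule nn_integral_multc[symmetric]) measurable
      then show "\<Psi> h * ennreal (riesz s h) = (\<integral>\<^sup>+x. ennreal ((\<phi> (x + h) - \<phi> x)\<^sup>2 * riesz s h) \<partial>lborel)"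
        by (simp add: ennreal_mult')
    qed
    then show ?thesis using E(1) by simp
  qed
  also have "ennreal (\<epsilon> ^ n) * (ennreal ((1 / \<epsilon>) powr (2 * s)) * ennreal E) = ennreal (\<epsilon> ^ n * ((1 / \<epsilon>) powr (2 * s) * E))"
    using \<epsilon> by (simp only: ennreal_mult' powr_ge_zero zero_le_power less_imp_le)
  finally have "ennreal (gagliardo s f) \<le> ennreal (\<epsilon> ^ n * ((1 / \<epsilon>) powr (2 * s) * E))"
    by (simp add: mult_left_mono)
  then have up: "gagliardo s f \<le> \<epsilon> ^ n * ((1 / \<epsilon>) powr (2 * s) * E)"
    using \<epsilon> E(2) by (subst (asm) ennreal_le_iff) auto
  have "ennreal (\<epsilon> ^ n * ((1 / \<epsilon>) powr (2 * s) * (H / (1 + \<kappa>) powr (2 * s)))) \<le> ennreal (hardy_integral s \<Omega> f)"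
  proof -
    have "ennreal (hardy_integral s \<Omega> f) = ennreal (\<epsilon> ^ n) * (\<integral>\<^sup>+y. ennreal ((f (p + \<epsilon> *\<^sub>R T y))\<^sup>2 / bdist \<Omega> (p + \<epsilon> *\<^sub>R T y) powr (2 * s)) \<partial>lborel)"
      unfolding ennreal_hardy_integral[OF \<Omega> f] n_def by (rule nn_integral_lborel_reflection_affine[OF T(1-3) _ \<epsilon>]) measurable
    also have "\<dots> \<ge> ennreal (\<epsilon> ^ n) * (\<integral>\<^sup>+y. ennreal ((1 / \<epsilon>) powr (2 * s) / (1 + \<kappa>) powr (2 * s)) * ennreal ((\<phi> y)\<^sup>2 / (y \<bullet> b0) powr (2 * s)) \<partial>lborel)"
    proof (intro mult_left_mono nn_integral_mono)
      fix y
      show "ennreal ((1 / \<epsilon>) powr (2 * s) / (1 + \<kappa>) powr (2 * s)) * ennreal ((\<phi> y)\<^sup>2 / (y \<bullet> b0) powr (2 * s))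
        \<le> ennreal ((f (p + \<epsilon> *\<^sub>R T y))\<^sup>2 / bdist \<Omega> (p + \<epsilon> *\<^sub>R T y) powr (2 * s))"
      proof (cases "\<phi> y = 0")
        case False
        note sy = supp[OF False]
        have c: "p + \<epsilon> *\<^sub>R T y \<in> \<Omega> \<and> bdist \<Omega> (p + \<epsilon> *\<^sub>R T y) \<le> \<epsilon> * ((1 + \<kappa>) * (y \<bullet> b0))"
          using close[of "T y"] sy by (simp add: T(2) Te)
        have yb: "y \<bullet> b0 > 0" using sy m by linarith
        have dpos: "bdist \<Omega> (p + \<epsilon> *\<^sub>R T y) > 0" using bdist_pos[OF \<Omega>] c by blast
        have "bdist \<Omega> (p + \<epsilon> *\<^sub>R T y) powr (2 * s) \<le> (\<epsilon> * ((1 + \<kappa>) * (y \<bullet> b0))) powr (2 * s)"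
          using c dpos s0 by (intro powr_mono2) auto
        also have "\<dots> = \<epsilon> powr (2 * s) * ((1 + \<kappa>) powr (2 * s) * (y \<bullet> b0) powr (2 * s))"
          using \<epsilon> \<kappa> yb by (simp add: powr_mult)
        finally have "(\<phi> y)\<^sup>2 / (\<epsilon> powr (2 * s) * ((1 + \<kappa>) powr (2 * s) * (y \<bullet> b0) powr (2 * s))) \<le> (\<phi> y)\<^sup>2 / bdist \<Omega> (p + \<epsilon> *\<^sub>R T y) powr (2 * s)"
          using dpos \<epsilon> \<kappa> yb by (intro divide_left_mono mult_pos_pos) auto
        moreover have "(1 / \<epsilon>) powr (2 * s) / (1 + \<kappa>) powr (2 * s) * ((\<phi> y)\<^sup>2 / (y \<bullet> b0) powr (2 * s)) = (\<phi> y)\<^sup>2 / (\<epsilon> powr (2 * s) * ((1 + \<kappa>) powr (2 * s) * (y \<bullet> b0) powr (2 * s)))"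
          using \<epsilon> by (subst powr_divide) auto
        ultimately have "(1 / \<epsilon>) powr (2 * s) / (1 + \<kappa>) powr (2 * s) * ((\<phi> y)\<^sup>2 / (y \<bullet> b0) powr (2 * s)) \<le> (f (p + \<epsilon> *\<^sub>R T y))\<^sup>2 / bdist \<Omega> (p + \<epsilon> *\<^sub>R T y) powr (2 * s)"
          by (simp add: f_at)
        from ennreal_leI[OF this] show ?thesis by (subst (asm) ennreal_mult') auto
      qed simp
    qed auto
    also have "(\<integral>\<^sup>+y. ennreal ((1 / \<epsilon>) powr (2 * s) / (1 + \<kappa>) powr (2 * s)) * ennreal ((\<phi> y)\<^sup>2 / (y \<bullet> b0) powr (2 * s)) \<partial>lborel)
      = ennreal ((1 / \<epsilon>) powr (2 * s) / (1 + \<kappa>) powr (2 * s)) * ennreal H"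
      unfolding H(1)[symmetric] by (rule nn_integral_cmult) measurable
    also have "ennreal (\<epsilon> ^ n) * (ennreal ((1 / \<epsilon>) powr (2 * s) / (1 + \<kappa>) powr (2 * s)) * ennreal H) = ennreal (\<epsilon> ^ n * ((1 / \<epsilon>) powr (2 * s) / (1 + \<kappa>) powr (2 * s) * H))"
      using \<epsilon> by (simp only: ennreal_mult' divide_nonneg_nonneg powr_ge_zero zero_le_power less_imp_le)
    finally show ?thesis by simp
  qed
  moreover have h0: "0 \<le> hardy_integral s \<Omega> f"
    unfolding hardy_integral_def set_lebesgue_integral_def by (rule Bochner_Integration.integral_nonneg) auto
  ultimately have low: "\<epsilon> ^ n * ((1 / \<epsilon>) powr (2 * s) * (H / (1 + \<kappa>) powr (2 * s))) \<le> hardy_integral s \<Omega> f"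
    by (simp add: ennreal_le_iff)
  have Cpos: "0 < C"
  proof -
    have "0 \<le> C * H" using lt E(2) by linarith
    moreover have "C * H \<noteq> 0" using lt E(2) by linarith
    ultimately show ?thesis using H(2) by (metis mult_eq_0_iff mult_less_0_iff not_less order_le_less)
  qed
  have w: "0 < \<epsilon> ^ n * (1 / \<epsilon>) powr (2 * s)" using \<epsilon> by simp
  have "gagliardo s f \<le> (\<epsilon> ^ n * (1 / \<epsilon>) powr (2 * s)) * E" using up by (simp add: mult.assoc)
  also have "\<dots> < (\<epsilon> ^ n * (1 / \<epsilon>) powr (2 * s)) * (C * (H / (1 + \<kappa>) powr (2 * s)))" using \<kappa>(2) w by (rule mult_strict_left_mono)
  also have "\<dots> = C * (\<epsilon> ^ n * ((1 / \<epsilon>) powr (2 * s) * (H / (1 + \<kappa>) powr (2 * s))))" by simp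
  also have "\<dots> \<le> C * hardy_integral s \<Omega> f" using low Cpos by (intro mult_left_mono) auto
  finally show ?thesis using f by blast
qed

theorem theorem1p5:
  fixes \<Omega> :: "'a::euclidean_space set" and s :: real
  assumes "1 / 2 \<le> s" and "s < 1" and "DIM('a) \<ge> 2"
    and "open \<Omega>" and "connected \<Omega>" and "\<Omega> \<noteq> {}" and "\<Omega> \<noteq> UNIV"
  shows
    "(convex \<Omega> \<longrightarrow>
        (\<forall>f\<in>test_functions \<Omega>.
           frac_form s f \<ge> (Gamma (s + 1 / 2))\<^sup>2 / pi * hardy_integral s \<Omega> f) \<and>
        (\<forall>f\<in>test_functions \<Omega>.
           gagliardo s f \<ge> k_const DIM('a) s * hardy_integral s \<Omega> f))
     \<and>
     ((\<exists>x0\<in>frontier \<Omega>. \<exists>r>0. C1_regular \<Omega> (frontier \<Omega> \<inter> ball x0 r)) \<longrightarrow>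
        (\<forall>C > (Gamma (s + 1 / 2))\<^sup>2 / pi.
           \<not> (\<forall>f\<in>test_functions \<Omega>. frac_form s f \<ge> C * hardy_integral s \<Omega> f)) \<and>
        (\<forall>C > k_const DIM('a) s.
           \<not> (\<forall>f\<in>test_functions \<Omega>. gagliardo s f \<ge> C * hardy_integral s \<Omega> f)))
     \<and>
     (uniformly_Lipschitz \<Omega> \<and> convex \<Omega> \<and> inner_radius \<Omega> < \<infinity> \<and> 1 / 2 < s \<longrightarrow>
        (\<exists>c>0. \<forall>f\<in>test_functions \<Omega>.
           frac_form s f \<ge> (Gamma (s + 1 / 2))\<^sup>2 / pi * hardy_integral s \<Omega> f
             + c * sobolev_term s \<Omega> f) \<and>
        (\<exists>c>0. \<forall>f\<in>test_functions \<Omega>.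
           gagliardo s f \<ge> k_const DIM('a) s * hardy_integral s \<Omega> f
             + c * sobolev_term s \<Omega> f))"
proof -
  \<comment> \<open>The positive factor between \<open>gagliardo\<close> and
    \<open>frac_form\<close>. Each claim is established for \<open>gagliardo\<close> and multiplied
    by it, so the Sobolev constant c becomes a c.\<close>
  define a where "a = frac_const DIM('a) s / 2"
  define k where "k = k_const DIM('a) s"
  have s0: "0 < s" using assms(1) by simp
  have a: "0 < a" using frac_const_pos[of s "DIM('a)"] s0 assms(2) by (simp add: a_def)
  have ak: "(Gamma (s + 1 / 2))\<^sup>2 / pi = a * k"
    using frac_const_k_const[OF s0 assms(2), of "DIM('a)"] by (simp add: a_def k_def)
  have ff: "frac_form s f = a * gagliardo s f" for f :: "'a \<Rightarrow> real" by (simp add: frac_form_def a_def)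
  have hardy: "k * hardy_integral s \<Omega> f \<le> gagliardo s f" if "convex \<Omega>" "f \<in> test_functions \<Omega>" for f
  proof -
    interpret convex_hardy \<Omega> s by unfold_locales (use assms that in auto)
    show ?thesis unfolding k_def by (rule hardy[OF that(2)])
  qed
  have opt: "\<exists>f\<in>test_functions \<Omega>. gagliardo s f < C * hardy_integral s \<Omega> f"
    if x0: "x0 \<in> frontier \<Omega>" "0 < r" "C1_regular \<Omega> (frontier \<Omega> \<inter> ball x0 r)" and C: "k < C" for x0 r C
  proof (rule hardy_constant_optimal)
    show "C1_regular \<Omega> {x0}" using x0 unfolding C1_regular_def by auto
  qed (use assms x0 C in \<open>auto simp: k_def\<close>)
  have sob: "\<exists>c>0. \<forall>f\<in>test_functions \<Omega>. k * hardy_integral s \<Omega> f + c * sobolev_term s \<Omega> f \<le> gagliardo s f"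
    if L: "uniformly_Lipschitz \<Omega>" "convex \<Omega>" "inner_radius \<Omega> < \<infinity>" "1 / 2 < s"
  proof -
    interpret convex_hardy \<Omega> s by unfold_locales (use assms L in auto)
    obtain x where x: "x \<in> \<Omega>" using assms(6) by blast
    have le: "ereal (bdist \<Omega> y) \<le> inner_radius \<Omega>" if "y \<in> \<Omega>" for y
      unfolding inner_radius_def using that by (rule SUP_upper)
    \<comment> \<open>A supremum in the extended reals: any point of the domain excludes minus
      infinity, so finiteness yields a real bound.\<close>
    obtain R where R: "inner_radius \<Omega> = ereal R"
      using L(3) le[OF x] by (cases "inner_radius \<Omega>") auto
    have bR: "bdist \<Omega> y \<le> R" if "y \<in> \<Omega>" for y using le[OF that] R by simp
    have "0 < R" using bdist_pos[OF assms(4,7) x] bR[OF x] by linarith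
    moreover have "2 * s < real DIM('a)" using assms(2,3) by simp
    ultimately show ?thesis unfolding k_def using hardy_Sobolev[OF L(4) _ bR _ L(1)] by blast
  qed
  show ?thesis
  proof (intro conjI impI ballI allI)
    fix f assume "convex \<Omega>" "f \<in> test_functions \<Omega>"
    note h = hardy[OF this]
    show "k_const DIM('a) s * hardy_integral s \<Omega> f \<le> gagliardo s f" using h by (simp add: k_def)
    show "(Gamma (s + 1 / 2))\<^sup>2 / pi * hardy_integral s \<Omega> f \<le> frac_form s f"
      unfolding ak ff mult.assoc using h a by (intro mult_left_mono) auto
  next
    fix C assume "\<exists>x0\<in>frontier \<Omega>. \<exists>r>0. C1_regular \<Omega> (frontier \<Omega> \<inter> ball x0 r)" "k_const DIM('a) s < C"
    then show "\<not> (\<forall>f\<in>test_functions \<Omega>. C * hardy_integral s \<Omega> f \<le> gagliardo s f)"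
      using opt unfolding k_def by (meson not_less)
  next
    fix C assume C1: "\<exists>x0\<in>frontier \<Omega>. \<exists>r>0. C1_regular \<Omega> (frontier \<Omega> \<inter> ball x0 r)" and C: "(Gamma (s + 1 / 2))\<^sup>2 / pi < C"
    have "k < C / a" using C a unfolding ak by (simp add: field_simps)
    then obtain f where f: "f \<in> test_functions \<Omega>" "gagliardo s f < C / a * hardy_integral s \<Omega> f" using opt C1 by blast
    have "a * gagliardo s f < a * (C / a * hardy_integral s \<Omega> f)" using f(2) a by (rule mult_strict_left_mono)
    then have "frac_form s f < C * hardy_integral s \<Omega> f" unfolding ff using a by simp
    then show "\<not> (\<forall>f\<in>test_functions \<Omega>. C * hardy_integral s \<Omega> f \<le> frac_form s f)" using f(1) by (meson not_less)
  next
    assume "uniformly_Lipschitz \<Omega> \<and> convex \<Omega> \<and> inner_radius \<Omega> < \<infinity> \<and> 1 / 2 < s"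
    then obtain c where c: "c > 0" "\<And>f. f \<in> test_functions \<Omega> \<Longrightarrow> k * hardy_integral s \<Omega> f + c * sobolev_term s \<Omega> f \<le> gagliardo s f"
      using sob by blast
    then show "\<exists>c>0. \<forall>f\<in>test_functions \<Omega>. k_const DIM('a) s * hardy_integral s \<Omega> f + c * sobolev_term s \<Omega> f \<le> gagliardo s f"
      unfolding k_def by blast
    have "(Gamma (s + 1 / 2))\<^sup>2 / pi * hardy_integral s \<Omega> f + a * c * sobolev_term s \<Omega> f \<le> frac_form s f" if "f \<in> test_functions \<Omega>" for f
    proof -
      have "a * (k * hardy_integral s \<Omega> f + c * sobolev_term s \<Omega> f) \<le> a * gagliardo s f"
        using c(2)[OF that] a by (intro mult_left_mono) auto
      then show ?thesis unfolding ak ff by (simp add: algebra_simps)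
    qed
    moreover have "a * c > 0" using a c(1) by simp
    ultimately show "\<exists>c>0. \<forall>f\<in>test_functions \<Omega>. (Gamma (s + 1 / 2))\<^sup>2 / pi * hardy_integral s \<Omega> f + c * sobolev_term s \<Omega> f \<le> frac_form s f"
      by blast
  qed
qed

end
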